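(* Let $T$ be a theory. The 2-category $\mathcal{C}$ of small pseudo $T$-algebras admits pseudo limits: every pseudo functor $F:\mathcal{J}\to\mathcal{C}$ from a small 1-category $\mathcal{J}$ admits a pseudo limit in $\mathcal{C}$.
   Context: Pseudo limits. Pseudo functors and pseudo natural transformations have invertible coherence 2-cells. For a pseudo functor $F:\mathcal{J}\to\mathcal{C}$, a pseudo limit is an object $W$ of $\mathcal{C}$ with a pseudo natural transformation $\pi:\Delta_W\Rightarrow F$ from the constant 2-functor such that for every object $C$ the functor $(\pi\circ):Mor_{\mathcal{C}}(C,W)\to PseudoCone(C,F)$ is an isomorphism of categories, where $PseudoCone(C,F)$ has as objects the pseudo natural transformations $\Delta_C\Rightarrow F$ and as morphisms the modifications. Theories. A theory $T$ is a category with objects $0,1,2,\dots$ in which $n$ is the product of $n$ copies of $1$, with chosen projections $pr_i:n\to 1$. Put $T(n)=Mor_T(n,1)$ (words of arity $n$). For a function $f:\{1,\dots,k\}\to\{1,\dots,\ell\}$ let $f':\ell\to k$ be the morphism with $pr_i f'=pr_{f(i)}$, and for $w\in T(k)$ put $w_f=w\circ f'\in T(\ell)$. For $w\in T(k)$, $w_i\in T(n_i)$ put $\gamma(w,w_1,\dots,w_k)=w\circ(w_1,\dots,w_k)\in T(n_1+\dots+n_k)$, where $(w_1,\dots,w_k):n_1+\dots+n_k\to k$ has $i$-th component $(w_i)_{\iota_i}$, $\iota_i$ being the inclusion onto the $i$-th block. The unit $1\in T(1)$ is the projection $pr_1:1\to1$. For a category $X$, $End(X)$ is the theory with $End(X)(n)=Functors(X^n,X)$;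 there $\gamma(F,F_1,\dots,F_k)=F\circ(F_1\times\dots\times F_k)$, $F_f(x_1,\dots,x_\ell)=F(x_{f1},\dots,x_{fk})$, and the unit is $1_X$; these operations also apply to natural transformations. Pseudo $T$-algebras. A pseudo $T$-algebra is a category $X$ with functions $\Phi:T(n)\to Functors(X^n,X)$ for all $n\ge 0$ and natural isomorphisms $c_{w,w_1,\dots,w_k}:\Phi(\gamma(w,w_1,\dots,w_k))\Rightarrow\gamma(\Phi(w),\Phi(w_1),\dots,\Phi(w_k))$, $I:\Phi(1)\Rightarrow 1_X$, $s_{w,f}:\Phi(w_f)\Rightarrow\Phi(w)_f$, such that (vertical composition written $\circ$, $i$ = identity 2-cell): (1) $\gamma(c_{w,w_1,\dots,w_k},i,\dots,i)\circ c_{\gamma(w,w_1,\dots,w_k),w_{11},\dots,w_{kn_k}}=\gamma(i_{\Phi(w)},c_{w_1,w_{11},\dots,w_{1n_1}},\dots,c_{w_k,w_{k1},\dots,w_{kn_k}})\circ c_{w,\gamma(w_1,w_{11},\dots),\dots,\gamma(w_k,w_{k1},\dots)}$; (2) $\gamma(i_{\Phi(w)},I,\dots,I)\circ c_{w,1,\dots,1}=i$; (3) $\gamma(I,i_{\Phi(w)})\circ c_{1,w}=i$; (4) for $f:\{1,\dots,k\}\to\{1,\dots,\ell\}$, $w\in T(k)$, $w_j\in T(n_j)$ ($1\le j\le\ell$), with $\bar f:\{1,\dots,n_{f1}+\dots+n_{fk}\}\to\{1,\dots,n_1+\dots+n_\ell\}$ carrying the $i$-th block identically onto the $f(i)$-th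 block: $(c_{w,w_{f1},\dots,w_{fk}})_{\bar f}\circ s_{\gamma(w,w_{f1},\dots,w_{fk}),\bar f}=\gamma(s_{w,f},i,\dots,i)\circ c_{w_f,w_1,\dots,w_\ell}$; (5) for functions $g_i:\{1,\dots,n_i\}\to\{1,\dots,n_i'\}$ with block sum $g=g_1+\dots+g_k$: $(c_{w,w_1,\dots,w_k})_g\circ s_{\gamma(w,w_1,\dots,w_k),g}=\gamma(i_{\Phi(w)},s_{w_1,g_1},\dots,s_{w_k,g_k})\circ c_{w,(w_1)_{g_1},\dots,(w_k)_{g_k}}$; (6) $(s_{w,f})_g\circ s_{w_f,g}=s_{w,g\circ f}$; (7) $s_{w,id}$ is the identity. A morphism $H:(X,\Phi)\to(Y,\Psi)$ of pseudo $T$-algebras is a functor with natural isomorphisms $\rho_w:H\circ\Phi(w)\Rightarrow\Psi(w)\circ(H,\dots,H)$ for all words $w$ such that $(c*i)\circ\rho_{\gamma(w,w_1,\dots,w_k)}=(i_{\Psi(w)}*(\rho_{w_1},\dots,\rho_{w_k}))\circ(\rho_w*i)\circ(i_H*c)$, $(I*i_H)\circ\rho_1=i_H*I$, and $(s_{w,f}*i)\circ\rho_{w_f}=(\rho_w)_f\circ(i_H*s_{w,f})$. Composites have $\rho^{HG}_w=(\rho^H_w*i)\circ(i_H*\rho^G_w)$. A 2-cell $\alpha:G\Rightarrow H$ is a natural transformation with $\rho^H_w\circ(\alpha*i_{\Phi(w)})=(i_{\Psi(w)}*(\alpha,\dots,\alpha))\circ\rho^G_w$ for all $w$. *)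

theory Defs
  imports Main "HOL-Library.FuncSet" "HOL-Library.Equipollence"
begin

text \<open>
  Conventions. Functions with a prescribed domain are extensional (value \<open>undefined\<close> outside
  of it), so that equality of functors, transformations, cones, etc. is HOL equality. The index
  set \<open>{1,...,n}\<close> is rendered as \<open>{..<n}\<close>, so that the chosen projections of \<open>n\<close> are
  \<open>pr n 0, ..., pr n (n - 1)\<close>.
\<close>


section \<open>Categories, functors, natural transformations\<close>

record ('o, 'm) cat =
  Ob :: "'o set"
  Arr :: "'m set"
  Dom :: "'m \<Rightarrow> 'o"
  Cod :: "'m \<Rightarrow> 'o"
  Id :: "'o \<Rightarrow> 'm"
  Comp :: "'m \<Rightarrow> 'm \<Rightarrow> 'm"  \<comment> \<open>\<open>Comp C g f\<close> is \<open>g \<circ> f\<close>\<close>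

definition hom :: "('o, 'm, 'z) cat_scheme \<Rightarrow> 'o \<Rightarrow> 'o \<Rightarrow> 'm set" where
  "hom C a b = {f \<in> Arr C. Dom C f = a \<and> Cod C f = b}"

locale category =
  fixes C :: "('o, 'm, 'z) cat_scheme"
  assumes Dom_Ob: "f \<in> Arr C \<Longrightarrow> Dom C f \<in> Ob C"
    and Cod_Ob: "f \<in> Arr C \<Longrightarrow> Cod C f \<in> Ob C"
    and Id_hom: "a \<in> Ob C \<Longrightarrow> Id C a \<in> hom C a a"
    and Comp_hom: "\<lbrakk>f \<in> hom C a b; g \<in> hom C b c\<rbrakk> \<Longrightarrow> Comp C g f \<in> hom C a c"
    and Comp_Id: "f \<in> hom C a b \<Longrightarrow> Comp C f (Id C a) = f"
    and Id_Comp: "f \<in> hom C a b \<Longrightarrow> Comp C (Id C b) f = f"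
    and Comp_assoc: "\<lbrakk>f \<in> hom C a b; g \<in> hom C b c; h \<in> hom C c d\<rbrakk>
      \<Longrightarrow> Comp C h (Comp C g f) = Comp C (Comp C h g) f"

definition isos :: "('o, 'm, 'z) cat_scheme \<Rightarrow> 'o \<Rightarrow> 'o \<Rightarrow> 'm set" where
  "isos C a b =
    {f \<in> hom C a b. \<exists>g \<in> hom C b a. Comp C g f = Id C a \<and> Comp C f g = Id C b}"

record ('o, 'm, 'p, 'n) ftor =
  FO :: "'o \<Rightarrow> 'p"
  FA :: "'m \<Rightarrow> 'n"

definition functors ::
  "('o, 'm) cat \<Rightarrow> ('p, 'n) cat \<Rightarrow> ('o, 'm, 'p, 'n) ftor set" where
  "functors A B = {F.
     FO F \<in> Ob A \<rightarrow>\<^sub>E Ob B \<and> FA F \<in> Arr A \<rightarrow>\<^sub>E Arr B \<and>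
     (\<forall>a b. \<forall>f \<in> hom A a b. FA F f \<in> hom B (FO F a) (FO F b)) \<and>
     (\<forall>a \<in> Ob A. FA F (Id A a) = Id B (FO F a)) \<and>
     (\<forall>a b c. \<forall>f \<in> hom A a b. \<forall>g \<in> hom A b c.
        FA F (Comp A g f) = Comp B (FA F g) (FA F f))}"

definition fid :: "('o, 'm) cat \<Rightarrow> ('o, 'm, 'o, 'm) ftor" where
  "fid A = \<lparr>FO = (\<lambda>x\<in>Ob A. x), FA = (\<lambda>f\<in>Arr A. f)\<rparr>"

text \<open>\<open>fcomp A G F\<close> is \<open>G \<circ> F\<close> for a functor \<open>F\<close> with domain category \<open>A\<close>.\<close>

definition fcomp ::
  "('o, 'm) cat \<Rightarrow> ('p, 'n, 'q, 'k) ftor \<Rightarrow> ('o, 'm, 'p, 'n) ftor \<Rightarrow> ('o, 'm, 'q, 'k) ftor" where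
  "fcomp A G F = \<lparr>FO = compose (Ob A) (FO G) (FO F), FA = compose (Arr A) (FA G) (FA F)\<rparr>"

definition cat_iso :: "('o, 'm) cat \<Rightarrow> ('p, 'n) cat \<Rightarrow> ('o, 'm, 'p, 'n) ftor \<Rightarrow> bool" where
  "cat_iso A B F \<longleftrightarrow>
     F \<in> functors A B \<and> (\<exists>G \<in> functors B A. fcomp A G F = fid A \<and> fcomp B F G = fid B)"

text \<open>
  An arrow together with its source and target. This is used for natural transformations
  (sources and targets are functors), for 2-cells of pseudo algebras (sources and targets are
  morphisms of pseudo algebras) and for modifications (sources and targets are pseudo natural
  transformations).
\<close>

record ('f, 'i, 'x) trans =
  Source :: 'f
  Target :: 'f
  At :: "'i \<Rightarrow> 'x"

type_synonym ('o, 'm, 'p, 'n) ntrans = "(('o, 'm, 'p, 'n) ftor, 'o, 'n) trans"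

definition nats :: "('o, 'm) cat \<Rightarrow> ('p, 'n) cat \<Rightarrow>
    ('o, 'm, 'p, 'n) ftor \<Rightarrow> ('o, 'm, 'p, 'n) ftor \<Rightarrow> ('o, 'm, 'p, 'n) ntrans set" where
  "nats A B F G = {\<alpha>.
     F \<in> functors A B \<and> G \<in> functors A B \<and> Source \<alpha> = F \<and> Target \<alpha> = G \<and>
     At \<alpha> \<in> (\<Pi>\<^sub>E x\<in>Ob A. hom B (FO F x) (FO G x)) \<and>
     (\<forall>a b. \<forall>f \<in> hom A a b. Comp B (At \<alpha> b) (FA F f) = Comp B (FA G f) (At \<alpha> a))}"

definition nat_isos :: "('o, 'm) cat \<Rightarrow> ('p, 'n) cat \<Rightarrow>
    ('o, 'm, 'p, 'n) ftor \<Rightarrow> ('o, 'm, 'p, 'n) ftor \<Rightarrow> ('o, 'm, 'p, 'n) ntrans set" where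
  "nat_isos A B F G = {\<alpha> \<in> nats A B F G. \<forall>x \<in> Ob A. At \<alpha> x \<in> isos B (FO F x) (FO G x)}"

definition idn :: "('o, 'm) cat \<Rightarrow> ('p, 'n) cat \<Rightarrow>
    ('o, 'm, 'p, 'n) ftor \<Rightarrow> ('o, 'm, 'p, 'n) ntrans" where
  "idn A B F = \<lparr>Source = F, Target = F, At = (\<lambda>x\<in>Ob A. Id B (FO F x))\<rparr>"

text \<open>Vertical composition \<open>\<beta> \<circ> \<alpha>\<close> of transformations between functors \<open>A \<rightarrow> B\<close>.\<close>

definition vcomp :: "('o, 'm) cat \<Rightarrow> ('p, 'n) cat \<Rightarrow>
    ('o, 'm, 'p, 'n) ntrans \<Rightarrow> ('o, 'm, 'p, 'n) ntrans \<Rightarrow> ('o, 'm, 'p, 'n) ntrans" where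
  "vcomp A B \<beta> \<alpha> =
    \<lparr>Source = Source \<alpha>, Target = Target \<beta>, At = (\<lambda>x\<in>Ob A. Comp B (At \<beta> x) (At \<alpha> x))\<rparr>"

text \<open>Horizontal composition \<open>\<beta> * \<alpha>\<close>, where \<open>\<alpha>\<close> is between functors \<open>A \<rightarrow> B\<close> and \<open>\<beta>\<close> is between
  functors \<open>B \<rightarrow> C\<close>.\<close>

definition hcomp :: "('o, 'm) cat \<Rightarrow> ('q, 'k) cat \<Rightarrow>
    ('p, 'n, 'q, 'k) ntrans \<Rightarrow> ('o, 'm, 'p, 'n) ntrans \<Rightarrow> ('o, 'm, 'q, 'k) ntrans" where
  "hcomp A C \<beta> \<alpha> =
    \<lparr>Source = fcomp A (Source \<beta>) (Source \<alpha>),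
     Target = fcomp A (Target \<beta>) (Target \<alpha>),
     At = (\<lambda>x\<in>Ob A. Comp C (At \<beta> (FO (Target \<alpha>) x)) (FA (Source \<beta>) (At \<alpha> x)))\<rparr>"


section \<open>Blocks\<close>

text \<open>\<open>offset n k\<close> is \<open>n\<^sub>0 + ... + n\<^sub>k\<^sub>-\<^sub>1\<close>. The \<open>i\<close>-th block of \<open>{..<offset n k}\<close> consists of the
  numbers \<open>incl n i j = offset n i + j\<close> with \<open>j < n i\<close>; conversely the number \<open>p\<close> lies
  in block \<open>blk_of n p\<close> at position \<open>pos_of n p\<close>.\<close>

definition offset :: "(nat \<Rightarrow> nat) \<Rightarrow> nat \<Rightarrow> nat" where
  "offset n k = (\<Sum>i<k. n i)"

definition incl :: "(nat \<Rightarrow> nat) \<Rightarrow> nat \<Rightarrow> nat \<Rightarrow> nat" where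
  "incl n i j = offset n i + j"

definition blk :: "(nat \<Rightarrow> nat) \<Rightarrow> nat \<Rightarrow> (nat \<Rightarrow> 'a) \<Rightarrow> nat \<Rightarrow> 'a" where
  "blk n i x = compose {..<n i} x (incl n i)"

definition blk_of :: "(nat \<Rightarrow> nat) \<Rightarrow> nat \<Rightarrow> nat" where
  "blk_of n p = (LEAST i. p < offset n (Suc i))"

definition pos_of :: "(nat \<Rightarrow> nat) \<Rightarrow> nat \<Rightarrow> nat" where
  "pos_of n p = p - offset n (blk_of n p)"

text \<open>\<open>blk_map n k f\<close> is the function \<open>f\<close>-bar, which carries the \<open>i\<close>-th block (of size \<open>n (f i)\<close>)
  identically onto the \<open>f i\<close>-th block, and \<open>blk_sum n n' k g\<close> is \<open>g\<^sub>0 + ... + g\<^sub>k\<^sub>-\<^sub>1\<close> for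
  \<open>g\<^sub>i : {..<n i} \<rightarrow> {..<n' i}\<close>.\<close>

definition blk_map :: "(nat \<Rightarrow> nat) \<Rightarrow> nat \<Rightarrow> (nat \<Rightarrow> nat) \<Rightarrow> nat \<Rightarrow> nat" where
  "blk_map n k f =
    (\<lambda>p\<in>{..<offset (n \<circ> f) k}. incl n (f (blk_of (n \<circ> f) p)) (pos_of (n \<circ> f) p))"

definition blk_sum ::
  "(nat \<Rightarrow> nat) \<Rightarrow> (nat \<Rightarrow> nat) \<Rightarrow> nat \<Rightarrow> (nat \<Rightarrow> nat \<Rightarrow> nat) \<Rightarrow> nat \<Rightarrow> nat" where
  "blk_sum n n' k g =
    (\<lambda>p\<in>{..<offset n k}. incl n' (blk_of n p) (g (blk_of n p) (pos_of n p)))"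


section \<open>Powers of categories and the theory \<open>End(X)\<close>\<close>

definition pw :: "('o, 'm) cat \<Rightarrow> nat \<Rightarrow> (nat \<Rightarrow> 'o, nat \<Rightarrow> 'm) cat" where
  "pw X n =
    \<lparr>Ob = {..<n} \<rightarrow>\<^sub>E Ob X, Arr = {..<n} \<rightarrow>\<^sub>E Arr X,
     Dom = (\<lambda>f. \<lambda>i\<in>{..<n}. Dom X (f i)), Cod = (\<lambda>f. \<lambda>i\<in>{..<n}. Cod X (f i)),
     Id = (\<lambda>x. \<lambda>i\<in>{..<n}. Id X (x i)),
     Comp = (\<lambda>g f. \<lambda>i\<in>{..<n}. Comp X (g i) (f i))\<rparr>"

text \<open>\<open>prodF X k n F\<close> is \<open>F\<^sub>0 \<times> ... \<times> F\<^sub>k\<^sub>-\<^sub>1 : X\<^bsup>offset n k\<^esup> \<rightarrow> Y\<^sup>k\<close> for \<open>F\<^sub>i : X\<^bsup>n i\<^esup> \<rightarrow> Y\<close>, and \<open>prodN\<close> is the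
  corresponding operation on natural transformations. \<open>powF\<close> and \<open>powN\<close> are the cases
  \<open>(H, ..., H) : X\<^sup>n \<rightarrow> Y\<^sup>n\<close> and \<open>(\<alpha>, ..., \<alpha>)\<close> of these for \<open>H : X \<rightarrow> Y\<close>.\<close>

definition prodF :: "('o, 'm) cat \<Rightarrow> nat \<Rightarrow> (nat \<Rightarrow> nat) \<Rightarrow>
    (nat \<Rightarrow> (nat \<Rightarrow> 'o, nat \<Rightarrow> 'm, 'p, 'n) ftor) \<Rightarrow> (nat \<Rightarrow> 'o, nat \<Rightarrow> 'm, nat \<Rightarrow> 'p, nat \<Rightarrow> 'n) ftor"
  where
  "prodF X k n F =
    \<lparr>FO = (\<lambda>x\<in>Ob (pw X (offset n k)). \<lambda>i\<in>{..<k}. FO (F i) (blk n i x)),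
     FA = (\<lambda>u\<in>Arr (pw X (offset n k)). \<lambda>i\<in>{..<k}. FA (F i) (blk n i u))\<rparr>"

definition prodN :: "('o, 'm) cat \<Rightarrow> nat \<Rightarrow> (nat \<Rightarrow> nat) \<Rightarrow>
    (nat \<Rightarrow> (nat \<Rightarrow> 'o, nat \<Rightarrow> 'm, 'p, 'n) ntrans) \<Rightarrow>
    (nat \<Rightarrow> 'o, nat \<Rightarrow> 'm, nat \<Rightarrow> 'p, nat \<Rightarrow> 'n) ntrans" where
  "prodN X k n \<alpha> =
    \<lparr>Source = prodF X k n (\<lambda>i. Source (\<alpha> i)),
     Target = prodF X k n (\<lambda>i. Target (\<alpha> i)),
     At = (\<lambda>x\<in>Ob (pw X (offset n k)). \<lambda>i\<in>{..<k}. At (\<alpha> i) (blk n i x))\<rparr>"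

definition powF :: "('o, 'm) cat \<Rightarrow> nat \<Rightarrow>
    ('o, 'm, 'p, 'n) ftor \<Rightarrow> (nat \<Rightarrow> 'o, nat \<Rightarrow> 'm, nat \<Rightarrow> 'p, nat \<Rightarrow> 'n) ftor" where
  "powF X n H =
    \<lparr>FO = (\<lambda>x\<in>Ob (pw X n). \<lambda>i\<in>{..<n}. FO H (x i)),
     FA = (\<lambda>u\<in>Arr (pw X n). \<lambda>i\<in>{..<n}. FA H (u i))\<rparr>"

definition powN :: "('o, 'm) cat \<Rightarrow> nat \<Rightarrow>
    ('o, 'm, 'p, 'n) ntrans \<Rightarrow> (nat \<Rightarrow> 'o, nat \<Rightarrow> 'm, nat \<Rightarrow> 'p, nat \<Rightarrow> 'n) ntrans" where
  "powN X n \<alpha> =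
    \<lparr>Source = powF X n (Source \<alpha>), Target = powF X n (Target \<alpha>),
     At = (\<lambda>x\<in>Ob (pw X n). \<lambda>i\<in>{..<n}. At \<alpha> (x i))\<rparr>"

text \<open>\<open>\<gamma>(F, F\<^sub>0, ..., F\<^sub>k\<^sub>-\<^sub>1)\<close> for \<open>F : X\<^sup>k \<rightarrow> X\<close> and \<open>F\<^sub>i : X\<^bsup>n i\<^esup> \<rightarrow> X\<close>, for functors and for natural
  transformations.\<close>

definition gammaF :: "('o, 'm) cat \<Rightarrow> nat \<Rightarrow> (nat \<Rightarrow> nat) \<Rightarrow>
    (nat \<Rightarrow> 'o, nat \<Rightarrow> 'm, 'o, 'm) ftor \<Rightarrow> (nat \<Rightarrow> (nat \<Rightarrow> 'o, nat \<Rightarrow> 'm, 'o, 'm) ftor) \<Rightarrow>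
    (nat \<Rightarrow> 'o, nat \<Rightarrow> 'm, 'o, 'm) ftor" where
  "gammaF X k n F Fs = fcomp (pw X (offset n k)) F (prodF X k n Fs)"

definition gammaN :: "('o, 'm) cat \<Rightarrow> nat \<Rightarrow> (nat \<Rightarrow> nat) \<Rightarrow>
    (nat \<Rightarrow> 'o, nat \<Rightarrow> 'm, 'o, 'm) ntrans \<Rightarrow> (nat \<Rightarrow> (nat \<Rightarrow> 'o, nat \<Rightarrow> 'm, 'o, 'm) ntrans) \<Rightarrow>
    (nat \<Rightarrow> 'o, nat \<Rightarrow> 'm, 'o, 'm) ntrans" where
  "gammaN X k n \<alpha> \<alpha>s = hcomp (pw X (offset n k)) X \<alpha> (prodN X k n \<alpha>s)"

text \<open>\<open>F\<^sub>f(x\<^sub>0, ..., x\<^sub>l\<^sub>-\<^sub>1) = F(x\<^bsub>f 0\<^esub>, ..., x\<^bsub>f (k-1)\<^esub>)\<close> for \<open>F : X\<^sup>k \<rightarrow> Y\<close> and \<open>f : {..<k} \<rightarrow> {..<l}\<close>.\<close>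

definition substF :: "('o, 'm) cat \<Rightarrow> nat \<Rightarrow> nat \<Rightarrow> (nat \<Rightarrow> nat) \<Rightarrow>
    (nat \<Rightarrow> 'o, nat \<Rightarrow> 'm, 'p, 'n) ftor \<Rightarrow> (nat \<Rightarrow> 'o, nat \<Rightarrow> 'm, 'p, 'n) ftor" where
  "substF X k l f F =
    \<lparr>FO = (\<lambda>x\<in>Ob (pw X l). FO F (compose {..<k} x f)),
     FA = (\<lambda>u\<in>Arr (pw X l). FA F (compose {..<k} u f))\<rparr>"

definition substN :: "('o, 'm) cat \<Rightarrow> nat \<Rightarrow> nat \<Rightarrow> (nat \<Rightarrow> nat) \<Rightarrow>
    (nat \<Rightarrow> 'o, nat \<Rightarrow> 'm, 'p, 'n) ntrans \<Rightarrow> (nat \<Rightarrow> 'o, nat \<Rightarrow> 'm, 'p, 'n) ntrans" where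
  "substN X k l f \<alpha> =
    \<lparr>Source = substF X k l f (Source \<alpha>), Target = substF X k l f (Target \<alpha>),
     At = (\<lambda>x\<in>Ob (pw X l). At \<alpha> (compose {..<k} x f))\<rparr>"

text \<open>The unit \<open>1\<^sub>X\<close> of \<open>End(X)\<close>, as a functor \<open>X\<^sup>1 \<rightarrow> X\<close>.\<close>

definition unitF :: "('o, 'm) cat \<Rightarrow> (nat \<Rightarrow> 'o, nat \<Rightarrow> 'm, 'o, 'm) ftor" where
  "unitF X = \<lparr>FO = (\<lambda>x\<in>Ob (pw X 1). x 0), FA = (\<lambda>u\<in>Arr (pw X 1). u 0)\<rparr>"


section \<open>Theories\<close>

record 't theory_data = "(nat, 't) cat" +
  pr :: "nat \<Rightarrow> nat \<Rightarrow> 't"  \<comment> \<open>\<open>pr T n i : n \<rightarrow> 1\<close> for \<open>i < n\<close>\<close>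

locale is_theory = category T for T :: "'t theory_data" +
  assumes Ob_nat: "Ob T = UNIV"
    and pr_hom: "i < n \<Longrightarrow> pr T n i \<in> hom T n 1"
    and pr_product: "(\<And>i. i < n \<Longrightarrow> h i \<in> hom T m 1) \<Longrightarrow>
      \<exists>!u. u \<in> hom T m n \<and> (\<forall>i<n. Comp T (pr T n i) u = h i)"

definition tupling :: "'t theory_data \<Rightarrow> nat \<Rightarrow> nat \<Rightarrow> (nat \<Rightarrow> 't) \<Rightarrow> 't" where
  "tupling T m n h = (THE u. u \<in> hom T m n \<and> (\<forall>i<n. Comp T (pr T n i) u = h i))"

definition words :: "'t theory_data \<Rightarrow> nat \<Rightarrow> 't set" where
  "words T n = hom T n 1"

definition wsubst :: "'t theory_data \<Rightarrow> nat \<Rightarrow> nat \<Rightarrow> (nat \<Rightarrow> nat) \<Rightarrow> 't \<Rightarrow> 't" where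
  "wsubst T k l f w = Comp T w (tupling T l k (\<lambda>i. pr T l (f i)))"

definition wgamma ::
  "'t theory_data \<Rightarrow> nat \<Rightarrow> (nat \<Rightarrow> nat) \<Rightarrow> 't \<Rightarrow> (nat \<Rightarrow> 't) \<Rightarrow> 't" where
  "wgamma T k n w ws =
    Comp T w (tupling T (offset n k) k (\<lambda>i. wsubst T (n i) (offset n k) (incl n i) (ws i)))"

definition wunit :: "'t theory_data \<Rightarrow> 't" where
  "wunit T = pr T 1 0"


section \<open>Pseudo algebras, their morphisms and 2-cells\<close>

text \<open>
  \<open>c w ws\<close> is the coherence isomorphism for \<open>w\<close> and the family \<open>ws\<close> (extensional on \<open>{..<k}\<close>, where
  \<open>k\<close> is the arity of \<open>w\<close>); \<open>s l w f\<close> is the one for \<open>w\<close> and \<open>f : {..<k} \<rightarrow> {..<l}\<close>. In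
  \<open>c_assoc\<close> the doubly indexed family of words \<open>w\<^sub>i\<^sub>j\<close> is listed as one family \<open>vs\<close>, whose
  \<open>i\<close>-th block is \<open>blk n i vs\<close>; the arities in that block are \<open>blk n i p\<close>.
\<close>

locale pseudo_algebra = category X
  for T :: "'t theory_data"
    and X :: "('o, 'm) cat"
    and \<Phi> :: "'t \<Rightarrow> (nat \<Rightarrow> 'o, nat \<Rightarrow> 'm, 'o, 'm) ftor"
    and c :: "'t \<Rightarrow> (nat \<Rightarrow> 't) \<Rightarrow> (nat \<Rightarrow> 'o, nat \<Rightarrow> 'm, 'o, 'm) ntrans"
    and I :: "(nat \<Rightarrow> 'o, nat \<Rightarrow> 'm, 'o, 'm) ntrans"
    and s :: "nat \<Rightarrow> 't \<Rightarrow> (nat \<Rightarrow> nat) \<Rightarrow> (nat \<Rightarrow> 'o, nat \<Rightarrow> 'm, 'o, 'm) ntrans" +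
  assumes Phi_functor: "w \<in> words T k \<Longrightarrow> \<Phi> w \<in> functors (pw X k) X"
    and c_iso: "\<lbrakk>w \<in> words T k; ws \<in> (\<Pi>\<^sub>E i\<in>{..<k}. words T (n i))\<rbrakk> \<Longrightarrow>
      c w ws \<in> nat_isos (pw X (offset n k)) X
        (\<Phi> (wgamma T k n w ws)) (gammaF X k n (\<Phi> w) (\<lambda>i. \<Phi> (ws i)))"
    and I_iso: "I \<in> nat_isos (pw X 1) X (\<Phi> (wunit T)) (unitF X)"
    and s_iso: "\<lbrakk>w \<in> words T k; f \<in> {..<k} \<rightarrow>\<^sub>E {..<l}\<rbrakk> \<Longrightarrow>
      s l w f \<in> nat_isos (pw X l) X (\<Phi> (wsubst T k l f w)) (substF X k l f (\<Phi> w))"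
    and c_assoc:
      "\<lbrakk>w \<in> words T k; ws \<in> (\<Pi>\<^sub>E i\<in>{..<k}. words T (n i));
        vs \<in> (\<Pi>\<^sub>E j\<in>{..<offset n k}. words T (p j))\<rbrakk> \<Longrightarrow>
      vcomp (pw X (offset p (offset n k))) X
        (gammaN X (offset n k) p (c w ws) (\<lambda>j. idn (pw X (p j)) X (\<Phi> (vs j))))
        (c (wgamma T k n w ws) vs)
      = vcomp (pw X (offset p (offset n k))) X
        (gammaN X k (\<lambda>i. offset (blk n i p) (n i)) (idn (pw X k) X (\<Phi> w))
          (\<lambda>i. c (ws i) (blk n i vs)))
        (c w (\<lambda>i\<in>{..<k}. wgamma T (n i) (blk n i p) (ws i) (blk n i vs)))"
    and c_unit_right: "w \<in> words T k \<Longrightarrow>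
      vcomp (pw X k) X (gammaN X k (\<lambda>_. 1) (idn (pw X k) X (\<Phi> w)) (\<lambda>_. I))
        (c w (\<lambda>i\<in>{..<k}. wunit T))
      = idn (pw X k) X (\<Phi> w)"
    and c_unit_left: "w \<in> words T k \<Longrightarrow>
      vcomp (pw X k) X (gammaN X 1 (\<lambda>_. k) I (\<lambda>_. idn (pw X k) X (\<Phi> w)))
        (c (wunit T) (\<lambda>i\<in>{..<1}. w))
      = idn (pw X k) X (\<Phi> w)"
    and c_s_outer:
      "\<lbrakk>w \<in> words T k; f \<in> {..<k} \<rightarrow>\<^sub>E {..<l}; ws \<in> (\<Pi>\<^sub>E j\<in>{..<l}. words T (n j))\<rbrakk> \<Longrightarrow>
      vcomp (pw X (offset n l)) X
        (substN X (offset (n \<circ> f) k) (offset n l) (blk_map n k f) (c w (compose {..<k} ws f)))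
        (s (offset n l) (wgamma T k (n \<circ> f) w (compose {..<k} ws f)) (blk_map n k f))
      = vcomp (pw X (offset n l)) X
        (gammaN X l n (s l w f) (\<lambda>j. idn (pw X (n j)) X (\<Phi> (ws j))))
        (c (wsubst T k l f w) ws)"
    and c_s_inner:
      "\<lbrakk>w \<in> words T k; ws \<in> (\<Pi>\<^sub>E i\<in>{..<k}. words T (n i));
        \<And>i. i < k \<Longrightarrow> gs i \<in> {..<n i} \<rightarrow>\<^sub>E {..<n' i}\<rbrakk> \<Longrightarrow>
      vcomp (pw X (offset n' k)) X
        (substN X (offset n k) (offset n' k) (blk_sum n n' k gs) (c w ws))
        (s (offset n' k) (wgamma T k n w ws) (blk_sum n n' k gs))
      = vcomp (pw X (offset n' k)) X
        (gammaN X k n' (idn (pw X k) X (\<Phi> w)) (\<lambda>i. s (n' i) (ws i) (gs i)))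
        (c w (\<lambda>i\<in>{..<k}. wsubst T (n i) (n' i) (gs i) (ws i)))"
    and s_comp:
      "\<lbrakk>w \<in> words T k; f \<in> {..<k} \<rightarrow>\<^sub>E {..<l}; g \<in> {..<l} \<rightarrow>\<^sub>E {..<m}\<rbrakk> \<Longrightarrow>
      vcomp (pw X m) X (substN X l m g (s l w f)) (s m (wsubst T k l f w) g)
      = s m w (compose {..<k} g f)"
    and s_id: "w \<in> words T k \<Longrightarrow> s k w (\<lambda>i\<in>{..<k}. i) = idn (pw X k) X (\<Phi> w)"

record ('t, 'o, 'm) psalg =
  car :: "('o, 'm) cat"
  Phi :: "'t \<Rightarrow> (nat \<Rightarrow> 'o, nat \<Rightarrow> 'm, 'o, 'm) ftor"
  cc :: "'t \<Rightarrow> (nat \<Rightarrow> 't) \<Rightarrow> (nat \<Rightarrow> 'o, nat \<Rightarrow> 'm, 'o, 'm) ntrans"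
  II :: "(nat \<Rightarrow> 'o, nat \<Rightarrow> 'm, 'o, 'm) ntrans"
  ss :: "nat \<Rightarrow> 't \<Rightarrow> (nat \<Rightarrow> nat) \<Rightarrow> (nat \<Rightarrow> 'o, nat \<Rightarrow> 'm, 'o, 'm) ntrans"

definition is_psalg :: "'t theory_data \<Rightarrow> ('t, 'o, 'm) psalg \<Rightarrow> bool" where
  "is_psalg T A \<longleftrightarrow> pseudo_algebra T (car A) (Phi A) (cc A) (II A) (ss A)"

record ('t, 'o, 'm) psmor =
  fun_of :: "('o, 'm, 'o, 'm) ftor"
  rho :: "'t \<Rightarrow> (nat \<Rightarrow> 'o, nat \<Rightarrow> 'm, 'o, 'm) ntrans"

definition psmors :: "'t theory_data \<Rightarrow>
    ('t, 'o, 'm) psalg \<Rightarrow> ('t, 'o, 'm) psalg \<Rightarrow> ('t, 'o, 'm) psmor set" where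
  "psmors T A B = {M.
    let X = car A; Y = car B; \<Phi> = Phi A; \<Psi> = Phi B; H = fun_of M; \<rho> = rho M in
      H \<in> functors X Y \<and>
      \<rho> \<in> extensional (\<Union>n. words T n) \<and>
      (\<forall>n. \<forall>w \<in> words T n.
        \<rho> w \<in> nat_isos (pw X n) Y (fcomp (pw X n) H (\<Phi> w)) (fcomp (pw X n) (\<Psi> w) (powF X n H))) \<and>
      (\<forall>k n. \<forall>w \<in> words T k. \<forall>ws \<in> (\<Pi>\<^sub>E i\<in>{..<k}. words T (n i)).
        let N = offset n k in
        vcomp (pw X N) Y
          (hcomp (pw X N) Y (cc B w ws) (idn (pw X N) (pw Y N) (powF X N H)))
          (\<rho> (wgamma T k n w ws))
        = vcomp (pw X N) Y
          (hcomp (pw X N) Y (idn (pw Y k) Y (\<Psi> w)) (prodN X k n (\<lambda>i. \<rho> (ws i))))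
          (vcomp (pw X N) Y
            (hcomp (pw X N) Y (\<rho> w) (idn (pw X N) (pw X k) (prodF X k n (\<lambda>i. \<Phi> (ws i)))))
            (hcomp (pw X N) Y (idn X Y H) (cc A w ws)))) \<and>
      vcomp (pw X 1) Y
        (hcomp (pw X 1) Y (II B) (idn (pw X 1) (pw Y 1) (powF X 1 H))) (\<rho> (wunit T))
      = hcomp (pw X 1) Y (idn X Y H) (II A) \<and>
      (\<forall>k l. \<forall>w \<in> words T k. \<forall>f \<in> {..<k} \<rightarrow>\<^sub>E {..<l}.
        vcomp (pw X l) Y
          (hcomp (pw X l) Y (ss B l w f) (idn (pw X l) (pw Y l) (powF X l H)))
          (\<rho> (wsubst T k l f w))
        = vcomp (pw X l) Y
          (substN X k l f (\<rho> w)) (hcomp (pw X l) Y (idn X Y H) (ss A l w f)))}"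

definition psmor_id :: "'t theory_data \<Rightarrow> ('t, 'o, 'm) psalg \<Rightarrow> ('t, 'o, 'm) psmor" where
  "psmor_id T A =
    \<lparr>fun_of = fid (car A),
     rho = (\<lambda>w\<in>(\<Union>n. words T n). idn (pw (car A) (Dom T w)) (car A) (Phi A w))\<rparr>"

text \<open>\<open>psmor_comp T A B C M L\<close> is \<open>M \<circ> L\<close> for \<open>L : A \<rightarrow> B\<close> and \<open>M : B \<rightarrow> C\<close>. The number
  \<open>Dom T w\<close> is the arity of the word \<open>w\<close>.\<close>

definition psmor_comp :: "'t theory_data \<Rightarrow>
    ('t, 'o, 'm) psalg \<Rightarrow> ('t, 'o, 'm) psalg \<Rightarrow> ('t, 'o, 'm) psalg \<Rightarrow>
    ('t, 'o, 'm) psmor \<Rightarrow> ('t, 'o, 'm) psmor \<Rightarrow> ('t, 'o, 'm) psmor" where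
  "psmor_comp T A B C M L =
    (let X = car A; Y = car B; Z = car C; H = fun_of M; G = fun_of L in
    \<lparr>fun_of = fcomp X H G,
     rho = (\<lambda>w\<in>(\<Union>n. words T n). let P = pw X (Dom T w) in
       vcomp P Z
         (hcomp P Z (rho M w) (idn P (pw Y (Dom T w)) (powF X (Dom T w) G)))
         (hcomp P Z (idn Y Z H) (rho L w)))\<rparr>)"

type_synonym ('t, 'o, 'm) pscell = "(('t, 'o, 'm) psmor, 'o, 'm) trans"

definition under :: "('t, 'o, 'm) pscell \<Rightarrow> ('o, 'm, 'o, 'm) ntrans" where
  "under \<alpha> = \<lparr>Source = fun_of (Source \<alpha>), Target = fun_of (Target \<alpha>), At = At \<alpha>\<rparr>"

definition pscells :: "'t theory_data \<Rightarrow>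
    ('t, 'o, 'm) psalg \<Rightarrow> ('t, 'o, 'm) psalg \<Rightarrow> ('t, 'o, 'm) pscell set" where
  "pscells T A B = {\<alpha>.
    let X = car A; Y = car B; G = Source \<alpha>; H = Target \<alpha> in
      G \<in> psmors T A B \<and> H \<in> psmors T A B \<and>
      under \<alpha> \<in> nats X Y (fun_of G) (fun_of H) \<and>
      (\<forall>n. \<forall>w \<in> words T n.
        vcomp (pw X n) Y
          (rho H w) (hcomp (pw X n) Y (under \<alpha>) (idn (pw X n) X (Phi A w)))
        = vcomp (pw X n) Y
          (hcomp (pw X n) Y (idn (pw Y n) Y (Phi B w)) (powN X n (under \<alpha>))) (rho G w))}"


section \<open>2-categories, pseudo functors, pseudo limits\<close>

text \<open>
  In a 2-category \<open>K\<close>, \<open>Hom K A B\<close> is the category of 1-cells \<open>A \<rightarrow> B\<close> and 2-cells (with vertical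
  composition), \<open>Comp1 K A B C g f\<close> is the composite of \<open>f : A \<rightarrow> B\<close> and \<open>g : B \<rightarrow> C\<close>,
  \<open>Comp2 K A B C \<beta> \<alpha>\<close> is the horizontal composite \<open>\<beta> * \<alpha>\<close>, and \<open>One K A\<close> is \<open>1\<^sub>A\<close>.
\<close>

record ('x, 'a, 'b) twocat =
  Obj :: "'x set"
  Hom :: "'x \<Rightarrow> 'x \<Rightarrow> ('a, 'b) cat"
  Comp1 :: "'x \<Rightarrow> 'x \<Rightarrow> 'x \<Rightarrow> 'a \<Rightarrow> 'a \<Rightarrow> 'a"
  Comp2 :: "'x \<Rightarrow> 'x \<Rightarrow> 'x \<Rightarrow> 'b \<Rightarrow> 'b \<Rightarrow> 'b"
  One :: "'x \<Rightarrow> 'a"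

text \<open>
  A pseudo functor \<open>F : J \<rightarrow> K\<close> on a 1-category \<open>J\<close> (whose only 2-cells are identities):
  \<open>PC F g f : F g \<circ> F f \<Rightarrow> F (g \<circ> f)\<close> and \<open>PU F j : 1 \<Rightarrow> F 1\<^sub>j\<close> are the invertible coherence 2-cells.
\<close>

record ('j, 'k, 'x, 'a, 'b) psfun =
  PO :: "'j \<Rightarrow> 'x"
  PA :: "'k \<Rightarrow> 'a"
  PC :: "'k \<Rightarrow> 'k \<Rightarrow> 'b"
  PU :: "'j \<Rightarrow> 'b"

locale pseudo_functor = category J
  for J :: "('j, 'k) cat"
    and K :: "('x, 'a, 'b) twocat"
    and F :: "('j, 'k, 'x, 'a, 'b) psfun" +
  assumes PO_Obj: "j \<in> Ob J \<Longrightarrow> PO F j \<in> Obj K"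
    and PA_hom: "f \<in> hom J a b \<Longrightarrow> PA F f \<in> Ob (Hom K (PO F a) (PO F b))"
    and PC_iso: "\<lbrakk>f \<in> hom J a b; g \<in> hom J b c\<rbrakk> \<Longrightarrow>
      PC F g f \<in> isos (Hom K (PO F a) (PO F c))
        (Comp1 K (PO F a) (PO F b) (PO F c) (PA F g) (PA F f)) (PA F (Comp J g f))"
    and PU_iso: "j \<in> Ob J \<Longrightarrow>
      PU F j \<in> isos (Hom K (PO F j) (PO F j)) (One K (PO F j)) (PA F (Id J j))"
    and PU_right: "f \<in> hom J a b \<Longrightarrow>
      Comp (Hom K (PO F a) (PO F b)) (PC F f (Id J a))
        (Comp2 K (PO F a) (PO F a) (PO F b) (Id (Hom K (PO F a) (PO F b)) (PA F f)) (PU F a))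
      = Id (Hom K (PO F a) (PO F b)) (PA F f)"
    and PU_left: "f \<in> hom J a b \<Longrightarrow>
      Comp (Hom K (PO F a) (PO F b)) (PC F (Id J b) f)
        (Comp2 K (PO F a) (PO F b) (PO F b) (PU F b) (Id (Hom K (PO F a) (PO F b)) (PA F f)))
      = Id (Hom K (PO F a) (PO F b)) (PA F f)"
    and PC_assoc: "\<lbrakk>f \<in> hom J a b; g \<in> hom J b c; h \<in> hom J c d\<rbrakk> \<Longrightarrow>
      Comp (Hom K (PO F a) (PO F d)) (PC F h (Comp J g f))
        (Comp2 K (PO F a) (PO F c) (PO F d) (Id (Hom K (PO F c) (PO F d)) (PA F h)) (PC F g f))
      = Comp (Hom K (PO F a) (PO F d)) (PC F (Comp J h g) f)
        (Comp2 K (PO F a) (PO F b) (PO F d) (PC F h g) (Id (Hom K (PO F a) (PO F b)) (PA F f)))"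

definition const_psfun :: "('x, 'a, 'b) twocat \<Rightarrow> 'x \<Rightarrow> ('j, 'k, 'x, 'a, 'b) psfun" where
  "const_psfun K C =
    \<lparr>PO = (\<lambda>_. C), PA = (\<lambda>_. One K C),
     PC = (\<lambda>_ _. Id (Hom K C C) (One K C)), PU = (\<lambda>_. Id (Hom K C C) (One K C))\<rparr>"

text \<open>
  A pseudo natural transformation \<open>\<alpha> : F \<Rightarrow> G\<close> has components \<open>NO \<alpha> j : F j \<rightarrow> G j\<close> and invertible
  coherence 2-cells \<open>NA \<alpha> f : G f \<circ> \<alpha>\<^sub>a \<Rightarrow> \<alpha>\<^sub>b \<circ> F f\<close> for \<open>f : a \<rightarrow> b\<close>. Naturality of the latter in
  \<open>f\<close> is void, since \<open>J\<close> has no nonidentity 2-cells.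
\<close>

record ('j, 'k, 'a, 'b) psnat =
  NO :: "'j \<Rightarrow> 'a"
  NA :: "'k \<Rightarrow> 'b"

definition psnats :: "('j, 'k) cat \<Rightarrow> ('x, 'a, 'b) twocat \<Rightarrow>
    ('j, 'k, 'x, 'a, 'b) psfun \<Rightarrow> ('j, 'k, 'x, 'a, 'b) psfun \<Rightarrow> ('j, 'k, 'a, 'b) psnat set" where
  "psnats J K F G = {\<alpha>.
    NO \<alpha> \<in> (\<Pi>\<^sub>E j\<in>Ob J. Ob (Hom K (PO F j) (PO G j))) \<and>
    NA \<alpha> \<in> extensional (Arr J) \<and>
    (\<forall>a b. \<forall>f \<in> hom J a b. NA \<alpha> f \<in> isos (Hom K (PO F a) (PO G b))
      (Comp1 K (PO F a) (PO G a) (PO G b) (PA G f) (NO \<alpha> a))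
      (Comp1 K (PO F a) (PO F b) (PO G b) (NO \<alpha> b) (PA F f))) \<and>
    (\<forall>a \<in> Ob J. let H = Hom K (PO F a) (PO G a) in
      Comp H (NA \<alpha> (Id J a)) (Comp2 K (PO F a) (PO G a) (PO G a) (PU G a) (Id H (NO \<alpha> a)))
      = Comp2 K (PO F a) (PO F a) (PO G a) (Id H (NO \<alpha> a)) (PU F a)) \<and>
    (\<forall>a b c. \<forall>f \<in> hom J a b. \<forall>g \<in> hom J b c. let H = Hom K (PO F a) (PO G c) in
      Comp H (NA \<alpha> (Comp J g f))
        (Comp2 K (PO F a) (PO G a) (PO G c) (PC G g f) (Id (Hom K (PO F a) (PO G a)) (NO \<alpha> a)))
      = Comp H
        (Comp2 K (PO F a) (PO F c) (PO G c) (Id (Hom K (PO F c) (PO G c)) (NO \<alpha> c)) (PC F g f))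
        (Comp H
          (Comp2 K (PO F a) (PO F b) (PO G c) (NA \<alpha> g) (Id (Hom K (PO F a) (PO F b)) (PA F f)))
          (Comp2 K (PO F a) (PO G b) (PO G c) (Id (Hom K (PO G b) (PO G c)) (PA G g)) (NA \<alpha> f))))}"

type_synonym ('j, 'k, 'a, 'b) modif = "(('j, 'k, 'a, 'b) psnat, 'j, 'b) trans"

definition modifs :: "('j, 'k) cat \<Rightarrow> ('x, 'a, 'b) twocat \<Rightarrow>
    ('j, 'k, 'x, 'a, 'b) psfun \<Rightarrow> ('j, 'k, 'x, 'a, 'b) psfun \<Rightarrow> ('j, 'k, 'a, 'b) modif set" where
  "modifs J K F G = {\<Xi>.
    let \<alpha> = Source \<Xi>; \<beta> = Target \<Xi> in
      \<alpha> \<in> psnats J K F G \<and> \<beta> \<in> psnats J K F G \<and>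
      At \<Xi> \<in> (\<Pi>\<^sub>E j\<in>Ob J. hom (Hom K (PO F j) (PO G j)) (NO \<alpha> j) (NO \<beta> j)) \<and>
      (\<forall>a b. \<forall>f \<in> hom J a b. let H = Hom K (PO F a) (PO G b) in
        Comp H
          (Comp2 K (PO F a) (PO F b) (PO G b) (At \<Xi> b) (Id (Hom K (PO F a) (PO F b)) (PA F f)))
          (NA \<alpha> f)
        = Comp H (NA \<beta> f)
          (Comp2 K (PO F a) (PO G a) (PO G b)
            (Id (Hom K (PO G a) (PO G b)) (PA G f)) (At \<Xi> a)))}"

definition psnat_cat :: "('j, 'k) cat \<Rightarrow> ('x, 'a, 'b) twocat \<Rightarrow>
    ('j, 'k, 'x, 'a, 'b) psfun \<Rightarrow> ('j, 'k, 'x, 'a, 'b) psfun \<Rightarrow>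
    (('j, 'k, 'a, 'b) psnat, ('j, 'k, 'a, 'b) modif) cat" where
  "psnat_cat J K F G =
    \<lparr>Ob = psnats J K F G, Arr = modifs J K F G, Dom = Source, Cod = Target,
     Id = (\<lambda>\<alpha>. \<lparr>Source = \<alpha>, Target = \<alpha>,
       At = (\<lambda>j\<in>Ob J. Id (Hom K (PO F j) (PO G j)) (NO \<alpha> j))\<rparr>),
     Comp = (\<lambda>\<Theta> \<Xi>. \<lparr>Source = Source \<Xi>, Target = Target \<Theta>,
       At = (\<lambda>j\<in>Ob J. Comp (Hom K (PO F j) (PO G j)) (At \<Theta> j) (At \<Xi> j))\<rparr>)\<rparr>"

definition pseudo_cone :: "('j, 'k) cat \<Rightarrow> ('x, 'a, 'b) twocat \<Rightarrow>
    'x \<Rightarrow> ('j, 'k, 'x, 'a, 'b) psfun \<Rightarrow>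
    (('j, 'k, 'a, 'b) psnat, ('j, 'k, 'a, 'b) modif) cat" where
  "pseudo_cone J K C F = psnat_cat J K (const_psfun K C) F"

text \<open>The functor \<open>(\<pi> \<circ>) : Hom(C, W) \<rightarrow> PseudoCone(C, F)\<close> for a pseudo cone \<open>\<pi>\<close> with vertex \<open>W\<close>.\<close>

definition postcomp :: "('j, 'k) cat \<Rightarrow> ('x, 'a, 'b) twocat \<Rightarrow> ('j, 'k, 'x, 'a, 'b) psfun \<Rightarrow>
    'x \<Rightarrow> ('j, 'k, 'a, 'b) psnat \<Rightarrow> 'x \<Rightarrow>
    ('a, 'b, ('j, 'k, 'a, 'b) psnat, ('j, 'k, 'a, 'b) modif) ftor" where
  "postcomp J K F W \<pi> C =
    (let cone = (\<lambda>h.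
       \<lparr>NO = (\<lambda>j\<in>Ob J. Comp1 K C W (PO F j) (NO \<pi> j) h),
        NA = (\<lambda>f\<in>Arr J. Comp2 K C W (PO F (Cod J f)) (NA \<pi> f) (Id (Hom K C W) h))\<rparr>) in
    \<lparr>FO = (\<lambda>h\<in>Ob (Hom K C W). cone h),
     FA = (\<lambda>\<theta>\<in>Arr (Hom K C W).
       \<lparr>Source = cone (Dom (Hom K C W) \<theta>), Target = cone (Cod (Hom K C W) \<theta>),
        At = (\<lambda>j\<in>Ob J. Comp2 K C W (PO F j) (Id (Hom K W (PO F j)) (NO \<pi> j)) \<theta>)\<rparr>)\<rparr>)"

definition pseudo_limit :: "('j, 'k) cat \<Rightarrow> ('x, 'a, 'b) twocat \<Rightarrow> ('j, 'k, 'x, 'a, 'b) psfun \<Rightarrow>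
    'x \<Rightarrow> ('j, 'k, 'a, 'b) psnat \<Rightarrow> bool" where
  "pseudo_limit J K F W \<pi> \<longleftrightarrow>
    W \<in> Obj K \<and> \<pi> \<in> psnats J K (const_psfun K W) F \<and>
    (\<forall>C \<in> Obj K. cat_iso (Hom K C W) (pseudo_cone J K C F) (postcomp J K F W \<pi> C))"


section \<open>Smallness and the 2-category of small pseudo algebras\<close>

text \<open>
  Smallness is relative to a universe, as usual. HOL has no type of all sets, so a
  universe is given by the collection \<open>U\<close> of those sets of elements of some type that count
  as small, subject to the closure properties of a Grothendieck universe up to bijection. That
  the small sets include the infinite set of natural numbers is not needed. (In the type \<open>V\<close> of
  ZFC sets, the collection of those \<open>A :: V set\<close> that are the extension of a set is an example;
  another one is the collection of finite sets of natural numbers.)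
\<close>

locale universe =
  fixes U :: "'u set set"
  assumes small_lepoll: "\<lbrakk>A \<in> U; B \<lesssim> A\<rbrakk> \<Longrightarrow> B \<in> U"
    and small_pair: "{a, b} \<in> U"
    and small_Pow: "A \<in> U \<Longrightarrow> \<exists>B \<in> U. Pow A \<approx> B"
    and small_UN: "\<lbrakk>I \<in> U; \<And>i. i \<in> I \<Longrightarrow> X i \<in> U\<rbrakk> \<Longrightarrow> (\<Union>i\<in>I. X i) \<in> U"

definition small_cat :: "'u set set \<Rightarrow> ('u, 'u) cat \<Rightarrow> bool" where
  "small_cat U C \<longleftrightarrow> category C \<and> Ob C \<in> U \<and> Arr C \<in> U"

definition PsAlg :: "'u set set \<Rightarrow> 't theory_data \<Rightarrow>
    (('t, 'u, 'u) psalg, ('t, 'u, 'u) psmor, ('t, 'u, 'u) pscell) twocat" where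
  "PsAlg U T =
    \<lparr>Obj = {A. is_psalg T A \<and> small_cat U (car A)},
     Hom = (\<lambda>A B.
       \<lparr>Ob = psmors T A B, Arr = pscells T A B, Dom = Source, Cod = Target,
        Id = (\<lambda>H. \<lparr>Source = H, Target = H, At = At (idn (car A) (car B) (fun_of H))\<rparr>),
        Comp = (\<lambda>\<beta> \<alpha>. \<lparr>Source = Source \<alpha>, Target = Target \<beta>,
          At = At (vcomp (car A) (car B) (under \<beta>) (under \<alpha>))\<rparr>)\<rparr>),
     Comp1 = psmor_comp T,
     Comp2 = (\<lambda>A B C \<beta> \<alpha>.
       \<lparr>Source = psmor_comp T A B C (Source \<beta>) (Source \<alpha>),
        Target = psmor_comp T A B C (Target \<beta>) (Target \<alpha>),
        At = At (hcomp (car A) (car C) (under \<beta>) (under \<alpha>))\<rparr>),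
     One = psmor_id T\<rparr>"

end

theory Submission
  imports Defs
begin

text \<open>
  The limit is the pseudo limit of the underlying categories: an object is a family \<open>x\<^sub>j\<close> of objects of
  the \<open>F j\<close> with isomorphisms \<open>\<phi>\<^sub>f : F f x\<^sub>a \<rightarrow> x\<^sub>b\<close> for \<open>f : a \<rightarrow> b\<close> that are coherent with respect to
  the 2-cells of \<open>F\<close>, and an arrow is a family of arrows compatible with the \<open>\<phi>\<^sub>f\<close>. A word \<open>w\<close> acts
  componentwise on objects, where the isomorphisms of the result are those of the arguments
  composed with the \<open>\<rho>\<^sub>w\<close> of the morphisms \<open>F f\<close>. The coherence isomorphisms are taken componentwise:
  the laws of a morphism of pseudo algebras say that they are compatible with the \<open>\<phi>\<^sub>f\<close>, and the
  laws of a pseudo algebra hold because they hold in each component. The projections are strict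
  morphisms. A pseudo cone on \<open>F\<close> with vertex \<open>C\<close> amounts, at each object of \<open>C\<close>, to an object of the
  limit, which gives the universal property on the nose.
\<close>

section \<open>Categories, functors, natural transformations\<close>

text \<open>A 2-cell carries its source and target, so an equation between 2-cells also asserts
  equalities of functors. For the laws of an algebra these follow from strict identities, between
  words of \<open>T\<close> for the sources and between functors of \<open>End(X)\<close> for the
  targets. Once they are known, a law is a family of equations between arrows, and in this form it
  passes to the limit and back. An equation in the limit category \<open>W\<close> can be tested on
  the components \<open>pa j\<close>, but only between parallel arrows of \<open>W\<close>; hence
  the recurring care with endpoints. The isomorphism at \<open>f\<close> points from
  \<open>F f x\<^sub>a\<close> to \<open>x\<^sub>b\<close>, the direction in which
  \<open>\<rho>\<^sub>w\<close> of \<open>F f\<close> can be precomposed without being inverted. The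
  universal property asks for an isomorphism of categories, not an equivalence. This is why the
  structure isomorphisms belong to the data of an object, and why it matters that the projections
  are strict: then \<open>rho\<close> of a morphism into the limit has as its components
  \<open>rho\<close> of the composites with the projections.\<close>

lemma homI: "\<lbrakk>f \<in> Arr C; Dom C f = a; Cod C f = b\<rbrakk> \<Longrightarrow> f \<in> hom C a b"
  by (simp add: hom_def)

lemma homD:
  assumes "f \<in> hom C a b"
  shows "f \<in> Arr C" "Dom C f = a" "Cod C f = b"
  using assms by (simp_all add: hom_def)

lemma Arr_hom: "f \<in> Arr C \<Longrightarrow> f \<in> hom C (Dom C f) (Cod C f)"
  by (simp add: hom_def)

lemma isos_hom: "f \<in> isos C a b \<Longrightarrow> f \<in> hom C a b"
  by (simp add: isos_def)

lemma isosI: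
  "\<lbrakk>f \<in> hom C a b; g \<in> hom C b a; Comp C g f = Id C a; Comp C f g = Id C b\<rbrakk> \<Longrightarrow> f \<in> isos C a b"
  by (auto simp: isos_def)

lemma isosE:
  assumes "f \<in> isos C a b"
  obtains g where "g \<in> hom C b a" "Comp C g f = Id C a" "Comp C f g = Id C b"
  using assms by (auto simp: isos_def)

context category
begin

lemma hom_Ob: "f \<in> hom C a b \<Longrightarrow> a \<in> Ob C" "f \<in> hom C a b \<Longrightarrow> b \<in> Ob C"
  using Dom_Ob Cod_Ob by (auto simp: hom_def)

lemma Id_isos: "a \<in> Ob C \<Longrightarrow> Id C a \<in> isos C a a"
  using Id_hom Id_Comp isosI by metis

lemma Comp_isos:
  assumes f: "f \<in> isos C a b" and g: "g \<in> isos C b c"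
  shows "Comp C g f \<in> isos C a c"
proof -
  obtain f' where f': "f' \<in> hom C b a" "Comp C f' f = Id C a" "Comp C f f' = Id C b"
    using f by (rule isosE)
  obtain g' where g': "g' \<in> hom C c b" "Comp C g' g = Id C b" "Comp C g g' = Id C c"
    using g by (rule isosE)
  note h = isos_hom[OF f] isos_hom[OF g] f'(1) g'(1)
  show ?thesis
  proof (rule isosI)
    have "Comp C (Comp C f' g') (Comp C g f) = Comp C f' (Comp C (Comp C g' g) f)"
      using Comp_assoc[OF Comp_hom[OF h(1,2)] h(4,3)] Comp_assoc[OF h(1,2,4)] by simp
    then show "Comp C (Comp C f' g') (Comp C g f) = Id C a"
      using f' g' by (simp add: Id_Comp[OF h(1)])
    have "Comp C (Comp C g f) (Comp C f' g') = Comp C g (Comp C (Comp C f f') g')"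
      using Comp_assoc[OF Comp_hom[OF h(4,3)] h(1,2)] Comp_assoc[OF h(4,3,1)] by simp
    then show "Comp C (Comp C g f) (Comp C f' g') = Id C c"
      using f' g' by (simp add: Id_Comp[OF h(4)])
  qed (use h Comp_hom in auto)
qed

text \<open>Insert \<open>f f'\<close> to the right of \<open>v\<close>, use the square and cancel
  \<open>g' g\<close>. Applied to componentwise inverses, it carries naturality, the 2-cell law and
  compatibility with structure isomorphisms over to the inverse.\<close>

lemma square_inverse:
  assumes f: "f \<in> hom C a b" "f' \<in> hom C b a" "Comp C f f' = Id C b"
    and g: "g \<in> hom C c d" "g' \<in> hom C d c" "Comp C g' g = Id C c"
    and u: "u \<in> hom C a c" "v \<in> hom C b d" and eq: "Comp C v f = Comp C g u"
  shows "Comp C g' v = Comp C u f'"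
proof -
  have "Comp C g' v = Comp C g' (Comp C v (Comp C f f'))"
    using f(3) u by (simp add: Comp_Id)
  also have "\<dots> = Comp C g' (Comp C (Comp C g u) f')"
    using Comp_assoc[OF f(2,1) u(2)] eq by simp
  also have "\<dots> = Comp C (Comp C g' g) (Comp C u f')"
    using Comp_assoc[OF f(2) u(1) g(1)] Comp_assoc[OF Comp_hom[OF f(2) u(1)] g(1,2)] by simp
  also have "\<dots> = Comp C u f'"
    using g(3) by (simp add: Id_Comp[OF Comp_hom[OF f(2) u(1)]])
  finally show ?thesis .
qed

end

section \<open>Functors and their composites\<close>

lemma functorsI:
  assumes "FO F \<in> extensional (Ob A)" "FA F \<in> extensional (Arr A)"
    and "\<And>x. x \<in> Ob A \<Longrightarrow> FO F x \<in> Ob B"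
    and "\<And>a b f. f \<in> hom A a b \<Longrightarrow> FA F f \<in> hom B (FO F a) (FO F b)"
    and "\<And>x. x \<in> Ob A \<Longrightarrow> FA F (Id A x) = Id B (FO F x)"
    and "\<And>a b c f g. \<lbrakk>f \<in> hom A a b; g \<in> hom A b c\<rbrakk> \<Longrightarrow>
      FA F (Comp A g f) = Comp B (FA F g) (FA F f)"
  shows "F \<in> functors A B"
proof -
  have "FA F f \<in> Arr B" if "f \<in> Arr A" for f
    using assms(4)[OF Arr_hom[OF that]] by (rule homD)
  then show ?thesis
    using assms unfolding functors_def PiE_def by blast
qed

lemma functorsD:
  assumes "F \<in> functors A B"
  shows "FO F \<in> extensional (Ob A)" "FA F \<in> extensional (Arr A)"
    and "x \<in> Ob A \<Longrightarrow> FO F x \<in> Ob B"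
    and "f \<in> hom A a b \<Longrightarrow> FA F f \<in> hom B (FO F a) (FO F b)"
    and "x \<in> Ob A \<Longrightarrow> FA F (Id A x) = Id B (FO F x)"
    and "\<lbrakk>f \<in> hom A a b; g \<in> hom A b c\<rbrakk> \<Longrightarrow> FA F (Comp A g f) = Comp B (FA F g) (FA F f)"
  using assms unfolding functors_def PiE_def by auto

lemma functor_eqI:
  assumes "F \<in> functors A B" "G \<in> functors A B"
    and "\<And>x. x \<in> Ob A \<Longrightarrow> FO F x = FO G x" "\<And>f. f \<in> Arr A \<Longrightarrow> FA F f = FA G f"
  shows "F = G"
proof (rule ftor.equality)
  show "FO F = FO G" "FA F = FA G"
    using assms functorsD(1,2) by (metis extensionalityI)+
qed simp

lemma functor_isos:
  assumes "F \<in> functors A B" "category A" "f \<in> isos A a b"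
  shows "FA F f \<in> isos B (FO F a) (FO F b)"
proof -
  obtain g where g: "g \<in> hom A b a" "Comp A g f = Id A a" "Comp A f g = Id A b"
    using assms(3) by (rule isosE)
  note f = isos_hom[OF assms(3)]
  note ob = category.hom_Ob[OF assms(2) f]
  show ?thesis
    using functorsD(4-6)[OF assms(1)] f g ob by (intro isosI[of _ _ _ _ "FA F g"]) metis+
qed

lemma FO_fcomp: "x \<in> Ob A \<Longrightarrow> FO (fcomp A G F) x = FO G (FO F x)"
  and FA_fcomp: "f \<in> Arr A \<Longrightarrow> FA (fcomp A G F) f = FA G (FA F f)"
  by (simp_all add: fcomp_def compose_def)

lemma FO_fid: "x \<in> Ob A \<Longrightarrow> FO (fid A) x = x"
  and FA_fid: "f \<in> Arr A \<Longrightarrow> FA (fid A) f = f"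
  by (simp_all add: fid_def)

lemma fid_functor: "category A \<Longrightarrow> fid A \<in> functors A A"
  by (rule functorsI)
    (auto simp: fid_def category.Id_hom category.Comp_hom category.hom_Ob homD
      dest: homD(1) category.Id_hom category.Comp_hom)

lemma fcomp_functor:
  assumes F: "F \<in> functors A B" and G: "G \<in> functors B C" and A: "category A"
  shows "fcomp A G F \<in> functors A C"
proof (rule functorsI)
  note ho = category.hom_Ob[OF A]
  show "FO (fcomp A G F) \<in> extensional (Ob A)" "FA (fcomp A G F) \<in> extensional (Arr A)"
    by (simp_all add: fcomp_def compose_def)
  show "FO (fcomp A G F) x \<in> Ob C" if "x \<in> Ob A" for x
    using that by (simp add: FO_fcomp functorsD[OF F] functorsD[OF G])
  show "FA (fcomp A G F) f \<in> hom C (FO (fcomp A G F) a) (FO (fcomp A G F) b)"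
    if "f \<in> hom A a b" for f a b
    using that ho[OF that] by (simp add: FO_fcomp FA_fcomp homD functorsD(4)[OF F]
        functorsD(4)[OF G])
  show "FA (fcomp A G F) (Id A x) = Id C (FO (fcomp A G F) x)" if "x \<in> Ob A" for x
    using that by (simp add: FO_fcomp FA_fcomp homD(1)[OF category.Id_hom[OF A]] functorsD[OF F]
        functorsD[OF G])
  show "FA (fcomp A G F) (Comp A g f) = Comp C (FA (fcomp A G F) g) (FA (fcomp A G F) f)"
    if "f \<in> hom A a b" "g \<in> hom A b c" for a b c f g
    using that by (simp add: FA_fcomp homD(1)[OF category.Comp_hom[OF A that]] homD(1)
        functorsD(6)[OF F that] functorsD(6)[OF G functorsD(4)[OF F that(1)]
            functorsD(4)[OF F that(2)]])
qed

lemma fcomp_assoc: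
  assumes "F \<in> functors A B"
  shows "fcomp A (fcomp B H G) F = fcomp A H (fcomp A G F)"
proof -
  have "FO F x \<in> Ob B" if "x \<in> Ob A" for x using that by (rule functorsD(3)[OF assms])
  moreover have "FA F f \<in> Arr B" if "f \<in> Arr A" for f
    by (rule homD(1)[OF functorsD(4)[OF assms Arr_hom[OF that]]])
  ultimately show ?thesis
    by (auto simp: fcomp_def compose_def fun_eq_iff)
qed

lemma fcomp_fid_right: "F \<in> functors A B \<Longrightarrow> fcomp A F (fid A) = F"
  using functorsD(1,2)[of F A B]
  by (intro ftor.equality) (auto simp: fcomp_def compose_def fid_def fun_eq_iff extensional_def)

lemma fcomp_fid_left:
  assumes "F \<in> functors A B"
  shows "fcomp A (fid B) F = F"
proof -
  have "FO F x \<in> Ob B" if "x \<in> Ob A" for x using that by (rule functorsD(3)[OF assms])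
  moreover have "FA F f \<in> Arr B" if "f \<in> Arr A" for f
    by (rule homD(1)[OF functorsD(4)[OF assms Arr_hom[OF that]]])
  ultimately show ?thesis
    using functorsD(1,2)[OF assms]
    by (intro ftor.equality) (auto simp: fcomp_def compose_def fid_def fun_eq_iff extensional_def)
qed

section \<open>Natural transformations with vertical and horizontal composition\<close>

lemma natsI:
  assumes "F \<in> functors A B" "G \<in> functors A B" "Source \<alpha> = F" "Target \<alpha> = G"
    and "At \<alpha> \<in> extensional (Ob A)"
    and "\<And>x. x \<in> Ob A \<Longrightarrow> At \<alpha> x \<in> hom B (FO F x) (FO G x)"
    and "\<And>a b f. f \<in> hom A a b \<Longrightarrow> Comp B (At \<alpha> b) (FA F f) = Comp B (FA G f) (At \<alpha> a)"
  shows "\<alpha> \<in> nats A B F G"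
  using assms by (auto simp: nats_def PiE_def)

lemma natsD:
  assumes "\<alpha> \<in> nats A B F G"
  shows "F \<in> functors A B" "G \<in> functors A B" "Source \<alpha> = F" "Target \<alpha> = G"
    and "At \<alpha> \<in> extensional (Ob A)"
    and "x \<in> Ob A \<Longrightarrow> At \<alpha> x \<in> hom B (FO F x) (FO G x)"
    and "f \<in> hom A a b \<Longrightarrow> Comp B (At \<alpha> b) (FA F f) = Comp B (FA G f) (At \<alpha> a)"
  using assms by (auto simp: nats_def PiE_def)

lemma nat_isosI:
  "\<lbrakk>\<alpha> \<in> nats A B F G; \<And>x. x \<in> Ob A \<Longrightarrow> At \<alpha> x \<in> isos B (FO F x) (FO G x)\<rbrakk> \<Longrightarrow>
    \<alpha> \<in> nat_isos A B F G"
  by (simp add: nat_isos_def)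

lemma nat_isosD:
  assumes "\<alpha> \<in> nat_isos A B F G"
  shows "\<alpha> \<in> nats A B F G" "x \<in> Ob A \<Longrightarrow> At \<alpha> x \<in> isos B (FO F x) (FO G x)"
  using assms by (simp_all add: nat_isos_def)

lemma trans_eqI:
  assumes "Source \<alpha> = Source \<beta>" "Target \<alpha> = Target \<beta>"
    and "At \<alpha> \<in> extensional S" "At \<beta> \<in> extensional S" "\<And>x. x \<in> S \<Longrightarrow> At \<alpha> x = At \<beta> x"
  shows "\<alpha> = (\<beta> :: ('f, 'i, 'x) trans)"
  using assms by (intro trans.equality extensionalityI[of _ S]) auto

lemma At_ext[simp]:
  "At (idn A B F) \<in> extensional (Ob A)" "At (vcomp A B \<beta> \<alpha>) \<in> extensional (Ob A)"
  "At (hcomp A C \<beta>' \<alpha>') \<in> extensional (Ob A)"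
  by (simp_all add: idn_def vcomp_def hcomp_def)

lemma ST_simps[simp]:
  "Source (idn A B F) = F" "Target (idn A B F) = F"
  "Source (vcomp A B \<beta> \<alpha>) = Source \<alpha>" "Target (vcomp A B \<beta> \<alpha>) = Target \<beta>"
  "Source (hcomp A C \<beta>' \<alpha>') = fcomp A (Source \<beta>') (Source \<alpha>')"
  "Target (hcomp A C \<beta>' \<alpha>') = fcomp A (Target \<beta>') (Target \<alpha>')"
  by (simp_all add: idn_def vcomp_def hcomp_def)

lemma At_idn: "x \<in> Ob A \<Longrightarrow> At (idn A B F) x = Id B (FO F x)"
  and At_vcomp: "x \<in> Ob A \<Longrightarrow> At (vcomp A B \<beta> \<alpha>) x = Comp B (At \<beta> x) (At \<alpha> x)"
  and At_hcomp: "x \<in> Ob A \<Longrightarrow> At (hcomp A C \<beta>' \<alpha>') x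
    = Comp C (At \<beta>' (FO (Target \<alpha>') x)) (FA (Source \<beta>') (At \<alpha>' x))"
  by (simp_all add: idn_def vcomp_def hcomp_def)

lemma idn_nats:
  assumes F: "F \<in> functors A B" and "category A" "category B"
  shows "idn A B F \<in> nats A B F F"
proof (rule natsI[OF F F])
  show "At (idn A B F) x \<in> hom B (FO F x) (FO F x)" if "x \<in> Ob A" for x
    using that functorsD(3)[OF F that] by (simp add: At_idn category.Id_hom assms)
  show "Comp B (At (idn A B F) b) (FA F f) = Comp B (FA F f) (At (idn A B F) a)"
    if "f \<in> hom A a b" for a b f
    using functorsD(4)[OF F that] category.hom_Ob[OF assms(2) that]
    by (simp add: At_idn category.Id_Comp[OF assms(3)] category.Comp_Id[OF assms(3)])
qed simp_all

lemma idn_nat_isos: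
  assumes F: "F \<in> functors A B" and "category A" "category B"
  shows "idn A B F \<in> nat_isos A B F F"
  by (rule nat_isosI[OF idn_nats[OF assms]])
    (simp add: At_idn category.Id_isos assms functorsD(3)[OF F])

lemma vcomp_nats:
  assumes a: "\<alpha> \<in> nats A B F G" and b: "\<beta> \<in> nats A B G H" and "category A" and B: "category B"
  shows "vcomp A B \<beta> \<alpha> \<in> nats A B F H"
proof (rule natsI)
  show "At (vcomp A B \<beta> \<alpha>) x \<in> hom B (FO F x) (FO H x)" if "x \<in> Ob A" for x
    using that natsD(6)[OF a that] natsD(6)[OF b that]
        by (simp add: At_vcomp category.Comp_hom[OF B])
  show "Comp B (At (vcomp A B \<beta> \<alpha>) y) (FA F f) = Comp B (FA H f) (At (vcomp A B \<beta> \<alpha>) x)"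
    if f: "f \<in> hom A x y" for x y f
  proof -
    note xy = category.hom_Ob[OF assms(3) f]
    note t = natsD(6)[OF a xy(1)] natsD(6)[OF a xy(2)] natsD(6)[OF b xy(1)] natsD(6)[OF b xy(2)]
      functorsD(4)[OF natsD(1)[OF a] f] functorsD(4)[OF natsD(2)[OF a] f]
      functorsD(4)[OF natsD(2)[OF b] f]
    show ?thesis
      using t xy natsD(7)[OF a f] natsD(7)[OF b f]
      category.Comp_assoc[OF B t(5,2,4)] category.Comp_assoc[OF B t(1,6,4)]
          category.Comp_assoc[OF B t(1,3,7)]
      by (simp add: At_vcomp)
  qed
qed (use natsD[OF a] natsD[OF b] in simp_all)

lemma vcomp_nat_isos:
  assumes a: "\<alpha> \<in> nat_isos A B F G" and b: "\<beta> \<in> nat_isos A B G H" and "category A" "category B"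
  shows "vcomp A B \<beta> \<alpha> \<in> nat_isos A B F H"
  using nat_isosD[OF a] nat_isosD[OF b] assms(3,4)
  by (intro nat_isosI vcomp_nats) (auto simp: At_vcomp intro: category.Comp_isos)

lemma hcomp_nats:
  assumes a: "\<alpha> \<in> nats A B F G" and b: "\<beta> \<in> nats B C H K"
    and A: "category A" and B: "category B" and C: "category C"
  shows "hcomp A C \<beta> \<alpha> \<in> nats A C (fcomp A H F) (fcomp A K G)"
proof (rule natsI)
  note F = natsD(1)[OF a] and G = natsD(2)[OF a] and H = natsD(1)[OF b] and K = natsD(2)[OF b]
  show "fcomp A H F \<in> functors A C" "fcomp A K G \<in> functors A C"
    using F G H K A by (auto intro: fcomp_functor)
  have t1: "FA H (At \<alpha> x) \<in> hom C (FO H (FO F x)) (FO H (FO G x))"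
    and t2: "At \<beta> (FO G x) \<in> hom C (FO H (FO G x)) (FO K (FO G x))" if "x \<in> Ob A" for x
    using functorsD(4)[OF H] natsD(6)[OF a] natsD(6)[OF b] functorsD(3)[OF G] that by auto
  show "At (hcomp A C \<beta> \<alpha>) x \<in> hom C (FO (fcomp A H F) x) (FO (fcomp A K G) x)"
    if "x \<in> Ob A" for x
    using t1[OF that] t2[OF that] that natsD(3,4)[OF a] natsD(3,4)[OF b]
    by (simp add: At_hcomp FO_fcomp category.Comp_hom[OF C])
  show "Comp C (At (hcomp A C \<beta> \<alpha>) y) (FA (fcomp A H F) f)
      = Comp C (FA (fcomp A K G) f) (At (hcomp A C \<beta> \<alpha>) x)"
    if f: "f \<in> hom A x y" for x y f
  proof -
    note xy = category.hom_Ob[OF A f]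
    \<comment> \<open>The square of \<open>\<alpha>\<close> at \<open>f\<close> is used under the
      functor \<open>H\<close>, the square of \<open>\<beta>\<close> at the arrow
      \<open>FA G f\<close>.\<close>
    have "Comp C (Comp C (At \<beta> (FO G y)) (FA H (At \<alpha> y))) (FA H (FA F f))
        = Comp C (At \<beta> (FO G y)) (FA H (Comp B (At \<alpha> y) (FA F f)))"
      using category.Comp_assoc[OF C functorsD(4)[OF H functorsD(4)[OF F f]] t1[OF xy(2)]
          t2[OF xy(2)]]
        functorsD(6)[OF H functorsD(4)[OF F f] natsD(6)[OF a xy(2)]] by simp
    also have "\<dots> = Comp C (At \<beta> (FO G y)) (Comp C (FA H (FA G f)) (FA H (At \<alpha> x)))"
      using natsD(7)[OF a f] functorsD(6)[OF H natsD(6)[OF a xy(1)] functorsD(4)[OF G f]] by simp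
    also have "\<dots> = Comp C (Comp C (FA K (FA G f)) (At \<beta> (FO G x))) (FA H (At \<alpha> x))"
      using category.Comp_assoc[OF C t1[OF xy(1)] functorsD(4)[OF H functorsD(4)[OF G f]]
          t2[OF xy(2)]]
        natsD(7)[OF b functorsD(4)[OF G f]] by simp
    also have "\<dots> = Comp C (FA K (FA G f)) (Comp C (At \<beta> (FO G x)) (FA H (At \<alpha> x)))"
      using category.Comp_assoc[OF C t1[OF xy(1)] t2[OF xy(1)]
          functorsD(4)[OF K functorsD(4)[OF G f]]]
      by simp
    finally show ?thesis
      using xy homD(1)[OF f] natsD(3,4)[OF a] natsD(3,4)[OF b] by (simp add: At_hcomp FA_fcomp)
  qed
qed (use natsD[OF a] natsD[OF b] in simp_all)

lemma hcomp_nat_isos: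
  assumes a: "\<alpha> \<in> nat_isos A B F G" and b: "\<beta> \<in> nat_isos B C H K"
    and A: "category A" and B: "category B" and C: "category C"
  shows "hcomp A C \<beta> \<alpha> \<in> nat_isos A C (fcomp A H F) (fcomp A K G)"
proof (rule nat_isosI)
  note a' = nat_isosD(1)[OF a] and b' = nat_isosD(1)[OF b]
  show "hcomp A C \<beta> \<alpha> \<in> nats A C (fcomp A H F) (fcomp A K G)"
    using assms by (auto intro: hcomp_nats nat_isosD)
  show "At (hcomp A C \<beta> \<alpha>) x \<in> isos C (FO (fcomp A H F) x) (FO (fcomp A K G) x)" if "x \<in> Ob A" for x
    using that natsD(3,4)[OF a'] natsD(3,4)[OF b'] category.Comp_isos[OF C
      functor_isos[OF natsD(1)[OF b'] B nat_isosD(2)[OF a that]]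
      nat_isosD(2)[OF b functorsD(3)[OF natsD(2)[OF a'] that]]]
    by (simp add: At_hcomp FO_fcomp)
qed

text \<open>The factor \<open>FA H\<close> in \<open>hcomp\<close> is applied to an identity and
  disappears, so whiskering on this side only reindexes the components. In the mirror image below it
  is the other factor that is an identity.\<close>

lemma At_hcomp_idn_right:
  assumes x: "x \<in> Ob A" and "F \<in> functors A B" "\<beta> \<in> nats B C H K" "category C"
  shows "At (hcomp A C \<beta> (idn A B F)) x = At \<beta> (FO F x)"
proof -
  have Fx: "FO F x \<in> Ob B" using functorsD(3)[OF assms(2) x] .
  show ?thesis
    using x category.Comp_Id[OF assms(4) natsD(6)[OF assms(3) Fx]]
        functorsD(5)[OF natsD(1)[OF assms(3)] Fx]
      natsD(3)[OF assms(3)]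
    by (simp add: At_hcomp At_idn)
qed

lemma At_hcomp_idn_left:
  assumes x: "x \<in> Ob A" and "\<alpha> \<in> nats A B F G" "H \<in> functors B C" "category C"
  shows "At (hcomp A C (idn B C H) \<alpha>) x = FA H (At \<alpha> x)"
proof -
  note t = natsD(6)[OF assms(2) x]
  show ?thesis
    using x functorsD(3)[OF natsD(2)[OF assms(2)] x] natsD(4)[OF assms(2)]
      category.Id_Comp[OF assms(4) functorsD(4)[OF assms(3) t]]
    by (simp add: At_hcomp At_idn)
qed

section \<open>Blocks and powers\<close>

lemma offset_0[simp]: "offset n 0 = 0"
  and offset_Suc[simp]: "offset n (Suc k) = offset n k + n k"
  by (simp_all add: offset_def)

lemma offset_const[simp]: "offset (\<lambda>_. m) k = k * m"
  by (simp add: offset_def)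

lemma offset_cong: "(\<And>i. i < k \<Longrightarrow> n i = n' i) \<Longrightarrow> offset n k = offset n' k"
  by (simp add: offset_def)

lemma offset_mono: "i \<le> k \<Longrightarrow> offset n i \<le> offset n k"
  unfolding offset_def by (rule sum_mono2) auto

lemma incl_less:
  assumes "i < k" "j < n i"
  shows "incl n i j < offset n k"
  using offset_mono[of "Suc i" k n] assms by (simp add: incl_def)

text \<open>Induction on the number of blocks: a number not below \<open>offset n k\<close> lies in
  the last one. Together with \<open>blk_of_incl\<close> and \<open>pos_of_incl\<close> this
  replaces arithmetic with \<open>blk_of\<close> and \<open>pos_of\<close> by reasoning about pairs
  of indices.\<close>

lemma incl_Ex:
  assumes "q < offset n k"
  shows "\<exists>i<k. \<exists>j<n i. q = incl n i j"
  using assms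
proof (induction k)
  case (Suc k)
  then show ?case
  proof (cases "q < offset n k")
    case False
    then have "q = incl n k (q - offset n k)" "q - offset n k < n k"
      using Suc.prems by (auto simp: incl_def)
    then show ?thesis by blast
  qed (use Suc less_Suc_eq in blast)
qed simp

lemma blk_of_incl:
  assumes "j < n i"
  shows "blk_of n (incl n i j) = i"
  unfolding blk_of_def
proof (rule Least_equality)
  show "incl n i j < offset n (Suc i)" using assms by (simp add: incl_def)
  fix i' assume "incl n i j < offset n (Suc i')"
  then show "i \<le> i'"
    using offset_mono[of "Suc i'" i n] by (fastforce simp: incl_def not_le Suc_le_eq)
qed

lemma pos_of_incl: "j < n i \<Longrightarrow> pos_of n (incl n i j) = j"
  by (simp add: pos_of_def blk_of_incl) (simp add: incl_def)

lemma blk_map_incl: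
  assumes "i < k" "j < n (f i)"
  shows "blk_map n k f (incl (n \<circ> f) i j) = incl n (f i) j"
  using assms incl_less[of i k j "n \<circ> f"] blk_of_incl[of j "n \<circ> f" i] pos_of_incl[of j "n \<circ> f" i]
  by (simp add: blk_map_def)

lemma blk_sum_incl:
  assumes "i < k" "j < n i"
  shows "blk_sum n n' k g (incl n i j) = incl n' i (g i j)"
  using assms incl_less[of i k j n] by (simp add: blk_sum_def blk_of_incl pos_of_incl)

lemma blk_map_PiE:
  assumes "f \<in> {..<k} \<rightarrow>\<^sub>E {..<l}"
  shows "blk_map n k f \<in> {..<offset (n \<circ> f) k} \<rightarrow>\<^sub>E {..<offset n l}"
proof (rule PiE_I)
  fix q assume "q \<in> {..<offset (n \<circ> f) k}"
  then obtain i j where ij: "i < k" "j < n (f i)" "q = incl (n \<circ> f) i j"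
    using incl_Ex[of q "n \<circ> f" k] by auto
  then show "blk_map n k f q \<in> {..<offset n l}"
    using assms by (auto simp: blk_map_incl intro!: incl_less)
qed (simp add: blk_map_def)

lemma blk_sum_PiE:
  assumes "\<And>i. i < k \<Longrightarrow> g i \<in> {..<n i} \<rightarrow>\<^sub>E {..<n' i}"
  shows "blk_sum n n' k g \<in> {..<offset n k} \<rightarrow>\<^sub>E {..<offset n' k}"
proof (rule PiE_I)
  fix q assume "q \<in> {..<offset n k}"
  then obtain i j where ij: "i < k" "j < n i" "q = incl n i j"
    using incl_Ex[of q n k] by auto
  then show "blk_sum n n' k g q \<in> {..<offset n' k}"
    using assms[OF ij(1)] by (auto simp: blk_sum_incl intro!: incl_less)
qed (simp add: blk_sum_def)

lemma blk_apply: "j < n i \<Longrightarrow> blk n i x j = x (incl n i j)"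
  by (simp add: blk_def compose_def)

lemma blk_restrict: "blk n i x = (\<lambda>j\<in>{..<n i}. x (incl n i j))"
  by (simp add: blk_def compose_def)

text \<open>The bound is \<open>j \<le> n i\<close> rather than \<open>j < n i\<close> because the
  end of one block has to serve as the start of the next in the induction on \<open>i\<close>; the
  inner induction then walks through a single block.\<close>

lemma offset_offset:
  assumes "j \<le> n i"
  shows "offset p (incl n i j) = offset (\<lambda>i. offset (blk n i p) (n i)) i + offset (blk n i p) j"
  using assms
proof (induction i arbitrary: j)
  case 0
  then show ?case by (auto simp: incl_def offset_def blk_def compose_def)
next
  case (Suc i)
  have "offset p (incl n (Suc i) 0) = offset p (incl n i (n i))"
    by (simp add: incl_def)
  also have "\<dots> = offset (\<lambda>i. offset (blk n i p) (n i)) (Suc i)"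
    using Suc.IH[of "n i"] by simp
  finally have 0: "offset p (offset n (Suc i)) = offset (\<lambda>i. offset (blk n i p) (n i)) (Suc i)"
    by (simp add: incl_def)
  from Suc.prems show ?case
  proof (induction j)
    case (Suc j)
    then show ?case by (simp add: incl_def blk_apply)
  qed (use 0 in \<open>simp add: incl_def\<close>)
qed

lemma offset_offset_total:
  "offset (\<lambda>i. offset (blk n i p) (n i)) k = offset p (offset n k)"
  using offset_offset[of 0 n k p] by (simp add: incl_def)

text \<open>Associativity of concatenation on the level of positions: joining all lists at once or
  joining groups of lists first puts each entry in the same place.\<close>

lemma incl_incl:
  assumes "j < n i"
  shows "incl p (incl n i j) q = incl (\<lambda>i. offset (blk n i p) (n i)) i (incl (blk n i p) j q)"
  using offset_offset[of j n i p] assms by (simp add: incl_def)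

text \<open>Functional form of \<open>incl_incl\<close>. It lets a family that is listed flatly,
  such as \<open>vs\<close> in \<open>c_assoc\<close>, be regrouped according to the outer
  words.\<close>

lemma blk_blk:
  assumes "j < n i"
  shows "blk (blk n i p) j (blk (\<lambda>i. offset (blk n i p) (n i)) i x) = blk p (incl n i j) x"
proof -
  have "incl (blk n i p) j q < offset (blk n i p) (n i)" if "q < p (incl n i j)" for q
    using that assms by (intro incl_less) (simp_all add: blk_apply)
  then show ?thesis
    using assms by (auto simp: blk_restrict[of "blk n i p"] blk_restrict[of p] fun_eq_iff blk_apply
        incl_incl[of j n i p])
qed

section \<open>Powers of a category and functors between them\<close>

lemma pw_simps[simp]:
  "Ob (pw X n) = ({..<n} \<rightarrow>\<^sub>E Ob X)" "Arr (pw X n) = ({..<n} \<rightarrow>\<^sub>E Arr X)"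
  "Id (pw X n) x = (\<lambda>i\<in>{..<n}. Id X (x i))"
  "Comp (pw X n) g f = (\<lambda>i\<in>{..<n}. Comp X (g i) (f i))"
  by (simp_all add: pw_def)

text \<open>\<open>Dom\<close> and \<open>Cod\<close> of a power are restricted functions, so the
  endpoints of an arrow are extensional. With this recorded, arrows of powers can be handled index
  by index.\<close>

lemma hom_pw: "f \<in> hom (pw X n) a b \<longleftrightarrow>
  f \<in> extensional {..<n} \<and> a \<in> extensional {..<n} \<and> b \<in> extensional {..<n} \<and>
  (\<forall>i<n. f i \<in> hom X (a i) (b i))"
  unfolding hom_def pw_def PiE_def Pi_def extensional_def restrict_def
  by (auto simp: fun_eq_iff)

lemma pw_category:
  assumes "category X"
  shows "category (pw X n)"
proof -
  interpret category X by fact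
  show ?thesis
  proof
    show "Dom (pw X n) f \<in> Ob (pw X n)" "Cod (pw X n) f \<in> Ob (pw X n)" if "f \<in> Arr (pw X n)" for f
      using that Dom_Ob Cod_Ob by (auto simp: pw_def)
    show "Id (pw X n) a \<in> hom (pw X n) a a" if "a \<in> Ob (pw X n)" for a
      using that Id_hom by (auto simp: hom_pw PiE_iff)
    fix f a b assume f: "f \<in> hom (pw X n) a b"
    then show "Comp (pw X n) f (Id (pw X n) a) = f" "Comp (pw X n) (Id (pw X n) b) f = f"
      using Id_Comp Comp_Id by (auto simp: hom_pw fun_eq_iff extensional_def)
    fix g c assume g: "g \<in> hom (pw X n) b c"
    show "Comp (pw X n) g f \<in> hom (pw X n) a c"
      using f g Comp_hom by (auto simp: hom_pw)
    fix h d assume h: "h \<in> hom (pw X n) c d"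
    show "Comp (pw X n) h (Comp (pw X n) g f) = Comp (pw X n) (Comp (pw X n) h g) f"
    proof -
      have "Comp X (h i) (Comp X (g i) (f i)) = Comp X (Comp X (h i) (g i)) (f i)" if "i < n" for i
        using that f g h Comp_assoc[of "f i" "a i" "b i" "g i" "c i" "h i" "d i"]
            by (simp add: hom_pw)
      then show ?thesis by auto
    qed
  qed
qed

lemma pw_isos:
  assumes "u \<in> extensional {..<n}" "x \<in> extensional {..<n}" "y \<in> extensional {..<n}"
    and "\<And>i. i < n \<Longrightarrow> u i \<in> isos X (x i) (y i)"
  shows "u \<in> isos (pw X n) x y"
proof -
  have "\<forall>i. \<exists>v. i < n \<longrightarrow> v \<in> hom X (y i) (x i) \<and> Comp X v (u i) = Id X (x i) \<and> Comp X (u i) v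
      = Id X (y i)"
    using assms(4) unfolding isos_def by blast
  then obtain v where v: "\<And>i. i < n \<Longrightarrow>
      v i \<in> hom X (y i) (x i) \<and> Comp X (v i) (u i) = Id X (x i) \<and> Comp X (u i) (v i) = Id X (y i)"
    by metis
  show ?thesis
    by (rule isosI[of _ _ _ _ "restrict v {..<n}"])
      (use assms v isos_hom[OF assms(4)] in \<open>auto simp: hom_pw fun_eq_iff\<close>)
qed

lemma compose_pw:
  assumes "\<And>i. i < k \<Longrightarrow> f i < l"
  shows "x \<in> Ob (pw X l) \<Longrightarrow> compose {..<k} x f \<in> Ob (pw X k)"
    and "u \<in> Arr (pw X l) \<Longrightarrow> compose {..<k} u f \<in> Arr (pw X k)"
    and "u \<in> hom (pw X l) x y \<Longrightarrow> compose {..<k} u f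
        \<in> hom (pw X k) (compose {..<k} x f) (compose {..<k} y f)"
    and "compose {..<k} (Id (pw X l) x) f = Id (pw X k) (compose {..<k} x f)"
    and "compose {..<k} (Comp (pw X l) u v) f
        = Comp (pw X k) (compose {..<k} u f) (compose {..<k} v f)"
  using assms by (auto simp: compose_def hom_pw fun_eq_iff PiE_iff)

lemma blk_pw:
  assumes "i < k"
  shows "x \<in> Ob (pw X (offset n k)) \<Longrightarrow> blk n i x \<in> Ob (pw X (n i))"
    and "u \<in> Arr (pw X (offset n k)) \<Longrightarrow> blk n i u \<in> Arr (pw X (n i))"
    and "u \<in> hom (pw X (offset n k)) x y \<Longrightarrow> blk n i u \<in> hom (pw X (n i)) (blk n i x) (blk n i y)"
    and "blk n i (Id (pw X (offset n k)) x) = Id (pw X (n i)) (blk n i x)"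
    and "blk n i (Comp (pw X (offset n k)) u v) = Comp (pw X (n i)) (blk n i u) (blk n i v)"
  unfolding blk_def by (rule compose_pw[OF incl_less[OF assms]]; assumption)+

lemma FO_prodF: "x \<in> Ob (pw X (offset n k)) \<Longrightarrow>
    FO (prodF X k n F) x = (\<lambda>i\<in>{..<k}. FO (F i) (blk n i x))"
  and FA_prodF: "u \<in> Arr (pw X (offset n k)) \<Longrightarrow>
    FA (prodF X k n F) u = (\<lambda>i\<in>{..<k}. FA (F i) (blk n i u))"
  and FO_powF: "x \<in> Ob (pw X n') \<Longrightarrow> FO (powF X n' H) x = (\<lambda>i\<in>{..<n'}. FO H (x i))"
  and FA_powF: "u \<in> Arr (pw X n') \<Longrightarrow> FA (powF X n' H) u = (\<lambda>i\<in>{..<n'}. FA H (u i))"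
  and FO_substF: "x \<in> Ob (pw X l) \<Longrightarrow> FO (substF X k l f G) x = FO G (compose {..<k} x f)"
  and FA_substF: "u \<in> Arr (pw X l) \<Longrightarrow> FA (substF X k l f G) u = FA G (compose {..<k} u f)"
  and FO_unitF: "x \<in> Ob (pw X 1) \<Longrightarrow> FO (unitF X) x = x 0"
  and FA_unitF: "u \<in> Arr (pw X 1) \<Longrightarrow> FA (unitF X) u = u 0"
  by (simp_all add: prodF_def powF_def substF_def unitF_def del: pw_simps)

lemma FO_gammaF: "x \<in> Ob (pw X (offset n k)) \<Longrightarrow>
    FO (gammaF X k n F Fs) x = FO F (\<lambda>i\<in>{..<k}. FO (Fs i) (blk n i x))"
  and FA_gammaF: "u \<in> Arr (pw X (offset n k)) \<Longrightarrow>
    FA (gammaF X k n F Fs) u = FA F (\<lambda>i\<in>{..<k}. FA (Fs i) (blk n i u))"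
  by (simp_all add: gammaF_def FO_fcomp FA_fcomp FO_prodF FA_prodF del: pw_simps)

lemma prodF_functor:
  assumes X: "category X" and F: "\<And>i. i < k \<Longrightarrow> F i \<in> functors (pw X (n i)) Y"
  shows "prodF X k n F \<in> functors (pw X (offset n k)) (pw Y k)"
proof (rule functorsI)
  let ?P = "pw X (offset n k)"
  interpret P: category ?P using X by (rule pw_category)
  show "FO (prodF X k n F) \<in> extensional (Ob ?P)" "FA (prodF X k n F) \<in> extensional (Arr ?P)"
    by (simp_all add: prodF_def)
  show "FO (prodF X k n F) x \<in> Ob (pw Y k)" if "x \<in> Ob ?P" for x
    using functorsD(3)[OF F] blk_pw(1)[OF _ that] by (auto simp: FO_prodF[OF that])
  show "FA (prodF X k n F) u \<in> hom (pw Y k) (FO (prodF X k n F) x) (FO (prodF X k n F) y)"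
    if "u \<in> hom ?P x y" for u x y
    using functorsD(4)[OF F] blk_pw(3)[OF _ that] P.hom_Ob[OF that] homD(1)[OF that]
    by (simp add: FO_prodF FA_prodF hom_pw del: pw_simps)
  show "FA (prodF X k n F) (Id ?P x) = Id (pw Y k) (FO (prodF X k n F) x)" if "x \<in> Ob ?P" for x
  proof -
    have "FA (prodF X k n F) (Id ?P x) = (\<lambda>i\<in>{..<k}. FA (F i) (Id (pw X (n i)) (blk n i x)))"
      using homD(1)[OF P.Id_hom[OF that]] blk_pw(4)[of _ k n X x]
      by (simp add: FA_prodF del: pw_simps cong: restrict_cong)
    also have "\<dots> = (\<lambda>i\<in>{..<k}. Id Y (FO (F i) (blk n i x)))"
      using functorsD(5)[OF F blk_pw(1)[OF _ that]] by (simp del: pw_simps cong: restrict_cong)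
    finally show ?thesis using that
      by (simp add: FO_prodF del: pw_simps(1-2) cong: restrict_cong)
  qed
  show "FA (prodF X k n F) (Comp ?P v u) = Comp (pw Y k) (FA (prodF X k n F) v)
      (FA (prodF X k n F) u)"
    if u: "u \<in> hom ?P x y" and v: "v \<in> hom ?P y z" for x y z u v
  proof -
    have "FA (prodF X k n F) (Comp ?P v u)
        = (\<lambda>i\<in>{..<k}. FA (F i) (Comp (pw X (n i)) (blk n i v) (blk n i u)))"
      using homD(1)[OF P.Comp_hom[OF u v]] blk_pw(5)[of _ k n X v u]
      by (simp add: FA_prodF del: pw_simps cong: restrict_cong)
    also have "\<dots> = (\<lambda>i\<in>{..<k}. Comp Y (FA (F i) (blk n i v)) (FA (F i) (blk n i u)))"
      using functorsD(6)[OF F blk_pw(3)[OF _ u] blk_pw(3)[OF _ v]]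
          by (simp del: pw_simps cong: restrict_cong)
    finally show ?thesis using homD(1)[OF u] homD(1)[OF v]
      by (simp add: FA_prodF del: pw_simps(1-2) cong: restrict_cong)
  qed
qed

lemma powF_functor:
  assumes X: "category X" and H: "H \<in> functors X Y"
  shows "powF X n H \<in> functors (pw X n) (pw Y n)"
proof (rule functorsI)
  interpret P: category "pw X n" using X by (rule pw_category)
  show "FO (powF X n H) \<in> extensional (Ob (pw X n))" "FA (powF X n H) \<in> extensional (Arr (pw X n))"
    by (simp_all add: powF_def)
  show "FO (powF X n H) x \<in> Ob (pw Y n)" if "x \<in> Ob (pw X n)" for x
    using that functorsD(3)[OF H] by (auto simp: FO_powF)
  show "FA (powF X n H) u \<in> hom (pw Y n) (FO (powF X n H) x) (FO (powF X n H) y)"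
    if "u \<in> hom (pw X n) x y" for u x y
    using that functorsD(4)[OF H] P.hom_Ob[OF that] homD(1)[OF that]
    by (simp add: FO_powF FA_powF hom_pw del: pw_simps)
  show "FA (powF X n H) (Id (pw X n) x) = Id (pw Y n) (FO (powF X n H) x)" if "x \<in> Ob (pw X n)"
      for x
    using homD(1)[OF P.Id_hom[OF that]] that functorsD(5)[OF H]
    by (auto simp: FA_powF[of _ X] FO_powF fun_eq_iff)
  show "FA (powF X n H) (Comp (pw X n) v u) = Comp (pw Y n) (FA (powF X n H) v) (FA (powF X n H) u)"
    if u: "u \<in> hom (pw X n) x y" and v: "v \<in> hom (pw X n) y z" for x y z u v
  proof -
    have "FA H (Comp X (v i) (u i)) = Comp Y (FA H (v i)) (FA H (u i))" if "i < n" for i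
      using that u v functorsD(6)[OF H, of "u i" "x i" "y i" "v i" "z i"] by (simp add: hom_pw)
    then show ?thesis
      using homD(1)[OF P.Comp_hom[OF u v]] homD(1)[OF u] homD(1)[OF v]
      by (auto simp: FA_powF[of _ X])
  qed
qed

lemma substF_functor:
  assumes X: "category X" and F: "F \<in> functors (pw X k) Y" and f: "\<And>i. i < k \<Longrightarrow> f i < l"
  shows "substF X k l f F \<in> functors (pw X l) Y"
proof (rule functorsI)
  interpret P: category "pw X l" using X by (rule pw_category)
  note [simp del] = pw_simps
  show "FO (substF X k l f F) \<in> extensional (Ob (pw X l))"
      "FA (substF X k l f F) \<in> extensional (Arr (pw X l))"
    by (simp_all add: substF_def)
  show "FO (substF X k l f F) x \<in> Ob Y" if "x \<in> Ob (pw X l)" for x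
    using functorsD(3)[OF F] compose_pw(1)[OF f that] by (simp add: FO_substF that)
  show "FA (substF X k l f F) u \<in> hom Y (FO (substF X k l f F) x) (FO (substF X k l f F) y)"
    if "u \<in> hom (pw X l) x y" for u x y
    using functorsD(4)[OF F] compose_pw(3)[OF f that] P.hom_Ob[OF that] homD(1)[OF that]
    by (simp add: FO_substF FA_substF)
  show "FA (substF X k l f F) (Id (pw X l) x) = Id Y (FO (substF X k l f F) x)" if "x \<in> Ob (pw X l)"
      for x
    using homD(1)[OF P.Id_hom[OF that]] that functorsD(5)[OF F compose_pw(1)[OF f that]]
    by (simp add: FA_substF FO_substF compose_pw(4)[OF f])
  show "FA (substF X k l f F) (Comp (pw X l) v u)
      = Comp Y (FA (substF X k l f F) v) (FA (substF X k l f F) u)"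
    if u: "u \<in> hom (pw X l) x y" and v: "v \<in> hom (pw X l) y z" for x y z u v
    using homD(1)[OF P.Comp_hom[OF u v]] homD(1)[OF u] homD(1)[OF v]
      functorsD(6)[OF F compose_pw(3)[OF f u] compose_pw(3)[OF f v]]
    by (simp add: FA_substF compose_pw(5)[OF f])
qed

lemma unitF_functor:
  assumes X: "category X"
  shows "unitF X \<in> functors (pw X 1) X"
proof (rule functorsI)
  interpret P: category "pw X 1" using X by (rule pw_category)
  show "FO (unitF X) \<in> extensional (Ob (pw X 1))" "FA (unitF X) \<in> extensional (Arr (pw X 1))"
    by (simp_all add: unitF_def)
  show "FO (unitF X) x \<in> Ob X" if "x \<in> Ob (pw X 1)" for x
    using that by (auto simp: FO_unitF)
  show "FA (unitF X) u \<in> hom X (FO (unitF X) x) (FO (unitF X) y)" if "u \<in> hom (pw X 1) x y"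
      for u x y
    using that P.hom_Ob[OF that] homD(1)[OF that]
        by (simp add: FO_unitF FA_unitF hom_pw del: pw_simps)
  show "FA (unitF X) (Id (pw X 1) x) = Id X (FO (unitF X) x)" if "x \<in> Ob (pw X 1)" for x
    using homD(1)[OF P.Id_hom[OF that]] that by (simp add: FA_unitF FO_unitF del: pw_simps(1,2))
  show "FA (unitF X) (Comp (pw X 1) v u) = Comp X (FA (unitF X) v) (FA (unitF X) u)"
    if u: "u \<in> hom (pw X 1) x y" and v: "v \<in> hom (pw X 1) y z" for x y z u v
    using homD(1)[OF P.Comp_hom[OF u v]] homD(1)[OF u] homD(1)[OF v]
    by (simp add: FA_unitF del: pw_simps(1,2))
qed

lemma gammaF_functor:
  assumes "category X" "F \<in> functors (pw X k) X" "\<And>i. i < k \<Longrightarrow> Fs i \<in> functors (pw X (n i)) X"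
  shows "gammaF X k n F Fs \<in> functors (pw X (offset n k)) X"
  unfolding gammaF_def
  by (rule fcomp_functor[OF prodF_functor[OF assms(1,3)] assms(2) pw_category[OF assms(1)]])

declare pw_simps(1,2)[simp del]

section \<open>Natural transformations between functors on powers\<close>

lemma ST_pw_simps[simp]:
  "Source (prodN X k n \<alpha>s) = prodF X k n (\<lambda>i. Source (\<alpha>s i))"
  "Target (prodN X k n \<alpha>s) = prodF X k n (\<lambda>i. Target (\<alpha>s i))"
  "Source (powN X k \<alpha>) = powF X k (Source \<alpha>)" "Target (powN X k \<alpha>) = powF X k (Target \<alpha>)"
  "Source (gammaN X k n \<beta> \<beta>s) = gammaF X k n (Source \<beta>) (\<lambda>i. Source (\<beta>s i))"
  "Target (gammaN X k n \<beta> \<beta>s) = gammaF X k n (Target \<beta>) (\<lambda>i. Target (\<beta>s i))"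
  "Source (substN X k l f \<gamma>) = substF X k l f (Source \<gamma>)"
  "Target (substN X k l f \<gamma>) = substF X k l f (Target \<gamma>)"
  by (simp_all add: prodN_def powN_def gammaN_def gammaF_def substN_def)

lemma At_prodN: "x \<in> Ob (pw X (offset n k)) \<Longrightarrow>
    At (prodN X k n \<alpha>s) x = (\<lambda>i\<in>{..<k}. At (\<alpha>s i) (blk n i x))"
  and At_powN: "x \<in> Ob (pw X n') \<Longrightarrow> At (powN X n' \<alpha>) x = (\<lambda>i\<in>{..<n'}. At \<alpha> (x i))"
  and At_substN: "x \<in> Ob (pw X l) \<Longrightarrow> At (substN X k l f \<gamma>) x = At \<gamma> (compose {..<k} x f)"
  by (simp_all add: prodN_def powN_def substN_def del: pw_simps)

lemma prodF_cong: "(\<And>i. i < k \<Longrightarrow> F i = G i) \<Longrightarrow> prodF X k n F = prodF X k n G"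
  by (simp add: prodF_def cong: restrict_cong)

lemma gammaF_cong: "(\<And>i. i < k \<Longrightarrow> Fs i = Gs i) \<Longrightarrow> gammaF X k n F Fs = gammaF X k n F Gs"
  using prodF_cong[of k Fs Gs X n] by (simp add: gammaF_def)

lemma prodN_nats:
  assumes X: "category X" and a: "\<And>i. i < k \<Longrightarrow> \<alpha>s i \<in> nats (pw X (n i)) Y (F i) (G i)"
  shows "prodN X k n \<alpha>s \<in> nats (pw X (offset n k)) (pw Y k) (prodF X k n F) (prodF X k n G)"
proof (rule natsI)
  let ?P = "pw X (offset n k)"
  interpret P: category ?P using X by (rule pw_category)
  show F: "prodF X k n F \<in> functors ?P (pw Y k)" and G: "prodF X k n G \<in> functors ?P (pw Y k)"
    using natsD(1,2)[OF a] by (auto intro: prodF_functor X)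
  show "Source (prodN X k n \<alpha>s) = prodF X k n F" "Target (prodN X k n \<alpha>s) = prodF X k n G"
    using natsD(3,4)[OF a] by (auto intro: prodF_cong)
  show "At (prodN X k n \<alpha>s) \<in> extensional (Ob ?P)" by (simp add: prodN_def)
  show "At (prodN X k n \<alpha>s) x \<in> hom (pw Y k) (FO (prodF X k n F) x) (FO (prodF X k n G) x)"
    if "x \<in> Ob ?P" for x
    using natsD(6)[OF a] blk_pw(1)[OF _ that] that by (simp add: At_prodN FO_prodF hom_pw)
  show "Comp (pw Y k) (At (prodN X k n \<alpha>s) y) (FA (prodF X k n F) u)
      = Comp (pw Y k) (FA (prodF X k n G) u) (At (prodN X k n \<alpha>s) x)" if u: "u
          \<in> hom ?P x y" for x y u
    using natsD(7)[OF a blk_pw(3)[OF _ u]] P.hom_Ob[OF u] homD(1)[OF u]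
    by (simp add: At_prodN FA_prodF cong: restrict_cong)
qed

text \<open>This exhibits \<open>gammaN\<close> with identities in the inner slots as a whiskering,
  so that the component formulas for \<open>hcomp\<close> apply to it.\<close>

lemma prodN_idn:
  "prodN X k n (\<lambda>i. idn (pw X (n i)) Y (F i)) = idn (pw X (offset n k)) (pw Y k) (prodF X k n F)"
proof (rule trans_eqI)
  show "At (prodN X k n (\<lambda>i. idn (pw X (n i)) Y (F i))) \<in> extensional (Ob (pw X (offset n k)))"
    by (simp add: prodN_def)
  show "At (prodN X k n (\<lambda>i. idn (pw X (n i)) Y (F i))) x
      = At (idn (pw X (offset n k)) (pw Y k) (prodF X k n F)) x" if "x
          \<in> Ob (pw X (offset n k))" for x
    using that blk_pw(1)[OF _ that]
    by (simp add: At_prodN At_idn FO_prodF del: pw_simps(1,2) cong: restrict_cong)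
qed simp_all

lemma powN_nats:
  assumes X: "category X" and a: "\<alpha> \<in> nats X Y F G"
  shows "powN X n \<alpha> \<in> nats (pw X n) (pw Y n) (powF X n F) (powF X n G)"
proof (rule natsI)
  interpret P: category "pw X n" using X by (rule pw_category)
  show "powF X n F \<in> functors (pw X n) (pw Y n)" "powF X n G \<in> functors (pw X n) (pw Y n)"
    using natsD(1,2)[OF a] by (auto intro: powF_functor X)
  show "Source (powN X n \<alpha>) = powF X n F" "Target (powN X n \<alpha>) = powF X n G"
    using natsD(3,4)[OF a] by simp_all
  show "At (powN X n \<alpha>) \<in> extensional (Ob (pw X n))" by (simp add: powN_def)
  show "At (powN X n \<alpha>) x \<in> hom (pw Y n) (FO (powF X n F) x) (FO (powF X n G) x)"
    if "x \<in> Ob (pw X n)" for x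
    using natsD(6)[OF a] that by (auto simp: At_powN FO_powF hom_pw) (auto simp: pw_simps)
  show "Comp (pw Y n) (At (powN X n \<alpha>) y) (FA (powF X n F) u)
      = Comp (pw Y n) (FA (powF X n G) u) (At (powN X n \<alpha>) x)" if u: "u
          \<in> hom (pw X n) x y" for x y u
  proof -
    have "Comp Y (At \<alpha> (y i)) (FA F (u i)) = Comp Y (FA G (u i)) (At \<alpha> (x i))" if "i < n" for i
      using that u natsD(7)[OF a, of "u i" "x i" "y i"] by (simp add: hom_pw)
    then show ?thesis
      using P.hom_Ob[OF u] homD(1)[OF u] by (simp add: At_powN FA_powF cong: restrict_cong)
  qed
qed

lemma At_gammaN_idn_right:
  assumes x: "x \<in> Ob (pw X (offset n k))" and X: "category X"
    and a: "\<alpha> \<in> nats (pw X k) X G H" and F: "\<And>i. i < k \<Longrightarrow> F i \<in> functors (pw X (n i)) X"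
  shows "At (gammaN X k n \<alpha> (\<lambda>i. idn (pw X (n i)) X (F i))) x
    = At \<alpha> (\<lambda>i\<in>{..<k}. FO (F i) (blk n i x))"
  using At_hcomp_idn_right[OF x prodF_functor[OF X F] a X] x
  by (simp add: gammaN_def prodN_idn FO_prodF del: pw_simps)

lemma At_gammaN_idn_left:
  assumes x: "x \<in> Ob (pw X (offset n k))" and X: "category X"
    and F: "F \<in> functors (pw X k) X" and a: "\<And>i. i < k \<Longrightarrow> \<alpha>s i \<in> nats (pw X (n i)) X (G i) (H i)"
  shows "At (gammaN X k n (idn (pw X k) X F) \<alpha>s) x = FA F (\<lambda>i\<in>{..<k}. At (\<alpha>s i) (blk n i x))"
  using At_hcomp_idn_left[OF x prodN_nats[OF X a] F X] x
  by (simp add: gammaN_def At_prodN del: pw_simps)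

text \<open>\<open>vcomp\<close> records the source of its first factor and the target of its
  second, so matching outer endpoints leave only the components to compare. Most coherence laws are
  reduced in this way.\<close>

lemma vcomp_eq_iff:
  assumes "Source \<alpha> = Source \<alpha>'" "Target \<beta> = Target \<beta>'"
  shows "vcomp A B \<beta> \<alpha> = vcomp A B \<beta>' \<alpha>' \<longleftrightarrow>
    (\<forall>x\<in>Ob A. Comp B (At \<beta> x) (At \<alpha> x) = Comp B (At \<beta>' x) (At \<alpha>' x))"
  using assms by (auto simp: vcomp_def fun_eq_iff restrict_def)

lemma vcomp_eq_iff':
  assumes "Source \<alpha> = Source \<delta>" "Target \<beta> = Target \<delta>" "At \<delta> \<in> extensional (Ob A)"
  shows "vcomp A B \<beta> \<alpha> = \<delta> \<longleftrightarrow> (\<forall>x\<in>Ob A. Comp B (At \<beta> x) (At \<alpha> x) = At \<delta> x)"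
proof
  show "\<forall>x\<in>Ob A. Comp B (At \<beta> x) (At \<alpha> x) = At \<delta> x" if "vcomp A B \<beta> \<alpha> = \<delta>"
    using that by (auto simp: At_vcomp)
  show "vcomp A B \<beta> \<alpha> = \<delta>" if "\<forall>x\<in>Ob A. Comp B (At \<beta> x) (At \<alpha> x) = At \<delta> x"
    by (rule trans_eqI[of _ _ "Ob A"]) (use that assms in \<open>simp_all add: At_vcomp\<close>)
qed

lemma blk_restrict_offset:
  "i < k \<Longrightarrow> blk n i (restrict h {..<offset n k}) = (\<lambda>j\<in>{..<n i}. h (incl n i j))"
  using incl_less[of i k _ n] by (auto simp: blk_restrict)

section \<open>Identities in the theory \<open>End(X)\<close>\<close>

text \<open>Compared with \<open>functor_eqI\<close> it asks for extensionality instead of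
  functoriality. Identities such as \<open>gammaF_assoc\<close> can therefore leave the outer
  \<open>F\<close> arbitrary.\<close>

lemma ftor_ext_eqI:
  fixes F G :: "('i \<Rightarrow> 'o, 'i \<Rightarrow> 'm, 'p, 'q) ftor"
  assumes "FO F \<in> extensional S" "FO G \<in> extensional S" "FA F \<in> extensional R"
      "FA G \<in> extensional R"
    and "\<And>x. x \<in> S \<Longrightarrow> FO F x = FO G x" "\<And>u. u \<in> R \<Longrightarrow> FA F u = FA G u"
  shows "F = G"
  using assms by (intro ftor.equality) (auto intro: extensionalityI)

lemma blk_blk_map:
  assumes "i < k"
  shows "blk (n \<circ> f) i (compose {..<offset (n \<circ> f) k} x (blk_map n k f)) = blk n (f i) x"
  using assms incl_less[of i k _ "n \<circ> f"]
  by (auto simp: blk_restrict compose_def blk_map_incl fun_eq_iff)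

lemma blk_blk_sum:
  assumes "i < k" "g i \<in> {..<n i} \<rightarrow> {..<n' i}"
  shows "blk n i (compose {..<offset n k} x (blk_sum n n' k g))
      = compose {..<n i} (blk n' i x) (g i)"
  using assms incl_less[of i k _ n]
  by (auto simp: blk_restrict compose_def blk_sum_incl fun_eq_iff Pi_iff)

lemma gammaF_ext[simp]:
  "FO (gammaF X k n F Fs) \<in> extensional (Ob (pw X (offset n k)))"
  "FA (gammaF X k n F Fs) \<in> extensional (Arr (pw X (offset n k)))"
  by (simp_all add: gammaF_def fcomp_def compose_def del: pw_simps)

lemma fcomp_ext[simp]:
  "FO (fcomp A F G) \<in> extensional (Ob A)" "FA (fcomp A F G) \<in> extensional (Arr A)"
  by (simp_all add: fcomp_def compose_def)

lemma substF_ext[simp]: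
  "FO (substF X k l f F) \<in> extensional (Ob (pw X l))"
  "FA (substF X k l f F) \<in> extensional (Arr (pw X l))"
  by (simp_all add: substF_def del: pw_simps)

text \<open>Both sides apply \<open>F\<close> to the same nested family once the blocks are
  regrouped by \<open>blk_blk\<close>. This is the target half of the associativity law for
  \<open>c\<close>; \<open>wgamma_assoc\<close> is the source half.\<close>

lemma gammaF_assoc:
  assumes X: "category X" and Fs: "\<And>i. i < k \<Longrightarrow> Fs i \<in> functors (pw X (n i)) X"
    and Gs: "\<And>j. j < offset n k \<Longrightarrow> Gs j \<in> functors (pw X (p j)) X"
  shows "gammaF X (offset n k) p (gammaF X k n F Fs) Gs
    = gammaF X k (\<lambda>i. offset (blk n i p) (n i)) F
        (\<lambda>i. gammaF X (n i) (blk n i p) (Fs i) (blk n i Gs))"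
proof (rule ftor_ext_eqI)
  let ?n = "\<lambda>i. offset (blk n i p) (n i)" and ?P = "pw X (offset p (offset n k))"
  note [simp] = offset_offset_total
  show "FO (gammaF X k ?n F (\<lambda>i. gammaF X (n i) (blk n i p) (Fs i) (blk n i Gs)))
      \<in> extensional (Ob ?P)"
    "FA (gammaF X k ?n F (\<lambda>i. gammaF X (n i) (blk n i p) (Fs i) (blk n i Gs)))
        \<in> extensional (Arr ?P)"
    using gammaF_ext[of X k ?n] by simp_all
  fix x assume x: "x \<in> Ob ?P"
  \<comment> \<open>The rule \<open>FO_gammaF\<close> computes on objects of the power only, so the
    family of inner values must first be known to be such an object.\<close>
  have 1: "(\<lambda>j\<in>{..<offset n k}. FO (Gs j) (blk p j x)) \<in> Ob (pw X (offset n k))"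
    using functorsD(3)[OF Gs blk_pw(1)[OF _ x]] by (auto simp: pw_simps)
  have 2: "blk ?n i x \<in> Ob (pw X (?n i))" if "i < k" for i
    using that x by (intro blk_pw(1)[of i k x X ?n]) simp_all
  have 3: "blk n i (\<lambda>j\<in>{..<offset n k}. FO (Gs j) (blk p j x))
      = (\<lambda>j\<in>{..<n i}. FO (blk n i Gs j) (blk (blk n i p) j (blk ?n i x)))" if "i < k" for i
    by (simp add: blk_restrict_offset[OF that] blk_apply blk_blk cong: restrict_cong)
  show "FO (gammaF X (offset n k) p (gammaF X k n F Fs) Gs) x
      = FO (gammaF X k ?n F (\<lambda>i. gammaF X (n i) (blk n i p) (Fs i) (blk n i Gs))) x"
    using x 1 2 3 by (simp add: FO_gammaF cong: restrict_cong)
next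
  let ?n = "\<lambda>i. offset (blk n i p) (n i)" and ?P = "pw X (offset p (offset n k))"
  note [simp] = offset_offset_total
  fix x assume x: "x \<in> Arr ?P"
  interpret P: category ?P using X by (rule pw_category)
  have 1: "(\<lambda>j\<in>{..<offset n k}. FA (Gs j) (blk p j x)) \<in> Arr (pw X (offset n k))"
    using homD(1)[OF functorsD(4)[OF Gs blk_pw(3)[OF _ Arr_hom[OF x]]]] by (auto simp: pw_simps)
  have 2: "blk ?n i x \<in> Arr (pw X (?n i))" if "i < k" for i
    using that x by (intro blk_pw(2)[of i k x X ?n]) simp_all
  have 3: "blk n i (\<lambda>j\<in>{..<offset n k}. FA (Gs j) (blk p j x))
      = (\<lambda>j\<in>{..<n i}. FA (blk n i Gs j) (blk (blk n i p) j (blk ?n i x)))" if "i < k" for i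
    by (simp add: blk_restrict_offset[OF that] blk_apply blk_blk cong: restrict_cong)
  show "FA (gammaF X (offset n k) p (gammaF X k n F Fs) Gs) x
      = FA (gammaF X k ?n F (\<lambda>i. gammaF X (n i) (blk n i p) (Fs i) (blk n i Gs))) x"
    using x 1 2 3 by (simp add: FA_gammaF cong: restrict_cong)
qed simp_all

lemma blk_1: "i < k \<Longrightarrow> blk (\<lambda>_. 1) i x 0 = x i"
  by (simp add: blk_apply incl_def)

lemma blk_0: "x \<in> extensional {..<n 0} \<Longrightarrow> blk n 0 x = x"
  by (auto simp: blk_restrict incl_def fun_eq_iff extensional_def)

lemma gammaF_unit_right:
  assumes F: "F \<in> functors (pw X k) X"
  shows "gammaF X k (\<lambda>_. 1) F (\<lambda>_. unitF X) = F"
proof (rule ftor_ext_eqI)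
  note [simp] = pw_simps(1,2)
  have *: "(\<lambda>i\<in>{..<k}. x i) = x" if "x \<in> {..<k} \<rightarrow>\<^sub>E S" for x :: "nat \<Rightarrow> 'zz" and S
    using that by (auto simp: fun_eq_iff)
  show "FO (gammaF X k (\<lambda>_. 1) F (\<lambda>_. unitF X)) x = FO F x" if "x \<in> Ob (pw X k)" for x
    using that blk_pw(1)[of _ k x X "\<lambda>_. 1"] FO_gammaF[of x X "\<lambda>_. 1" k F] *[of x]
    by (simp add: FO_unitF blk_1[unfolded One_nat_def] cong: restrict_cong)
  show "FA (gammaF X k (\<lambda>_. 1) F (\<lambda>_. unitF X)) x = FA F x" if "x \<in> Arr (pw X k)" for x
    using that blk_pw(2)[of _ k x X "\<lambda>_. 1"] FA_gammaF[of x X "\<lambda>_. 1" k F] *[of x]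
    by (simp add: FA_unitF blk_1[unfolded One_nat_def] cong: restrict_cong)
qed (use gammaF_ext[of X k "\<lambda>_. 1"] functorsD(1,2)[OF F] in simp_all)

lemma gammaF_unit_left:
  assumes F: "F \<in> functors (pw X k) X"
  shows "gammaF X 1 (\<lambda>_. k) (unitF X) (\<lambda>_. F) = F"
proof (rule ftor_ext_eqI)
  note [simp] = pw_simps(1,2)
  show "FO (gammaF X 1 (\<lambda>_. k) (unitF X) (\<lambda>_. F)) x = FO F x" if "x \<in> Ob (pw X k)" for x
    using that functorsD(3)[OF F that] FO_gammaF[of x X "\<lambda>_. k" 1 "unitF X"]
    by (simp add: FO_unitF blk_0 PiE_iff)
  show "FA (gammaF X 1 (\<lambda>_. k) (unitF X) (\<lambda>_. F)) x = FA F x" if "x \<in> Arr (pw X k)" for x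
    using that homD(1)[OF functorsD(4)[OF F Arr_hom[OF that]]] FA_gammaF[of x X "\<lambda>_. k" 1 "unitF X"]
    by (simp add: FA_unitF blk_0 PiE_iff)
qed (use gammaF_ext[of X 1 "\<lambda>_. k"] functorsD(1,2)[OF F] in simp_all)

text \<open>Reindexing along \<open>blk_map\<close> makes block \<open>f i\<close> of the argument
  the new block \<open>i\<close>, so the repeated functors \<open>Fs (f i)\<close> produce exactly
  the values that \<open>substF\<close> duplicates afterwards. It supplies the target half of
  \<open>c_s_outer\<close>.\<close>

lemma substF_gammaF_outer:
  assumes f: "f \<in> {..<k} \<rightarrow>\<^sub>E {..<l}" and X: "category X"
    and Fs: "\<And>j. j < l \<Longrightarrow> Fs j \<in> functors (pw X (n j)) X"
  shows "substF X (offset (n \<circ> f) k) (offset n l) (blk_map n k f)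
      (gammaF X k (n \<circ> f) F (\<lambda>i. Fs (f i)))
    = gammaF X l n (substF X k l f F) Fs"
proof (rule ftor_ext_eqI)
  have b: "blk_map n k f i < offset n l" if "i < offset (n \<circ> f) k" for i
    using blk_map_PiE[OF f, of n] that by auto
  have f': "f i < l" if "i < k" for i using f that by auto
  show "FO (substF X (offset (n \<circ> f) k) (offset n l) (blk_map n k f)
      (gammaF X k (n \<circ> f) F (\<lambda>i. Fs (f i)))) x
    = FO (gammaF X l n (substF X k l f F) Fs) x" if x: "x \<in> Ob (pw X (offset n l))" for x
  proof -
    have 1: "(\<lambda>j\<in>{..<l}. FO (Fs j) (blk n j x)) \<in> Ob (pw X l)"
      using functorsD(3)[OF Fs blk_pw(1)[OF _ x]] by (auto simp: pw_simps)
    show ?thesis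
      using x 1 compose_pw(1)[OF b x]
      by (simp add: FO_substF FO_gammaF blk_blk_map cong: restrict_cong)
        (simp add: compose_def f' cong: restrict_cong)
  qed
  show "FA (substF X (offset (n \<circ> f) k) (offset n l) (blk_map n k f)
      (gammaF X k (n \<circ> f) F (\<lambda>i. Fs (f i)))) x
    = FA (gammaF X l n (substF X k l f F) Fs) x" if x: "x \<in> Arr (pw X (offset n l))" for x
  proof -
    have 1: "(\<lambda>j\<in>{..<l}. FA (Fs j) (blk n j x)) \<in> Arr (pw X l)"
      using homD(1)[OF functorsD(4)[OF Fs blk_pw(3)[OF _ Arr_hom[OF x]]]] by (auto simp: pw_simps)
    show ?thesis
      using x 1 compose_pw(2)[OF b x]
      by (simp add: FA_substF FA_gammaF blk_blk_map cong: restrict_cong)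
        (simp add: compose_def f' cong: restrict_cong)
  qed
qed simp_all

lemma substF_gammaF_inner:
  assumes g: "\<And>i. i < k \<Longrightarrow> gs i \<in> {..<n i} \<rightarrow>\<^sub>E {..<n' i}"
  shows "substF X (offset n k) (offset n' k) (blk_sum n n' k gs) (gammaF X k n F Fs)
    = gammaF X k n' F (\<lambda>i. substF X (n i) (n' i) (gs i) (Fs i))"
proof (rule ftor_ext_eqI)
  have b: "blk_sum n n' k gs i < offset n' k" if "i < offset n k" for i
    using blk_sum_PiE[of k gs n n', OF g] that by auto
  have g': "gs i \<in> {..<n i} \<rightarrow> {..<n' i}" if "i < k" for i
    using g[OF that] by auto
  show "FO (substF X (offset n k) (offset n' k) (blk_sum n n' k gs) (gammaF X k n F Fs)) x
    = FO (gammaF X k n' F (\<lambda>i. substF X (n i) (n' i) (gs i) (Fs i))) x"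
    if x: "x \<in> Ob (pw X (offset n' k))" for x
    using x compose_pw(1)[OF b x] blk_pw(1)[OF _ x] g'
    by (simp add: FO_substF FO_gammaF blk_blk_sum cong: restrict_cong)
  show "FA (substF X (offset n k) (offset n' k) (blk_sum n n' k gs) (gammaF X k n F Fs)) x
    = FA (gammaF X k n' F (\<lambda>i. substF X (n i) (n' i) (gs i) (Fs i))) x"
    if x: "x \<in> Arr (pw X (offset n' k))" for x
    using x compose_pw(2)[OF b x] blk_pw(2)[OF _ x] g'
    by (simp add: FA_substF FA_gammaF blk_blk_sum cong: restrict_cong)
qed simp_all

lemma substF_substF:
  assumes f: "f \<in> {..<k} \<rightarrow>\<^sub>E {..<l}" and g: "g \<in> {..<l} \<rightarrow>\<^sub>E {..<m}"
  shows "substF X l m g (substF X k l f F) = substF X k m (compose {..<k} g f) F"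
proof (rule ftor_ext_eqI)
  have b: "g i < m" if "i < l" for i
    using g that by auto
  have f': "f i < l" if "i < k" for i using f that by auto
  have c: "compose {..<k} (compose {..<l} x g) f = compose {..<k} x (compose {..<k} g f)"
    for x :: "nat \<Rightarrow> 'zz"
    by (simp add: compose_def f' cong: restrict_cong)
  show "FO (substF X l m g (substF X k l f F)) x = FO (substF X k m (compose {..<k} g f) F) x"
    if x: "x \<in> Ob (pw X m)" for x
    using x compose_pw(1)[OF b x] by (simp add: FO_substF c)
  show "FA (substF X l m g (substF X k l f F)) x = FA (substF X k m (compose {..<k} g f) F) x"
    if x: "x \<in> Arr (pw X m)" for x
    using x compose_pw(2)[OF b x] by (simp add: FA_substF c)
qed simp_all

lemma substF_id:
  assumes F: "F \<in> functors (pw X k) Y"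
  shows "substF X k k (\<lambda>i\<in>{..<k}. i) F = F"
proof (rule ftor_ext_eqI)
  have *: "compose {..<k} x (\<lambda>i\<in>{..<k}. i) = x" if "x \<in> {..<k} \<rightarrow>\<^sub>E S" for x :: "nat \<Rightarrow> 'zz" and S
    by (rule ext) (use that in \<open>simp add: compose_def PiE_iff extensional_def\<close>)
  show "FO (substF X k k (\<lambda>i\<in>{..<k}. i) F) x = FO F x" if "x \<in> Ob (pw X k)" for x
    using that *[of x "Ob X"] by (simp add: FO_substF pw_simps)
  show "FA (substF X k k (\<lambda>i\<in>{..<k}. i) F) x = FA F x" if "x \<in> Arr (pw X k)" for x
    using that *[of x "Arr X"] by (simp add: FA_substF pw_simps)
qed (use substF_ext[of X k k] functorsD(1,2)[OF F] in simp_all)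

text \<open>The functor \<open>(H, ..., H)\<close> commutes with cutting into blocks. This matches
  the targets of the two sides of the composition law of a morphism.\<close>

lemma powF_gammaF:
  assumes X: "category X" and H: "H \<in> functors X Y"
  shows "fcomp (pw X (offset n k)) (gammaF Y k n F Fs) (powF X (offset n k) H)
    = fcomp (pw X (offset n k)) F (prodF X k n (\<lambda>i. fcomp (pw X (n i)) (Fs i) (powF X (n i) H)))"
proof (rule ftor_ext_eqI)
  let ?N = "offset n k"
  have b: "blk n i (\<lambda>i\<in>{..<?N}. h (x i)) = (\<lambda>j\<in>{..<n i}. h (blk n i x j))"
    if "i < k" for i and h :: "_ \<Rightarrow> 'yy" and x :: "nat \<Rightarrow> 'zz"
    using incl_less[OF that, of _ n] by (auto simp: blk_restrict)
  show "FO (fcomp (pw X ?N) (gammaF Y k n F Fs) (powF X ?N H)) x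
    = FO (fcomp (pw X ?N) F (prodF X k n (\<lambda>i. fcomp (pw X (n i)) (Fs i) (powF X (n i) H)))) x"
    if x: "x \<in> Ob (pw X ?N)" for x
    using x functorsD(3)[OF powF_functor[OF X H] x] blk_pw(1)[OF _ x]
    by (simp add: FO_fcomp FO_gammaF FO_prodF FO_powF b cong: restrict_cong)
  show "FA (fcomp (pw X ?N) (gammaF Y k n F Fs) (powF X ?N H)) x
    = FA (fcomp (pw X ?N) F (prodF X k n (\<lambda>i. fcomp (pw X (n i)) (Fs i) (powF X (n i) H)))) x"
    if x: "x \<in> Arr (pw X ?N)" for x
    using x homD(1)[OF functorsD(4)[OF powF_functor[OF X H] Arr_hom[OF x]]] blk_pw(2)[OF _ x]
    by (simp add: FA_fcomp FA_gammaF FA_prodF FA_powF b cong: restrict_cong)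
qed simp_all

lemma powF_unitF:
  assumes X: "category X" and H: "H \<in> functors X Y"
  shows "fcomp (pw X 1) (unitF Y) (powF X 1 H) = fcomp (pw X 1) H (unitF X)"
proof (rule ftor_ext_eqI)
  show "FO (fcomp (pw X 1) (unitF Y) (powF X 1 H)) x = FO (fcomp (pw X 1) H (unitF X)) x"
    if x: "x \<in> Ob (pw X 1)" for x
    using x functorsD(3)[OF powF_functor[OF X H] x] by (simp add: FO_fcomp FO_unitF FO_powF)
  show "FA (fcomp (pw X 1) (unitF Y) (powF X 1 H)) x = FA (fcomp (pw X 1) H (unitF X)) x"
    if x: "x \<in> Arr (pw X 1)" for x
    using x homD(1)[OF functorsD(4)[OF powF_functor[OF X H] Arr_hom[OF x]]]
    by (simp add: FA_fcomp FA_unitF FA_powF)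
qed simp_all

lemma powF_substF:
  assumes X: "category X" and H: "H \<in> functors X Y" and f: "f \<in> {..<k} \<rightarrow>\<^sub>E {..<l}"
  shows "fcomp (pw X l) (substF Y k l f F) (powF X l H)
      = substF X k l f (fcomp (pw X k) F (powF X k H))"
proof (rule ftor_ext_eqI)
  have b: "f i < l" if "i < k" for i
    using f that by auto
  show "FO (fcomp (pw X l) (substF Y k l f F) (powF X l H)) x
    = FO (substF X k l f (fcomp (pw X k) F (powF X k H))) x" if x: "x \<in> Ob (pw X l)" for x
    using x functorsD(3)[OF powF_functor[OF X H] x] compose_pw(1)[OF b x] b
    by (simp add: FO_fcomp FO_substF FO_powF compose_def cong: restrict_cong)
  show "FA (fcomp (pw X l) (substF Y k l f F) (powF X l H)) x
    = FA (substF X k l f (fcomp (pw X k) F (powF X k H))) x" if x: "x \<in> Arr (pw X l)" for x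
    using x homD(1)[OF functorsD(4)[OF powF_functor[OF X H] Arr_hom[OF x]]] compose_pw(2)[OF b x] b
    by (simp add: FA_fcomp FA_substF FA_powF compose_def cong: restrict_cong)
qed simp_all

section \<open>Words of a theory\<close>

context is_theory
begin

lemma tupling:
  assumes "\<And>i. i < n \<Longrightarrow> h i \<in> words T m"
  shows "tupling T m n h \<in> hom T m n" "i < n \<Longrightarrow> Comp T (pr T n i) (tupling T m n h) = h i"
  using theI'[OF pr_product[of n h m]] assms unfolding tupling_def words_def by blast+

lemma tuple_eqI:
  assumes "u \<in> hom T m n" "v \<in> hom T m n"
    and "\<And>i. i < n \<Longrightarrow> Comp T (pr T n i) u = Comp T (pr T n i) v"
  shows "u = v"
  using pr_product[of n "\<lambda>i. Comp T (pr T n i) u" m] assms Comp_hom[OF assms(1) pr_hom] by metis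

lemma pr_words: "i < n \<Longrightarrow> pr T n i \<in> words T n"
  using pr_hom by (simp add: words_def)

lemma Comp_words: "\<lbrakk>w \<in> words T k; u \<in> hom T l k\<rbrakk> \<Longrightarrow> Comp T w u \<in> words T l"
  using Comp_hom by (simp add: words_def)

lemma Comp_tupling:
  assumes h: "\<And>i. i < n \<Longrightarrow> h i \<in> words T m" and u: "u \<in> hom T l m"
  shows "Comp T (tupling T m n h) u = tupling T l n (\<lambda>i. Comp T (h i) u)"
proof (rule tuple_eqI)
  have h': "\<And>i. i < n \<Longrightarrow> Comp T (h i) u \<in> words T l" using h u Comp_words by blast
  show "Comp T (tupling T m n h) u \<in> hom T l n" by (rule Comp_hom[OF u tupling(1)[OF h]])
  show "tupling T l n (\<lambda>i. Comp T (h i) u) \<in> hom T l n" by (rule tupling(1)[OF h'])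
  show "Comp T (pr T n i) (Comp T (tupling T m n h) u)
      = Comp T (pr T n i) (tupling T l n (\<lambda>i. Comp T (h i) u))" if "i < n" for i
    using that Comp_assoc[OF u tupling(1)[OF h] pr_hom] tupling(2)[of n h m i, OF h]
      tupling(2)[of n "\<lambda>i. Comp T (h i) u" l i, OF h'] by simp
qed

text \<open>\<open>wsubst\<close> and \<open>wgamma\<close> both have the form of a word after a
  tuple, so this rule is the engine behind all their composites.\<close>

lemma Comp_Comp_tupling:
  assumes w: "w \<in> words T n" and h: "\<And>i. i < n \<Longrightarrow> h i \<in> words T m" and u: "u \<in> hom T l m"
  shows "Comp T (Comp T w (tupling T m n h)) u = Comp T w (tupling T l n (\<lambda>i. Comp T (h i) u))"
  using Comp_assoc[OF u tupling(1)[of n h m, OF h] w[unfolded words_def]]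
      Comp_tupling[of n h m u l, OF h u]
  by simp

lemma tupling_cong: "(\<And>i. i < n \<Longrightarrow> h i = h' i) \<Longrightarrow> tupling T m n h = tupling T m n h'"
  unfolding tupling_def by (rule arg_cong[of _ _ The]) auto

lemma wsubst_words: "\<lbrakk>w \<in> words T k; \<And>i. i < k \<Longrightarrow> f i < l\<rbrakk> \<Longrightarrow> wsubst T k l f w \<in> words T l"
  unfolding wsubst_def by (intro Comp_words[of w k] tupling(1)) (auto intro: pr_words)

lemma wsubst_cong:
  "(\<And>i. i < k \<Longrightarrow> f i = g i) \<Longrightarrow> wsubst T k l f w = wsubst T k l g w"
  unfolding wsubst_def by (intro arg_cong[of _ _ "Comp T w"] tupling_cong) simp

lemma Comp_wsubst:
  assumes "w \<in> words T k" "\<And>i. i < k \<Longrightarrow> f i < l" "\<And>j. j < l \<Longrightarrow> h j \<in> words T m"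
  shows "Comp T (wsubst T k l f w) (tupling T m l h) = Comp T w (tupling T m k (\<lambda>i. h (f i)))"
  unfolding wsubst_def using assms
  by (subst Comp_Comp_tupling[where m = l and l = m])
    (auto intro!: arg_cong[of _ _ "Comp T w"] tupling_cong tupling pr_words)

lemma wsubst_wsubst:
  assumes "w \<in> words T k" "\<And>i. i < k \<Longrightarrow> f i < l" "\<And>j. j < l \<Longrightarrow> g j < m"
  shows "wsubst T l m g (wsubst T k l f w) = wsubst T k m (\<lambda>i. g (f i)) w"
  using Comp_wsubst[OF assms(1,2), where h = "\<lambda>j. pr T m (g j)" and m = m] assms(3) pr_words
  by (simp add: wsubst_def)

lemma wsubst_id:
  assumes "w \<in> words T k"
  shows "wsubst T k k (\<lambda>i. i) w = w"
proof -
  \<comment> \<open>The tuple of all projections is the identity, by the uniqueness part of the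
    product property.\<close>
  have "tupling T k k (\<lambda>i. pr T k i) = Id T k"
    by (rule tuple_eqI[of _ k k]) (auto simp: Ob_nat Comp_Id[OF pr_hom]
        intro!: Id_hom tupling(1) pr_words tupling(2)[of k "\<lambda>i. pr T k i" k, THEN trans])
  then show ?thesis
    using assms Comp_Id by (simp add: wsubst_def words_def)
qed

lemma wsubst_pr:
  assumes "i < k" "\<And>i. i < k \<Longrightarrow> f i < l"
  shows "wsubst T k l f (pr T k i) = pr T l (f i)"
  unfolding wsubst_def using assms by (intro tupling(2)) (auto intro: pr_words)

lemma wunit_words: "wunit T \<in> words T 1"
  by (simp add: wunit_def pr_words)

lemma wgamma_args:
  assumes "\<And>i. i < k \<Longrightarrow> ws i \<in> words T (n i)" "i < k"
  shows "wsubst T (n i) (offset n k) (incl n i) (ws i) \<in> words T (offset n k)"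
  using assms by (intro wsubst_words incl_less) auto

lemma wgamma_words:
  assumes "w \<in> words T k" "\<And>i. i < k \<Longrightarrow> ws i \<in> words T (n i)"
  shows "wgamma T k n w ws \<in> words T (offset n k)"
  unfolding wgamma_def by (rule Comp_words[OF assms(1) tupling(1)[OF wgamma_args[OF assms(2)]]])

lemma wgamma_cong:
  assumes "\<And>i. i < k \<Longrightarrow> ws i = ws' i"
  shows "wgamma T k n w ws = wgamma T k n w ws'"
  unfolding wgamma_def using assms by (intro arg_cong[of _ _ "Comp T w"] tupling_cong) simp

text \<open>The outer substitution passes into the tuple, where it meets the block inclusions; two
  successive substitutions of an inner word then merge into one.\<close>

lemma wsubst_wgamma:
  assumes w: "w \<in> words T k" and ws: "\<And>i. i < k \<Longrightarrow> ws i \<in> words T (n i)"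
    and f: "\<And>j. j < offset n k \<Longrightarrow> f j < l"
  shows "wsubst T (offset n k) l f (wgamma T k n w ws)
    = Comp T w (tupling T l k (\<lambda>i. wsubst T (n i) l (\<lambda>j. f (incl n i j)) (ws i)))"
proof -
  have "wsubst T (offset n k) l f (wgamma T k n w ws)
    = Comp T w (tupling T l k (\<lambda>i. wsubst T (offset n k) l f
        (wsubst T (n i) (offset n k) (incl n i) (ws i))))"
    unfolding wsubst_def[of T "offset n k"] wgamma_def
    by (rule Comp_Comp_tupling[OF w wgamma_args[OF ws] tupling(1)]) (auto intro: pr_words f)
  also have "\<dots> = Comp T w (tupling T l k (\<lambda>i. wsubst T (n i) l (\<lambda>j. f (incl n i j)) (ws i)))"
    by (intro arg_cong[of _ _ "Comp T w"] tupling_cong wsubst_wsubst ws incl_less f)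
  finally show ?thesis .
qed

text \<open>Both sides are brought to \<open>w\<close> after a tuple whose entry \<open>i\<close> is
  \<open>ws i\<close> after the tuple of the words of group \<open>i\<close>, each of them placed
  directly in its final block of variables.\<close>

lemma wgamma_assoc:
  assumes w: "w \<in> words T k" and ws: "\<And>i. i < k \<Longrightarrow> ws i \<in> words T (n i)"
    and vs: "\<And>j. j < offset n k \<Longrightarrow> vs j \<in> words T (p j)"
  shows "wgamma T (offset n k) p (wgamma T k n w ws) vs
    = wgamma T k (\<lambda>i. offset (blk n i p) (n i)) w
        (\<lambda>i. wgamma T (n i) (blk n i p) (ws i) (blk n i vs))"
proof -
  let ?N = "offset n k" let ?P = "offset p ?N" let ?n = "\<lambda>i. offset (blk n i p) (n i)"
  let ?v = "\<lambda>j. wsubst T (p j) ?P (incl p j) (vs j)"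
  have v: "?v j \<in> words T ?P" if "j < ?N" for j
    using wgamma_args[of ?N vs p] vs that by blast
  have vs': "blk n i vs j \<in> words T (blk n i p j)" if "i < k" "j < n i" for i j
    using that vs incl_less by (simp add: blk_apply)
  have "wgamma T ?N p (wgamma T k n w ws) vs
    = Comp T w (tupling T ?P k (\<lambda>i. Comp T (wsubst T (n i) ?N (incl n i) (ws i))
        (tupling T ?P ?N ?v)))"
    unfolding wgamma_def[of T ?N] wgamma_def[of T k]
    by (rule Comp_Comp_tupling[OF w wgamma_args[OF ws] tupling(1)[OF v]])
  also have "\<dots> = Comp T w (tupling T ?P k (\<lambda>i. Comp T (ws i)
      (tupling T ?P (n i) (\<lambda>j. ?v (incl n i j)))))"
    by (intro arg_cong[of _ _ "Comp T w"] tupling_cong Comp_wsubst ws v incl_less)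
  also have "\<dots> = Comp T w (tupling T ?P k
      (\<lambda>i. wsubst T (?n i) ?P (incl ?n i) (wgamma T (n i) (blk n i p) (ws i) (blk n i vs))))"
  proof (intro arg_cong[of _ _ "Comp T w"] tupling_cong)
    fix i assume i: "i < k"
    \<comment> \<open>The grouped side reaches the common form from the other end;
      \<open>incl_incl\<close> says that placing a word in two stages agrees with placing it at
      once.\<close>
    have "wsubst T (?n i) ?P (incl ?n i) (wgamma T (n i) (blk n i p) (ws i) (blk n i vs))
      = Comp T (ws i) (tupling T ?P (n i) (\<lambda>j. wsubst T (blk n i p j) ?P
          (\<lambda>q. incl ?n i (incl (blk n i p) j q)) (blk n i vs j)))"
      using incl_less[OF i, of _ ?n] by (intro wsubst_wgamma ws i vs')
          (simp_all add: offset_offset_total)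
    also have "\<dots> = Comp T (ws i) (tupling T ?P (n i) (\<lambda>j. ?v (incl n i j)))"
      by (intro arg_cong[of _ _ "Comp T (ws i)"] tupling_cong)
          (simp add: blk_apply incl_incl[of _ n i p, symmetric])
    finally show "Comp T (ws i) (tupling T ?P (n i) (\<lambda>j. ?v (incl n i j)))
      = wsubst T (?n i) ?P (incl ?n i) (wgamma T (n i) (blk n i p) (ws i) (blk n i vs))" by simp
  qed
  finally show ?thesis by (simp add: wgamma_def[of T k] offset_offset_total)
qed

lemma wgamma_unit_right:
  assumes w: "w \<in> words T k" and "\<And>i. i < k \<Longrightarrow> ws i = wunit T"
  shows "wgamma T k (\<lambda>_. 1) w ws = w"
proof -
  have "wgamma T k (\<lambda>_. 1) w ws = Comp T w (tupling T k k (\<lambda>i. pr T k i))"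
    unfolding wgamma_def using assms(2)
    by (auto simp: wunit_def incl_def intro!: arg_cong[of _ _ "Comp T w"] tupling_cong
        wsubst_pr[of 0 1, simplified, THEN trans])
  then show ?thesis using wsubst_id[OF w] by (simp add: wsubst_def)
qed

lemma wgamma_unit_left:
  assumes w: "w \<in> words T k"
  shows "wgamma T 1 (\<lambda>_. k) (wunit T) (\<lambda>i\<in>{..<1}. w) = w"
proof -
  have "wgamma T 1 (\<lambda>_. k) (wunit T) (\<lambda>i\<in>{..<1}. w) = wsubst T k k (incl (\<lambda>_. k) 0) w"
    unfolding wgamma_def wunit_def using w
    by (subst tupling(2)) (auto intro!: wsubst_words simp: incl_def)
  then show ?thesis
    using wsubst_id[OF w] wsubst_cong[of k "incl (\<lambda>_. k) 0" "\<lambda>i. i" k w] by (simp add: incl_def)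
qed

text \<open>On the left each repetition of \<open>ws (f i)\<close> first gets variables of its own;
  \<open>blk_map\<close> identifies these with the block of the single copy of that word on the
  right. It supplies the source half of \<open>c_s_outer\<close>.\<close>

lemma wgamma_outer:
  assumes w: "w \<in> words T k" and ws: "\<And>j. j < l \<Longrightarrow> ws j \<in> words T (n j)"
    and f: "f \<in> {..<k} \<rightarrow>\<^sub>E {..<l}"
  shows "wsubst T (offset (n \<circ> f) k) (offset n l) (blk_map n k f)
      (wgamma T k (n \<circ> f) w (compose {..<k} ws f))
    = wgamma T l n (wsubst T k l f w) ws"
proof -
  have f': "f i < l" if "i < k" for i using f that by auto
  have "wsubst T (offset (n \<circ> f) k) (offset n l) (blk_map n k f)
      (wgamma T k (n \<circ> f) w (compose {..<k} ws f))
    = Comp T w (tupling T (offset n l) k (\<lambda>i. wsubst T ((n \<circ> f) i) (offset n l)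
        (\<lambda>j. blk_map n k f (incl (n \<circ> f) i j)) (compose {..<k} ws f i)))"
    using ws f' blk_map_PiE[OF f, of n] by (intro wsubst_wgamma w) (auto simp: compose_def)
  also have "\<dots> = Comp T w (tupling T (offset n l) k
      (\<lambda>i. wsubst T (n (f i)) (offset n l) (incl n (f i)) (ws (f i))))"
    by (intro arg_cong[of _ _ "Comp T w"] tupling_cong)
        (auto simp: compose_def blk_map_incl intro!: wsubst_cong)
  also have "\<dots> = wgamma T l n (wsubst T k l f w) ws"
    unfolding wgamma_def by (rule Comp_wsubst[OF w f' wgamma_args[OF ws], symmetric])
  finally show ?thesis .
qed

lemma wgamma_inner:
  assumes w: "w \<in> words T k" and ws: "\<And>j. j < k \<Longrightarrow> ws j \<in> words T (n j)"
    and g: "\<And>i. i < k \<Longrightarrow> gs i \<in> {..<n i} \<rightarrow>\<^sub>E {..<n' i}"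
  shows "wsubst T (offset n k) (offset n' k) (blk_sum n n' k gs) (wgamma T k n w ws)
    = wgamma T k n' w (\<lambda>i. wsubst T (n i) (n' i) (gs i) (ws i))"
proof -
  have "wsubst T (offset n k) (offset n' k) (blk_sum n n' k gs) (wgamma T k n w ws)
    = Comp T w (tupling T (offset n' k) k (\<lambda>i. wsubst T (n i) (offset n' k)
        (\<lambda>j. blk_sum n n' k gs (incl n i j)) (ws i)))"
    using blk_sum_PiE[of k gs n n', OF g] by (intro wsubst_wgamma w ws) auto
  also have "\<dots> = wgamma T k n' w (\<lambda>i. wsubst T (n i) (n' i) (gs i) (ws i))"
    unfolding wgamma_def
  proof (intro arg_cong[of _ _ "Comp T w"] tupling_cong)
    fix i assume i: "i < k"
    have "wsubst T (n' i) (offset n' k) (incl n' i) (wsubst T (n i) (n' i) (gs i) (ws i))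
      = wsubst T (n i) (offset n' k) (\<lambda>j. incl n' i (gs i j)) (ws i)"
      using g[OF i] incl_less[OF i, of _ n'] by (intro wsubst_wsubst ws i) auto
    then show "wsubst T (n i) (offset n' k) (\<lambda>j. blk_sum n n' k gs (incl n i j)) (ws i)
      = wsubst T (n' i) (offset n' k) (incl n' i) (wsubst T (n i) (n' i) (gs i) (ws i))"
      using wsubst_cong[of "n i" "\<lambda>j. blk_sum n n' k gs (incl n i j)" "\<lambda>j. incl n' i (gs i j)"] i
      by (simp add: blk_sum_incl)
  qed
  finally show ?thesis .
qed

end

section \<open>Pseudo algebras\<close>

text \<open>
  The typing axioms of a pseudo algebra. They already force the two sides of each coherence law to
  have the same source and target, by the laws of \<open>T\<close> and of \<open>End(X)\<close>. Hence the law is equivalent to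
  its component form, which is what the lemmas \<open>_iff\<close> state.
\<close>

locale algebra_data = is_theory T + X: category X
  for T :: "'t theory_data"
    and X :: "('o, 'm) cat"
    and \<Phi> :: "'t \<Rightarrow> (nat \<Rightarrow> 'o, nat \<Rightarrow> 'm, 'o, 'm) ftor"
    and c :: "'t \<Rightarrow> (nat \<Rightarrow> 't) \<Rightarrow> (nat \<Rightarrow> 'o, nat \<Rightarrow> 'm, 'o, 'm) ntrans"
    and I :: "(nat \<Rightarrow> 'o, nat \<Rightarrow> 'm, 'o, 'm) ntrans"
    and s :: "nat \<Rightarrow> 't \<Rightarrow> (nat \<Rightarrow> nat) \<Rightarrow> (nat \<Rightarrow> 'o, nat \<Rightarrow> 'm, 'o, 'm) ntrans" +
  assumes Phi_functor: "w \<in> words T k \<Longrightarrow> \<Phi> w \<in> functors (pw X k) X"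
    and c_iso: "\<lbrakk>w \<in> words T k; ws \<in> (\<Pi>\<^sub>E i\<in>{..<k}. words T (n i))\<rbrakk> \<Longrightarrow>
      c w ws \<in> nat_isos (pw X (offset n k)) X
        (\<Phi> (wgamma T k n w ws)) (gammaF X k n (\<Phi> w) (\<lambda>i. \<Phi> (ws i)))"
    and I_iso: "I \<in> nat_isos (pw X 1) X (\<Phi> (wunit T)) (unitF X)"
    and s_iso: "\<lbrakk>w \<in> words T k; f \<in> {..<k} \<rightarrow>\<^sub>E {..<l}\<rbrakk> \<Longrightarrow>
      s l w f \<in> nat_isos (pw X l) X (\<Phi> (wsubst T k l f w)) (substF X k l f (\<Phi> w))"
begin

lemmas c_nats = nat_isosD(1)[OF c_iso]
lemmas c_ST = natsD(3,4)[OF c_nats]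
lemmas I_nats = nat_isosD(1)[OF I_iso]
lemmas s_nats = nat_isosD(1)[OF s_iso]
lemmas s_ST = natsD(3,4)[OF s_nats]

lemma PiE_words: "ws \<in> (\<Pi>\<^sub>E i\<in>{..<k}. words T (n i)) \<Longrightarrow> i < k \<Longrightarrow> ws i \<in> words T (n i)"
  by auto

lemma blk_words:
  assumes "vs \<in> (\<Pi>\<^sub>E j\<in>{..<offset n k}. words T (p j))" "i < k"
  shows "blk n i vs \<in> (\<Pi>\<^sub>E j\<in>{..<n i}. words T (blk n i p j))"
  using assms incl_less[of i k _ n] by (auto simp: blk_restrict PiE_iff)

lemma wgamma_PiE:
  assumes "ws \<in> (\<Pi>\<^sub>E i\<in>{..<k}. words T (n i))" "vs \<in> (\<Pi>\<^sub>E j\<in>{..<offset n k}. words T (p j))"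
  shows "(\<lambda>i\<in>{..<k}. wgamma T (n i) (blk n i p) (ws i) (blk n i vs))
    \<in> (\<Pi>\<^sub>E i\<in>{..<k}. words T (offset (blk n i p) (n i)))"
  using assms(1) PiE_words[OF blk_words[OF assms(2)]] by (auto intro!: wgamma_words)

lemma c_assoc_iff:
  assumes w: "w \<in> words T k" and ws: "ws \<in> (\<Pi>\<^sub>E i\<in>{..<k}. words T (n i))"
    and vs: "vs \<in> (\<Pi>\<^sub>E j\<in>{..<offset n k}. words T (p j))"
  shows "vcomp (pw X (offset p (offset n k))) X
        (gammaN X (offset n k) p (c w ws) (\<lambda>j. idn (pw X (p j)) X (\<Phi> (vs j))))
        (c (wgamma T k n w ws) vs)
      = vcomp (pw X (offset p (offset n k))) X
        (gammaN X k (\<lambda>i. offset (blk n i p) (n i)) (idn (pw X k) X (\<Phi> w))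
          (\<lambda>i. c (ws i) (blk n i vs)))
        (c w (\<lambda>i\<in>{..<k}. wgamma T (n i) (blk n i p) (ws i) (blk n i vs)))
    \<longleftrightarrow> (\<forall>x\<in>Ob (pw X (offset p (offset n k))).
      Comp X (At (c w ws) (\<lambda>j\<in>{..<offset n k}. FO (\<Phi> (vs j)) (blk p j x)))
        (At (c (wgamma T k n w ws) vs) x)
      = Comp X (FA (\<Phi> w) (\<lambda>i\<in>{..<k}.
            At (c (ws i) (blk n i vs)) (blk (\<lambda>i. offset (blk n i p) (n i)) i x)))
        (At (c w (\<lambda>i\<in>{..<k}. wgamma T (n i) (blk n i p) (ws i) (blk n i vs))) x))"
proof (subst vcomp_eq_iff)
  let ?n = "\<lambda>i. offset (blk n i p) (n i)"
  note ws' = PiE_words[OF ws] and vs' = PiE_words[OF vs]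
  note cs = c_nats[OF ws' blk_words[OF vs]]
  \<comment> \<open>The typing of \<open>c\<close> speaks of the restricted family of words, whereas
    \<open>wgamma_assoc\<close> yields the unrestricted one; \<open>wgamma_cong\<close> bridges the
    two.\<close>
  show "Source (c (wgamma T k n w ws) vs)
      = Source (c w (\<lambda>i\<in>{..<k}. wgamma T (n i) (blk n i p) (ws i) (blk n i vs)))"
    using c_ST(1)[OF wgamma_words[OF w ws'] vs] c_ST(1)[OF w wgamma_PiE[OF ws vs]]
      wgamma_assoc[OF w ws' vs']
      wgamma_cong[of k "\<lambda>i\<in>{..<k}. wgamma T (n i) (blk n i p) (ws i) (blk n i vs)"
        "\<lambda>i. wgamma T (n i) (blk n i p) (ws i) (blk n i vs)" ?n w]
    by simp
  \<comment> \<open>The targets of the inner isomorphisms are known for \<open>i < k\<close> only,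
    hence the rewriting under \<open>gammaF_cong\<close>.\<close>
  have "gammaF X k ?n (\<Phi> w) (\<lambda>i. Target (c (ws i) (blk n i vs)))
    = gammaF X k ?n (\<Phi> w) (\<lambda>i. gammaF X (n i) (blk n i p) (\<Phi> (ws i)) (blk n i (\<lambda>j. \<Phi> (vs j))))"
  proof (rule gammaF_cong)
    fix i assume i: "i < k"
    show "Target (c (ws i) (blk n i vs))
      = gammaF X (n i) (blk n i p) (\<Phi> (ws i)) (blk n i (\<lambda>j. \<Phi> (vs j)))"
      using natsD(4)[OF cs[OF i i]] by (simp add: blk_apply cong: gammaF_cong)
  qed
  then show "Target (gammaN X (offset n k) p (c w ws) (\<lambda>j. idn (pw X (p j)) X (\<Phi> (vs j))))
    = Target (gammaN X k ?n (idn (pw X k) X (\<Phi> w)) (\<lambda>i. c (ws i) (blk n i vs)))"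
    using gammaF_assoc[OF X.category_axioms, of k "\<lambda>i. \<Phi> (ws i)" n "\<lambda>j. \<Phi> (vs j)" p "\<Phi> w"]
      Phi_functor[OF ws'] Phi_functor[OF vs'] c_ST(2)[OF w ws] by simp
  show "(\<forall>x\<in>Ob (pw X (offset p (offset n k))).
      Comp X (At (gammaN X (offset n k) p (c w ws) (\<lambda>j. idn (pw X (p j)) X (\<Phi> (vs j)))) x)
        (At (c (wgamma T k n w ws) vs) x)
      = Comp X (At (gammaN X k ?n (idn (pw X k) X (\<Phi> w)) (\<lambda>i. c (ws i) (blk n i vs))) x)
        (At (c w (\<lambda>i\<in>{..<k}. wgamma T (n i) (blk n i p) (ws i) (blk n i vs))) x))
    \<longleftrightarrow> (\<forall>x\<in>Ob (pw X (offset p (offset n k))).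
      Comp X (At (c w ws) (\<lambda>j\<in>{..<offset n k}. FO (\<Phi> (vs j)) (blk p j x)))
        (At (c (wgamma T k n w ws) vs) x)
      = Comp X (FA (\<Phi> w) (\<lambda>i\<in>{..<k}. At (c (ws i) (blk n i vs)) (blk ?n i x)))
        (At (c w (\<lambda>i\<in>{..<k}. wgamma T (n i) (blk n i p) (ws i) (blk n i vs))) x))"
  proof (rule ball_cong[OF refl])
    fix x assume x: "x \<in> Ob (pw X (offset p (offset n k)))"
    \<comment> \<open>The same object serves both sides, since the flat and the grouped arities have
      the same total.\<close>
    then have x': "x \<in> Ob (pw X (offset ?n k))" by (simp add: offset_offset_total)
    show "Comp X (At (gammaN X (offset n k) p (c w ws) (\<lambda>j. idn (pw X (p j)) X (\<Phi> (vs j)))) x)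
        (At (c (wgamma T k n w ws) vs) x)
      = Comp X (At (gammaN X k ?n (idn (pw X k) X (\<Phi> w)) (\<lambda>i. c (ws i) (blk n i vs))) x)
        (At (c w (\<lambda>i\<in>{..<k}. wgamma T (n i) (blk n i p) (ws i) (blk n i vs))) x)
    \<longleftrightarrow> Comp X (At (c w ws) (\<lambda>j\<in>{..<offset n k}. FO (\<Phi> (vs j)) (blk p j x)))
        (At (c (wgamma T k n w ws) vs) x)
      = Comp X (FA (\<Phi> w) (\<lambda>i\<in>{..<k}. At (c (ws i) (blk n i vs)) (blk ?n i x)))
        (At (c w (\<lambda>i\<in>{..<k}. wgamma T (n i) (blk n i p) (ws i) (blk n i vs))) x)"
      unfolding At_gammaN_idn_right[OF x X.category_axioms c_nats[OF w ws] Phi_functor[OF vs'],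
          simplified]
        At_gammaN_idn_left[OF x' X.category_axioms Phi_functor[OF w] cs, simplified] ..
  qed
qed

lemma c_unit_right_iff:
  assumes w: "w \<in> words T k"
  shows "vcomp (pw X k) X (gammaN X k (\<lambda>_. 1) (idn (pw X k) X (\<Phi> w)) (\<lambda>_. I))
        (c w (\<lambda>i\<in>{..<k}. wunit T))
      = idn (pw X k) X (\<Phi> w)
    \<longleftrightarrow> (\<forall>x\<in>Ob (pw X k). Comp X (FA (\<Phi> w) (\<lambda>i\<in>{..<k}. At I (blk (\<lambda>_. 1) i x)))
        (At (c w (\<lambda>i\<in>{..<k}. wunit T)) x) = Id X (FO (\<Phi> w) x))"
proof -
  have u: "(\<lambda>i\<in>{..<k}. wunit T) \<in> (\<Pi>\<^sub>E i\<in>{..<k}. words T 1)" using wunit_words by auto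
  have o: "offset (\<lambda>_. 1) k = k" by simp
  show ?thesis
  proof (subst vcomp_eq_iff')
    show "Source (c w (\<lambda>i\<in>{..<k}. wunit T)) = Source (idn (pw X k) X (\<Phi> w))"
      using c_ST(1)[OF w u] wgamma_unit_right[OF w, of "\<lambda>i\<in>{..<k}. wunit T"] by simp
    show "Target (gammaN X k (\<lambda>_. 1) (idn (pw X k) X (\<Phi> w)) (\<lambda>_. I))
        = Target (idn (pw X k) X (\<Phi> w))"
      using gammaF_unit_right[OF Phi_functor[OF w]] natsD(4)[OF I_nats] by simp
    show "(\<forall>x\<in>Ob (pw X k). Comp X (At (gammaN X k (\<lambda>_. 1) (idn (pw X k) X (\<Phi> w)) (\<lambda>_. I)) x)
        (At (c w (\<lambda>i\<in>{..<k}. wunit T)) x) = At (idn (pw X k) X (\<Phi> w)) x)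
      \<longleftrightarrow> (\<forall>x\<in>Ob (pw X k). Comp X (FA (\<Phi> w) (\<lambda>i\<in>{..<k}. At I (blk (\<lambda>_. 1) i x)))
        (At (c w (\<lambda>i\<in>{..<k}. wunit T)) x) = Id X (FO (\<Phi> w) x))"
      using At_gammaN_idn_left[of _ X "\<lambda>_. 1" k "\<Phi> w" "\<lambda>_. I", unfolded o, OF _ X.category_axioms
          Phi_functor[OF w] I_nats]
      by (simp add: At_idn)
  qed simp
qed

lemma c_unit_left_iff:
  assumes w: "w \<in> words T k"
  shows "vcomp (pw X k) X (gammaN X 1 (\<lambda>_. k) I (\<lambda>_. idn (pw X k) X (\<Phi> w)))
        (c (wunit T) (\<lambda>i\<in>{..<1}. w))
      = idn (pw X k) X (\<Phi> w)
    \<longleftrightarrow> (\<forall>x\<in>Ob (pw X k). Comp X (At I (\<lambda>i\<in>{..<1}. FO (\<Phi> w) (blk (\<lambda>_. k) i x)))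
        (At (c (wunit T) (\<lambda>i\<in>{..<1}. w)) x) = Id X (FO (\<Phi> w) x))"
proof -
  have u: "(\<lambda>i\<in>{..<1}. w) \<in> (\<Pi>\<^sub>E i\<in>{..<1::nat}. words T k)" using w by auto
  have o: "offset (\<lambda>_. k) 1 = k" by simp
  show ?thesis
  proof (subst vcomp_eq_iff')
    show "Source (c (wunit T) (\<lambda>i\<in>{..<1}. w)) = Source (idn (pw X k) X (\<Phi> w))"
      using c_ST(1)[OF wunit_words u] wgamma_unit_left[OF w] by simp
    show "Target (gammaN X 1 (\<lambda>_. k) I (\<lambda>_. idn (pw X k) X (\<Phi> w))) = Target (idn (pw X k) X (\<Phi> w))"
      using gammaF_unit_left[OF Phi_functor[OF w]] natsD(4)[OF I_nats] by simp
    show "(\<forall>x\<in>Ob (pw X k). Comp X (At (gammaN X 1 (\<lambda>_. k) I (\<lambda>_. idn (pw X k) X (\<Phi> w))) x)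
        (At (c (wunit T) (\<lambda>i\<in>{..<1}. w)) x) = At (idn (pw X k) X (\<Phi> w)) x)
      \<longleftrightarrow> (\<forall>x\<in>Ob (pw X k). Comp X (At I (\<lambda>i\<in>{..<1}. FO (\<Phi> w) (blk (\<lambda>_. k) i x)))
        (At (c (wunit T) (\<lambda>i\<in>{..<1}. w)) x) = Id X (FO (\<Phi> w) x))"
      using At_gammaN_idn_right[of _ X "\<lambda>_. k" 1 I _ _ "\<lambda>_. \<Phi> w", unfolded o, OF _ X.category_axioms
          I_nats Phi_functor[OF w]]
      by (simp add: At_idn)
  qed simp
qed

lemma compose_words:
  assumes "f \<in> {..<k} \<rightarrow>\<^sub>E {..<l}" "ws \<in> (\<Pi>\<^sub>E j\<in>{..<l}. words T (n j))"
  shows "compose {..<k} ws f \<in> (\<Pi>\<^sub>E i\<in>{..<k}. words T ((n \<circ> f) i))"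
  using assms by (auto simp: compose_def PiE_iff)

lemma PiE_less: "f \<in> {..<k} \<rightarrow>\<^sub>E {..<l} \<Longrightarrow> i < k \<Longrightarrow> f i < (l::nat)"
  by auto

lemma c_s_outer_iff:
  assumes w: "w \<in> words T k" and f: "f \<in> {..<k} \<rightarrow>\<^sub>E {..<l}"
    and ws: "ws \<in> (\<Pi>\<^sub>E j\<in>{..<l}. words T (n j))"
  shows "vcomp (pw X (offset n l)) X
        (substN X (offset (n \<circ> f) k) (offset n l) (blk_map n k f) (c w (compose {..<k} ws f)))
        (s (offset n l) (wgamma T k (n \<circ> f) w (compose {..<k} ws f)) (blk_map n k f))
      = vcomp (pw X (offset n l)) X
        (gammaN X l n (s l w f) (\<lambda>j. idn (pw X (n j)) X (\<Phi> (ws j))))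
        (c (wsubst T k l f w) ws)
    \<longleftrightarrow> (\<forall>x\<in>Ob (pw X (offset n l)).
      Comp X (At (c w (compose {..<k} ws f)) (compose {..<offset (n \<circ> f) k} x (blk_map n k f)))
        (At (s (offset n l) (wgamma T k (n \<circ> f) w (compose {..<k} ws f)) (blk_map n k f)) x)
      = Comp X (At (s l w f) (\<lambda>j\<in>{..<l}. FO (\<Phi> (ws j)) (blk n j x)))
          (At (c (wsubst T k l f w) ws) x))"
proof (subst vcomp_eq_iff)
  note ws' = PiE_words[OF ws] and cw = compose_words[OF f ws] and f' = PiE_less[OF f]
  note cw' = PiE_words[OF cw]
  show "Source (s (offset n l) (wgamma T k (n \<circ> f) w (compose {..<k} ws f)) (blk_map n k f))
    = Source (c (wsubst T k l f w) ws)"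
    using s_ST(1)[OF wgamma_words[of w k "compose {..<k} ws f" "n \<circ> f", OF w cw'] blk_map_PiE[OF f]]
      c_ST(1)[OF wsubst_words[of w k f l, OF w f'] ws] wgamma_outer[of w k l ws n f, OF w ws' f]
          by simp
  have "gammaF X k (n \<circ> f) (\<Phi> w) (\<lambda>i. \<Phi> (compose {..<k} ws f i))
    = gammaF X k (n \<circ> f) (\<Phi> w) (\<lambda>i. \<Phi> (ws (f i)))"
    by (rule gammaF_cong) (simp add: compose_def)
  then show "Target (substN X (offset (n \<circ> f) k) (offset n l) (blk_map n k f)
      (c w (compose {..<k} ws f)))
    = Target (gammaN X l n (s l w f) (\<lambda>j. idn (pw X (n j)) X (\<Phi> (ws j))))"
    using substF_gammaF_outer[OF f X.category_axioms, of "\<lambda>j. \<Phi> (ws j)" n "\<Phi> w"] Phi_functor[OF ws']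
      c_ST(2)[where n = "n \<circ> f", OF w cw] s_ST(2)[OF w f] by simp
  note [simp] = At_gammaN_idn_right[OF _ X.category_axioms s_nats[OF w f] Phi_functor[OF ws']]
  show "(\<forall>x\<in>Ob (pw X (offset n l)).
      Comp X (At (substN X (offset (n \<circ> f) k) (offset n l) (blk_map n k f)
          (c w (compose {..<k} ws f))) x)
        (At (s (offset n l) (wgamma T k (n \<circ> f) w (compose {..<k} ws f)) (blk_map n k f)) x)
      = Comp X (At (gammaN X l n (s l w f) (\<lambda>j. idn (pw X (n j)) X (\<Phi> (ws j)))) x)
          (At (c (wsubst T k l f w) ws) x))
    \<longleftrightarrow> (\<forall>x\<in>Ob (pw X (offset n l)).
      Comp X (At (c w (compose {..<k} ws f)) (compose {..<offset (n \<circ> f) k} x (blk_map n k f)))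
        (At (s (offset n l) (wgamma T k (n \<circ> f) w (compose {..<k} ws f)) (blk_map n k f)) x)
      = Comp X (At (s l w f) (\<lambda>j\<in>{..<l}. FO (\<Phi> (ws j)) (blk n j x)))
          (At (c (wsubst T k l f w) ws) x))"
    by (simp add: At_substN)
qed

lemma c_s_inner_iff:
  assumes w: "w \<in> words T k" and ws: "ws \<in> (\<Pi>\<^sub>E i\<in>{..<k}. words T (n i))"
    and g: "\<And>i. i < k \<Longrightarrow> gs i \<in> {..<n i} \<rightarrow>\<^sub>E {..<n' i}"
  shows "vcomp (pw X (offset n' k)) X
        (substN X (offset n k) (offset n' k) (blk_sum n n' k gs) (c w ws))
        (s (offset n' k) (wgamma T k n w ws) (blk_sum n n' k gs))
      = vcomp (pw X (offset n' k)) X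
        (gammaN X k n' (idn (pw X k) X (\<Phi> w)) (\<lambda>i. s (n' i) (ws i) (gs i)))
        (c w (\<lambda>i\<in>{..<k}. wsubst T (n i) (n' i) (gs i) (ws i)))
    \<longleftrightarrow> (\<forall>x\<in>Ob (pw X (offset n' k)).
      Comp X (At (c w ws) (compose {..<offset n k} x (blk_sum n n' k gs)))
        (At (s (offset n' k) (wgamma T k n w ws) (blk_sum n n' k gs)) x)
      = Comp X (FA (\<Phi> w) (\<lambda>i\<in>{..<k}. At (s (n' i) (ws i) (gs i)) (blk n' i x)))
        (At (c w (\<lambda>i\<in>{..<k}. wsubst T (n i) (n' i) (gs i) (ws i))) x))"
proof (subst vcomp_eq_iff)
  note ws' = PiE_words[OF ws] and g' = PiE_less[OF g]
  have gw: "(\<lambda>i\<in>{..<k}. wsubst T (n i) (n' i) (gs i) (ws i)) \<in> (\<Pi>\<^sub>E i\<in>{..<k}. words T (n' i))"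
    using ws' g' wsubst_words by auto
  show "Source (s (offset n' k) (wgamma T k n w ws) (blk_sum n n' k gs))
    = Source (c w (\<lambda>i\<in>{..<k}. wsubst T (n i) (n' i) (gs i) (ws i)))"
    using s_ST(1)[OF wgamma_words[of w k ws n, OF w ws'] blk_sum_PiE[of k gs n n', OF g]]
        c_ST(1)[OF w gw]
      wgamma_inner[of w k ws n gs n', OF w ws' g]
      wgamma_cong[of k "\<lambda>i\<in>{..<k}. wsubst T (n i) (n' i) (gs i) (ws i)"
        "\<lambda>i. wsubst T (n i) (n' i) (gs i) (ws i)" n' w]
    by simp
  have "gammaF X k n' (\<Phi> w) (\<lambda>i. Target (s (n' i) (ws i) (gs i)))
    = gammaF X k n' (\<Phi> w) (\<lambda>i. substF X (n i) (n' i) (gs i) (\<Phi> (ws i)))"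
    by (rule gammaF_cong) (simp add: s_ST(2)[OF ws' g])
  then show "Target (substN X (offset n k) (offset n' k) (blk_sum n n' k gs) (c w ws))
    = Target (gammaN X k n' (idn (pw X k) X (\<Phi> w)) (\<lambda>i. s (n' i) (ws i) (gs i)))"
    using substF_gammaF_inner[of k gs n n' X "\<Phi> w" "\<lambda>i. \<Phi> (ws i)", OF g] c_ST(2)[OF w ws] by simp
  note [simp] = At_gammaN_idn_left[where \<alpha>s = "\<lambda>i. s (n' i) (ws i) (gs i)" and n = n' and k = k,
    OF _ X.category_axioms Phi_functor[OF w] s_nats[OF ws' g]]
  show "(\<forall>x\<in>Ob (pw X (offset n' k)).
      Comp X (At (substN X (offset n k) (offset n' k) (blk_sum n n' k gs) (c w ws)) x)
        (At (s (offset n' k) (wgamma T k n w ws) (blk_sum n n' k gs)) x)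
      = Comp X (At (gammaN X k n' (idn (pw X k) X (\<Phi> w)) (\<lambda>i. s (n' i) (ws i) (gs i))) x)
        (At (c w (\<lambda>i\<in>{..<k}. wsubst T (n i) (n' i) (gs i) (ws i))) x))
    \<longleftrightarrow> (\<forall>x\<in>Ob (pw X (offset n' k)).
      Comp X (At (c w ws) (compose {..<offset n k} x (blk_sum n n' k gs)))
        (At (s (offset n' k) (wgamma T k n w ws) (blk_sum n n' k gs)) x)
      = Comp X (FA (\<Phi> w) (\<lambda>i\<in>{..<k}. At (s (n' i) (ws i) (gs i)) (blk n' i x)))
        (At (c w (\<lambda>i\<in>{..<k}. wsubst T (n i) (n' i) (gs i) (ws i))) x))"
    by (simp add: At_substN)
qed

lemma s_comp_iff:
  assumes w: "w \<in> words T k" and f: "f \<in> {..<k} \<rightarrow>\<^sub>E {..<l}" and g: "g \<in> {..<l} \<rightarrow>\<^sub>E {..<m}"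
  shows "vcomp (pw X m) X (substN X l m g (s l w f)) (s m (wsubst T k l f w) g)
      = s m w (compose {..<k} g f)
    \<longleftrightarrow> (\<forall>x\<in>Ob (pw X m). Comp X (At (s l w f) (compose {..<l} x g)) (At (s m (wsubst T k l f w) g) x)
      = At (s m w (compose {..<k} g f)) x)"
proof (subst vcomp_eq_iff')
  have gf: "compose {..<k} g f \<in> {..<k} \<rightarrow>\<^sub>E {..<m}"
    using f g by (auto simp: compose_def PiE_iff)
  note f' = PiE_less[OF f] and g' = PiE_less[OF g]
  show "Source (s m (wsubst T k l f w) g) = Source (s m w (compose {..<k} g f))"
    using s_ST(1)[OF wsubst_words[OF w f'] g] s_ST(1)[OF w gf] wsubst_wsubst[OF w f' g']
      wsubst_cong[of k "compose {..<k} g f" "\<lambda>i. g (f i)" m w] by (simp add: compose_def)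
  show "Target (substN X l m g (s l w f)) = Target (s m w (compose {..<k} g f))"
    using s_ST(2)[OF w f] s_ST(2)[OF w gf] substF_substF[OF f g] by simp
  show "At (s m w (compose {..<k} g f)) \<in> extensional (Ob (pw X m))"
    by (rule natsD(5)[OF s_nats[OF w gf]])
qed (simp add: At_substN)

lemma s_id_iff:
  assumes w: "w \<in> words T k"
  shows "s k w (\<lambda>i\<in>{..<k}. i) = idn (pw X k) X (\<Phi> w)
    \<longleftrightarrow> (\<forall>x\<in>Ob (pw X k). At (s k w (\<lambda>i\<in>{..<k}. i)) x = Id X (FO (\<Phi> w) x))"
proof
  have i: "(\<lambda>i\<in>{..<k}. i) \<in> {..<k} \<rightarrow>\<^sub>E {..<k}" by auto
  assume *: "\<forall>x\<in>Ob (pw X k). At (s k w (\<lambda>i\<in>{..<k}. i)) x = Id X (FO (\<Phi> w) x)"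
  show "s k w (\<lambda>i\<in>{..<k}. i) = idn (pw X k) X (\<Phi> w)"
  proof (rule trans_eqI)
    show "Source (s k w (\<lambda>i\<in>{..<k}. i)) = Source (idn (pw X k) X (\<Phi> w))"
      using s_ST(1)[OF w i] wsubst_id[OF w] wsubst_cong[of k "\<lambda>i\<in>{..<k}. i" "\<lambda>i. i" k w] by simp
    show "Target (s k w (\<lambda>i\<in>{..<k}. i)) = Target (idn (pw X k) X (\<Phi> w))"
      using s_ST(2)[OF w i] substF_id[OF Phi_functor[OF w]] by simp
    show "At (s k w (\<lambda>i\<in>{..<k}. i)) \<in> extensional (Ob (pw X k))"
      by (rule natsD(5)[OF s_nats[OF w i]])
  qed (use * in \<open>simp_all add: At_idn\<close>)
qed (simp add: At_idn)

end

lemma pseudo_algebra_data: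
  assumes "is_theory T" "pseudo_algebra T X \<Phi> c I s"
  shows "algebra_data T X \<Phi> c I s"
proof -
  interpret is_theory T by fact
  interpret pseudo_algebra T X \<Phi> c I s by fact
  show ?thesis
    by unfold_locales (fact Phi_functor c_iso I_iso s_iso)+
qed

lemma is_psalg_data:
  assumes "is_theory T" "is_psalg T A"
  shows "algebra_data T (car A) (Phi A) (cc A) (II A) (ss A)"
  using assms pseudo_algebra_data unfolding is_psalg_def by blast

section \<open>Morphisms of pseudo algebras\<close>

text \<open>This contains just the typing clauses of \<open>psmors\<close>. As for algebras, typing
  fixes the endpoints of every law, so the three laws can be split off and stated at
  objects.\<close>

locale morphism_data =
  A: algebra_data T "car A" "Phi A" "cc A" "II A" "ss A" +
  B: algebra_data T "car B" "Phi B" "cc B" "II B" "ss B"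
  for T :: "'t theory_data" and A B :: "('t, 'o, 'm) psalg" +
  fixes M :: "('t, 'o, 'm) psmor"
  assumes fun_functor: "fun_of M \<in> functors (car A) (car B)"
    and rho_ext: "rho M \<in> extensional (\<Union>n. words T n)"
    and rho_iso: "w \<in> words T n \<Longrightarrow> rho M w \<in> nat_isos (pw (car A) n) (car B)
      (fcomp (pw (car A) n) (fun_of M) (Phi A w))
          (fcomp (pw (car A) n) (Phi B w) (powF (car A) n (fun_of M)))"
begin

abbreviation "X \<equiv> car A"
abbreviation "Y \<equiv> car B"
abbreviation "H \<equiv> fun_of M"

lemmas rho_nats = nat_isosD(1)[OF rho_iso]
lemmas rho_ST = natsD(3,4)[OF rho_nats]
lemmas A_cat = A.X.category_axioms
lemmas B_cat = B.X.category_axioms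

lemma rho_hom:
  assumes "w \<in> words T n" "x \<in> Ob (pw X n)"
  shows "At (rho M w) x \<in> hom Y (FO H (FO (Phi A w) x)) (FO (Phi B w) (\<lambda>i\<in>{..<n}. FO H (x i)))"
  using natsD(6)[OF rho_nats[OF assms(1)] assms(2)] assms(2) by (simp add: FO_fcomp FO_powF)

lemma rho_isos:
  assumes "w \<in> words T n" "x \<in> Ob (pw X n)"
  shows "At (rho M w) x \<in> isos Y (FO H (FO (Phi A w) x)) (FO (Phi B w) (\<lambda>i\<in>{..<n}. FO H (x i)))"
  using nat_isosD(2)[OF rho_iso[OF assms(1)] assms(2)] assms(2) by (simp add: FO_fcomp FO_powF)

lemma rho_natural:
  assumes "w \<in> words T n" "u \<in> hom (pw X n) x y"
  shows "Comp Y (At (rho M w) y) (FA H (FA (Phi A w) u))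
    = Comp Y (FA (Phi B w) (\<lambda>i\<in>{..<n}. FA H (u i))) (At (rho M w) x)"
  using natsD(7)[OF rho_nats[OF assms(1)] assms(2)] homD(1)[OF assms(2)]
  by (simp add: FA_fcomp FA_powF)

lemma pow_Ob: "x \<in> Ob (pw X n) \<Longrightarrow> (\<lambda>i\<in>{..<n}. FO H (x i)) \<in> Ob (pw Y n)"
  using functorsD(3)[OF powF_functor[OF A_cat fun_functor], of x n] by (simp add: FO_powF)

lemma gamma_iff:
  assumes w: "w \<in> words T k" and ws: "ws \<in> (\<Pi>\<^sub>E i\<in>{..<k}. words T (n i))"
  shows "vcomp (pw X (offset n k)) Y
          (hcomp (pw X (offset n k)) Y (cc B w ws)
            (idn (pw X (offset n k)) (pw Y (offset n k)) (powF X (offset n k) H)))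
          (rho M (wgamma T k n w ws))
        = vcomp (pw X (offset n k)) Y
          (hcomp (pw X (offset n k)) Y (idn (pw Y k) Y (Phi B w)) (prodN X k n (\<lambda>i. rho M (ws i))))
          (vcomp (pw X (offset n k)) Y
            (hcomp (pw X (offset n k)) Y (rho M w)
              (idn (pw X (offset n k)) (pw X k) (prodF X k n (\<lambda>i. Phi A (ws i)))))
            (hcomp (pw X (offset n k)) Y (idn X Y H) (cc A w ws)))
    \<longleftrightarrow> (\<forall>x\<in>Ob (pw X (offset n k)).
      Comp Y (At (cc B w ws) (\<lambda>i\<in>{..<offset n k}. FO H (x i))) (At (rho M (wgamma T k n w ws)) x)
      = Comp Y (FA (Phi B w) (\<lambda>i\<in>{..<k}. At (rho M (ws i)) (blk n i x)))
        (Comp Y (At (rho M w) (\<lambda>i\<in>{..<k}. FO (Phi A (ws i)) (blk n i x)))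
          (FA H (At (cc A w ws) x))))"
proof (subst vcomp_eq_iff)
  let ?N = "offset n k"
  note ws' = A.PiE_words[OF ws]
  note wg = A.wgamma_words[of w k ws n, OF w ws']
  show "Source (rho M (wgamma T k n w ws)) = Source (vcomp (pw X ?N) Y
            (hcomp (pw X ?N) Y (rho M w) (idn (pw X ?N) (pw X k) (prodF X k n (\<lambda>i. Phi A (ws i)))))
            (hcomp (pw X ?N) Y (idn X Y H) (cc A w ws)))"
    using rho_ST(1)[OF wg] A.c_ST(1)[OF w ws] by simp
  have "prodF X k n (\<lambda>i. Target (rho M (ws i)))
    = prodF X k n (\<lambda>i. fcomp (pw X (n i)) (Phi B (ws i)) (powF X (n i) H))"
    by (rule prodF_cong) (simp add: rho_ST(2)[OF ws'])
  then show "Target (hcomp (pw X ?N) Y (cc B w ws) (idn (pw X ?N) (pw Y ?N) (powF X ?N H)))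
    = Target (hcomp (pw X ?N) Y (idn (pw Y k) Y (Phi B w)) (prodN X k n (\<lambda>i. rho M (ws i))))"
    using B.c_ST(2)[OF w ws] powF_gammaF[OF A_cat fun_functor, of n k "Phi B w"] by simp
  note [simp] = At_hcomp_idn_right[OF _ powF_functor[OF A_cat fun_functor] B.c_nats[OF w ws] B_cat]
    At_hcomp_idn_right[OF _ prodF_functor[OF A_cat A.Phi_functor[OF ws']] rho_nats[OF w] B_cat]
    At_hcomp_idn_left[OF _ prodN_nats[OF A_cat rho_nats[OF ws']] B.Phi_functor[OF w] B_cat]
    At_hcomp_idn_left[OF _ A.c_nats[OF w ws] fun_functor B_cat]
  show "(\<forall>x\<in>Ob (pw X ?N).
      Comp Y (At (hcomp (pw X ?N) Y (cc B w ws) (idn (pw X ?N) (pw Y ?N) (powF X ?N H))) x)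
          (At (rho M (wgamma T k n w ws)) x)
      = Comp Y (At (hcomp (pw X ?N) Y (idn (pw Y k) Y (Phi B w)) (prodN X k n (\<lambda>i. rho M (ws i))))
          x)
          (At (vcomp (pw X ?N) Y
            (hcomp (pw X ?N) Y (rho M w) (idn (pw X ?N) (pw X k) (prodF X k n (\<lambda>i. Phi A (ws i)))))
            (hcomp (pw X ?N) Y (idn X Y H) (cc A w ws))) x))
    \<longleftrightarrow> (\<forall>x\<in>Ob (pw X ?N).
      Comp Y (At (cc B w ws) (\<lambda>i\<in>{..<?N}. FO H (x i))) (At (rho M (wgamma T k n w ws)) x)
      = Comp Y (FA (Phi B w) (\<lambda>i\<in>{..<k}. At (rho M (ws i)) (blk n i x)))
        (Comp Y (At (rho M w) (\<lambda>i\<in>{..<k}. FO (Phi A (ws i)) (blk n i x)))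
          (FA H (At (cc A w ws) x))))"
    by (simp add: At_vcomp At_prodN FO_powF FO_prodF)
qed

lemma unit_iff:
  "vcomp (pw X 1) Y
        (hcomp (pw X 1) Y (II B) (idn (pw X 1) (pw Y 1) (powF X 1 H))) (rho M (wunit T))
      = hcomp (pw X 1) Y (idn X Y H) (II A)
    \<longleftrightarrow> (\<forall>x\<in>Ob (pw X 1). Comp Y (At (II B) (\<lambda>i\<in>{..<1}. FO H (x i))) (At (rho M (wunit T)) x)
      = FA H (At (II A) x))"
proof (subst vcomp_eq_iff')
  show "Source (rho M (wunit T)) = Source (hcomp (pw X 1) Y (idn X Y H) (II A))"
    using rho_ST(1)[OF A.wunit_words] natsD(3)[OF A.I_nats] by simp
  show "Target (hcomp (pw X 1) Y (II B) (idn (pw X 1) (pw Y 1) (powF X 1 H)))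
    = Target (hcomp (pw X 1) Y (idn X Y H) (II A))"
    using powF_unitF[OF A_cat fun_functor] natsD(4)[OF A.I_nats] natsD(4)[OF B.I_nats] by simp
qed (simp_all del: One_nat_def add: At_hcomp_idn_right[OF _ powF_functor[OF A_cat fun_functor]
    B.I_nats B_cat]
    At_hcomp_idn_left[OF _ A.I_nats fun_functor B_cat] FO_powF)

lemma subst_iff:
  assumes w: "w \<in> words T k" and f: "f \<in> {..<k} \<rightarrow>\<^sub>E {..<l}"
  shows "vcomp (pw X l) Y
          (hcomp (pw X l) Y (ss B l w f) (idn (pw X l) (pw Y l) (powF X l H)))
          (rho M (wsubst T k l f w))
        = vcomp (pw X l) Y
          (substN X k l f (rho M w)) (hcomp (pw X l) Y (idn X Y H) (ss A l w f))
    \<longleftrightarrow> (\<forall>x\<in>Ob (pw X l).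
      Comp Y (At (ss B l w f) (\<lambda>i\<in>{..<l}. FO H (x i))) (At (rho M (wsubst T k l f w)) x)
      = Comp Y (At (rho M w) (compose {..<k} x f)) (FA H (At (ss A l w f) x)))"
proof (subst vcomp_eq_iff)
  note f' = A.PiE_less[OF f]
  show "Source (rho M (wsubst T k l f w)) = Source (hcomp (pw X l) Y (idn X Y H) (ss A l w f))"
    using rho_ST(1)[OF A.wsubst_words[OF w f']] A.s_ST(1)[OF w f] by simp
  show "Target (hcomp (pw X l) Y (ss B l w f) (idn (pw X l) (pw Y l) (powF X l H)))
    = Target (substN X k l f (rho M w))"
    using powF_substF[OF A_cat fun_functor f] rho_ST(2)[OF w] B.s_ST(2)[OF w f] by simp
  note [simp] = At_hcomp_idn_right[OF _ powF_functor[OF A_cat fun_functor] B.s_nats[OF w f] B_cat]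
    At_hcomp_idn_left[OF _ A.s_nats[OF w f] fun_functor B_cat]
  show "(\<forall>x\<in>Ob (pw X l). Comp Y
          (At (hcomp (pw X l) Y (ss B l w f) (idn (pw X l) (pw Y l) (powF X l H))) x)
          (At (rho M (wsubst T k l f w)) x)
        = Comp Y (At (substN X k l f (rho M w)) x)
            (At (hcomp (pw X l) Y (idn X Y H) (ss A l w f)) x))
    \<longleftrightarrow> (\<forall>x\<in>Ob (pw X l).
      Comp Y (At (ss B l w f) (\<lambda>i\<in>{..<l}. FO H (x i))) (At (rho M (wsubst T k l f w)) x)
      = Comp Y (At (rho M w) (compose {..<k} x f)) (FA H (At (ss A l w f) x)))"
    by (simp add: At_substN FO_powF)
qed

text \<open>The laws get names at a single object because a proof for one morphism quotes the law of
  another at a particular object.\<close>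

definition gamma_law where
  "gamma_law k n w ws x \<longleftrightarrow>
    Comp Y (At (cc B w ws) (\<lambda>i\<in>{..<offset n k}. FO H (x i))) (At (rho M (wgamma T k n w ws)) x)
      = Comp Y (FA (Phi B w) (\<lambda>i\<in>{..<k}. At (rho M (ws i)) (blk n i x)))
        (Comp Y (At (rho M w) (\<lambda>i\<in>{..<k}. FO (Phi A (ws i)) (blk n i x)))
          (FA H (At (cc A w ws) x)))"

definition unit_law where
  "unit_law x \<longleftrightarrow> Comp Y (At (II B) (\<lambda>i\<in>{..<1}. FO H (x i))) (At (rho M (wunit T)) x)
      = FA H (At (II A) x)"

definition subst_law where
  "subst_law k l w f x \<longleftrightarrow>
    Comp Y (At (ss B l w f) (\<lambda>i\<in>{..<l}. FO H (x i))) (At (rho M (wsubst T k l f w)) x)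
      = Comp Y (At (rho M w) (compose {..<k} x f)) (FA H (At (ss A l w f) x))"

lemma psmors_iff:
  "M \<in> psmors T A B \<longleftrightarrow>
    (\<forall>k n. \<forall>w\<in>words T k. \<forall>ws\<in>(\<Pi>\<^sub>E i\<in>{..<k}. words T (n i)). \<forall>x\<in>Ob (pw X (offset n k)).
      gamma_law k n w ws x) \<and>
    (\<forall>x\<in>Ob (pw X 1). unit_law x) \<and>
    (\<forall>k l. \<forall>w\<in>words T k. \<forall>f\<in>{..<k} \<rightarrow>\<^sub>E {..<l}. \<forall>x\<in>Ob (pw X l). subst_law k l w f x)"
  unfolding psmors_def mem_Collect_eq Let_def gamma_law_def unit_law_def subst_law_def unit_iff
  by (simp add: gamma_iff subst_iff fun_functor rho_ext rho_iso del: One_nat_def cong: ball_cong)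

end

lemma psmors_data:
  assumes "is_theory T" "is_psalg T A" "is_psalg T B" "M \<in> psmors T A B"
  shows "morphism_data T A B M"
proof (intro morphism_data.intro morphism_data_axioms.intro is_psalg_data assms)
  note M = assms(4)[unfolded psmors_def Let_def mem_Collect_eq]
  show "fun_of M \<in> functors (car A) (car B)" "rho M \<in> extensional (\<Union>n. words T n)"
    by (rule M[THEN conjunct1], rule M[THEN conjunct2, THEN conjunct1])
  show "rho M w \<in> nat_isos (pw (car A) n) (car B) (fcomp (pw (car A) n) (fun_of M) (Phi A w))
      (fcomp (pw (car A) n) (Phi B w) (powF (car A) n (fun_of M)))" if "w \<in> words T n" for w n
    using M[THEN conjunct2, THEN conjunct2, THEN conjunct1] that by blast
qed

section \<open>Pasting of commuting diagrams\<close>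

context category
begin

lemma Comp_cong_left:
  assumes "f \<in> hom C a b" "g \<in> hom C b d" "h \<in> hom C d e" "k \<in> hom C b d'" "l \<in> hom C d' e"
    and "Comp C h g = Comp C l k"
  shows "Comp C h (Comp C g f) = Comp C l (Comp C k f)"
  using Comp_assoc[OF assms(1-3)] Comp_assoc[OF assms(1,4,5)] assms(6) by simp

lemma paste:
  assumes "f \<in> hom C a b" "g \<in> hom C b c" "f' \<in> hom C a' b'" "g' \<in> hom C b' c'"
    and "u \<in> hom C a a'" "v \<in> hom C b b'" "w \<in> hom C c c'"
    and "Comp C v f = Comp C f' u" "Comp C w g = Comp C g' v"
  shows "Comp C w (Comp C g f) = Comp C (Comp C g' f') u"
  using Comp_assoc[OF assms(1,2,7)] Comp_assoc[OF assms(1,6,4)] Comp_assoc[OF assms(5,3,4)]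
      assms(8,9)
  by simp

text \<open>The diagram behind the composition law of a composite \<open>M\<close> after
  \<open>L\<close>: hypothesis \<open>1\<close> becomes the law of \<open>M\<close>, hypothesis
  \<open>2\<close> the image under \<open>M\<close> of the law of \<open>L\<close>, and hypothesis
  \<open>3\<close> the naturality of \<open>rho M\<close> at the components of
  \<open>rho L\<close>.\<close>

lemma paste_gamma:
  assumes q: "q \<in> hom C o0 o1" and p: "p \<in> hom C o1 o2" and a: "a \<in> hom C o2 o5"
    and s: "s \<in> hom C o1 o3" and r: "r \<in> hom C o3 o4" and b: "b \<in> hom C o4 o5"
    and z: "z \<in> hom C o0 o6" and v: "v \<in> hom C o6 o7" and t: "t \<in> hom C o7 o3"
    and e: "e \<in> hom C o7 o8" and d: "d \<in> hom C o8 o4"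
    and 1: "Comp C a p = Comp C b (Comp C r s)" and 2: "Comp C s q = Comp C t (Comp C v z)"
    and 3: "Comp C r t = Comp C d e"
  shows "Comp C a (Comp C p q) = Comp C (Comp C b d) (Comp C (Comp C e v) z)"
proof -
  have "Comp C a (Comp C p q) = Comp C (Comp C b (Comp C r s)) q"
    using Comp_assoc[OF q p a] 1 by simp
  also have "\<dots> = Comp C b (Comp C r (Comp C s q))"
    using Comp_assoc[OF q Comp_hom[OF s r] b] Comp_assoc[OF q s r] by simp
  also have "\<dots> = Comp C b (Comp C (Comp C d e) (Comp C v z))"
    using Comp_assoc[OF Comp_hom[OF z v] t r] 2 3 by simp
  also have "\<dots> = Comp C b (Comp C d (Comp C (Comp C e v) z))"
    using Comp_assoc[OF Comp_hom[OF z v] e d] Comp_assoc[OF z v e] by simp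
  also have "\<dots> = Comp C (Comp C b d) (Comp C (Comp C e v) z)"
    using Comp_assoc[OF Comp_hom[OF z Comp_hom[OF v e]] d b] by simp
  finally show ?thesis .
qed

end

lemma blk_map_fun:
  "i < k \<Longrightarrow> blk n i (\<lambda>q\<in>{..<offset n k}. h (x q)) = (\<lambda>j\<in>{..<n i}. h (blk n i x j))"
  by (simp add: blk_restrict_offset blk_apply cong: restrict_cong)

context algebra_data
begin

lemma Phi_Comp:
  assumes "w \<in> words T k" "u \<in> hom (pw X k) x y" "v \<in> hom (pw X k) y z"
  shows "FA (\<Phi> w) (\<lambda>i\<in>{..<k}. Comp X (v i) (u i)) = Comp X (FA (\<Phi> w) v) (FA (\<Phi> w) u)"
  using functorsD(6)[OF Phi_functor[OF assms(1)] assms(2,3)] by simp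

lemma Phi_Id:
  assumes "w \<in> words T k" "x \<in> Ob (pw X k)"
  shows "FA (\<Phi> w) (\<lambda>i\<in>{..<k}. Id X (x i)) = Id X (FO (\<Phi> w) x)"
  using functorsD(5)[OF Phi_functor[OF assms(1)] assms(2)] by simp

lemma c_isos:
  assumes "w \<in> words T k" "ws \<in> (\<Pi>\<^sub>E i\<in>{..<k}. words T (n i))" "x \<in> Ob (pw X (offset n k))"
  shows "At (c w ws) x \<in> isos X (FO (\<Phi> (wgamma T k n w ws)) x)
    (FO (\<Phi> w) (\<lambda>i\<in>{..<k}. FO (\<Phi> (ws i)) (blk n i x)))"
  using nat_isosD(2)[OF c_iso[OF assms(1,2)] assms(3)] by (simp add: FO_gammaF assms)

lemma s_isos:
  assumes "w \<in> words T k" "f \<in> {..<k} \<rightarrow>\<^sub>E {..<l}" "x \<in> Ob (pw X l)"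
  shows "At (s l w f) x \<in> isos X (FO (\<Phi> (wsubst T k l f w)) x) (FO (\<Phi> w) (compose {..<k} x f))"
  using nat_isosD(2)[OF s_iso[OF assms(1,2)] assms(3)] by (simp add: FO_substF assms)

lemma I_isos: "x \<in> Ob (pw X 1) \<Longrightarrow> At I x \<in> isos X (FO (\<Phi> (wunit T)) x) (x 0)"
  using nat_isosD(2)[OF I_iso] by (simp add: FO_unitF del: One_nat_def)

lemmas c_hom = isos_hom[OF c_isos]
lemmas s_hom = isos_hom[OF s_isos]
lemmas I_hom = isos_hom[OF I_isos]

lemma c_natural:
  assumes "w \<in> words T k" "ws \<in> (\<Pi>\<^sub>E i\<in>{..<k}. words T (n i))" "u \<in> hom (pw X (offset n k)) x y"
  shows "Comp X (At (c w ws) y) (FA (\<Phi> (wgamma T k n w ws)) u)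
    = Comp X (FA (\<Phi> w) (\<lambda>i\<in>{..<k}. FA (\<Phi> (ws i)) (blk n i u))) (At (c w ws) x)"
  using natsD(7)[OF c_nats[OF assms(1,2)] assms(3)] homD(1)[OF assms(3)] by (simp add: FA_gammaF)

lemma s_natural:
  assumes "w \<in> words T k" "f \<in> {..<k} \<rightarrow>\<^sub>E {..<l}" "u \<in> hom (pw X l) x y"
  shows "Comp X (At (s l w f) y) (FA (\<Phi> (wsubst T k l f w)) u)
    = Comp X (FA (\<Phi> w) (compose {..<k} u f)) (At (s l w f) x)"
  using natsD(7)[OF s_nats[OF assms(1,2)] assms(3)] homD(1)[OF assms(3)] by (simp add: FA_substF)

lemma I_natural:
  assumes "u \<in> hom (pw X 1) x y"
  shows "Comp X (At I y) (FA (\<Phi> (wunit T)) u) = Comp X (u 0) (At I x)"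
  using natsD(7)[OF I_nats assms] homD(1)[OF assms] by (simp add: FA_unitF del: One_nat_def)

lemma words_Phi_Ob:
  assumes ws: "ws \<in> (\<Pi>\<^sub>E i\<in>{..<k}. words T (n i))" and x: "x \<in> Ob (pw X (offset n k))"
  shows "(\<lambda>i\<in>{..<k}. FO (\<Phi> (ws i)) (blk n i x)) \<in> Ob (pw X k)"
  using functorsD(3)[OF Phi_functor[OF PiE_words[OF ws]] blk_pw(1)[OF _ x]] by (auto simp: pw_simps)

end

lemma Dom_words: "w \<in> words T n \<Longrightarrow> Dom T w = n"
  by (simp add: words_def homD)

lemma powF_fcomp:
  assumes "category X" "G \<in> functors X Y"
  shows "powF X n (fcomp X H G) = fcomp (pw X n) (powF Y n H) (powF X n G)"
proof (rule ftor_ext_eqI)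
  show "FO (powF X n (fcomp X H G)) \<in> extensional (Ob (pw X n))"
    "FA (powF X n (fcomp X H G)) \<in> extensional (Arr (pw X n))"
    by (simp_all add: powF_def)
  show "FO (powF X n (fcomp X H G)) x = FO (fcomp (pw X n) (powF Y n H) (powF X n G)) x"
    if x: "x \<in> Ob (pw X n)" for x
  proof -
    have "x i \<in> Ob X" if "i < n" for i using x that by (auto simp: pw_simps)
    then show ?thesis
      using x functorsD(3)[OF powF_functor[OF assms] x]
      by (simp add: FO_powF FO_fcomp cong: restrict_cong)
  qed
  show "FA (powF X n (fcomp X H G)) x = FA (fcomp (pw X n) (powF Y n H) (powF X n G)) x"
    if x: "x \<in> Arr (pw X n)" for x
  proof -
    have "x i \<in> Arr X" if "i < n" for i using x that by (auto simp: pw_simps)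
    then show ?thesis
      using x homD(1)[OF functorsD(4)[OF powF_functor[OF assms] Arr_hom[OF x]]]
      by (simp add: FA_powF FA_fcomp cong: restrict_cong)
  qed
qed simp_all

text \<open>The source and target of \<open>rho M w\<close> are determined by the functor and the
  two algebra structures, so only its components are left to compare.\<close>

lemma psmor_eqI:
  assumes T: "is_theory T" and A: "is_psalg T A" and B: "is_psalg T B"
    and M: "M \<in> psmors T A B" and N: "N \<in> psmors T A B" and f: "fun_of M = fun_of N"
    and r: "\<And>n w x. \<lbrakk>w \<in> words T n; x \<in> Ob (pw (car A) n)\<rbrakk> \<Longrightarrow> At (rho M w) x = At (rho N w) x"
  shows "M = N"
proof (rule psmor.equality)
  interpret M: morphism_data T A B M by (rule psmors_data[OF T A B M])
  interpret N: morphism_data T A B N by (rule psmors_data[OF T A B N])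
  show "rho M = rho N"
  proof (rule extensionalityI[OF M.rho_ext N.rho_ext])
    fix w assume "w \<in> (\<Union>n. words T n)"
    then obtain n where w: "w \<in> words T n" by blast
    show "rho M w = rho N w"
      using M.rho_ST[OF w] N.rho_ST[OF w] natsD(5)[OF M.rho_nats[OF w]]
          natsD(5)[OF N.rho_nats[OF w]]
        r[OF w] f by (intro trans_eqI) simp_all
  qed
qed (use f in simp_all)

section \<open>Composition of morphisms of pseudo algebras\<close>

locale morphism_comp = L: morphism_data T A B L + M: morphism_data T B C M
  for T :: "'t theory_data" and A B C :: "('t, 'o, 'm) psalg" and L M
begin

abbreviation "N \<equiv> psmor_comp T A B C M L"

lemma fun_comp: "fun_of N = fcomp L.X M.H L.H"
  by (simp add: psmor_comp_def Let_def)

lemma rho_comp: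
  assumes w: "w \<in> words T n"
  shows "rho N w = vcomp (pw L.X n) M.Y
    (hcomp (pw L.X n) M.Y (rho M w) (idn (pw L.X n) (pw L.Y n) (powF L.X n L.H)))
    (hcomp (pw L.X n) M.Y (idn L.Y M.Y M.H) (rho L w))"
proof -
  have "w \<in> (\<Union>n. words T n)" using w by blast
  then show ?thesis by (simp add: psmor_comp_def Let_def Dom_words[OF w])
qed

lemma At_rho_comp:
  assumes w: "w \<in> words T n" and x: "x \<in> Ob (pw L.X n)"
  shows "At (rho N w) x = Comp M.Y (At (rho M w) (\<lambda>i\<in>{..<n}. FO L.H (x i)))
      (FA M.H (At (rho L w) x))"
  using x At_hcomp_idn_right[OF x powF_functor[OF L.A_cat L.fun_functor] M.rho_nats[OF w] M.B_cat]
    At_hcomp_idn_left[OF x L.rho_nats[OF w] M.fun_functor M.B_cat]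
  by (simp add: rho_comp[OF w] At_vcomp FO_powF)

lemma comp_data: "morphism_data T A C N"
proof (intro morphism_data.intro morphism_data_axioms.intro L.A.algebra_data_axioms
    M.B.algebra_data_axioms)
  show "fun_of N \<in> functors L.X M.Y"
    unfolding fun_comp by (rule fcomp_functor[OF L.fun_functor M.fun_functor L.A_cat])
  show "rho N \<in> extensional (\<Union>n. words T n)"
    by (simp add: psmor_comp_def Let_def)
  fix w n assume w: "w \<in> words T n"
  note pX = pw_category[OF L.A_cat, of n] and pY = pw_category[OF L.B_cat, of n]
  note pG = powF_functor[OF L.A_cat L.fun_functor, of n]
  have 1: "hcomp (pw L.X n) M.Y (idn L.Y M.Y M.H) (rho L w) \<in> nat_isos (pw L.X n) M.Y
      (fcomp (pw L.X n) M.H (fcomp (pw L.X n) L.H (Phi A w)))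
      (fcomp (pw L.X n) M.H (fcomp (pw L.X n) (Phi B w) (powF L.X n L.H)))"
    by (rule hcomp_nat_isos[OF L.rho_iso[OF w] idn_nat_isos[OF M.fun_functor M.A_cat M.B_cat] pX
        M.A_cat M.B_cat])
  have 2: "hcomp (pw L.X n) M.Y (rho M w) (idn (pw L.X n) (pw L.Y n) (powF L.X n L.H))
      \<in> nat_isos (pw L.X n) M.Y
      (fcomp (pw L.X n) (fcomp (pw L.Y n) M.H (Phi B w)) (powF L.X n L.H))
      (fcomp (pw L.X n) (fcomp (pw L.Y n) (Phi C w) (powF L.Y n M.H)) (powF L.X n L.H))"
    by (rule hcomp_nat_isos[OF idn_nat_isos[OF pG pX pY] M.rho_iso[OF w] pX pY M.B_cat])
  \<comment> \<open>Functors are compared by equality, so reassociation must be explicit: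
    \<open>a\<close> makes the two factors composable, while \<open>b\<close> and \<open>c\<close>
    bring the outer ends into the form prescribed for the composite functor.\<close>
  have a: "fcomp (pw L.X n) (fcomp (pw L.Y n) M.H (Phi B w)) (powF L.X n L.H)
    = fcomp (pw L.X n) M.H (fcomp (pw L.X n) (Phi B w) (powF L.X n L.H))"
    by (rule fcomp_assoc[OF pG])
  have b: "fcomp (pw L.X n) (fcomp (pw L.Y n) (Phi C w) (powF L.Y n M.H)) (powF L.X n L.H)
    = fcomp (pw L.X n) (Phi C w) (powF L.X n (fcomp L.X M.H L.H))"
    unfolding powF_fcomp[OF L.A_cat L.fun_functor] by (rule fcomp_assoc[OF pG])
  have c: "fcomp (pw L.X n) M.H (fcomp (pw L.X n) L.H (Phi A w))
      = fcomp (pw L.X n) (fcomp L.X M.H L.H) (Phi A w)"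
    by (rule fcomp_assoc[OF L.A.Phi_functor[OF w], symmetric])
  show "rho N w \<in> nat_isos (pw L.X n) M.Y (fcomp (pw L.X n) (fun_of N) (Phi A w))
      (fcomp (pw L.X n) (Phi C w) (powF L.X n (fun_of N)))"
    unfolding rho_comp[OF w] fun_comp b[symmetric] c[symmetric]
    by (rule vcomp_nat_isos[OF 1 2[unfolded a] pX M.B_cat])
qed

sublocale N: morphism_data T A C N by (rule comp_data)

lemma comp_psmors:
  assumes L: "L \<in> psmors T A B" and M: "M \<in> psmors T B C"
  shows "N \<in> psmors T A C"
  unfolding N.psmors_iff
proof (intro conjI allI ballI)
  note L' = L[unfolded L.psmors_iff] and M' = M[unfolded M.psmors_iff]
  have FO_comp: "FO N.H x = FO M.H (FO L.H x)" if "x \<in> Ob L.X" for x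
    using that by (simp add: fun_comp FO_fcomp)
  have FA_comp: "FA N.H x = FA M.H (FA L.H x)" if "x \<in> hom L.X a b" for x a b
    using homD(1)[OF that] by (simp add: fun_comp FA_fcomp)
  have pw_comp: "(\<lambda>i\<in>{..<n}. FO M.H ((\<lambda>i\<in>{..<n}. FO L.H (x i)) i)) = (\<lambda>i\<in>{..<n}. FO N.H (x i))"
    if "x \<in> Ob (pw L.X n)" for x n
  proof (rule restrict_ext)
    fix i assume i: "i \<in> {..<n}"
    then have "x i \<in> Ob L.X" using that by (auto simp: pw_simps(1))
    then show "FO M.H ((\<lambda>i\<in>{..<n}. FO L.H (x i)) i) = FO N.H (x i)"
      using i FO_comp by simp
  qed
  {
    fix k n w ws x
    assume w: "w \<in> words T k" and ws: "ws \<in> (\<Pi>\<^sub>E i\<in>{..<k}. words T (n i))"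
      and x: "x \<in> Ob (pw L.X (offset n k))"
    let ?N = "offset n k" let ?\<gamma> = "wgamma T k n w ws"
    note ws' = L.A.PiE_words[OF ws]
    note g = L.A.wgamma_words[of w k ws n, OF w ws']
    note bx = blk_pw(1)[OF _ x]
    define y where "y = (\<lambda>i\<in>{..<?N}. FO L.H (x i))"
    have y: "y \<in> Ob (pw L.Y ?N)" using L.pow_Ob[OF x] by (simp add: y_def)
    have yb: "blk n i y = (\<lambda>j\<in>{..<n i}. FO L.H (blk n i x j))" if "i < k" for i
      unfolding y_def by (rule blk_map_fun[OF that])
    define z where "z = (\<lambda>i\<in>{..<k}. FO (Phi A (ws i)) (blk n i x))"
    have z: "z \<in> Ob (pw L.X k)" unfolding z_def by (rule L.A.words_Phi_Ob[OF ws x])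
    define u where "u = (\<lambda>i\<in>{..<k}. At (rho L (ws i)) (blk n i x))"
    have u: "u \<in> hom (pw L.Y k) (\<lambda>i\<in>{..<k}. FO L.H (z i))
        (\<lambda>i\<in>{..<k}. FO (Phi B (ws i)) (blk n i y))"
      using L.rho_hom[OF ws' bx] by (simp add: hom_pw u_def z_def yb)
    define v where "v = (\<lambda>i\<in>{..<k}. At (rho M (ws i)) (blk n i y))"
    have yb': "blk n i y \<in> Ob (pw L.Y (n i))" if "i < k" for i by (rule blk_pw(1)[OF that y])
    have bh: "blk n i (\<lambda>q\<in>{..<?N}. FO M.H (y q)) = (\<lambda>j\<in>{..<n i}. FO M.H (blk n i y j))" if "i < k"
        for i
      by (rule blk_map_fun[OF that])
    have v: "v \<in> hom (pw M.Y k) (\<lambda>i\<in>{..<k}. FO M.H (FO (Phi B (ws i)) (blk n i y)))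
        (\<lambda>i\<in>{..<k}. FO (Phi C (ws i)) (blk n i (\<lambda>q\<in>{..<?N}. FO M.H (y q))))"
      using M.rho_hom[OF ws' yb'] by (simp add: hom_pw v_def bh)
    have mu: "(\<lambda>i\<in>{..<k}. FA M.H (u i)) \<in> hom (pw M.Y k) (\<lambda>i\<in>{..<k}. FO M.H (FO L.H (z i)))
        (\<lambda>i\<in>{..<k}. FO M.H (FO (Phi B (ws i)) (blk n i y)))"
      using u functorsD(4)[OF M.fun_functor] by (simp add: hom_pw)
    have zB: "(\<lambda>i\<in>{..<k}. FO (Phi B (ws i)) (blk n i y)) \<in> Ob (pw L.Y k)"
      by (rule L.B.words_Phi_Ob[OF ws y])
    have r1: "At (rho N (ws i)) (blk n i x) = Comp M.Y (v i) (FA M.H (u i))" if "i < k" for i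
      using that At_rho_comp[OF ws'[OF that] bx[OF that]] by (simp add: v_def u_def yb)
    have e1: "Comp M.Y (At (cc C w ws) (\<lambda>i\<in>{..<?N}. FO M.H (y i))) (At (rho M ?\<gamma>) y)
      = Comp M.Y (FA (Phi C w) v) (Comp M.Y (At (rho M w)
          (\<lambda>i\<in>{..<k}. FO (Phi B (ws i)) (blk n i y)))
          (FA M.H (At (cc B w ws) y)))"
      using M' w ws y by (auto simp: M.gamma_law_def v_def)
    have "Comp L.Y (At (cc B w ws) y) (At (rho L ?\<gamma>) x)
      = Comp L.Y (FA (Phi B w) u) (Comp L.Y (At (rho L w) z) (FA L.H (At (cc A w ws) x)))"
      using L' w ws x by (auto simp: L.gamma_law_def y_def u_def z_def)
    moreover
    have h1: "At (rho L ?\<gamma>) x \<in> hom L.Y (FO L.H (FO (Phi A ?\<gamma>) x)) (FO (Phi B ?\<gamma>) y)"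
      using L.rho_hom[OF g x] by (simp add: y_def)
    moreover have h2: "At (cc B w ws) y \<in> hom L.Y (FO (Phi B ?\<gamma>) y)
        (FO (Phi B w) (\<lambda>i\<in>{..<k}. FO (Phi B (ws i)) (blk n i y)))"
      by (rule L.B.c_hom[OF w ws y])
    moreover have h3: "FA L.H (At (cc A w ws) x)
        \<in> hom L.Y (FO L.H (FO (Phi A ?\<gamma>) x)) (FO L.H (FO (Phi A w) z))"
      using functorsD(4)[OF L.fun_functor L.A.c_hom[OF w ws x]] by (simp add: z_def)
    moreover have h4: "At (rho L w) z \<in> hom L.Y (FO L.H (FO (Phi A w) z))
        (FO (Phi B w) (\<lambda>i\<in>{..<k}. FO L.H (z i)))"
      by (rule L.rho_hom[OF w z])
    moreover note h5 = functorsD(4)[OF L.B.Phi_functor[OF w] u]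
    \<comment> \<open>The composition law of \<open>L\<close>, with the functor of \<open>M\<close>
      applied to it and distributed over the composites.\<close>
    ultimately have e2: "Comp M.Y (FA M.H (At (cc B w ws) y)) (FA M.H (At (rho L ?\<gamma>) x))
      = Comp M.Y (FA M.H (FA (Phi B w) u)) (Comp M.Y (FA M.H (At (rho L w) z))
          (FA M.H (FA L.H (At (cc A w ws) x))))"
      using functorsD(6)[OF M.fun_functor h1 h2]
          functorsD(6)[OF M.fun_functor L.B.X.Comp_hom[OF h3 h4] h5]
        functorsD(6)[OF M.fun_functor h3 h4] by simp
    note e3 = M.rho_natural[OF w u]
    have mh: "FA M.H f \<in> hom M.Y (FO M.H a) (FO M.H b)" if "f \<in> hom L.Y a b" for f a b
      using functorsD(4)[OF M.fun_functor that] .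
    have HC: "(\<lambda>i\<in>{..<k}. FO M.H ((\<lambda>i\<in>{..<k}. FO (Phi B (ws i)) (blk n i y)) i))
      = (\<lambda>i\<in>{..<k}. FO M.H (FO (Phi B (ws i)) (blk n i y)))" by auto
    have HC2: "(\<lambda>i\<in>{..<k}. FO M.H ((\<lambda>i\<in>{..<k}. FO L.H (z i)) i))
        = (\<lambda>i\<in>{..<k}. FO M.H (FO L.H (z i)))"
      by auto
    have "Comp M.Y (At (cc C w ws) (\<lambda>i\<in>{..<?N}. FO M.H (y i)))
        (Comp M.Y (At (rho M ?\<gamma>) y) (FA M.H (At (rho L ?\<gamma>) x)))
      = Comp M.Y (Comp M.Y (FA (Phi C w) v) (FA (Phi C w) (\<lambda>i\<in>{..<k}. FA M.H (u i))))
        (Comp M.Y (Comp M.Y (At (rho M w) (\<lambda>i\<in>{..<k}. FO L.H (z i))) (FA M.H (At (rho L w) z)))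
          (FA M.H (FA L.H (At (cc A w ws) x))))"
      by (rule M.B.X.paste_gamma[OF mh[OF h1] M.rho_hom[OF g y] M.B.c_hom[OF w ws M.pow_Ob[OF y]]
            mh[OF h2] M.rho_hom[OF w zB, unfolded HC] functorsD(4)[OF M.B.Phi_functor[OF w] v]
            mh[OF h3] mh[OF h4] mh[OF h5] M.rho_hom[OF w L.pow_Ob[OF z], unfolded HC2]
            functorsD(4)[OF M.B.Phi_functor[OF w] mu] e1 e2 e3])
    moreover have "FA (Phi C w) (\<lambda>i\<in>{..<k}. At (rho N (ws i)) (blk n i x))
      = Comp M.Y (FA (Phi C w) v) (FA (Phi C w) (\<lambda>i\<in>{..<k}. FA M.H (u i)))"
      using M.B.Phi_Comp[OF w mu v] r1 by (simp cong: restrict_cong)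
    moreover have "(\<lambda>i\<in>{..<?N}. FO M.H (y i)) = (\<lambda>i\<in>{..<?N}. FO N.H (x i))"
      using pw_comp[OF x] by (simp add: y_def)
    ultimately show "N.gamma_law k n w ws x"
      using At_rho_comp[OF g x] At_rho_comp[OF w z] FA_comp[OF L.A.c_hom[OF w ws x]]
      by (simp add: N.gamma_law_def y_def[symmetric] z_def[symmetric])
  }
  {
    fix x assume x: "x \<in> Ob (pw L.X 1)"
    note u1 = L.A.wunit_words
    define y where "y = (\<lambda>i\<in>{..<1}. FO L.H (x i))"
    have y: "y \<in> Ob (pw L.Y 1)" unfolding y_def by (rule L.pow_Ob[OF x])
    note h1 = M.rho_hom[OF u1 y] and h0 = L.rho_hom[OF u1 x, folded y_def]
    note h2 = M.B.I_hom[OF M.pow_Ob[OF y]] and h3 = L.B.I_hom[OF y]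
    have e1: "Comp M.Y (At (II C) (\<lambda>i\<in>{..<1}. FO M.H (y i))) (At (rho M (wunit T)) y)
        = FA M.H (At (II B) y)"
      using M' y by (auto simp: M.unit_law_def simp del: One_nat_def)
    have e2: "Comp L.Y (At (II B) y) (At (rho L (wunit T)) x) = FA L.H (At (II A) x)"
      using L' x by (auto simp: L.unit_law_def y_def simp del: One_nat_def)
    \<comment> \<open>\<open>e1\<close> trades \<open>II C\<close> for the image of
      \<open>II B\<close>, and the image of \<open>e2\<close> then absorbs
      \<open>rho L\<close>.\<close>
    have "Comp M.Y (At (II C) (\<lambda>i\<in>{..<1}. FO M.H (y i)))
        (Comp M.Y (At (rho M (wunit T)) y) (FA M.H (At (rho L (wunit T)) x)))
      = FA M.H (FA L.H (At (II A) x))"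
      using M.B.X.Comp_assoc[OF functorsD(4)[OF M.fun_functor h0] h1 h2] e1 e2
        functorsD(6)[OF M.fun_functor h0 h3] by simp
    then show "N.unit_law x"
      using At_rho_comp[OF u1 x] FA_comp[OF L.A.I_hom[OF x]] pw_comp[OF x]
      by (simp add: N.unit_law_def y_def del: One_nat_def)
  }
  {
    fix k l w f x assume w: "w \<in> words T k" and f: "f \<in> {..<k} \<rightarrow>\<^sub>E {..<l}"
        and x: "x \<in> Ob (pw L.X l)"
    note f' = L.A.PiE_less[OF f]
    note wf = L.A.wsubst_words[of w k f l, OF w f']
    define y where "y = (\<lambda>i\<in>{..<l}. FO L.H (x i))"
    have y: "y \<in> Ob (pw L.Y l)" unfolding y_def by (rule L.pow_Ob[OF x])
    have yf: "compose {..<k} y f = (\<lambda>i\<in>{..<k}. FO L.H (compose {..<k} x f i))"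
      using f' by (auto simp: compose_def y_def)
    note xf = compose_pw(1)[of k f l, OF f' x] and yf' = compose_pw(1)[of k f l, OF f' y]
    note h0 = L.rho_hom[OF wf x, folded y_def] and h1 = M.rho_hom[OF wf y]
    note h2 = M.B.s_hom[OF w f M.pow_Ob[OF y]] and h3 = L.B.s_hom[OF w f y]
    note h4 = M.rho_hom[OF w yf'] and h5 = L.rho_hom[OF w xf, folded yf]
    note h6 = functorsD(4)[OF L.fun_functor L.A.s_hom[OF w f x]]
    have My: "compose {..<k} (\<lambda>i\<in>{..<l}. FO M.H (y i)) f
        = (\<lambda>i\<in>{..<k}. FO M.H (compose {..<k} y f i))"
      using f' by (auto simp: compose_def)
    note mh = functorsD(4)[OF M.fun_functor]
    have e1: "Comp M.Y (At (ss C l w f) (\<lambda>i\<in>{..<l}. FO M.H (y i))) (At (rho M (wsubst T k l f w)) y)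
      = Comp M.Y (At (rho M w) (compose {..<k} y f)) (FA M.H (At (ss B l w f) y))"
      using M' w f y by (auto simp: M.subst_law_def)
    have "Comp L.Y (At (ss B l w f) y) (At (rho L (wsubst T k l f w)) x)
      = Comp L.Y (At (rho L w) (compose {..<k} x f)) (FA L.H (At (ss A l w f) x))"
      using L' w f x by (auto simp: L.subst_law_def y_def)
    then have e2: "Comp M.Y (FA M.H (At (ss B l w f) y)) (FA M.H (At (rho L (wsubst T k l f w)) x))
      = Comp M.Y (FA M.H (At (rho L w) (compose {..<k} x f))) (FA M.H (FA L.H (At (ss A l w f) x)))"
      using functorsD(6)[OF M.fun_functor h0 h3] functorsD(6)[OF M.fun_functor h6 h5] by simp
    \<comment> \<open>Two squares are placed side by side: the image under \<open>M\<close> of the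
      substitution law of \<open>L\<close>, and the substitution law of \<open>M\<close>.\<close>
    have "Comp M.Y (At (ss C l w f) (\<lambda>i\<in>{..<l}. FO M.H (y i)))
        (Comp M.Y (At (rho M (wsubst T k l f w)) y) (FA M.H (At (rho L (wsubst T k l f w)) x)))
      = Comp M.Y (Comp M.Y (At (rho M w) (compose {..<k} y f))
          (FA M.H (At (rho L w) (compose {..<k} x f))))
        (FA M.H (FA L.H (At (ss A l w f) x)))"
      by (rule M.B.X.paste[OF mh[OF h0] h1 mh[OF h5] h4 mh[OF h6] mh[OF h3] h2[unfolded My] e2 e1])
    then show "N.subst_law k l w f x"
      using At_rho_comp[OF wf x] At_rho_comp[OF w xf] FA_comp[OF L.A.s_hom[OF w f x]] pw_comp[OF x]
      by (simp add: N.subst_law_def y_def[symmetric] yf)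
  }
qed

end

section \<open>The 2-category of pseudo algebras\<close>

lemma under_simps[simp]:
  "At (under \<alpha>) = At \<alpha>" "Source (under \<alpha>) = fun_of (Source \<alpha>)"
      "Target (under \<alpha>) = fun_of (Target \<alpha>)"
  by (simp_all add: under_def)

lemma PsAlg_simps[simp]:
  "Obj (PsAlg U T) = {A. is_psalg T A \<and> small_cat U (car A)}"
  "Ob (Hom (PsAlg U T) A B) = psmors T A B" "Arr (Hom (PsAlg U T) A B) = pscells T A B"
  "Dom (Hom (PsAlg U T) A B) = Source" "Cod (Hom (PsAlg U T) A B) = Target"
  "Comp1 (PsAlg U T) = psmor_comp T" "One (PsAlg U T) = psmor_id T"
  "Source (Id (Hom (PsAlg U T) A B) M) = M" "Target (Id (Hom (PsAlg U T) A B) M) = M"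
  "Source (Comp (Hom (PsAlg U T) A B) \<beta> \<alpha>) = Source \<alpha>"
      "Target (Comp (Hom (PsAlg U T) A B) \<beta> \<alpha>) = Target \<beta>"
  "Source (Comp2 (PsAlg U T) A B C \<beta> \<alpha>) = psmor_comp T A B C (Source \<beta>) (Source \<alpha>)"
  "Target (Comp2 (PsAlg U T) A B C \<beta> \<alpha>) = psmor_comp T A B C (Target \<beta>) (Target \<alpha>)"
  by (simp_all add: PsAlg_def)

lemma PsAlg_At_ext[simp]:
  "At (Id (Hom (PsAlg U T) A B) M) \<in> extensional (Ob (car A))"
  "At (Comp (Hom (PsAlg U T) A B) \<beta> \<alpha>) \<in> extensional (Ob (car A))"
  "At (Comp2 (PsAlg U T) A B C \<beta> \<alpha>) \<in> extensional (Ob (car A))"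
  by (simp_all add: PsAlg_def)

lemma At_Id: "x \<in> Ob (car A) \<Longrightarrow> At (Id (Hom (PsAlg U T) A B) M) x = Id (car B) (FO (fun_of M) x)"
  and At_Comp: "x \<in> Ob (car A) \<Longrightarrow>
    At (Comp (Hom (PsAlg U T) A B) \<beta> \<alpha>) x = Comp (car B) (At \<beta> x) (At \<alpha> x)"
  by (simp_all add: PsAlg_def At_idn At_vcomp)

lemma under_Id: "under (Id (Hom (PsAlg U T) A B) M) = idn (car A) (car B) (fun_of M)"
  by (simp add: under_def PsAlg_def idn_def)

lemma under_Comp: "under (Comp (Hom (PsAlg U T) A B) \<beta> \<alpha>)
    = vcomp (car A) (car B) (under \<beta>) (under \<alpha>)"
  by (simp add: under_def PsAlg_def vcomp_def)

lemma under_Comp2: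
  "under (Comp2 (PsAlg U T) A B C \<beta> \<alpha>) = hcomp (car A) (car C) (under \<beta>) (under \<alpha>)"
  by (simp add: under_def PsAlg_def hcomp_def psmor_comp_def Let_def)

lemma hom_PsAlg: "\<alpha> \<in> hom (Hom (PsAlg U T) A B) M N \<longleftrightarrow> \<alpha> \<in> pscells T A B \<and> Source \<alpha> = M \<and> Target \<alpha>
    = N"
  by (simp add: hom_def)

lemma pw_Ob_nth: "\<lbrakk>x \<in> Ob (pw X n); i < n\<rbrakk> \<Longrightarrow> x i \<in> Ob X"
  by (auto simp: pw_simps(1))

lemma pow_fid:
  assumes "x \<in> Ob (pw X n)"
  shows "(\<lambda>i\<in>{..<n}. FO (fid X) (x i)) = x"
proof (rule ext)
  show "(\<lambda>i\<in>{..<n}. FO (fid X) (x i)) i = x i" for i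
    using assms PiE_arb[of x "{..<n}" "\<lambda>_. Ob X" i]
    by (cases "i < n") (simp_all add: FO_fid pw_Ob_nth[OF assms] pw_simps(1))
qed

lemma psalg_category: "is_psalg T A \<Longrightarrow> category (car A)"
  by (simp add: is_psalg_def pseudo_algebra_def)

context is_theory
begin

lemma psmors_functor: "M \<in> psmors T A B \<Longrightarrow> fun_of M \<in> functors (car A) (car B)"
  by (simp add: psmors_def Let_def)

text \<open>The typing of \<open>rho\<close> already equates the endpoints of both sides of the
  2-cell law, so the law can be read off at single objects.\<close>

lemma pscells_iff:
  assumes A: "is_psalg T A" and B: "is_psalg T B"
  shows "\<alpha> \<in> pscells T A B \<longleftrightarrow> Source \<alpha> \<in> psmors T A B \<and> Target \<alpha> \<in> psmors T A B \<and>
    under \<alpha> \<in> nats (car A) (car B) (fun_of (Source \<alpha>)) (fun_of (Target \<alpha>)) \<and>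
    (\<forall>n. \<forall>w\<in>words T n. \<forall>x\<in>Ob (pw (car A) n).
      Comp (car B) (At (rho (Target \<alpha>) w) x) (At \<alpha> (FO (Phi A w) x))
      = Comp (car B) (FA (Phi B w) (\<lambda>i\<in>{..<n}. At \<alpha> (x i))) (At (rho (Source \<alpha>) w) x))"
proof -
  have "vcomp (pw (car A) n) (car B)
          (rho (Target \<alpha>) w) (hcomp (pw (car A) n) (car B) (under \<alpha>)
              (idn (pw (car A) n) (car A) (Phi A w)))
        = vcomp (pw (car A) n) (car B)
          (hcomp (pw (car A) n) (car B) (idn (pw (car B) n) (car B) (Phi B w))
              (powN (car A) n (under \<alpha>)))
          (rho (Source \<alpha>) w)
    \<longleftrightarrow> (\<forall>x\<in>Ob (pw (car A) n).
      Comp (car B) (At (rho (Target \<alpha>) w) x) (At \<alpha> (FO (Phi A w) x))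
      = Comp (car B) (FA (Phi B w) (\<lambda>i\<in>{..<n}. At \<alpha> (x i))) (At (rho (Source \<alpha>) w) x))"
    if S: "Source \<alpha> \<in> psmors T A B" and R: "Target \<alpha> \<in> psmors T A B"
      and a: "under \<alpha> \<in> nats (car A) (car B) (fun_of (Source \<alpha>)) (fun_of (Target \<alpha>))"
      and w: "w \<in> words T n" for n w
  proof (subst vcomp_eq_iff)
    interpret S: morphism_data T A B "Source \<alpha>" by (rule psmors_data[OF is_theory_axioms A B S])
    interpret R: morphism_data T A B "Target \<alpha>" by (rule psmors_data[OF is_theory_axioms A B R])
    show "Source (hcomp (pw (car A) n) (car B) (under \<alpha>) (idn (pw (car A) n) (car A) (Phi A w)))
        = Source (rho (Source \<alpha>) w)"
      using S.rho_ST(1)[OF w] by simp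
    show "Target (rho (Target \<alpha>) w)
      = Target (hcomp (pw (car A) n) (car B) (idn (pw (car B) n) (car B) (Phi B w))
          (powN (car A) n (under \<alpha>)))"
      using R.rho_ST(2)[OF w] by simp
    note [simp] = At_hcomp_idn_right[OF _ S.A.Phi_functor[OF w] a S.B_cat]
      At_hcomp_idn_left[OF _ powN_nats[OF S.A_cat a] S.B.Phi_functor[OF w] S.B_cat]
    show "(\<forall>x\<in>Ob (pw (car A) n). Comp (car B) (At (rho (Target \<alpha>) w) x)
          (At (hcomp (pw (car A) n) (car B) (under \<alpha>) (idn (pw (car A) n) (car A) (Phi A w))) x)
        = Comp (car B)
          (At (hcomp (pw (car A) n) (car B) (idn (pw (car B) n) (car B) (Phi B w))
              (powN (car A) n (under \<alpha>))) x)
          (At (rho (Source \<alpha>) w) x))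
    \<longleftrightarrow> (\<forall>x\<in>Ob (pw (car A) n).
      Comp (car B) (At (rho (Target \<alpha>) w) x) (At \<alpha> (FO (Phi A w) x))
      = Comp (car B) (FA (Phi B w) (\<lambda>i\<in>{..<n}. At \<alpha> (x i))) (At (rho (Source \<alpha>) w) x))"
      by (simp add: At_powN)
  qed
  then show ?thesis
    unfolding pscells_def Let_def mem_Collect_eq by blast
qed

context
  fixes A B :: "('t, 'u, 'u) psalg" and U :: "'u set set"
  assumes A: "is_psalg T A" and B: "is_psalg T B"
begin

lemma pscellsI:
  assumes "G \<in> psmors T A B" "H \<in> psmors T A B" "Source \<alpha> = G" "Target \<alpha> = H"
    and "At \<alpha> \<in> extensional (Ob (car A))"
    and "\<And>x. x \<in> Ob (car A) \<Longrightarrow> At \<alpha> x \<in> hom (car B) (FO (fun_of G) x) (FO (fun_of H) x)"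
    and "\<And>a b f. f \<in> hom (car A) a b \<Longrightarrow>
      Comp (car B) (At \<alpha> b) (FA (fun_of G) f) = Comp (car B) (FA (fun_of H) f) (At \<alpha> a)"
    and "\<And>n w x. \<lbrakk>w \<in> words T n; x \<in> Ob (pw (car A) n)\<rbrakk> \<Longrightarrow>
      Comp (car B) (At (rho H w) x) (At \<alpha> (FO (Phi A w) x))
      = Comp (car B) (FA (Phi B w) (\<lambda>i\<in>{..<n}. At \<alpha> (x i))) (At (rho G w) x)"
  shows "\<alpha> \<in> pscells T A B"
  unfolding pscells_iff[OF A B]
  using assms by (auto intro!: natsI psmors_functor)

lemma pscellsD:
  assumes "\<alpha> \<in> pscells T A B"
  shows "Source \<alpha> \<in> psmors T A B" "Target \<alpha> \<in> psmors T A B" "At \<alpha> \<in> extensional (Ob (car A))"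
    and "under \<alpha> \<in> nats (car A) (car B) (fun_of (Source \<alpha>)) (fun_of (Target \<alpha>))"
    and "x \<in> Ob (car A) \<Longrightarrow> At \<alpha> x \<in> hom (car B) (FO (fun_of (Source \<alpha>)) x)
        (FO (fun_of (Target \<alpha>)) x)"
    and "f \<in> hom (car A) a b \<Longrightarrow>
      Comp (car B) (At \<alpha> b) (FA (fun_of (Source \<alpha>)) f)
          = Comp (car B) (FA (fun_of (Target \<alpha>)) f) (At \<alpha> a)"
    and "\<lbrakk>w \<in> words T n; x' \<in> Ob (pw (car A) n)\<rbrakk> \<Longrightarrow>
      Comp (car B) (At (rho (Target \<alpha>) w) x') (At \<alpha> (FO (Phi A w) x'))
      = Comp (car B) (FA (Phi B w) (\<lambda>i\<in>{..<n}. At \<alpha> (x' i))) (At (rho (Source \<alpha>) w) x')"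
proof -
  note a = assms[unfolded pscells_iff[OF A B]]
  show "Source \<alpha> \<in> psmors T A B" "Target \<alpha> \<in> psmors T A B"
    and u: "under \<alpha> \<in> nats (car A) (car B) (fun_of (Source \<alpha>)) (fun_of (Target \<alpha>))"
    using a by simp_all
  show "At \<alpha> \<in> extensional (Ob (car A))"
    and "x \<in> Ob (car A) \<Longrightarrow> At \<alpha> x \<in> hom (car B) (FO (fun_of (Source \<alpha>)) x)
        (FO (fun_of (Target \<alpha>)) x)"
    and "f \<in> hom (car A) a b \<Longrightarrow>
      Comp (car B) (At \<alpha> b) (FA (fun_of (Source \<alpha>)) f)
          = Comp (car B) (FA (fun_of (Target \<alpha>)) f) (At \<alpha> a)"
    using natsD(5-7)[OF u] by simp_all
  show "\<lbrakk>w \<in> words T n; x' \<in> Ob (pw (car A) n)\<rbrakk> \<Longrightarrow>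
      Comp (car B) (At (rho (Target \<alpha>) w) x') (At \<alpha> (FO (Phi A w) x'))
      = Comp (car B) (FA (Phi B w) (\<lambda>i\<in>{..<n}. At \<alpha> (x' i))) (At (rho (Source \<alpha>) w) x')"
    using a by blast
qed

lemma At_pow_hom:
  assumes "\<alpha> \<in> pscells T A B" "x \<in> Ob (pw (car A) n)"
  shows "(\<lambda>i\<in>{..<n}. At \<alpha> (x i)) \<in> hom (pw (car B) n)
    (\<lambda>i\<in>{..<n}. FO (fun_of (Source \<alpha>)) (x i)) (\<lambda>i\<in>{..<n}. FO (fun_of (Target \<alpha>)) (x i))"
proof -
  have "x i \<in> Ob (car A)" if "i < n" for i using assms(2) that by (auto simp: pw_simps(1))
  then show ?thesis using pscellsD(5)[OF assms(1)] by (simp add: hom_pw)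
qed

lemma Id_cell:
  assumes M: "M \<in> psmors T A B"
  shows "Id (Hom (PsAlg U T) A B) M \<in> pscells T A B"
proof (rule pscellsI[OF M M])
  interpret M: morphism_data T A B M by (rule psmors_data[OF is_theory_axioms A B M])
  note n = idn_nats[OF M.fun_functor M.A_cat M.B_cat, folded under_Id[of U T]]
  show "At (Id (Hom (PsAlg U T) A B) M) x \<in> hom (car B) (FO (fun_of M) x) (FO (fun_of M) x)"
    if "x \<in> Ob (car A)" for x
    using natsD(6)[OF n that] by simp
  show "Comp (car B) (At (Id (Hom (PsAlg U T) A B) M) b) (FA (fun_of M) f)
    = Comp (car B) (FA (fun_of M) f) (At (Id (Hom (PsAlg U T) A B) M) a)" if "f
        \<in> hom (car A) a b" for a b f
    using natsD(7)[OF n that] by simp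
  fix n w x assume w: "w \<in> words T n" and x: "x \<in> Ob (pw (car A) n)"
  have i: "x i \<in> Ob (car A)" if "i < n" for i using x that by (auto simp: pw_simps(1))
  have eq: "(\<lambda>i\<in>{..<n}. At (Id (Hom (PsAlg U T) A B) M) (x i))
      = (\<lambda>i\<in>{..<n}. Id (car B) ((\<lambda>i\<in>{..<n}. FO (fun_of M) (x i)) i))"
    using i by (auto simp: At_Id)
  note r = M.rho_hom[OF w x]
  show "Comp (car B) (At (rho M w) x) (At (Id (Hom (PsAlg U T) A B) M) (FO (Phi A w) x))
    = Comp (car B) (FA (Phi B w) (\<lambda>i\<in>{..<n}. At (Id (Hom (PsAlg U T) A B) M) (x i)))
        (At (rho M w) x)"
    using M.B.Phi_Id[OF w M.pow_Ob[OF x]] M.B.X.Comp_Id[OF r] M.B.X.Id_Comp[OF r]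
      functorsD(3)[OF M.A.Phi_functor[OF w] x] by (simp only: eq At_Id)
qed simp_all

lemma Comp_cell:
  assumes a: "\<alpha> \<in> pscells T A B" and b: "\<beta> \<in> pscells T A B" and ab: "Source \<beta> = Target \<alpha>"
  shows "Comp (Hom (PsAlg U T) A B) \<beta> \<alpha> \<in> pscells T A B"
proof (rule pscellsI[OF pscellsD(1)[OF a] pscellsD(2)[OF b]])
  interpret M: morphism_data T A B "Source \<alpha>"
      by (rule psmors_data[OF is_theory_axioms A B pscellsD(1)[OF a]])
  interpret N: morphism_data T A B "Target \<alpha>"
      by (rule psmors_data[OF is_theory_axioms A B pscellsD(2)[OF a]])
  interpret K: morphism_data T A B "Target \<beta>"
      by (rule psmors_data[OF is_theory_axioms A B pscellsD(2)[OF b]])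
  note n = vcomp_nats[OF pscellsD(4)[OF a] pscellsD(4)[OF b, unfolded ab] M.A_cat M.B_cat, folded
      under_Comp[of U T]]
  show "At (Comp (Hom (PsAlg U T) A B) \<beta> \<alpha>) x \<in> hom (car B) (FO M.H x) (FO K.H x)"
    if "x \<in> Ob (car A)" for x
    using natsD(6)[OF n that] by simp
  show "Comp (car B) (At (Comp (Hom (PsAlg U T) A B) \<beta> \<alpha>) y) (FA M.H f)
    = Comp (car B) (FA K.H f) (At (Comp (Hom (PsAlg U T) A B) \<beta> \<alpha>) x)" if "f
        \<in> hom (car A) x y" for x y f
    using natsD(7)[OF n that] by simp
  fix n w x assume w: "w \<in> words T n" and x: "x \<in> Ob (pw (car A) n)"
  have i: "x i \<in> Ob (car A)" if "i < n" for i using x that by (auto simp: pw_simps(1))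
  note y = functorsD(3)[OF M.A.Phi_functor[OF w] x]
  note pa = At_pow_hom[OF a x] and pb = At_pow_hom[OF b x, unfolded ab]
  note ha = pscellsD(5)[OF a y] and hb = pscellsD(5)[OF b y, unfolded ab]
  note ea = pscellsD(7)[OF a w x] and eb = pscellsD(7)[OF b w x, unfolded ab]
  have eq: "FA (Phi B w) (\<lambda>i\<in>{..<n}. At (Comp (Hom (PsAlg U T) A B) \<beta> \<alpha>) (x i))
    = Comp (car B) (FA (Phi B w) (\<lambda>i\<in>{..<n}. At \<beta> (x i))) (FA (Phi B w) (\<lambda>i\<in>{..<n}. At \<alpha> (x i)))"
    using M.B.Phi_Comp[OF w pa pb] i by (simp add: At_Comp cong: restrict_cong)
  note f = functorsD(4)[OF M.B.Phi_functor[OF w]]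
  show "Comp (car B) (At (rho (Target \<beta>) w) x)
      (At (Comp (Hom (PsAlg U T) A B) \<beta> \<alpha>) (FO (Phi A w) x))
    = Comp (car B) (FA (Phi B w) (\<lambda>i\<in>{..<n}. At (Comp (Hom (PsAlg U T) A B) \<beta> \<alpha>) (x i)))
        (At (rho (Source \<alpha>) w) x)"
    unfolding eq At_Comp[OF y]
    by (rule M.B.X.paste[OF ha hb f[OF pa] f[OF pb] M.rho_hom[OF w x] N.rho_hom[OF w x]
        K.rho_hom[OF w x] ea eb])
qed simp_all

text \<open>Pointwise inverses form a 2-cell: \<open>square_inverse\<close> reverses the naturality
  squares and the squares of the 2-cell law. Thus invertibility of the coherence cells of a pseudo
  cone becomes a condition at each object, as in \<open>limit_obs\<close>.\<close>

lemma cell_isos: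
  "\<alpha> \<in> isos (Hom (PsAlg U T) A B) M N \<longleftrightarrow> \<alpha> \<in> pscells T A B \<and> Source \<alpha> = M \<and> Target \<alpha> = N \<and>
    (\<forall>x\<in>Ob (car A). At \<alpha> x \<in> isos (car B) (FO (fun_of M) x) (FO (fun_of N) x))"
proof (intro iffI conjI ballI)
  assume a: "\<alpha> \<in> isos (Hom (PsAlg U T) A B) M N"
  then obtain \<beta> where b: "\<beta> \<in> hom (Hom (PsAlg U T) A B) N M"
    "Comp (Hom (PsAlg U T) A B) \<beta> \<alpha> = Id (Hom (PsAlg U T) A B) M"
    "Comp (Hom (PsAlg U T) A B) \<alpha> \<beta> = Id (Hom (PsAlg U T) A B) N"
    by (rule isosE)
  note a' = isos_hom[OF a, unfolded hom_PsAlg] and b' = b(1)[unfolded hom_PsAlg]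
  show "\<alpha> \<in> pscells T A B" "Source \<alpha> = M" "Target \<alpha> = N" using a' by simp_all
  fix x assume x: "x \<in> Ob (car A)"
  show "At \<alpha> x \<in> isos (car B) (FO (fun_of M) x) (FO (fun_of N) x)"
  proof (rule isosI)
    show "At \<alpha> x \<in> hom (car B) (FO (fun_of M) x) (FO (fun_of N) x)"
      using pscellsD(5)[OF a'[THEN conjunct1] x] a' by simp
    show "At \<beta> x \<in> hom (car B) (FO (fun_of N) x) (FO (fun_of M) x)"
      using pscellsD(5)[OF b'[THEN conjunct1] x] b' by simp
    show "Comp (car B) (At \<beta> x) (At \<alpha> x) = Id (car B) (FO (fun_of M) x)"
      "Comp (car B) (At \<alpha> x) (At \<beta> x) = Id (car B) (FO (fun_of N) x)"
      using b(2,3) At_Comp[OF x, of U T B] At_Id[OF x, of U T B] by metis+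
  qed
next
  assume "\<alpha> \<in> pscells T A B \<and> Source \<alpha> = M \<and> Target \<alpha> = N \<and>
    (\<forall>x\<in>Ob (car A). At \<alpha> x \<in> isos (car B) (FO (fun_of M) x) (FO (fun_of N) x))"
  then have a: "\<alpha> \<in> pscells T A B" and M: "Source \<alpha> = M" and N: "Target \<alpha> = N"
    and "\<forall>x. \<exists>y. x \<in> Ob (car A) \<longrightarrow> y \<in> hom (car B) (FO (fun_of N) x) (FO (fun_of M) x) \<and>
      Comp (car B) y (At \<alpha> x) = Id (car B) (FO (fun_of M) x) \<and>
      Comp (car B) (At \<alpha> x) y = Id (car B) (FO (fun_of N) x)"
    unfolding isos_def by auto
  then obtain b where b: "\<And>x. x \<in> Ob (car A) \<Longrightarrow> b x
      \<in> hom (car B) (FO (fun_of N) x) (FO (fun_of M) x)"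
      "\<And>x. x \<in> Ob (car A) \<Longrightarrow> Comp (car B) (b x) (At \<alpha> x) = Id (car B) (FO (fun_of M) x)"
      "\<And>x. x \<in> Ob (car A) \<Longrightarrow> Comp (car B) (At \<alpha> x) (b x) = Id (car B) (FO (fun_of N) x)"
    by metis
  define \<beta> where "\<beta> = \<lparr>Source = N, Target = M, At = (\<lambda>x\<in>Ob (car A). b x)\<rparr>"
  note M' = pscellsD(1)[OF a, unfolded M] and N' = pscellsD(2)[OF a, unfolded N]
  interpret M: morphism_data T A B M by (rule psmors_data[OF is_theory_axioms A B M'])
  interpret N: morphism_data T A B N by (rule psmors_data[OF is_theory_axioms A B N'])
  note ah = pscellsD(5)[OF a, unfolded M N]
  have \<beta>: "\<beta> \<in> pscells T A B"
  proof (rule pscellsI[OF N' M'])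
    show "At \<beta> x \<in> hom (car B) (FO N.H x) (FO M.H x)" if "x \<in> Ob (car A)" for x
      using that b(1) by (simp add: \<beta>_def)
    show "Comp (car B) (At \<beta> y) (FA N.H f) = Comp (car B) (FA M.H f) (At \<beta> x)"
      if f: "f \<in> hom (car A) x y" for x y f
    proof -
      note xy = M.A.X.hom_Ob[OF f]
      show ?thesis
        using M.B.X.square_inverse[OF ah[OF xy(1)] b(1,3)[OF xy(1)] ah[OF xy(2)] b(1,2)[OF xy(2)]
            functorsD(4)[OF M.fun_functor f] functorsD(4)[OF N.fun_functor f]]
          pscellsD(6)[OF a f] xy by (simp add: \<beta>_def M N)
    qed
    fix n w x assume w: "w \<in> words T n" and x: "x \<in> Ob (pw (car A) n)"
    have i: "x i \<in> Ob (car A)" if "i < n" for i using x that by (auto simp: pw_simps(1))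
    note y = functorsD(3)[OF M.A.Phi_functor[OF w] x]
    note pa = At_pow_hom[OF a x, unfolded M N]
    have pb: "(\<lambda>i\<in>{..<n}. b (x i)) \<in> hom (pw (car B) n) (\<lambda>i\<in>{..<n}. FO N.H (x i))
        (\<lambda>i\<in>{..<n}. FO M.H (x i))"
      using i b(1) by (simp add: hom_pw)
    note f = functorsD(4)[OF M.B.Phi_functor[OF w]]
    \<comment> \<open>For the 2-cell law the side \<open>FA (Phi B w)\<close> of the square also has
      to be inverted. Functoriality of \<open>Phi B w\<close> provides its one-sided
      inverse.\<close>
    have e: "Comp (car B) (FA (Phi B w) (\<lambda>i\<in>{..<n}. b (x i))) (FA (Phi B w) (\<lambda>i\<in>{..<n}. At \<alpha> (x i)))
      = Id (car B) (FO (Phi B w) (\<lambda>i\<in>{..<n}. FO M.H (x i)))"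
      using M.B.Phi_Comp[OF w pa pb] M.B.Phi_Id[OF w M.pow_Ob[OF x]] i b(2)
          by (simp cong: restrict_cong)
    have "Comp (car B) (FA (Phi B w) (\<lambda>i\<in>{..<n}. b (x i))) (At (rho N w) x)
      = Comp (car B) (At (rho M w) x) (b (FO (Phi A w) x))"
      by (rule M.B.X.square_inverse[OF ah[OF y] b(1,3)[OF y] f[OF pa] f[OF pb] e M.rho_hom[OF w x]
          N.rho_hom[OF w x]
          pscellsD(7)[OF a w x, unfolded M N]])
    then show "Comp (car B) (At (rho M w) x) (At \<beta> (FO (Phi A w) x))
      = Comp (car B) (FA (Phi B w) (\<lambda>i\<in>{..<n}. At \<beta> (x i))) (At (rho N w) x)"
      using y i by (simp add: \<beta>_def cong: restrict_cong)
  qed (simp_all add: \<beta>_def)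
  show "\<alpha> \<in> isos (Hom (PsAlg U T) A B) M N"
  proof (rule isosI)
    show "\<alpha> \<in> hom (Hom (PsAlg U T) A B) M N" "\<beta> \<in> hom (Hom (PsAlg U T) A B) N M"
      using a \<beta> M N by (simp_all add: hom_PsAlg \<beta>_def)
    show "Comp (Hom (PsAlg U T) A B) \<beta> \<alpha> = Id (Hom (PsAlg U T) A B) M"
      "Comp (Hom (PsAlg U T) A B) \<alpha> \<beta> = Id (Hom (PsAlg U T) A B) N"
      using b M N by (auto intro!: trans_eqI[of _ _ "Ob (car A)"] simp: At_Comp At_Id)
          (simp_all add: \<beta>_def)
  qed
qed

end

lemma psmor_comp_psmors:
  assumes "is_psalg T A" "is_psalg T B" "is_psalg T C" "L \<in> psmors T A B" "M \<in> psmors T B C"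
  shows "psmor_comp T A B C M L \<in> psmors T A C"
  by (rule morphism_comp.comp_psmors[OF morphism_comp.intro[OF
      psmors_data[OF is_theory_axioms assms(1,2,4)]
          psmors_data[OF is_theory_axioms assms(2,3,5)]] assms(4,5)])

lemma fun_of_comp: "fun_of (psmor_comp T A B C M L) = fcomp (car A) (fun_of M) (fun_of L)"
  by (simp add: psmor_comp_def Let_def)

lemma At_rho_psmor_comp:
  assumes "is_psalg T A" "is_psalg T B" "is_psalg T C" "L \<in> psmors T A B" "M \<in> psmors T B C"
    and "w \<in> words T n" "x \<in> Ob (pw (car A) n)"
  shows "At (rho (psmor_comp T A B C M L) w) x
    = Comp (car C) (At (rho M w) (\<lambda>i\<in>{..<n}. FO (fun_of L) (x i))) (FA (fun_of M) (At (rho L w) x))"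
  by (rule morphism_comp.At_rho_comp[OF morphism_comp.intro[OF
      psmors_data[OF is_theory_axioms assms(1,2,4)]
          psmors_data[OF is_theory_axioms assms(2,3,5)]] assms(6,7)])

text \<open>Associativity is strict. On components of \<open>rho\<close> both sides are the same
  threefold composite once the functor of \<open>N\<close> has been distributed over the inner
  one.\<close>

lemma psmor_comp_assoc:
  assumes A: "is_psalg T A" and B: "is_psalg T B" and C: "is_psalg T C" and D: "is_psalg T D"
    and L: "L \<in> psmors T A B" and M: "M \<in> psmors T B C" and N: "N \<in> psmors T C D"
  shows "psmor_comp T A B D (psmor_comp T B C D N M) L
      = psmor_comp T A C D N (psmor_comp T A B C M L)"
proof (rule psmor_eqI[OF is_theory_axioms A D])
  note NM = psmor_comp_psmors[OF B C D M N] and MoL = psmor_comp_psmors[OF A B C L M]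
  show "psmor_comp T A B D (psmor_comp T B C D N M) L \<in> psmors T A D"
    "psmor_comp T A C D N (psmor_comp T A B C M L) \<in> psmors T A D"
    by (rule psmor_comp_psmors[OF A B D L NM], rule psmor_comp_psmors[OF A C D MoL N])
  show "fun_of (psmor_comp T A B D (psmor_comp T B C D N M) L)
    = fun_of (psmor_comp T A C D N (psmor_comp T A B C M L))"
    unfolding fun_of_comp by (rule fcomp_assoc[OF psmors_functor[OF L]])
  interpret L: morphism_data T A B L by (rule psmors_data[OF is_theory_axioms A B L])
  interpret M: morphism_data T B C M by (rule psmors_data[OF is_theory_axioms B C M])
  interpret N: morphism_data T C D N by (rule psmors_data[OF is_theory_axioms C D N])
  fix n w x assume w: "w \<in> words T n" and x: "x \<in> Ob (pw (car A) n)"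
  note y = L.pow_Ob[OF x]
  define y' where "y' = (\<lambda>i\<in>{..<n}. FO L.H (x i))"
  have z: "(\<lambda>i\<in>{..<n}. FO (fcomp (car A) M.H L.H) (x i)) = (\<lambda>i\<in>{..<n}. FO M.H (y' i))"
    by (rule restrict_ext) (simp add: FO_fcomp y'_def pw_Ob_nth[OF x])
  note l = L.rho_hom[OF w x, folded y'_def] and m = M.rho_hom[OF w y, folded y'_def]
  note n = N.rho_hom[OF w M.pow_Ob[OF y], folded y'_def]
  note fm = functorsD(4)[OF M.fun_functor] and fn = functorsD(4)[OF N.fun_functor]
  show "At (rho (psmor_comp T A B D (psmor_comp T B C D N M) L) w) x
    = At (rho (psmor_comp T A C D N (psmor_comp T A B C M L)) w) x"
    unfolding At_rho_psmor_comp[OF A B D L NM w x] At_rho_psmor_comp[OF A C D MoL N w x]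
      At_rho_psmor_comp[OF B C D M N w y] At_rho_psmor_comp[OF A B C L M w x] fun_of_comp z
    using N.B.X.Comp_assoc[OF fn[OF fm[OF l]] fn[OF m] n] functorsD(6)[OF N.fun_functor fm[OF l] m]
      homD(1)[OF l] by (simp add: FA_fcomp y'_def[symmetric])
qed

lemma At_rho_id:
  assumes "w \<in> words T n" "x \<in> Ob (pw (car A) n)"
  shows "At (rho (psmor_id T A) w) x = Id (car A) (FO (Phi A w) x)"
proof -
  have "w \<in> (\<Union>n. words T n)" using assms by blast
  then show ?thesis using assms by (simp add: psmor_id_def At_idn Dom_words)
qed

lemma fun_of_id: "fun_of (psmor_id T A) = fid (car A)"
  by (simp add: psmor_id_def)

lemma psmor_id_psmors:
  assumes A: "is_psalg T A"
  shows "psmor_id T A \<in> psmors T A A"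
proof -
  interpret A: algebra_data T "car A" "Phi A" "cc A" "II A" "ss A"
    by (rule is_psalg_data[OF is_theory_axioms A])
  have res: "(\<lambda>i\<in>{..<n}. FO (fid (car A)) (x i)) = x" if "x \<in> Ob (pw (car A) n)" for x n
    by (rule pow_fid[OF that])
  have fa: "FA (fid (car A)) f = f" if "f \<in> hom (car A) a b" for f a b
    using homD(1)[OF that] by (simp add: FA_fid)
  \<comment> \<open>The required target of \<open>rho\<close> contains a power of the identity
    functor. For an identity transformation to be well typed there, this power has to equal the
    identity functor of the power.\<close>
  have pid: "powF (car A) n (fid (car A)) = fid (pw (car A) n)" for n
  proof (rule functor_eqI)
    show "powF (car A) n (fid (car A)) \<in> functors (pw (car A) n) (pw (car A) n)"
      "fid (pw (car A) n) \<in> functors (pw (car A) n) (pw (car A) n)"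
      using powF_functor[OF A.X.category_axioms fid_functor[OF A.X.category_axioms]]
        fid_functor[OF pw_category[OF A.X.category_axioms]] by auto
    show "FO (powF (car A) n (fid (car A))) x = FO (fid (pw (car A) n)) x"
        if "x \<in> Ob (pw (car A) n)" for x
      using that res[OF that] by (simp add: FO_powF FO_fid)
    show "FA (powF (car A) n (fid (car A))) x = FA (fid (pw (car A) n)) x"
        if "x \<in> Arr (pw (car A) n)" for x
    proof (rule ext)
      show "FA (powF (car A) n (fid (car A))) x i = FA (fid (pw (car A) n)) x i" for i
        using that PiE_arb[of x "{..<n}" "\<lambda>_. Arr (car A)" i]
            PiE_mem[of x "{..<n}" "\<lambda>_. Arr (car A)" i]
        by (cases "i < n") (simp_all add: FA_powF[OF that] FA_fid[OF that] FA_fid pw_simps(2))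
    qed
  qed
  have rho: "rho (psmor_id T A) w = idn (pw (car A) n) (car A) (Phi A w)" if "w \<in> words T n" for w n
  proof -
    have "w \<in> (\<Union>n. words T n)" using that by blast
    then show ?thesis using that by (simp add: psmor_id_def Dom_words)
  qed
  interpret I: morphism_data T A A "psmor_id T A"
  proof (intro morphism_data.intro morphism_data_axioms.intro A.algebra_data_axioms)
    show "fun_of (psmor_id T A) \<in> functors (car A) (car A)"
      by (simp add: fun_of_id fid_functor A.X.category_axioms)
    show "rho (psmor_id T A) \<in> extensional (\<Union>n. words T n)"
      by (simp add: psmor_id_def)
    show "rho (psmor_id T A) w \<in> nat_isos (pw (car A) n) (car A)
        (fcomp (pw (car A) n) (fun_of (psmor_id T A)) (Phi A w))
      (fcomp (pw (car A) n) (Phi A w) (powF (car A) n (fun_of (psmor_id T A))))" if w: "w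
          \<in> words T n" for w n
      using idn_nat_isos[OF A.Phi_functor[OF w] pw_category[OF A.X.category_axioms]
          A.X.category_axioms]
        fcomp_fid_left[OF A.Phi_functor[OF w]] fcomp_fid_right[OF A.Phi_functor[OF w]]
      by (simp add: fun_of_id pid rho[OF w])
  qed
  show ?thesis
    unfolding I.psmors_iff
  proof (intro conjI allI ballI)
    fix k n w ws x assume w: "w \<in> words T k" and ws: "ws \<in> (\<Pi>\<^sub>E i\<in>{..<k}. words T (n i))"
      and x: "x \<in> Ob (pw (car A) (offset n k))"
    note ws' = A.PiE_words[OF ws]
    note g = wgamma_words[of w k ws n, OF w ws'] and c = A.c_hom[OF w ws x] and y
        = A.words_Phi_Ob[OF ws x]
    have eq: "(\<lambda>i\<in>{..<k}. At (rho (psmor_id T A) (ws i)) (blk n i x))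
      = (\<lambda>i\<in>{..<k}. Id (car A) ((\<lambda>i\<in>{..<k}. FO (Phi A (ws i)) (blk n i x)) i))"
      using At_rho_id[OF ws' blk_pw(1)[OF _ x]] by auto
    show "I.gamma_law k n w ws x"
      unfolding I.gamma_law_def eq fun_of_id res[OF x] At_rho_id[OF g x] At_rho_id[OF w y] fa[OF c]
          A.Phi_Id[OF w y]
      using A.X.Comp_Id[OF c] A.X.Id_Comp[OF c] At_rho_id[OF g x] by simp
  next
    fix x assume x: "x \<in> Ob (pw (car A) 1)"
    note c = A.I_hom[OF x]
    show "I.unit_law x"
      unfolding I.unit_law_def fun_of_id res[OF x] At_rho_id[OF wunit_words x] fa[OF c]
      by (rule A.X.Comp_Id[OF c])
  next
    fix k l w f x assume w: "w \<in> words T k" and f: "f \<in> {..<k} \<rightarrow>\<^sub>E {..<l}"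
        and x: "x \<in> Ob (pw (car A) l)"
    note f' = A.PiE_less[OF f]
    note g = wsubst_words[of w k f l, OF w f'] and c = A.s_hom[OF w f x]
    note y = compose_pw(1)[of k f l, OF f' x]
    show "I.subst_law k l w f x"
      unfolding I.subst_law_def fun_of_id res[OF x] At_rho_id[OF g x] At_rho_id[OF w y] fa[OF c]
      using A.X.Comp_Id[OF c] A.X.Id_Comp[OF c] At_rho_id[OF g x] At_rho_id[OF w y] by simp
  qed
qed

text \<open>Units are strict too. This removes the composites with \<open>psmor_id\<close> that the
  constant pseudo functor introduces into the axioms of a pseudo cone.\<close>

lemma psmor_comp_id:
  assumes A: "is_psalg T A" and B: "is_psalg T B" and M: "M \<in> psmors T A B"
  shows "psmor_comp T A A B M (psmor_id T A) = M" "psmor_comp T A B B (psmor_id T B) M = M"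
proof -
  interpret M: morphism_data T A B M by (rule psmors_data[OF is_theory_axioms A B M])
  note iA = psmor_id_psmors[OF A] and iB = psmor_id_psmors[OF B]
  show "psmor_comp T A A B M (psmor_id T A) = M"
  proof (rule psmor_eqI[OF is_theory_axioms A B psmor_comp_psmors[OF A A B iA M] M])
    show "fun_of (psmor_comp T A A B M (psmor_id T A)) = fun_of M"
      unfolding fun_of_comp fun_of_id by (rule fcomp_fid_right[OF M.fun_functor])
    fix n w x assume w: "w \<in> words T n" and x: "x \<in> Ob (pw (car A) n)"
    note y = functorsD(3)[OF M.A.Phi_functor[OF w] x]
    have res: "(\<lambda>i\<in>{..<n}. FO (fid (car A)) (x i)) = x"
      by (rule pow_fid[OF x])
    show "At (rho (psmor_comp T A A B M (psmor_id T A)) w) x = At (rho M w) x"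
      unfolding At_rho_psmor_comp[OF A A B iA M w x] At_rho_id[OF w x] fun_of_id res
          functorsD(5)[OF M.fun_functor y]
      by (rule M.B.X.Comp_Id[OF M.rho_hom[OF w x]])
  qed
  show "psmor_comp T A B B (psmor_id T B) M = M"
  proof (rule psmor_eqI[OF is_theory_axioms A B psmor_comp_psmors[OF A B B M iB] M])
    show "fun_of (psmor_comp T A B B (psmor_id T B) M) = fun_of M"
      unfolding fun_of_comp fun_of_id by (rule fcomp_fid_left[OF M.fun_functor])
    fix n w x assume w: "w \<in> words T n" and x: "x \<in> Ob (pw (car A) n)"
    show "At (rho (psmor_comp T A B B (psmor_id T B) M) w) x = At (rho M w) x"
      unfolding At_rho_psmor_comp[OF A B B M iB w x] At_rho_id[OF w M.pow_Ob[OF x]] fun_of_id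
        FA_fid[OF homD(1)[OF M.rho_hom[OF w x]]]
      by (rule M.B.X.Id_Comp[OF M.rho_hom[OF w x]])
  qed
qed

section \<open>Whiskering of 2-cells by morphisms\<close>

context
  fixes A B C :: "('t, 'u, 'u) psalg" and U :: "'u set set"
  assumes A: "is_psalg T A" and B: "is_psalg T B" and C: "is_psalg T C"
begin

lemma At_whisker_right:
  assumes b: "\<beta> \<in> pscells T B C" and L: "L \<in> psmors T A B" and x: "x \<in> Ob (car A)"
  shows "At (Comp2 (PsAlg U T) A B C \<beta> (Id (Hom (PsAlg U T) A B) L)) x = At \<beta> (FO (fun_of L) x)"
  using At_hcomp_idn_right[OF x psmors_functor[OF L] pscellsD(4)[OF B C b] psalg_category[OF C]]
  by (simp flip: under_simps(1)[of "Comp2 _ _ _ _ _ _"] add: under_Comp2 under_Id)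

lemma At_whisker_left:
  assumes a: "\<alpha> \<in> pscells T A B" and M: "M \<in> psmors T B C" and x: "x \<in> Ob (car A)"
  shows "At (Comp2 (PsAlg U T) A B C (Id (Hom (PsAlg U T) B C) M) \<alpha>) x = FA (fun_of M) (At \<alpha> x)"
  using At_hcomp_idn_left[OF x pscellsD(4)[OF A B a] psmors_functor[OF M] psalg_category[OF C]]
  by (simp flip: under_simps(1)[of "Comp2 _ _ _ _ _ _"] add: under_Comp2 under_Id)

lemma whisker_right_cell:
  assumes b: "\<beta> \<in> pscells T B C" and L: "L \<in> psmors T A B"
  shows "Comp2 (PsAlg U T) A B C \<beta> (Id (Hom (PsAlg U T) A B) L) \<in> pscells T A C"
    (is "?w \<in> _")
proof -
  note M = pscellsD(1)[OF B C b] and N = pscellsD(2)[OF B C b]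
  interpret L: morphism_data T A B L by (rule psmors_data[OF is_theory_axioms A B L])
  interpret M: morphism_data T B C "Source \<beta>" by (rule psmors_data[OF is_theory_axioms B C M])
  interpret N: morphism_data T B C "Target \<beta>" by (rule psmors_data[OF is_theory_axioms B C N])
  have n: "under ?w \<in> nats (car A) (car C) (fun_of (psmor_comp T A B C (Source \<beta>) L))
      (fun_of (psmor_comp T A B C (Target \<beta>) L))"
    unfolding under_Comp2 under_Id fun_of_comp
    by (rule hcomp_nats[OF idn_nats[OF L.fun_functor L.A_cat L.B_cat] pscellsD(4)[OF B C b] L.A_cat
        L.B_cat M.B_cat])
  show ?thesis
  proof (rule pscellsI[OF A C psmor_comp_psmors[OF A B C L M] psmor_comp_psmors[OF A B C L N]])
    show "At ?w x \<in> hom (car C) (FO (fun_of (psmor_comp T A B C (Source \<beta>) L)) x)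
        (FO (fun_of (psmor_comp T A B C (Target \<beta>) L)) x)" if "x \<in> Ob (car A)" for x
      using natsD(6)[OF n that] by simp
    show "Comp (car C) (At ?w y) (FA (fun_of (psmor_comp T A B C (Source \<beta>) L)) f)
        = Comp (car C) (FA (fun_of (psmor_comp T A B C (Target \<beta>) L)) f) (At ?w x)"
      if "f \<in> hom (car A) x y" for x y f
      using natsD(7)[OF n that] by simp
    fix n w x assume w: "w \<in> words T n" and x: "x \<in> Ob (pw (car A) n)"
    have i: "x i \<in> Ob (car A)" if "i < n" for i using x that by (auto simp: pw_simps(1))
    note z = functorsD(3)[OF L.A.Phi_functor[OF w] x]
    define y where "y = (\<lambda>i\<in>{..<n}. FO L.H (x i))"
    note y = L.pow_Ob[OF x, folded y_def] and l = L.rho_hom[OF w x, folded y_def]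
    \<comment> \<open>The 2-cell law of the whiskered cell is a pasting: naturality of
      \<open>\<beta>\<close> at the component of \<open>rho L\<close>, then the 2-cell law of
      \<open>\<beta>\<close> at the image of \<open>x\<close>.\<close>
    note e1 = pscellsD(6)[OF B C b l] and e2 = pscellsD(7)[OF B C b w y]
    have eq: "(\<lambda>i\<in>{..<n}. At ?w (x i)) = (\<lambda>i\<in>{..<n}. At \<beta> (y i))"
      using At_whisker_right[OF b L i] by (auto simp: y_def)
    note h = pscellsD(5)[OF B C b]
    show "Comp (car C) (At (rho (psmor_comp T A B C (Target \<beta>) L) w) x) (At ?w (FO (Phi A w) x))
      = Comp (car C) (FA (Phi C w) (\<lambda>i\<in>{..<n}. At ?w (x i)))
          (At (rho (psmor_comp T A B C (Source \<beta>) L) w) x)"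
      unfolding At_rho_psmor_comp[OF A B C L M w x] At_rho_psmor_comp[OF A B C L N w x]
        At_whisker_right[OF b L z] eq y_def[symmetric]
      by (rule M.B.X.paste[OF functorsD(4)[OF M.fun_functor l] M.rho_hom[OF w y]
            functorsD(4)[OF N.fun_functor l] N.rho_hom[OF w y]
            h[OF functorsD(3)[OF L.fun_functor z]] h[OF functorsD(3)[OF L.B.Phi_functor[OF w] y]]
            functorsD(4)[OF M.B.Phi_functor[OF w] At_pow_hom[OF B C b y]] e1 e2[symmetric],
                symmetric])
  qed simp_all
qed

lemma whisker_left_cell:
  assumes a: "\<alpha> \<in> pscells T A B" and M: "M \<in> psmors T B C"
  shows "Comp2 (PsAlg U T) A B C (Id (Hom (PsAlg U T) B C) M) \<alpha> \<in> pscells T A C"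
    (is "?w \<in> _")
proof -
  note K = pscellsD(1)[OF A B a] and L = pscellsD(2)[OF A B a]
  interpret M: morphism_data T B C M by (rule psmors_data[OF is_theory_axioms B C M])
  interpret K: morphism_data T A B "Source \<alpha>" by (rule psmors_data[OF is_theory_axioms A B K])
  interpret L: morphism_data T A B "Target \<alpha>" by (rule psmors_data[OF is_theory_axioms A B L])
  have n: "under ?w \<in> nats (car A) (car C) (fun_of (psmor_comp T A B C M (Source \<alpha>)))
      (fun_of (psmor_comp T A B C M (Target \<alpha>)))"
    unfolding under_Comp2 under_Id fun_of_comp
    by (rule hcomp_nats[OF pscellsD(4)[OF A B a] idn_nats[OF M.fun_functor M.A_cat M.B_cat] L.A_cat
        L.B_cat M.B_cat])
  show ?thesis
  proof (rule pscellsI[OF A C psmor_comp_psmors[OF A B C K M] psmor_comp_psmors[OF A B C L M]])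
    show "At ?w x \<in> hom (car C) (FO (fun_of (psmor_comp T A B C M (Source \<alpha>))) x)
        (FO (fun_of (psmor_comp T A B C M (Target \<alpha>))) x)" if "x \<in> Ob (car A)" for x
      using natsD(6)[OF n that] by simp
    show "Comp (car C) (At ?w y) (FA (fun_of (psmor_comp T A B C M (Source \<alpha>))) f)
        = Comp (car C) (FA (fun_of (psmor_comp T A B C M (Target \<alpha>))) f) (At ?w x)"
      if "f \<in> hom (car A) x y" for x y f
      using natsD(7)[OF n that] by simp
    fix n w x assume w: "w \<in> words T n" and x: "x \<in> Ob (pw (car A) n)"
    have i: "x i \<in> Ob (car A)" if "i < n" for i using x that by (auto simp: pw_simps(1))
    note z = functorsD(3)[OF K.A.Phi_functor[OF w] x]
    note p = At_pow_hom[OF A B a x]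
    note h = pscellsD(5)[OF A B a z] and l = L.rho_hom[OF w x] and k = K.rho_hom[OF w x]
    note ph = functorsD(4)[OF M.A.Phi_functor[OF w] p]
    \<comment> \<open>The image under \<open>M\<close> of the 2-cell law of \<open>\<alpha>\<close>.
      It is pasted with \<open>e2\<close>, the naturality of \<open>rho M\<close> at the tuple of
      components of \<open>\<alpha>\<close>.\<close>
    have e1: "Comp (car C) (FA M.H (At (rho (Target \<alpha>) w) x)) (FA M.H (At \<alpha> (FO (Phi A w) x)))
      = Comp (car C) (FA M.H (FA (Phi B w) (\<lambda>i\<in>{..<n}. At \<alpha> (x i))))
          (FA M.H (At (rho (Source \<alpha>) w) x))"
      using functorsD(6)[OF M.fun_functor h l] functorsD(6)[OF M.fun_functor k ph]
          pscellsD(7)[OF A B a w x] by simp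
    note e2 = M.rho_natural[OF w p]
    have eq: "(\<lambda>i\<in>{..<n}. At ?w (x i)) = (\<lambda>i\<in>{..<n}. FA M.H ((\<lambda>i\<in>{..<n}. At \<alpha> (x i)) i))"
      using At_whisker_left[OF a M i] by auto
    have mp: "(\<lambda>i\<in>{..<n}. FA M.H ((\<lambda>i\<in>{..<n}. At \<alpha> (x i)) i)) \<in> hom (pw (car C) n)
      (\<lambda>i\<in>{..<n}. FO M.H ((\<lambda>i\<in>{..<n}. FO K.H (x i)) i))
          (\<lambda>i\<in>{..<n}. FO M.H ((\<lambda>i\<in>{..<n}. FO L.H (x i)) i))"
      using p functorsD(4)[OF M.fun_functor] by (simp add: hom_pw)
    note mh = functorsD(4)[OF M.fun_functor]
    note l2 = M.rho_hom[OF w L.pow_Ob[OF x]] and k2 = M.rho_hom[OF w K.pow_Ob[OF x]]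
    note P = functorsD(4)[OF M.B.Phi_functor[OF w] mp]
    have "Comp (car C) (Comp (car C) (At (rho M w) (\<lambda>i\<in>{..<n}. FO L.H (x i)))
        (FA M.H (At (rho (Target \<alpha>) w) x)))
        (FA M.H (At \<alpha> (FO (Phi A w) x)))
      = Comp (car C) (FA (Phi C w) (\<lambda>i\<in>{..<n}. FA M.H ((\<lambda>i\<in>{..<n}. At \<alpha> (x i)) i)))
        (Comp (car C) (At (rho M w) (\<lambda>i\<in>{..<n}. FO K.H (x i))) (FA M.H (At (rho (Source \<alpha>) w) x)))"
      using M.B.X.paste[OF mh[OF k] k2 mh[OF l] l2 mh[OF h] mh[OF ph] P e1[symmetric] e2[symmetric]]
          by simp
    then show "Comp (car C) (At (rho (psmor_comp T A B C M (Target \<alpha>)) w) x)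
        (At ?w (FO (Phi A w) x))
      = Comp (car C) (FA (Phi C w) (\<lambda>i\<in>{..<n}. At ?w (x i)))
          (At (rho (psmor_comp T A B C M (Source \<alpha>)) w) x)"
      unfolding At_rho_psmor_comp[OF A B C K M w x] At_rho_psmor_comp[OF A B C L M w x]
        At_whisker_left[OF a M z] eq .
  qed simp_all
qed

end

end

section \<open>Smallness\<close>

context universe
begin

text \<open>\<open>U\<close> contains sets of elements of \<open>'u\<close> only. Measuring by
  injections into members of \<open>U\<close> extends smallness to sets of any type, such as sets of
  pairs or of functions.\<close>

definition small :: "'a set \<Rightarrow> bool" where
  "small S \<longleftrightarrow> (\<exists>B\<in>U. S \<lesssim> B)"

lemma small_iff: "small S \<longleftrightarrow> S \<in> U"
  using small_lepoll by (auto simp: small_def)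

lemma small_mono: "\<lbrakk>S \<lesssim> R; small R\<rbrakk> \<Longrightarrow> small S"
  unfolding small_def using lepoll_trans by blast

lemma small_inj: "\<lbrakk>inj_on f S; f ` S \<subseteq> R; small R\<rbrakk> \<Longrightarrow> small S"
  using small_mono unfolding lepoll_def by blast

lemma small_Powr:
  assumes "small S"
  shows "small (Pow S)"
proof -
  obtain B where B: "B \<in> U" "S \<lesssim> B" using assms by (auto simp: small_def)
  obtain f where f: "inj_on f S" "f ` S \<subseteq> B" using B(2) by (auto simp: lepoll_def)
  obtain D where D: "D \<in> U" "Pow B \<approx> D" using small_Pow[OF B(1)] by blast
  have "Pow S \<lesssim> Pow B"
    unfolding lepoll_def using f by (intro exI[of _ "image f"]) (auto simp: inj_on_image_Pow)
  then show ?thesis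
    using D unfolding small_def by (meson eqpoll_imp_lepoll lepoll_trans)
qed

lemma small_Un:
  assumes "A \<in> U" "B \<in> U"
  shows "A \<union> B \<in> U"
proof -
  \<comment> \<open>To index a union of two sets by a small set, two different elements are needed.
    If \<open>'u\<close> had only one, the two subsets of a singleton could not inject into a set of
    elements of \<open>'u\<close>, against closure under power sets.\<close>
  have "\<exists>a b :: 'u. a \<noteq> b"
  proof (rule ccontr)
    assume "\<nexists>a b :: 'u. a \<noteq> b"
    then have *: "a = b" for a b :: 'u by blast
    have "{undefined :: 'u} \<in> U" using small_pair[of undefined undefined] by simp
    then obtain D :: "'u set" where "Pow {undefined :: 'u} \<approx> D" using small_Pow by blast
    then obtain f where f: "bij_betw f (Pow {undefined :: 'u}) D"
      unfolding eqpoll_def by blast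
    have "f {} = f {undefined}" by (rule *)
    then have "{} = {undefined :: 'u}"
      using inj_onD[OF bij_betw_imp_inj_on[OF f], of "{}" "{undefined}"] by simp
    then show False by simp
  qed
  then obtain a b :: 'u where ab: "a \<noteq> b" by blast
  have "(\<Union>i\<in>{a, b}. if i = a then A else B) \<in> U"
    using assms by (intro small_UN small_pair) auto
  also have "(\<Union>i\<in>{a, b}. if i = a then A else B) = A \<union> B"
    using ab by auto
  finally show ?thesis .
qed

text \<open>Kuratowski pairs of codes lie in the double power set of the union of the two code sets,
  which reduces products to unions and power sets.\<close>

lemma small_times:
  assumes "small S" "small R"
  shows "small (S \<times> R)"
proof -
  obtain A B f g where A: "A \<in> U" "inj_on f S" "f ` S \<subseteq> A" and B: "B \<in> U" "inj_on g R" "g ` R \<subseteq> B"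
    using assms by (auto simp: small_def lepoll_def)
  have pair: "a = a' \<and> b = b'" if "{{a}, {a, b}} = {{a'}, {a', b'}}" for a b a' b' :: 'u
    using that by (auto simp: doubleton_eq_iff)
  have "inj_on (\<lambda>(a, b). {{f a}, {f a, g b}}) (S \<times> R)"
  proof (rule inj_onI, clarify)
    fix a b a' b' assume *: "a \<in> S" "b \<in> R" "a' \<in> S" "b' \<in> R"
      and "{{f a}, {f a, g b}} = {{f a'}, {f a', g b'}}"
    then have "f a = f a'" "g b = g b'" using pair by blast+
    then show "a = a' \<and> b = b'" using * inj_onD[OF A(2)] inj_onD[OF B(2)] by blast
  qed
  moreover have "(\<lambda>(a, b). {{f a}, {f a, g b}}) ` (S \<times> R) \<subseteq> Pow (Pow (A \<union> B))"
    using A(3) B(3) by auto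
  moreover have "small (Pow (Pow (A \<union> B)))"
    using small_Un[OF A(1) B(1)] by (intro small_Powr) (simp add: small_iff)
  ultimately show ?thesis by (rule small_inj)
qed

text \<open>An extensional function is determined by its graph, which is a subset of a small
  product.\<close>

lemma small_PiE:
  assumes "S \<in> U" "\<And>x. x \<in> S \<Longrightarrow> R x \<in> U"
  shows "small (\<Pi>\<^sub>E x\<in>S. R x)"
proof (rule small_inj)
  let ?g = "\<lambda>f. {(x, f x) |x. x \<in> S}"
  show "inj_on ?g (\<Pi>\<^sub>E x\<in>S. R x)"
    by (rule inj_onI, rule extensionalityI[of _ S]) (auto simp: PiE_iff)
  show "?g ` (\<Pi>\<^sub>E x\<in>S. R x) \<subseteq> Pow (S \<times> (\<Union>x\<in>S. R x))"
    by auto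
  show "small (Pow (S \<times> (\<Union>x\<in>S. R x)))"
    using assms small_UN[of S R] by (intro small_Powr small_times) (simp_all add: small_iff)
qed

text \<open>The image of an injection into a small set is a subset of that set and hence belongs to
  \<open>U\<close>. Such images will be the sets of objects and arrows of the limit
  category.\<close>

lemma small_encoding:
  assumes "small S"
  shows "\<exists>e. inj_on e S \<and> e ` S \<in> U"
proof -
  obtain B e where "B \<in> U" "inj_on e S" "e ` S \<subseteq> B"
    using assms by (auto simp: small_def lepoll_def)
  then show ?thesis using small_lepoll subset_imp_lepoll by blast
qed

end

section \<open>The limit category\<close>

locale diagram = T: is_theory T + V: universe U + J: pseudo_functor J "PsAlg U T" F
  for T :: "'t theory_data" and U :: "'u set set" and J :: "('u, 'u) cat"
    and F :: "('u, 'u, ('t, 'u, 'u) psalg, ('t, 'u, 'u) psmor, ('t, 'u, 'u) pscell) psfun" +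
  assumes J_small: "small_cat U J"
begin

abbreviation "K \<equiv> PsAlg U T"
abbreviation "A \<equiv> PO F"
abbreviation "X j \<equiv> car (A j)"
abbreviation "H f \<equiv> fun_of (PA F f)"

lemma A_psalg: "j \<in> Ob J \<Longrightarrow> is_psalg T (A j)"
  and X_small: "j \<in> Ob J \<Longrightarrow> small_cat U (X j)"
  using J.PO_Obj by simp_all

lemma X_category: "j \<in> Ob J \<Longrightarrow> category (X j)"
  using A_psalg psalg_category by blast

lemma A_data: "j \<in> Ob J \<Longrightarrow> algebra_data T (X j) (Phi (A j)) (cc (A j)) (II (A j)) (ss (A j))"
  using is_psalg_data[OF T.is_theory_axioms A_psalg] .

lemma M_psmors: "f \<in> hom J a b \<Longrightarrow> PA F f \<in> psmors T (A a) (A b)"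
  using J.PA_hom by simp

lemma H_functor: "f \<in> hom J a b \<Longrightarrow> H f \<in> functors (X a) (X b)"
  using M_psmors T.psmors_functor by blast

lemma M_data:
  assumes "f \<in> hom J a b"
  shows "morphism_data T (A a) (A b) (PA F f)"
  using assms by (intro psmors_data[OF T.is_theory_axioms] A_psalg M_psmors J.hom_Ob)

lemma PC_cell:
  assumes f: "f \<in> hom J a b" and g: "g \<in> hom J b c"
  shows "PC F g f \<in> pscells T (A a) (A c)"
    and "Source (PC F g f) = psmor_comp T (A a) (A b) (A c) (PA F g) (PA F f)"
    and "Target (PC F g f) = PA F (Comp J g f)"
  using J.PC_iso[OF f g] T.cell_isos[OF A_psalg A_psalg] J.hom_Ob[OF f] J.hom_Ob[OF g] by auto

lemma PU_cell:
  assumes j: "j \<in> Ob J"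
  shows "PU F j \<in> pscells T (A j) (A j)" "Source (PU F j) = psmor_id T (A j)"
      "Target (PU F j) = PA F (Id J j)"
  using J.PU_iso[OF j] T.cell_isos[OF A_psalg A_psalg] j by auto

lemma PC_hom:
  assumes f: "f \<in> hom J a b" and g: "g \<in> hom J b c" and x: "x \<in> Ob (X a)"
  shows "At (PC F g f) x \<in> hom (X c) (FO (H g) (FO (H f) x)) (FO (H (Comp J g f)) x)"
  using T.pscellsD(5)[OF A_psalg A_psalg PC_cell(1)[OF f g] x] J.hom_Ob[OF f] J.hom_Ob[OF g] x
  by (simp add: PC_cell[OF f g] T.fun_of_comp FO_fcomp)

lemma PU_hom:
  assumes j: "j \<in> Ob J" and x: "x \<in> Ob (X j)"
  shows "At (PU F j) x \<in> hom (X j) x (FO (H (Id J j)) x)"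
  using T.pscellsD(5)[OF A_psalg A_psalg PU_cell(1)[OF j] x] j x
  by (simp add: PU_cell[OF j] T.fun_of_id FO_fid)

text \<open>The last three conditions are the invertibility, unit and composition axioms of a pseudo
  cone, read at one object of its vertex. The coherence 2-cells of the constant pseudo functor are
  identities and leave no trace.\<close>

definition limit_obs :: "(('u \<Rightarrow> 'u) \<times> ('u \<Rightarrow> 'u)) set" where
  "limit_obs = {(x, \<phi>). x \<in> (\<Pi>\<^sub>E j\<in>Ob J. Ob (X j)) \<and> \<phi> \<in> extensional (Arr J) \<and>
    (\<forall>a b. \<forall>f\<in>hom J a b. \<phi> f \<in> isos (X b) (FO (H f) (x a)) (x b)) \<and>
    (\<forall>a\<in>Ob J. Comp (X a) (\<phi> (Id J a)) (At (PU F a) (x a)) = Id (X a) (x a)) \<and>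
    (\<forall>a b c. \<forall>f\<in>hom J a b. \<forall>g\<in>hom J b c.
      Comp (X c) (\<phi> (Comp J g f)) (At (PC F g f) (x a)) = Comp (X c) (\<phi> g) (FA (H g) (\<phi> f)))}"

text \<open>The endpoints are stored with the family, so that \<open>Dom\<close> and
  \<open>Cod\<close> can be recovered from an arrow alone.\<close>

definition limit_ars where
  "limit_ars = {(p, q, u). p \<in> limit_obs \<and> q \<in> limit_obs \<and>
    u \<in> (\<Pi>\<^sub>E j\<in>Ob J. hom (X j) (fst p j) (fst q j)) \<and>
    (\<forall>a b. \<forall>f\<in>hom J a b. Comp (X b) (u b) (snd p f) = Comp (X b) (snd q f) (FA (H f) (u a)))}"

lemma small_limit: "V.small limit_obs" "V.small limit_ars"
proof -
  have J: "Ob J \<in> U" "Arr J \<in> U" using J_small by (simp_all add: small_cat_def)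
  have X: "Ob (X j) \<in> U" "Arr (X j) \<in> U" if "j \<in> Ob J" for j
    using X_small[OF that] by (simp_all add: small_cat_def)
  \<comment> \<open>The isomorphism at \<open>f\<close> lives in the category over the codomain of
    \<open>f\<close>, so the families \<open>\<phi>\<close> range over a small dependent
    product.\<close>
  have arr: "\<phi> f \<in> Arr (X (Cod J f))"
    if "f \<in> Arr J" "\<forall>a b. \<forall>f\<in>hom J a b. \<phi> f \<in> isos (X b) (FO (H f) (x a)) (x b)" for x \<phi> f
  proof -
    have "\<phi> f \<in> isos (X (Cod J f)) (FO (H f) (x (Dom J f))) (x (Cod J f))"
      using that Arr_hom[OF that(1)] by blast
    then show ?thesis by (rule homD(1)[OF isos_hom])
  qed
  have "limit_obs \<subseteq> (\<Pi>\<^sub>E j\<in>Ob J. Ob (X j)) \<times> (\<Pi>\<^sub>E f\<in>Arr J. Arr (X (Cod J f)))"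
  proof (rule subsetI)
    fix p assume "p \<in> limit_obs"
    then obtain x \<phi> where p: "p = (x, \<phi>)" "x \<in> (\<Pi>\<^sub>E j\<in>Ob J. Ob (X j))" "\<phi> \<in> extensional (Arr J)"
      and i: "\<forall>a b. \<forall>f\<in>hom J a b. \<phi> f \<in> isos (X b) (FO (H f) (x a)) (x b)"
      by (auto simp: limit_obs_def)
    have "\<phi> \<in> (\<Pi>\<^sub>E f\<in>Arr J. Arr (X (Cod J f)))"
      using arr[OF _ i] p(3) by (simp add: PiE_iff)
    then show "p \<in> (\<Pi>\<^sub>E j\<in>Ob J. Ob (X j)) \<times> (\<Pi>\<^sub>E f\<in>Arr J. Arr (X (Cod J f)))"
      using p by simp
  qed
  moreover have "V.small ((\<Pi>\<^sub>E j\<in>Ob J. Ob (X j)) \<times> (\<Pi>\<^sub>E f\<in>Arr J. Arr (X (Cod J f))))"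
    using J X J.Cod_Ob by (intro V.small_times V.small_PiE) auto
  ultimately show obs: "V.small limit_obs"
    using V.small_mono subset_imp_lepoll by blast
  have "limit_ars \<subseteq> limit_obs \<times> limit_obs \<times> (\<Pi>\<^sub>E j\<in>Ob J. Arr (X j))"
    by (auto simp: limit_ars_def PiE_iff extensional_def dest: homD(1))
  moreover have "V.small (limit_obs \<times> limit_obs \<times> (\<Pi>\<^sub>E j\<in>Ob J. Arr (X j)))"
    using J X obs by (intro V.small_times V.small_PiE) auto
  ultimately show "V.small limit_ars"
    using V.small_mono subset_imp_lepoll by blast
qed

text \<open>A coding is chosen among those that \<open>small_encoding\<close> provides: any
  injective one with image in \<open>U\<close> serves.\<close>

definition "enc_ob = (SOME e. inj_on e limit_obs \<and> e ` limit_obs \<in> U)"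
definition "enc_ar = (SOME e. inj_on e limit_ars \<and> e ` limit_ars \<in> U)"
definition "dec_ob = inv_into limit_obs enc_ob"
definition "dec_ar = inv_into limit_ars enc_ar"

lemma enc: "inj_on enc_ob limit_obs" "enc_ob ` limit_obs \<in> U" "inj_on enc_ar limit_ars"
    "enc_ar ` limit_ars \<in> U"
  using someI_ex[OF V.small_encoding[OF small_limit(1)]]
      someI_ex[OF V.small_encoding[OF small_limit(2)]]
  unfolding enc_ob_def enc_ar_def by auto

lemma dec: "p \<in> limit_obs \<Longrightarrow> dec_ob (enc_ob p) = p" "m \<in> limit_ars \<Longrightarrow> dec_ar (enc_ar m) = m"
  unfolding dec_ob_def dec_ar_def using enc by auto

text \<open>
  Since objects and arrows of a small category must be elements of type \<open>'u\<close>, the families are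
  coded by such elements; \<open>po\<close>, \<open>ph\<close> and \<open>pa\<close> read off the components.
\<close>

definition po :: "'u \<Rightarrow> 'u \<Rightarrow> 'u" where "po j w = fst (dec_ob w) j"
definition ph :: "'u \<Rightarrow> 'u \<Rightarrow> 'u" where "ph f w = snd (dec_ob w) f"
definition pa :: "'u \<Rightarrow> 'u \<Rightarrow> 'u" where "pa j m = snd (snd (dec_ar m)) j"
definition mk_ob :: "('u \<Rightarrow> 'u) \<Rightarrow> ('u \<Rightarrow> 'u) \<Rightarrow> 'u" where
  "mk_ob x \<phi> = enc_ob (restrict x (Ob J), restrict \<phi> (Arr J))"
definition mk_ar :: "'u \<Rightarrow> 'u \<Rightarrow> ('u \<Rightarrow> 'u) \<Rightarrow> 'u" where
  "mk_ar w w' u = enc_ar (dec_ob w, dec_ob w', restrict u (Ob J))"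

definition W :: "('u, 'u) cat" where
  "W = \<lparr>Ob = enc_ob ` limit_obs, Arr = enc_ar ` limit_ars,
    Dom = (\<lambda>m. enc_ob (fst (dec_ar m))), Cod = (\<lambda>m. enc_ob (fst (snd (dec_ar m)))),
    Id = (\<lambda>w. mk_ar w w (\<lambda>j. Id (X j) (po j w))),
    Comp = (\<lambda>g f. mk_ar (enc_ob (fst (dec_ar f))) (enc_ob (fst (snd (dec_ar g))))
      (\<lambda>j. Comp (X j) (pa j g) (pa j f)))\<rparr>"

text \<open>The restrictions are built in, so that an object of the limit can be presented by plain
  lambda terms, as in the arguments of \<open>mk_ob\<close>.\<close>

definition compatible :: "('u \<Rightarrow> 'u) \<Rightarrow> ('u \<Rightarrow> 'u) \<Rightarrow> bool" where
  "compatible x \<phi> \<longleftrightarrow> (restrict x (Ob J), restrict \<phi> (Arr J)) \<in> limit_obs"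

lemma compatible_iff:
  "compatible x \<phi> \<longleftrightarrow> (\<forall>j\<in>Ob J. x j \<in> Ob (X j)) \<and>
    (\<forall>a b. \<forall>f\<in>hom J a b. \<phi> f \<in> isos (X b) (FO (H f) (x a)) (x b)) \<and>
    (\<forall>a\<in>Ob J. Comp (X a) (\<phi> (Id J a)) (At (PU F a) (x a)) = Id (X a) (x a)) \<and>
    (\<forall>a b c. \<forall>f\<in>hom J a b. \<forall>g\<in>hom J b c.
      Comp (X c) (\<phi> (Comp J g f)) (At (PC F g f) (x a)) = Comp (X c) (\<phi> g) (FA (H g) (\<phi> f)))"
proof -
  have "(\<forall>a b. \<forall>f\<in>hom J a b. restrict \<phi> (Arr J) f
        \<in> isos (X b) (FO (H f) (restrict x (Ob J) a)) (restrict x (Ob J) b))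
    \<longleftrightarrow> (\<forall>a b. \<forall>f\<in>hom J a b. \<phi> f \<in> isos (X b) (FO (H f) (x a)) (x b))"
  proof (intro all_cong1 ball_cong[OF refl])
    fix a b f assume f: "f \<in> hom J a b"
    show "restrict \<phi> (Arr J) f \<in> isos (X b) (FO (H f) (restrict x (Ob J) a)) (restrict x (Ob J) b)
      \<longleftrightarrow> \<phi> f \<in> isos (X b) (FO (H f) (x a)) (x b)"
      using J.hom_Ob[OF f] homD(1)[OF f] by simp
  qed
  moreover have "(\<forall>a\<in>Ob J. Comp (X a) (restrict \<phi> (Arr J) (Id J a))
      (At (PU F a) (restrict x (Ob J) a))
        = Id (X a) (restrict x (Ob J) a))
    \<longleftrightarrow> (\<forall>a\<in>Ob J. Comp (X a) (\<phi> (Id J a)) (At (PU F a) (x a)) = Id (X a) (x a))"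
    using homD(1)[OF J.Id_hom] by simp
  moreover have "(\<forall>a b c. \<forall>f\<in>hom J a b. \<forall>g\<in>hom J b c.
      Comp (X c) (restrict \<phi> (Arr J) (Comp J g f)) (At (PC F g f) (restrict x (Ob J) a))
      = Comp (X c) (restrict \<phi> (Arr J) g) (FA (H g) (restrict \<phi> (Arr J) f)))
    \<longleftrightarrow> (\<forall>a b c. \<forall>f\<in>hom J a b. \<forall>g\<in>hom J b c.
      Comp (X c) (\<phi> (Comp J g f)) (At (PC F g f) (x a)) = Comp (X c) (\<phi> g) (FA (H g) (\<phi> f)))"
  proof (intro all_cong1 ball_cong[OF refl])
    fix a b c f g assume f: "f \<in> hom J a b" and g: "g \<in> hom J b c"
    show "Comp (X c) (restrict \<phi> (Arr J) (Comp J g f)) (At (PC F g f) (restrict x (Ob J) a))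
      = Comp (X c) (restrict \<phi> (Arr J) g) (FA (H g) (restrict \<phi> (Arr J) f))
      \<longleftrightarrow> Comp (X c) (\<phi> (Comp J g f)) (At (PC F g f) (x a)) = Comp (X c) (\<phi> g) (FA (H g) (\<phi> f))"
      using J.hom_Ob[OF f] homD(1)[OF f] homD(1)[OF g] homD(1)[OF J.Comp_hom[OF f g]] by simp
  qed
  moreover have "restrict x (Ob J) \<in> (\<Pi>\<^sub>E j\<in>Ob J. Ob (X j)) \<longleftrightarrow> (\<forall>j\<in>Ob J. x j \<in> Ob (X j))"
    by (simp add: restrict_PiE_iff Pi_iff)
  ultimately show ?thesis
    unfolding compatible_def limit_obs_def mem_Collect_eq prod.case by simp
qed

lemma W_Ob:
  assumes "w \<in> Ob W"
  shows "dec_ob w \<in> limit_obs" "enc_ob (dec_ob w) = w"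
  using assms dec(1) by (auto simp: W_def)

lemma W_compatible:
  assumes "w \<in> Ob W"
  shows "compatible (\<lambda>j. po j w) (\<lambda>f. ph f w)"
proof -
  have "(restrict (\<lambda>j. po j w) (Ob J), restrict (\<lambda>f. ph f w) (Arr J)) = dec_ob w"
    using W_Ob(1)[OF assms]
    by (auto simp: po_def ph_def limit_obs_def PiE_def extensional_restrict prod_eq_iff)
  then show ?thesis using W_Ob(1)[OF assms] by (simp add: compatible_def)
qed

lemma po_Ob: "\<lbrakk>w \<in> Ob W; j \<in> Ob J\<rbrakk> \<Longrightarrow> po j w \<in> Ob (X j)"
  and ph_isos: "\<lbrakk>w \<in> Ob W; f \<in> hom J a b\<rbrakk> \<Longrightarrow> ph f w \<in> isos (X b) (FO (H f) (po a w)) (po b w)"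
  and ph_Id: "\<lbrakk>w \<in> Ob W; a \<in> Ob J\<rbrakk> \<Longrightarrow>
    Comp (X a) (ph (Id J a) w) (At (PU F a) (po a w)) = Id (X a) (po a w)"
  and ph_Comp: "\<lbrakk>w \<in> Ob W; f \<in> hom J a b; g \<in> hom J b c\<rbrakk> \<Longrightarrow>
    Comp (X c) (ph (Comp J g f) w) (At (PC F g f) (po a w))
        = Comp (X c) (ph g w) (FA (H g) (ph f w))"
  using W_compatible unfolding compatible_iff by blast+

lemmas ph_hom = isos_hom[OF ph_isos]

lemma mk_ob:
  assumes "compatible x \<phi>"
  shows "mk_ob x \<phi> \<in> Ob W" "j \<in> Ob J \<Longrightarrow> po j (mk_ob x \<phi>) = x j" "f \<in> Arr J \<Longrightarrow> ph f (mk_ob x \<phi>) = \<phi> f"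
  using assms dec(1) by (auto simp: compatible_def mk_ob_def W_def po_def ph_def)

lemma W_ob_eqI:
  assumes "w \<in> Ob W" "w' \<in> Ob W" "\<And>j. j \<in> Ob J \<Longrightarrow> po j w = po j w'"
      "\<And>f. f \<in> Arr J \<Longrightarrow> ph f w = ph f w'"
  shows "w = w'"
proof -
  have "dec_ob w = dec_ob w'"
  proof (rule prod_eqI)
    show "fst (dec_ob w) = fst (dec_ob w')"
      by (rule extensionalityI[of _ "Ob J"])
        (use W_Ob(1)[OF assms(1)] W_Ob(1)[OF assms(2)] assms(3) in \<open>auto simp: limit_obs_def po_def
            PiE_iff\<close>)
    show "snd (dec_ob w) = snd (dec_ob w')"
      by (rule extensionalityI[of _ "Arr J"])
        (use W_Ob(1)[OF assms(1)] W_Ob(1)[OF assms(2)] assms(4) in \<open>auto simp: limit_obs_def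
            ph_def\<close>)
  qed
  then show ?thesis using W_Ob(2)[OF assms(1)] W_Ob(2)[OF assms(2)] by metis
qed

lemma W_homD:
  assumes "m \<in> hom W w w'"
  shows "dec_ar m \<in> limit_ars" "enc_ar (dec_ar m) = m" "fst (dec_ar m) = dec_ob w"
      "fst (snd (dec_ar m)) = dec_ob w'"
    and "w \<in> Ob W" "w' \<in> Ob W" "enc_ob (fst (dec_ar m)) = w" "enc_ob (fst (snd (dec_ar m))) = w'"
proof -
  have m: "m \<in> Arr W" and w: "w = enc_ob (fst (dec_ar m))"
      and w': "w' = enc_ob (fst (snd (dec_ar m)))"
    using homD[OF assms] by (simp_all add: W_def)
  show 1: "dec_ar m \<in> limit_ars" "enc_ar (dec_ar m) = m"
    using m dec(2) by (auto simp: W_def)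
  have "fst (dec_ar m) \<in> limit_obs" "fst (snd (dec_ar m)) \<in> limit_obs"
    using 1 by (auto simp: limit_ars_def)
  then show "fst (dec_ar m) = dec_ob w" "fst (snd (dec_ar m)) = dec_ob w'" "w \<in> Ob W" "w' \<in> Ob W"
    using dec(1) by (auto simp: w w' W_def)
  show "enc_ob (fst (dec_ar m)) = w" "enc_ob (fst (snd (dec_ar m))) = w'" by (simp_all add: w w')
qed

lemma pa_hom:
  assumes "m \<in> hom W w w'"
  shows "j \<in> Ob J \<Longrightarrow> pa j m \<in> hom (X j) (po j w) (po j w')"
    and "f \<in> hom J a b \<Longrightarrow> Comp (X b) (pa b m) (ph f w) = Comp (X b) (ph f w') (FA (H f) (pa a m))"
proof -
  note m = W_homD[OF assms]
  obtain u where u: "dec_ar m = (dec_ob w, dec_ob w', u)"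
    using m(3,4) by (metis prod.collapse)
  show "j \<in> Ob J \<Longrightarrow> pa j m \<in> hom (X j) (po j w) (po j w')"
    and "f \<in> hom J a b \<Longrightarrow> Comp (X b) (pa b m) (ph f w) = Comp (X b) (ph f w') (FA (H f) (pa a m))"
    using m(1) by (auto simp: u limit_ars_def pa_def po_def ph_def)
qed

lemma mk_ar:
  assumes w: "w \<in> Ob W" "w' \<in> Ob W"
    and u: "\<And>j. j \<in> Ob J \<Longrightarrow> u j \<in> hom (X j) (po j w) (po j w')"
    and "\<And>a b f. f \<in> hom J a b \<Longrightarrow> Comp (X b) (u b) (ph f w) = Comp (X b) (ph f w') (FA (H f) (u a))"
  shows "mk_ar w w' u \<in> hom W w w'" "j \<in> Ob J \<Longrightarrow> pa j (mk_ar w w' u) = u j"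
proof -
  have "(dec_ob w, dec_ob w', restrict u (Ob J)) \<in> limit_ars"
    using W_Ob(1)[OF w(1)] W_Ob(1)[OF w(2)] u assms(4) J.hom_Ob
    by (auto simp: limit_ars_def po_def ph_def)
  then show "mk_ar w w' u \<in> hom W w w'" "j \<in> Ob J \<Longrightarrow> pa j (mk_ar w w' u) = u j"
    using dec(2) W_Ob(2)[OF w(1)] W_Ob(2)[OF w(2)] by (auto simp: hom_def W_def mk_ar_def pa_def)
qed

text \<open>Parallel arrows have the same stored endpoints, so their codes can differ in the
  components only. This is the device by which equations are transferred from the \<open>X j\<close>
  to \<open>W\<close>.\<close>

lemma W_ar_eqI:
  assumes "m \<in> hom W w w'" "m' \<in> hom W w w'" "\<And>j. j \<in> Ob J \<Longrightarrow> pa j m = pa j m'"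
  shows "m = m'"
proof -
  note m = W_homD[OF assms(1)] and m' = W_homD[OF assms(2)]
  have "snd (snd (dec_ar m)) = snd (snd (dec_ar m'))"
    by (rule extensionalityI[of _ "Ob J"])
      (use m(1) m'(1) assms(3) in \<open>auto simp: limit_ars_def pa_def PiE_iff\<close>)
  then have "dec_ar m = dec_ar m'"
    using m(3,4) m'(3,4) by (simp add: prod_eq_iff)
  then show ?thesis using m(2) m'(2) by metis
qed

lemma W_Id_hom:
  assumes w: "w \<in> Ob W"
  shows "Id W w \<in> hom W w w" "j \<in> Ob J \<Longrightarrow> pa j (Id W w) = Id (X j) (po j w)"
proof -
  have 1: "Id (X j) (po j w) \<in> hom (X j) (po j w) (po j w)" if "j \<in> Ob J" for j
    using category.Id_hom[OF X_category[OF that] po_Ob[OF w that]] .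
  have 2: "Comp (X b) (Id (X b) (po b w)) (ph f w)
      = Comp (X b) (ph f w) (FA (H f) (Id (X a) (po a w)))"
    if f: "f \<in> hom J a b" for f a b
  proof -
    note ob = J.hom_Ob[OF f]
    show ?thesis
      using category.Id_Comp[OF X_category[OF ob(2)] ph_hom[OF w f]]
          functorsD(5)[OF H_functor[OF f] po_Ob[OF w ob(1)]]
        category.Comp_Id[OF X_category[OF ob(2)] ph_hom[OF w f]] by simp
  qed
  show "Id W w \<in> hom W w w" "j \<in> Ob J \<Longrightarrow> pa j (Id W w) = Id (X j) (po j w)"
    using mk_ar[OF w w, of "\<lambda>j. Id (X j) (po j w)", OF 1 2] by (simp_all add: W_def)
qed

lemma W_Comp_hom:
  assumes f: "f \<in> hom W w w'" and g: "g \<in> hom W w' w''"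
  shows "Comp W g f \<in> hom W w w''" "j \<in> Ob J \<Longrightarrow> pa j (Comp W g f) = Comp (X j) (pa j g) (pa j f)"
proof -
  note wf = W_homD[OF f] and wg = W_homD[OF g]
  have 1: "Comp (X j) (pa j g) (pa j f) \<in> hom (X j) (po j w) (po j w'')" if "j \<in> Ob J" for j
    using category.Comp_hom[OF X_category[OF that] pa_hom(1)[OF f that] pa_hom(1)[OF g that]] .
  have 2: "Comp (X b) (Comp (X b) (pa b g) (pa b f)) (ph h w)
    = Comp (X b) (ph h w'') (FA (H h) (Comp (X a) (pa a g) (pa a f)))"
    if h: "h \<in> hom J a b" for h a b
  proof -
    note ob = J.hom_Ob[OF h]
    interpret B: category "X b" using X_category[OF ob(2)] .
    note fa = pa_hom(1)[OF f ob(1)] and fb = pa_hom(1)[OF f ob(2)]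
    note ga = pa_hom(1)[OF g ob(1)] and gb = pa_hom(1)[OF g ob(2)]
    note hh = functorsD(4)[OF H_functor[OF h]]
    show ?thesis
      using B.paste[OF hh[OF fa] hh[OF ga] fb gb ph_hom[OF wf(5) h] ph_hom[OF wf(6) h]
          ph_hom[OF wg(6) h]
          pa_hom(2)[OF f h, symmetric] pa_hom(2)[OF g h, symmetric]]
        functorsD(6)[OF H_functor[OF h] fa ga] by simp
  qed
  show "Comp W g f \<in> hom W w w''" "j \<in> Ob J \<Longrightarrow> pa j (Comp W g f) = Comp (X j) (pa j g) (pa j f)"
    using mk_ar[OF wf(5) wg(6), of "\<lambda>j. Comp (X j) (pa j g) (pa j f)", OF 1 2] wf(7) wg(8)
        by (simp_all add: W_def)
qed

sublocale W: category W
proof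
  show "Dom W m \<in> Ob W" "Cod W m \<in> Ob W" if "m \<in> Arr W" for m
    using W_homD(5,6)[OF Arr_hom[OF that]] by auto
  show "Id W w \<in> hom W w w" if "w \<in> Ob W" for w by (rule W_Id_hom(1)[OF that])
  show "Comp W g f \<in> hom W w w''" if "f \<in> hom W w w'" "g \<in> hom W w' w''" for f g w w' w''
    by (rule W_Comp_hom(1)[OF that])
next
  fix f a b assume f: "f \<in> hom W a b"
  note ab = W_homD(5,6)[OF f]
  show "Comp W f (Id W a) = f"
  proof (rule W_ar_eqI[OF W_Comp_hom(1)[OF W_Id_hom(1)[OF ab(1)] f] f])
    fix j assume j: "j \<in> Ob J"
    show "pa j (Comp W f (Id W a)) = pa j f"
      using category.Comp_Id[OF X_category[OF j] pa_hom(1)[OF f j]]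
      by (simp add: W_Comp_hom(2)[OF W_Id_hom(1)[OF ab(1)] f j] W_Id_hom(2)[OF ab(1) j])
  qed
  show "Comp W (Id W b) f = f"
  proof (rule W_ar_eqI[OF W_Comp_hom(1)[OF f W_Id_hom(1)[OF ab(2)]] f])
    fix j assume j: "j \<in> Ob J"
    show "pa j (Comp W (Id W b) f) = pa j f"
      using category.Id_Comp[OF X_category[OF j] pa_hom(1)[OF f j]]
      by (simp add: W_Comp_hom(2)[OF f W_Id_hom(1)[OF ab(2)] j] W_Id_hom(2)[OF ab(2) j])
  qed
next
  fix f g h a b c d assume f: "f \<in> hom W a b" and g: "g \<in> hom W b c" and h: "h \<in> hom W c d"
  note gf = W_Comp_hom(1)[OF f g] and hg = W_Comp_hom(1)[OF g h]
  show "Comp W h (Comp W g f) = Comp W (Comp W h g) f"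
  proof (rule W_ar_eqI[OF W_Comp_hom(1)[OF gf h] W_Comp_hom(1)[OF f hg]])
    fix j assume j: "j \<in> Ob J"
    show "pa j (Comp W h (Comp W g f)) = pa j (Comp W (Comp W h g) f)"
      using category.Comp_assoc[OF X_category[OF j] pa_hom(1)[OF f j] pa_hom(1)[OF g j]
          pa_hom(1)[OF h j]]
      by (simp add: W_Comp_hom(2)[OF gf h j] W_Comp_hom(2)[OF f g j] W_Comp_hom(2)[OF f hg j]
          W_Comp_hom(2)[OF g h j])
  qed
qed

lemma W_small: "small_cat U W"
  unfolding small_cat_def using W.category_axioms enc by (simp add: W_def)

text \<open>The componentwise inverses satisfy the compatibility condition by
  \<open>square_inverse\<close>, applied to the square of \<open>m\<close> at \<open>f\<close>;
  \<open>H f\<close> carries the inverse over the domain of \<open>f\<close> to an inverse of the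
  image.\<close>

lemma W_isos:
  assumes m: "m \<in> hom W w w'" and i: "\<And>j. j \<in> Ob J \<Longrightarrow> pa j m \<in> isos (X j) (po j w) (po j w')"
  shows "m \<in> isos W w w'"
proof -
  have "\<forall>j. \<exists>v. j \<in> Ob J \<longrightarrow> v \<in> hom (X j) (po j w') (po j w) \<and> Comp (X j) v (pa j m)
      = Id (X j) (po j w) \<and>
      Comp (X j) (pa j m) v = Id (X j) (po j w')"
    using i unfolding isos_def by blast
  then obtain v where v: "\<And>j. j \<in> Ob J \<Longrightarrow> v j \<in> hom (X j) (po j w') (po j w)"
    "\<And>j. j \<in> Ob J \<Longrightarrow> Comp (X j) (v j) (pa j m) = Id (X j) (po j w)"
    "\<And>j. j \<in> Ob J \<Longrightarrow> Comp (X j) (pa j m) (v j) = Id (X j) (po j w')"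
    by metis
  note w = W_homD(5,6)[OF m]
  have c: "Comp (X b) (v b) (ph f w') = Comp (X b) (ph f w) (FA (H f) (v a))" if f: "f \<in> hom J a b"
      for f a b
  proof -
    note ob = J.hom_Ob[OF f]
    interpret B: category "X b" using X_category[OF ob(2)] .
    note hh = functorsD(4)[OF H_functor[OF f]]
    have e: "Comp (X b) (FA (H f) (pa a m)) (FA (H f) (v a)) = Id (X b) (FO (H f) (po a w'))"
      using functorsD(6)[OF H_functor[OF f] v(1)[OF ob(1)] pa_hom(1)[OF m ob(1)]] v(3)[OF ob(1)]
        functorsD(5)[OF H_functor[OF f] po_Ob[OF w(2) ob(1)]] by simp
    show ?thesis
      by (rule B.square_inverse[OF hh[OF pa_hom(1)[OF m ob(1)]] hh[OF v(1)[OF ob(1)]] e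
            pa_hom(1)[OF m ob(2)] v(1,2)[OF ob(2)] ph_hom[OF w(1) f] ph_hom[OF w(2) f]
                pa_hom(2)[OF m f, symmetric]])
  qed
  have n: "mk_ar w' w v \<in> hom W w' w" "\<And>j. j \<in> Ob J \<Longrightarrow> pa j (mk_ar w' w v) = v j"
    using mk_ar[OF w(2,1), of v, OF v(1) c] by simp_all
  show ?thesis
  proof (rule isosI[OF m n(1)])
    show "Comp W (mk_ar w' w v) m = Id W w"
      by (rule W_ar_eqI[OF W_Comp_hom(1)[OF m n(1)] W_Id_hom(1)[OF w(1)]])
        (simp add: W_Comp_hom(2)[OF m n(1)] W_Id_hom(2)[OF w(1)] n(2) v(2))
    show "Comp W m (mk_ar w' w v) = Id W w'"
      by (rule W_ar_eqI[OF W_Comp_hom(1)[OF n(1) m] W_Id_hom(1)[OF w(2)]])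
        (simp add: W_Comp_hom(2)[OF n(1) m] W_Id_hom(2)[OF w(2)] n(2) v(3))
  qed
qed

end

section \<open>The pseudo algebra structure on the limit category\<close>

lemma blk_cong:
  assumes "\<And>i. i < k \<Longrightarrow> n i = n' i" "i < k"
  shows "blk n i x = blk n' i x"
  using assms offset_cong[of i n n'] by (simp add: blk_restrict incl_def)

text \<open>The arities in \<open>cW\<close> are read off from the words as
  \<open>Dom T (ws i)\<close>, which is known to be the given \<open>n i\<close> for
  \<open>i < k\<close> only. This lemma and \<open>wgamma_arity_cong\<close> pass from one to the
  other.\<close>

lemma gammaF_arity_cong:
  assumes "\<And>i. i < k \<Longrightarrow> n i = n' i"
  shows "gammaF X k n F Fs = gammaF X k n' F Fs"
proof -
  have "prodF X k n Fs = prodF X k n' Fs"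
    using offset_cong[of k n n', OF assms]
    by (simp add: prodF_def blk_cong[of k n n', OF assms] cong: restrict_cong)
  then show ?thesis using offset_cong[of k n n', OF assms] by (simp add: gammaF_def)
qed

section \<open>Functors and natural transformations into the limit category\<close>

context diagram
begin

definition liftF where
  "liftF D L lam = \<lparr>FO = (\<lambda>x\<in>Ob D. mk_ob (\<lambda>j. FO (L j) x) (\<lambda>f. lam f x)),
    FA = (\<lambda>m\<in>Arr D. mk_ar (mk_ob (\<lambda>j. FO (L j) (Dom D m)) (\<lambda>f. lam f (Dom D m)))
      (mk_ob (\<lambda>j. FO (L j) (Cod D m)) (\<lambda>f. lam f (Cod D m))) (\<lambda>j. FA (L j) m))\<rparr>"

text \<open>The existence half of the universal property of \<open>W\<close> among categories. It
  produces both the functors \<open>PhiW w\<close> and the functor underlying the morphism induced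
  by a cone.\<close>

lemma liftF:
  assumes D: "category D" and L: "\<And>j. j \<in> Ob J \<Longrightarrow> L j \<in> functors D (X j)"
    and comp: "\<And>x. x \<in> Ob D \<Longrightarrow> compatible (\<lambda>j. FO (L j) x) (\<lambda>f. lam f x)"
    and nat: "\<And>a b f x y m. \<lbrakk>f \<in> hom J a b; m \<in> hom D x y\<rbrakk> \<Longrightarrow>
      Comp (X b) (FA (L b) m) (lam f x) = Comp (X b) (lam f y) (FA (H f) (FA (L a) m))"
  shows "liftF D L lam \<in> functors D W"
    and "\<lbrakk>x \<in> Ob D; j \<in> Ob J\<rbrakk> \<Longrightarrow> po j (FO (liftF D L lam) x) = FO (L j) x"
    and "\<lbrakk>x \<in> Ob D; f \<in> Arr J\<rbrakk> \<Longrightarrow> ph f (FO (liftF D L lam) x) = lam f x"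
    and "\<lbrakk>m \<in> Arr D; j \<in> Ob J\<rbrakk> \<Longrightarrow> pa j (FA (liftF D L lam) m) = FA (L j) m"
proof -
  interpret D: category D by fact
  let ?G = "liftF D L lam"
  have FO: "FO ?G x = mk_ob (\<lambda>j. FO (L j) x) (\<lambda>f. lam f x)" if "x \<in> Ob D" for x
    using that by (simp add: liftF_def)
  have Ob: "FO ?G x \<in> Ob W" if "x \<in> Ob D" for x
    using mk_ob(1)[OF comp[OF that]] by (simp add: FO[OF that])
  show po: "po j (FO ?G x) = FO (L j) x" if "x \<in> Ob D" "j \<in> Ob J" for x j
    using mk_ob(2)[OF comp] that by (simp add: FO)
  show ph: "ph f (FO ?G x) = lam f x" if "x \<in> Ob D" "f \<in> Arr J" for x f
    using mk_ob(3)[OF comp] that by (simp add: FO)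
  have FA: "FA ?G m = mk_ar (FO ?G x) (FO ?G y) (\<lambda>j. FA (L j) m)" if "m \<in> hom D x y" for m x y
    using homD[OF that] D.hom_Ob[OF that] FO by (simp add: liftF_def)
  have ar: "FA ?G m \<in> hom W (FO ?G x) (FO ?G y)" "j \<in> Ob J \<Longrightarrow> pa j (FA ?G m) = FA (L j) m"
    if m: "m \<in> hom D x y" for m x y j
  proof -
    note xy = D.hom_Ob[OF m]
    have 1: "FA (L j) m \<in> hom (X j) (po j (FO ?G x)) (po j (FO ?G y))" if "j \<in> Ob J" for j
      using functorsD(4)[OF L[OF that] m] po xy that by simp
    have 2: "Comp (X b) (FA (L b) m) (ph f (FO ?G x))
        = Comp (X b) (ph f (FO ?G y)) (FA (H f) (FA (L a) m))"
      if "f \<in> hom J a b" for f a b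
      using nat[OF that m] ph xy homD(1)[OF that] by simp
    show "FA ?G m \<in> hom W (FO ?G x) (FO ?G y)" "j \<in> Ob J \<Longrightarrow> pa j (FA ?G m) = FA (L j) m"
      using mk_ar[OF Ob[OF xy(1)] Ob[OF xy(2)], of "\<lambda>j. FA (L j) m", OF 1 2] FA[OF m] by simp_all
  qed
  show pa: "pa j (FA ?G m) = FA (L j) m" if "m \<in> Arr D" "j \<in> Ob J" for m j
    using ar(2)[OF Arr_hom[OF that(1)] that(2)] .
  show "?G \<in> functors D W"
  proof (rule functorsI)
    show "FO ?G \<in> extensional (Ob D)" "FA ?G \<in> extensional (Arr D)"
      by (simp_all add: liftF_def)
    show "FO ?G x \<in> Ob W" if "x \<in> Ob D" for x by (rule Ob[OF that])
    show "FA ?G m \<in> hom W (FO ?G x) (FO ?G y)" if "m \<in> hom D x y" for m x y by (rule ar(1)[OF that])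
    show "FA ?G (Id D x) = Id W (FO ?G x)" if x: "x \<in> Ob D" for x
    proof (rule W_ar_eqI[OF ar(1)[OF D.Id_hom[OF x]] W_Id_hom(1)[OF Ob[OF x]]])
      fix j assume j: "j \<in> Ob J"
      show "pa j (FA ?G (Id D x)) = pa j (Id W (FO ?G x))"
        using ar(2)[OF D.Id_hom[OF x] j] W_Id_hom(2)[OF Ob[OF x] j] functorsD(5)[OF L[OF j] x]
            po[OF x j] by simp
    qed
    show "FA ?G (Comp D g f) = Comp W (FA ?G g) (FA ?G f)" if f: "f \<in> hom D x y"
        and g: "g \<in> hom D y z" for x y z f g
    proof (rule W_ar_eqI[OF ar(1)[OF D.Comp_hom[OF f g]] W_Comp_hom(1)[OF ar(1)[OF f] ar(1)[OF g]]])
      fix j assume j: "j \<in> Ob J"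
      show "pa j (FA ?G (Comp D g f)) = pa j (Comp W (FA ?G g) (FA ?G f))"
        using ar(2)[OF D.Comp_hom[OF f g] j] W_Comp_hom(2)[OF ar(1)[OF f] ar(1)[OF g] j]
            functorsD(6)[OF L[OF j] f g]
          ar(2)[OF f j] ar(2)[OF g j] by simp
    qed
  qed
qed

definition liftN where
  "liftN D G G' t = \<lparr>Source = G, Target = G', At = (\<lambda>x\<in>Ob D. mk_ar (FO G x) (FO G' x) (\<lambda>j. t j x))\<rparr>"

text \<open>The counterpart of \<open>liftF\<close> for transformations: the hypothesis
  \<open>comp\<close> turns the components at \<open>x\<close> into one arrow of \<open>W\<close>,
  and naturality is tested by \<open>W_ar_eqI\<close>. The coherence isomorphisms of the limit and
  \<open>rho\<close> of a lifted morphism arise in this way.\<close>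

lemma liftN:
  assumes D: "category D" and G: "G \<in> functors D W" and G': "G' \<in> functors D W"
    and t: "\<And>j x. \<lbrakk>j \<in> Ob J; x \<in> Ob D\<rbrakk> \<Longrightarrow> t j x \<in> hom (X j) (po j (FO G x)) (po j (FO G' x))"
    and nat: "\<And>j x y m. \<lbrakk>j \<in> Ob J; m \<in> hom D x y\<rbrakk> \<Longrightarrow>
      Comp (X j) (t j y) (pa j (FA G m)) = Comp (X j) (pa j (FA G' m)) (t j x)"
    and comp: "\<And>a b f x. \<lbrakk>f \<in> hom J a b; x \<in> Ob D\<rbrakk> \<Longrightarrow>
      Comp (X b) (t b x) (ph f (FO G x)) = Comp (X b) (ph f (FO G' x)) (FA (H f) (t a x))"
  shows "liftN D G G' t \<in> nats D W G G'"
    and "\<lbrakk>x \<in> Ob D; j \<in> Ob J\<rbrakk> \<Longrightarrow> pa j (At (liftN D G G' t) x) = t j x"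
proof -
  interpret D: category D by fact
  let ?t = "liftN D G G' t"
  have ar: "At ?t x \<in> hom W (FO G x) (FO G' x)" "j \<in> Ob J \<Longrightarrow> pa j (At ?t x) = t j x"
    if x: "x \<in> Ob D" for x j
    using mk_ar[OF functorsD(3)[OF G x] functorsD(3)[OF G' x], of "\<lambda>j. t j x", OF t comp, OF _ x _
        x] x
    by (simp_all add: liftN_def)
  show "pa j (At ?t x) = t j x" if "x \<in> Ob D" "j \<in> Ob J" for x j by (rule ar(2)[OF that])
  show "?t \<in> nats D W G G'"
  proof (rule natsI[OF G G'])
    show "Source ?t = G" "Target ?t = G'" "At ?t \<in> extensional (Ob D)" by (simp_all add: liftN_def)
    show "At ?t x \<in> hom W (FO G x) (FO G' x)" if "x \<in> Ob D" for x by (rule ar(1)[OF that])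
    show "Comp W (At ?t y) (FA G m) = Comp W (FA G' m) (At ?t x)" if m: "m \<in> hom D x y" for m x y
    proof -
      note xy = D.hom_Ob[OF m]
      note g = functorsD(4)[OF G m] and g' = functorsD(4)[OF G' m]
      show ?thesis
      proof (rule W_ar_eqI[OF W_Comp_hom(1)[OF g ar(1)[OF xy(2)]]
          W_Comp_hom(1)[OF ar(1)[OF xy(1)] g']])
        fix j assume j: "j \<in> Ob J"
        show "pa j (Comp W (At ?t y) (FA G m)) = pa j (Comp W (FA G' m) (At ?t x))"
          using nat[OF j m] ar(2)[OF xy(1) j] ar(2)[OF xy(2) j]
              W_Comp_hom(2)[OF g ar(1)[OF xy(2)] j]
            W_Comp_hom(2)[OF ar(1)[OF xy(1)] g' j] by simp
      qed
    qed
  qed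
qed

lemma liftN_iso:
  assumes "\<alpha> \<in> nats D W G G'"
    and "\<And>j x. \<lbrakk>j \<in> Ob J; x \<in> Ob D\<rbrakk> \<Longrightarrow> pa j (At \<alpha> x) \<in> isos (X j) (po j (FO G x)) (po j (FO G' x))"
  shows "\<alpha> \<in> nat_isos D W G G'"
  using assms by (intro nat_isosI W_isos natsD(6)) auto

definition proj :: "'u \<Rightarrow> ('u, 'u, 'u, 'u) ftor" where
  "proj j = \<lparr>FO = (\<lambda>w\<in>Ob W. po j w), FA = (\<lambda>m\<in>Arr W. pa j m)\<rparr>"

lemma FO_proj: "w \<in> Ob W \<Longrightarrow> FO (proj j) w = po j w"
  and FA_proj: "m \<in> Arr W \<Longrightarrow> FA (proj j) m = pa j m"
  by (simp_all add: proj_def)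

lemma proj_functor: "j \<in> Ob J \<Longrightarrow> proj j \<in> functors W (X j)"
proof (rule functorsI)
  assume j: "j \<in> Ob J"
  show "FO (proj j) \<in> extensional (Ob W)" "FA (proj j) \<in> extensional (Arr W)"
    by (simp_all add: proj_def)
  show "FO (proj j) w \<in> Ob (X j)" if "w \<in> Ob W" for w
    using po_Ob[OF that j] that by (simp add: FO_proj)
  show "FA (proj j) m \<in> hom (X j) (FO (proj j) w) (FO (proj j) w')" if "m \<in> hom W w w'" for m w w'
    using pa_hom(1)[OF that j] W.hom_Ob[OF that] homD(1)[OF that] by (simp add: FO_proj FA_proj)
  show "FA (proj j) (Id W w) = Id (X j) (FO (proj j) w)" if "w \<in> Ob W" for w
    using that homD(1)[OF W.Id_hom[OF that]] W_Id_hom(2)[OF that j] by (simp add: FO_proj FA_proj)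
  show "FA (proj j) (Comp W g f) = Comp (X j) (FA (proj j) g) (FA (proj j) f)"
    if "f \<in> hom W a b" "g \<in> hom W b c" for a b c f g
    using W_Comp_hom(2)[OF that j] homD(1)[OF W.Comp_hom[OF that]] homD(1)[OF that(1)]
        homD(1)[OF that(2)]
    by (simp add: FA_proj)
qed

abbreviation "pos n j x \<equiv> (\<lambda>i\<in>{..<n}. po j (x i))"
abbreviation "pas n j u \<equiv> (\<lambda>i\<in>{..<n}. pa j (u i))"
abbreviation "phs n f x \<equiv> (\<lambda>i\<in>{..<n}. ph f (x i))"

lemma pos_Ob:
  assumes "x \<in> Ob (pw W n)" "j \<in> Ob J"
  shows "pos n j x \<in> Ob (pw (X j) n)"
  using po_Ob[OF pw_Ob_nth[OF assms(1)] assms(2)] by (auto simp: pw_simps(1))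

lemma pas_hom:
  assumes "u \<in> hom (pw W n) x y" "j \<in> Ob J"
  shows "pas n j u \<in> hom (pw (X j) n) (pos n j x) (pos n j y)"
  using assms(1) pa_hom(1)[OF _ assms(2)] by (simp add: hom_pw)

lemma phs_isos:
  assumes "x \<in> Ob (pw W n)" "f \<in> hom J a b"
  shows "phs n f x \<in> isos (pw (X b) n) (\<lambda>i\<in>{..<n}. FO (H f) (pos n a x i)) (pos n b x)"
  using ph_isos[OF pw_Ob_nth[OF assms(1)] assms(2)] by (intro pw_isos) simp_all

lemmas phs_hom = isos_hom[OF phs_isos]

text \<open>The intended composite of \<open>PhiW w\<close> with the projection to \<open>j\<close>,
  available before \<open>PhiW\<close> is constructed. The identity on it becomes \<open>rho\<close>
  of that projection.\<close>

definition PhiF :: "'t \<Rightarrow> nat \<Rightarrow> 'u \<Rightarrow> (nat \<Rightarrow> 'u, nat \<Rightarrow> 'u, 'u, 'u) ftor" where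
  "PhiF w n j = fcomp (pw W n) (Phi (A j) w) (powF W n (proj j))"

text \<open>
  The structure isomorphism at \<open>f\<close> of the object \<open>\<Phi>(w)(x\<^sub>0, ..., x\<^sub>n\<^sub>-\<^sub>1)\<close> of the limit: first
  \<open>\<rho>\<^sub>w\<close> of the morphism \<open>F f\<close>, then \<open>\<Phi>(w)\<close> of the structure isomorphisms of the \<open>x\<^sub>i\<close>.
\<close>

definition lam :: "'t \<Rightarrow> nat \<Rightarrow> 'u \<Rightarrow> (nat \<Rightarrow> 'u) \<Rightarrow> 'u" where
  "lam w n f x = Comp (X (Cod J f)) (FA (Phi (A (Cod J f)) w) (phs n f x))
    (At (rho (PA F f) w) (pos n (Dom J f) x))"

definition PhiW :: "'t \<Rightarrow> (nat \<Rightarrow> 'u, nat \<Rightarrow> 'u, 'u, 'u) ftor" where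
  "PhiW w = liftF (pw W (Dom T w)) (PhiF w (Dom T w)) (lam w (Dom T w))"

lemma PhiF_functor:
  assumes w: "w \<in> words T n" and j: "j \<in> Ob J"
  shows "PhiF w n j \<in> functors (pw W n) (X j)"
proof -
  interpret Aj: algebra_data T "X j" "Phi (A j)" "cc (A j)" "II (A j)" "ss (A j)"
      by (rule A_data[OF j])
  show ?thesis
    unfolding PhiF_def
    by (rule fcomp_functor[OF powF_functor[OF W.category_axioms proj_functor[OF j]]
        Aj.Phi_functor[OF w]
          pw_category[OF W.category_axioms]])
qed

lemma FO_PhiF: "x \<in> Ob (pw W n) \<Longrightarrow> FO (PhiF w n j) x = FO (Phi (A j) w) (pos n j x)"
  by (simp add: PhiF_def FO_fcomp FO_powF FO_proj pw_Ob_nth cong: restrict_cong)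

lemma FA_PhiF:
  assumes "u \<in> Arr (pw W n)"
  shows "FA (PhiF w n j) u = FA (Phi (A j) w) (pas n j u)"
proof -
  have "u i \<in> Arr W" if "i < n" for i using assms that by (auto simp: pw_simps(2))
  then show ?thesis using assms by (simp add: PhiF_def FA_fcomp FA_powF FA_proj cong: restrict_cong)
qed

lemma lam_eq:
  assumes "f \<in> hom J a b"
  shows "lam w n f x = Comp (X b) (FA (Phi (A b) w) (phs n f x)) (At (rho (PA F f) w) (pos n a x))"
  using homD[OF assms] by (simp add: lam_def)

lemma lam_parts:
  assumes w: "w \<in> words T n" and x: "x \<in> Ob (pw W n)" and f: "f \<in> hom J a b"
  shows "At (rho (PA F f) w) (pos n a x) \<in> isos (X b) (FO (H f) (FO (Phi (A a) w) (pos n a x)))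
      (FO (Phi (A b) w) (\<lambda>i\<in>{..<n}. FO (H f) (pos n a x i)))"
    and "FA (Phi (A b) w) (phs n f x) \<in> isos (X b)
        (FO (Phi (A b) w) (\<lambda>i\<in>{..<n}. FO (H f) (pos n a x i)))
      (FO (Phi (A b) w) (pos n b x))"
proof -
  note ob = J.hom_Ob[OF f]
  interpret M: morphism_data T "A a" "A b" "PA F f" by (rule M_data[OF f])
  show "At (rho (PA F f) w) (pos n a x) \<in> isos (X b) (FO (H f) (FO (Phi (A a) w) (pos n a x)))
      (FO (Phi (A b) w) (\<lambda>i\<in>{..<n}. FO (H f) (pos n a x i)))"
    by (rule M.rho_isos[OF w pos_Ob[OF x ob(1)]])
  show "FA (Phi (A b) w) (phs n f x) \<in> isos (X b)
      (FO (Phi (A b) w) (\<lambda>i\<in>{..<n}. FO (H f) (pos n a x i)))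
      (FO (Phi (A b) w) (pos n b x))"
    by (rule functor_isos[OF M.B.Phi_functor[OF w] pw_category[OF M.B_cat] phs_isos[OF x f]])
qed

lemma lam_isos:
  assumes w: "w \<in> words T n" and x: "x \<in> Ob (pw W n)" and f: "f \<in> hom J a b"
  shows "lam w n f x \<in> isos (X b) (FO (H f) (FO (Phi (A a) w) (pos n a x)))
      (FO (Phi (A b) w) (pos n b x))"
  unfolding lam_eq[OF f] by (rule category.Comp_isos[OF X_category[OF J.hom_Ob(2)[OF f]]
      lam_parts[OF assms]])

text \<open>Since \<open>PU F a\<close> is a 2-cell from the identity morphism, whose
  \<open>rho\<close> is an identity, it moves past \<open>rho\<close> into the arguments of
  \<open>Phi (A a) w\<close>. There the unit condition of each \<open>x i\<close> cancels
  it.\<close>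

lemma lam_Id:
  assumes w: "w \<in> words T n" and x: "x \<in> Ob (pw W n)" and a: "a \<in> Ob J"
  shows "Comp (X a) (lam w n (Id J a) x) (At (PU F a) (FO (Phi (A a) w) (pos n a x)))
    = Id (X a) (FO (Phi (A a) w) (pos n a x))"
proof -
  note f = J.Id_hom[OF a]
  interpret M: morphism_data T "A a" "A a" "PA F (Id J a)" by (rule M_data[OF f])
  let ?y = "pos n a x"
  note y = pos_Ob[OF x a] and xi = pw_Ob_nth[OF x]
  note Py = functorsD(3)[OF M.A.Phi_functor[OF w] y]
  note h = PU_hom[OF a Py] and p = lam_parts[OF w x f, THEN isos_hom]
  have pu: "(\<lambda>i\<in>{..<n}. At (PU F a) (?y i)) \<in> hom (pw (X a) n) ?y
      (\<lambda>i\<in>{..<n}. FO (H (Id J a)) (?y i))"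
    using PU_hom[OF a po_Ob[OF xi a]] by (simp add: hom_pw)
  have e: "Comp (X a) (At (rho (PA F (Id J a)) w) ?y) (At (PU F a) (FO (Phi (A a) w) ?y))
    = FA (Phi (A a) w) (\<lambda>i\<in>{..<n}. At (PU F a) (?y i))"
    using T.pscellsD(7)[OF A_psalg[OF a] A_psalg[OF a] PU_cell(1)[OF a] w y] PU_cell(2,3)[OF a]
      T.At_rho_id[OF w y] M.A.X.Comp_Id[OF functorsD(4)[OF M.A.Phi_functor[OF w] pu]] by simp
  have "Comp (X a) (lam w n (Id J a) x) (At (PU F a) (FO (Phi (A a) w) ?y))
    = Comp (X a) (FA (Phi (A a) w) (phs n (Id J a) x))
        (FA (Phi (A a) w) (\<lambda>i\<in>{..<n}. At (PU F a) (?y i)))"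
    unfolding lam_eq[OF f] e[symmetric] by (rule M.A.X.Comp_assoc[OF h p, symmetric])
  also have "\<dots> = FA (Phi (A a) w) (\<lambda>i\<in>{..<n}. Comp (X a) (phs n (Id J a) x i)
      ((\<lambda>i\<in>{..<n}. At (PU F a) (?y i)) i))"
    by (rule M.A.Phi_Comp[OF w pu phs_hom[OF x f], symmetric])
  also have "\<dots> = FA (Phi (A a) w) (\<lambda>i\<in>{..<n}. Id (X a) (?y i))"
    using ph_Id[OF xi a] by (simp cong: restrict_cong)
  also have "\<dots> = Id (X a) (FO (Phi (A a) w) ?y)"
    by (rule M.A.Phi_Id[OF w y])
  finally show ?thesis .
qed

text \<open>The 2-cell law of \<open>PC F g f\<close> moves this cell past \<open>rho\<close> into
  the arguments of \<open>Phi (A c) w\<close> (\<open>e\<close>), where the composition condition of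
  each \<open>x i\<close> applies (\<open>e2\<close>).\<close>

lemma lam_Comp:
  assumes w: "w \<in> words T n" and x: "x \<in> Ob (pw W n)" and f: "f \<in> hom J a b" and g: "g \<in> hom J b c"
  shows "Comp (X c) (lam w n (Comp J g f) x) (At (PC F g f) (FO (Phi (A a) w) (pos n a x)))
    = Comp (X c) (lam w n g x) (FA (H g) (lam w n f x))"
proof -
  note gf = J.Comp_hom[OF f g] and obf = J.hom_Ob[OF f] and obg = J.hom_Ob[OF g]
  interpret f: morphism_data T "A a" "A b" "PA F f" by (rule M_data[OF f])
  interpret g: morphism_data T "A b" "A c" "PA F g" by (rule M_data[OF g])
  interpret gf: morphism_data T "A a" "A c" "PA F (Comp J g f)" by (rule M_data[OF gf])
  let ?y = "pos n a x" and ?z = "\<lambda>i\<in>{..<n}. FO (H f) (pos n a x i)" and ?P = "FA (Phi (A c) w)"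
  note y = pos_Ob[OF x obf(1)] and xi = pw_Ob_nth[OF x]
  note z = f.pow_Ob[OF y]
  note Py = functorsD(3)[OF f.A.Phi_functor[OF w] y]
  note pf = lam_parts[OF w x f, THEN isos_hom] and pg = lam_parts[OF w x g, THEN isos_hom]
    and pgf = lam_parts[OF w x gf, THEN isos_hom]
  note h = PC_hom[OF f g Py]
  have pc: "(\<lambda>i\<in>{..<n}. At (PC F g f) (?y i)) \<in> hom (pw (X c) n) (\<lambda>i\<in>{..<n}. FO (H g) (?z i))
      (\<lambda>i\<in>{..<n}. FO (H (Comp J g f)) (?y i))"
    using PC_hom[OF f g po_Ob[OF xi obf(1)]] by (simp add: hom_pw)
  have hf: "(\<lambda>i\<in>{..<n}. FA (H g) (phs n f x i)) \<in> hom (pw (X c) n) (\<lambda>i\<in>{..<n}. FO (H g) (?z i))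
      (\<lambda>i\<in>{..<n}. FO (H g) (pos n b x i))"
    using functorsD(4)[OF g.fun_functor ph_hom[OF xi f]] by (simp add: hom_pw)
  note Pc = functorsD(4)[OF g.B.Phi_functor[OF w]] and Hg = functorsD(4)[OF g.fun_functor]
  note r = g.rho_hom[OF w z]
  have e: "Comp (X c) (At (rho (PA F (Comp J g f)) w) ?y) (At (PC F g f) (FO (Phi (A a) w) ?y))
    = Comp (X c) (?P (\<lambda>i\<in>{..<n}. At (PC F g f) (?y i)))
      (Comp (X c) (At (rho (PA F g) w) ?z) (FA (H g) (At (rho (PA F f) w) ?y)))"
    using T.pscellsD(7)[OF A_psalg[OF obf(1)] A_psalg[OF obg(2)] PC_cell(1)[OF f g] w y]
        PC_cell(2,3)[OF f g]
      T.At_rho_psmor_comp[OF A_psalg[OF obf(1)] A_psalg[OF obf(2)] A_psalg[OF obg(2)] M_psmors[OF f]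
          M_psmors[OF g] w y]
    by simp
  have e2: "Comp (X c) (?P (phs n (Comp J g f) x)) (?P (\<lambda>i\<in>{..<n}. At (PC F g f) (?y i)))
    = Comp (X c) (?P (phs n g x)) (?P (\<lambda>i\<in>{..<n}. FA (H g) (phs n f x i)))"
    using g.B.Phi_Comp[OF w pc phs_hom[OF x gf]] g.B.Phi_Comp[OF w hf phs_hom[OF x g]]
        ph_Comp[OF xi f g]
    by (simp cong: restrict_cong)
  note rf = Hg[OF pf(1)]
  have "Comp (X c) (lam w n (Comp J g f) x) (At (PC F g f) (FO (Phi (A a) w) ?y))
    = Comp (X c) (?P (phs n (Comp J g f) x)) (Comp (X c) (?P (\<lambda>i\<in>{..<n}. At (PC F g f) (?y i)))
      (Comp (X c) (At (rho (PA F g) w) ?z) (FA (H g) (At (rho (PA F f) w) ?y))))"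
    unfolding lam_eq[OF gf] e[symmetric] by (rule g.B.X.Comp_assoc[OF h pgf, symmetric])
  also have "\<dots> = Comp (X c) (?P (phs n g x)) (Comp (X c) (?P (\<lambda>i\<in>{..<n}. FA (H g) (phs n f x i)))
      (Comp (X c) (At (rho (PA F g) w) ?z) (FA (H g) (At (rho (PA F f) w) ?y))))"
    by (rule g.B.X.Comp_cong_left[OF g.B.X.Comp_hom[OF rf r] Pc[OF pc] pgf(2) Pc[OF hf] pg(2) e2])
  \<comment> \<open>Naturality of \<open>rho\<close> of \<open>F g\<close> at the structure
    isomorphisms over \<open>f\<close> interchanges the two middle factors; the outcome falls apart
    into the isomorphism over \<open>g\<close> and the image of the one over
    \<open>f\<close>.\<close>
  also have "\<dots> = Comp (X c) (?P (phs n g x)) (Comp (X c) (At (rho (PA F g) w) (pos n b x))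
      (Comp (X c) (FA (H g) (FA (Phi (A b) w) (phs n f x))) (FA (H g) (At (rho (PA F f) w) ?y))))"
    using g.B.X.Comp_cong_left[OF rf r Pc[OF hf] Hg[OF pf(2)] pg(1)
        g.rho_natural[OF w phs_hom[OF x f], symmetric]]
    by simp
  also have "\<dots> = Comp (X c) (lam w n g x) (FA (H g) (lam w n f x))"
    unfolding lam_eq[OF f] lam_eq[OF g] functorsD(6)[OF g.fun_functor pf]
    by (rule g.B.X.Comp_assoc[OF g.B.X.Comp_hom[OF rf Hg[OF pf(2)]] pg])
  finally show ?thesis .
qed

text \<open>Two squares are pasted: naturality of \<open>rho\<close> of \<open>F f\<close>, and the
  image under \<open>Phi (A b) w\<close> of the compatibility squares of the arrows
  \<open>m i\<close>.\<close>

lemma lam_natural: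
  assumes w: "w \<in> words T n" and m: "m \<in> hom (pw W n) x y" and f: "f \<in> hom J a b"
  shows "Comp (X b) (FA (Phi (A b) w) (pas n b m)) (lam w n f x)
    = Comp (X b) (lam w n f y) (FA (H f) (FA (Phi (A a) w) (pas n a m)))"
proof -
  note ob = J.hom_Ob[OF f] and xy = category.hom_Ob[OF pw_category[OF W.category_axioms] m]
  interpret f: morphism_data T "A a" "A b" "PA F f" by (rule M_data[OF f])
  note px = lam_parts[OF w xy(1) f, THEN isos_hom] and py = lam_parts[OF w xy(2) f, THEN isos_hom]
  note ma = pas_hom[OF m ob(1)] and mb = pas_hom[OF m ob(2)]
  have hm: "(\<lambda>i\<in>{..<n}. FA (H f) (pas n a m i)) \<in> hom (pw (X b) n)
      (\<lambda>i\<in>{..<n}. FO (H f) (pos n a x i)) (\<lambda>i\<in>{..<n}. FO (H f) (pos n a y i))"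
    using ma functorsD(4)[OF f.fun_functor] by (simp add: hom_pw)
  note P = functorsD(4)[OF f.B.Phi_functor[OF w]]
  have mi: "m i \<in> hom W (x i) (y i)" if "i < n" for i using m that by (simp add: hom_pw)
  have e: "Comp (X b) (FA (Phi (A b) w) (pas n b m)) (FA (Phi (A b) w) (phs n f x))
    = Comp (X b) (FA (Phi (A b) w) (phs n f y))
        (FA (Phi (A b) w) (\<lambda>i\<in>{..<n}. FA (H f) (pas n a m i)))"
    using f.B.Phi_Comp[OF w phs_hom[OF xy(1) f] mb] f.B.Phi_Comp[OF w hm phs_hom[OF xy(2) f]]
        pa_hom(2)[OF mi f]
    by (simp cong: restrict_cong)
  show ?thesis
    unfolding lam_eq[OF f]
    by (rule f.B.X.paste[OF px py functorsD(4)[OF f.fun_functor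
        functorsD(4)[OF f.A.Phi_functor[OF w] ma]]
          P[OF hm] P[OF mb] f.rho_natural[OF w ma, symmetric] e])
qed

text \<open>The facts on \<open>lam\<close> are exactly the hypotheses of \<open>liftF\<close>:
  \<open>lam_isos\<close>, \<open>lam_Id\<close> and \<open>lam_Comp\<close> give compatibility, and
  \<open>lam_natural\<close> gives naturality.\<close>

lemma PhiW:
  assumes w: "w \<in> words T n"
  shows "PhiW w \<in> functors (pw W n) W"
    and "\<lbrakk>x \<in> Ob (pw W n); j \<in> Ob J\<rbrakk> \<Longrightarrow> po j (FO (PhiW w) x) = FO (Phi (A j) w) (pos n j x)"
    and "\<lbrakk>x \<in> Ob (pw W n); f \<in> Arr J\<rbrakk> \<Longrightarrow> ph f (FO (PhiW w) x) = lam w n f x"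
    and "\<lbrakk>m \<in> Arr (pw W n); j \<in> Ob J\<rbrakk> \<Longrightarrow> pa j (FA (PhiW w) m) = FA (Phi (A j) w) (pas n j m)"
proof -
  have 1: "compatible (\<lambda>j. FO (PhiF w n j) x) (\<lambda>f. lam w n f x)" if x: "x \<in> Ob (pw W n)" for x
    unfolding compatible_iff FO_PhiF[OF x]
    using lam_isos[OF w x] lam_Id[OF w x] lam_Comp[OF w x]
        functorsD(3)[OF algebra_data.Phi_functor[OF A_data w] pos_Ob[OF x]]
    by blast
  have 2: "Comp (X b) (FA (PhiF w n b) m) (lam w n f x)
      = Comp (X b) (lam w n f y) (FA (H f) (FA (PhiF w n a) m))"
    if f: "f \<in> hom J a b" and m: "m \<in> hom (pw W n) x y" for f a b m x y
    unfolding FA_PhiF[OF homD(1)[OF m]] by (rule lam_natural[OF w m f])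
  note l = liftF[OF pw_category[OF W.category_axioms] PhiF_functor[OF w] 1 2, folded
      PhiW_def[of w, unfolded Dom_words[OF w]]]
  show "PhiW w \<in> functors (pw W n) W"
    and "\<lbrakk>x \<in> Ob (pw W n); j \<in> Ob J\<rbrakk> \<Longrightarrow> po j (FO (PhiW w) x) = FO (Phi (A j) w) (pos n j x)"
    and "\<lbrakk>x \<in> Ob (pw W n); f \<in> Arr J\<rbrakk> \<Longrightarrow> ph f (FO (PhiW w) x) = lam w n f x"
    and "\<lbrakk>m \<in> Arr (pw W n); j \<in> Ob J\<rbrakk> \<Longrightarrow> pa j (FA (PhiW w) m) = FA (Phi (A j) w) (pas n j m)"
    using l by (simp_all add: FO_PhiF FA_PhiF)
qed

end

lemma compose_map_fun:
  "(\<And>i. i < k \<Longrightarrow> f i < l) \<Longrightarrow>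
    compose {..<k} (\<lambda>q\<in>{..<l}. h (x q)) f = (\<lambda>i\<in>{..<k}. h (compose {..<k} x f i))"
  by (simp add: compose_def cong: restrict_cong)

lemma compose_compose:
  "(\<And>i. i < k \<Longrightarrow> f i < l) \<Longrightarrow>
    compose {..<k} (compose {..<l} x g) f = compose {..<k} x (compose {..<k} g f)"
  by (simp add: compose_def cong: restrict_cong)

lemma compose_Id_pw: "x \<in> Ob (pw X k) \<Longrightarrow> compose {..<k} x (\<lambda>i\<in>{..<k}. i) = x"
  by (rule ext) (simp add: pw_simps(1) compose_def PiE_iff extensional_def)

lemma (in is_theory) wgamma_arity_cong:
  assumes "\<And>i. i < k \<Longrightarrow> n i = n' i"
  shows "wgamma T k n w ws = wgamma T k n' w ws"
proof -
  have "incl n i = incl n' i" if "i < k" for i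
    using offset_cong[of i n n'] assms that by (simp add: incl_def fun_eq_iff)
  then show ?thesis
    using offset_cong[of k n n', OF assms] assms unfolding wgamma_def
    by (intro arg_cong[of _ _ "Comp T w"]) (auto intro!: tupling_cong)
qed

section \<open>Coherence isomorphisms of the limit algebra\<close>

context diagram
begin

text \<open>Application of words in \<open>W\<close> is componentwise, so component \<open>j\<close>
  of a nested application is the nested application in \<open>A j\<close>. The structure
  isomorphisms of the inner values are the \<open>lam\<close> of the inner words.\<close>

lemma W_gamma:
  assumes w: "w \<in> words T k" and wsP: "ws \<in> (\<Pi>\<^sub>E i\<in>{..<k}. words T (n i))"
  shows "gammaF W k n (PhiW w) (\<lambda>i. PhiW (ws i)) \<in> functors (pw W (offset n k)) W"
    and "x \<in> Ob (pw W (offset n k)) \<Longrightarrow> (\<lambda>i\<in>{..<k}. FO (PhiW (ws i)) (blk n i x)) \<in> Ob (pw W k)"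
    and "\<lbrakk>x \<in> Ob (pw W (offset n k)); j \<in> Ob J\<rbrakk> \<Longrightarrow>
      pos k j (\<lambda>i\<in>{..<k}. FO (PhiW (ws i)) (blk n i x))
      = (\<lambda>i\<in>{..<k}. FO (Phi (A j) (ws i)) (blk n i (pos (offset n k) j x)))"
    and "\<lbrakk>x \<in> Ob (pw W (offset n k)); f \<in> Arr J\<rbrakk> \<Longrightarrow>
      phs k f (\<lambda>i\<in>{..<k}. FO (PhiW (ws i)) (blk n i x))
          = (\<lambda>i\<in>{..<k}. lam (ws i) (n i) f (blk n i x))"
    and "\<lbrakk>m \<in> hom (pw W (offset n k)) x y; j \<in> Ob J\<rbrakk> \<Longrightarrow>
      pa j (FA (gammaF W k n (PhiW w) (\<lambda>i. PhiW (ws i))) m)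
      = FA (Phi (A j) w) (\<lambda>i\<in>{..<k}. FA (Phi (A j) (ws i)) (blk n i (pas (offset n k) j m)))"
proof -
  have ws: "ws i \<in> words T (n i)" if "i < k" for i using wsP that by auto
  show "gammaF W k n (PhiW w) (\<lambda>i. PhiW (ws i)) \<in> functors (pw W (offset n k)) W"
    by (rule gammaF_functor[OF W.category_axioms PhiW(1)[OF w] PhiW(1)[OF ws]])
  note b = blk_pw(1)[where X = W and n = n and k = k]
  show z: "(\<lambda>i\<in>{..<k}. FO (PhiW (ws i)) (blk n i x)) \<in> Ob (pw W k)" if "x \<in> Ob (pw W (offset n k))"
      for x
    using functorsD(3)[OF PhiW(1)[OF ws] b[OF _ that]] by (auto simp: pw_simps(1))
  show "pos k j (\<lambda>i\<in>{..<k}. FO (PhiW (ws i)) (blk n i x))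
      = (\<lambda>i\<in>{..<k}. FO (Phi (A j) (ws i)) (blk n i (pos (offset n k) j x)))"
    if "x \<in> Ob (pw W (offset n k))" "j \<in> Ob J" for x j
    by (rule restrict_ext) (simp add: PhiW(2)[OF ws b[OF _ that(1)] that(2)] blk_map_fun)
  show "phs k f (\<lambda>i\<in>{..<k}. FO (PhiW (ws i)) (blk n i x))
      = (\<lambda>i\<in>{..<k}. lam (ws i) (n i) f (blk n i x))"
    if "x \<in> Ob (pw W (offset n k))" "f \<in> Arr J" for x f
    by (rule restrict_ext) (simp add: PhiW(3)[OF ws b[OF _ that(1)] that(2)])
  show "pa j (FA (gammaF W k n (PhiW w) (\<lambda>i. PhiW (ws i))) m)
      = FA (Phi (A j) w) (\<lambda>i\<in>{..<k}. FA (Phi (A j) (ws i)) (blk n i (pas (offset n k) j m)))"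
    if m: "m \<in> hom (pw W (offset n k)) x y" and j: "j \<in> Ob J" for m x y j
  proof -
    note bm = blk_pw(3)[OF _ m]
    have u: "(\<lambda>i\<in>{..<k}. FA (PhiW (ws i)) (blk n i m)) \<in> Arr (pw W k)"
      using homD(1)[OF functorsD(4)[OF PhiW(1)[OF ws] bm]] by (auto simp: pw_simps(2))
    have "pas k j (\<lambda>i\<in>{..<k}. FA (PhiW (ws i)) (blk n i m))
      = (\<lambda>i\<in>{..<k}. FA (Phi (A j) (ws i)) (blk n i (pas (offset n k) j m)))"
      by (rule restrict_ext) (simp add: PhiW(4)[OF ws homD(1)[OF bm] j] blk_map_fun)
    then show ?thesis
      using PhiW(4)[OF w u j] by (simp add: FA_gammaF[OF homD(1)[OF m]])
  qed
qed

text \<open>Arities are not arguments of a coherence isomorphism, so they are recovered as the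
  domains of the words.\<close>

definition cW :: "'t \<Rightarrow> (nat \<Rightarrow> 't) \<Rightarrow> (nat \<Rightarrow> 'u, nat \<Rightarrow> 'u, 'u, 'u) ntrans" where
  "cW w ws = (let k = Dom T w; n = (\<lambda>i. Dom T (ws i)) in
    liftN (pw W (offset n k)) (PhiW (wgamma T k n w ws)) (gammaF W k n (PhiW w) (\<lambda>i. PhiW (ws i)))
      (\<lambda>j x. At (cc (A j) w ws) (pos (offset n k) j x)))"

definition IW :: "(nat \<Rightarrow> 'u, nat \<Rightarrow> 'u, 'u, 'u) ntrans" where
  "IW = liftN (pw W 1) (PhiW (wunit T)) (unitF W) (\<lambda>j x. At (II (A j)) (pos 1 j x))"

definition sW :: "nat \<Rightarrow> 't \<Rightarrow> (nat \<Rightarrow> nat) \<Rightarrow> (nat \<Rightarrow> 'u, nat \<Rightarrow> 'u, 'u, 'u) ntrans" where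
  "sW l w f = liftN (pw W l) (PhiW (wsubst T (Dom T w) l f w)) (substF W (Dom T w) l f (PhiW w))
    (\<lambda>j x. At (ss (A j) l w f) (pos l j x))"

lemma cW_eq:
  assumes w: "w \<in> words T k" and ws: "\<And>i. i < k \<Longrightarrow> ws i \<in> words T (n i)"
  shows "cW w ws = liftN (pw W (offset n k)) (PhiW (wgamma T k n w ws))
      (gammaF W k n (PhiW w) (\<lambda>i. PhiW (ws i)))
      (\<lambda>j x. At (cc (A j) w ws) (pos (offset n k) j x))"
proof -
  have n: "Dom T (ws i) = n i" if "i < k" for i using Dom_words[OF ws[OF that]] .
  show ?thesis
    using offset_cong[of k "\<lambda>i. Dom T (ws i)" n, OF n]
      T.wgamma_arity_cong[of k "\<lambda>i. Dom T (ws i)" n w ws, OF n]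
      gammaF_arity_cong[of k "\<lambda>i. Dom T (ws i)" n W "PhiW w" "\<lambda>i. PhiW (ws i)", OF n]
    by (simp add: cW_def Dom_words[OF w])
qed

lemma cW:
  assumes w: "w \<in> words T k" and ws: "ws \<in> (\<Pi>\<^sub>E i\<in>{..<k}. words T (n i))"
  shows "cW w ws \<in> nat_isos (pw W (offset n k)) W (PhiW (wgamma T k n w ws))
      (gammaF W k n (PhiW w) (\<lambda>i. PhiW (ws i)))"
    and "\<lbrakk>x \<in> Ob (pw W (offset n k)); j \<in> Ob J\<rbrakk> \<Longrightarrow>
      pa j (At (cW w ws) x) = At (cc (A j) w ws) (pos (offset n k) j x)"
proof -
  have ws': "ws i \<in> words T (n i)" if "i < k" for i using ws that by auto
  let ?N = "offset n k" and ?\<gamma> = "wgamma T k n w ws" and ?G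
      = "gammaF W k n (PhiW w) (\<lambda>i. PhiW (ws i))"
  have g: "?\<gamma> \<in> words T ?N" by (rule T.wgamma_words[OF w ws'])
  have eq: "cW w ws = liftN (pw W ?N) (PhiW ?\<gamma>) ?G (\<lambda>j x. At (cc (A j) w ws) (pos ?N j x))"
    by (rule cW_eq[OF w ws'])
  note zW = W_gamma(2)[OF w ws]
  have G: "po j (FO ?G x) = FO (Phi (A j) w) (\<lambda>i\<in>{..<k}. FO (Phi (A j) (ws i))
      (blk n i (pos ?N j x)))"
    if "x \<in> Ob (pw W ?N)" "j \<in> Ob J" for x j
    using PhiW(2)[OF w zW[OF that(1)] that(2)] W_gamma(3)[OF w ws that]
    by (simp add: FO_gammaF[OF that(1)])
  have iso: "At (cc (A j) w ws) (pos ?N j x) \<in> isos (X j) (po j (FO (PhiW ?\<gamma>) x)) (po j (FO ?G x))"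
    if j: "j \<in> Ob J" and x: "x \<in> Ob (pw W ?N)" for j x
    using algebra_data.c_isos[OF A_data[OF j] w ws pos_Ob[OF x j]]
        by (simp add: PhiW(2)[OF g x j] G[OF x j])
  have nat: "Comp (X j) (At (cc (A j) w ws) (pos ?N j y)) (pa j (FA (PhiW ?\<gamma>) m))
    = Comp (X j) (pa j (FA ?G m)) (At (cc (A j) w ws) (pos ?N j x))"
    if j: "j \<in> Ob J" and m: "m \<in> hom (pw W ?N) x y" for j m x y
    using algebra_data.c_natural[OF A_data[OF j] w ws pas_hom[OF m j]] PhiW(4)[OF g homD(1)[OF m] j]
      W_gamma(5)[OF w ws m j] by simp
  \<comment> \<open>Two squares are pasted: the composition law of the morphism \<open>F f\<close>,
    and naturality of \<open>cc (A b) w ws\<close> at the structure isomorphisms of the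
    arguments.\<close>
  have comp: "Comp (X b) (At (cc (A b) w ws) (pos ?N b x)) (ph f (FO (PhiW ?\<gamma>) x))
    = Comp (X b) (ph f (FO ?G x)) (FA (H f) (At (cc (A a) w ws) (pos ?N a x)))"
    if f: "f \<in> hom J a b" and x: "x \<in> Ob (pw W ?N)" for a b f x
  proof -
    note ob = J.hom_Ob[OF f] and fA = homD(1)[OF f]
    interpret f: morphism_data T "A a" "A b" "PA F f" by (rule M_data[OF f])
    note bx = blk_pw(1)[OF _ x]
    define y where "y = pos ?N a x"
    define y' where "y' = (\<lambda>i\<in>{..<?N}. FO (H f) (y i))"
    have y: "y \<in> Ob (pw (X a) ?N)" unfolding y_def by (rule pos_Ob[OF x ob(1)])
    have y': "y' \<in> Ob (pw (X b) ?N)" unfolding y'_def by (rule f.pow_Ob[OF y])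
    define z where "z = (\<lambda>i\<in>{..<k}. FO (PhiW (ws i)) (blk n i x))"
    define za where "za = (\<lambda>i\<in>{..<k}. FO (Phi (A a) (ws i)) (blk n i y))"
    have z: "z \<in> Ob (pw W k)" unfolding z_def by (rule zW[OF x])
    have pz: "pos k a z = za" unfolding z_def za_def y_def using W_gamma(3)[OF w ws x ob(1)] by simp
    have za: "za \<in> Ob (pw (X a) k)" using pos_Ob[OF z ob(1)] pz by simp
    have phz: "phs k f z = (\<lambda>i\<in>{..<k}. lam (ws i) (n i) f (blk n i x))"
      unfolding z_def using W_gamma(4)[OF w ws x fA] by simp
    note parts = lam_parts[OF ws' bx f, THEN isos_hom]
    have py: "pos (n i) a (blk n i x) = blk n i y" if "i < k" for i
      by (simp add: y_def blk_map_fun[OF that])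
    have py': "(\<lambda>q\<in>{..<n i}. FO (H f) (blk n i y q)) = blk n i y'" if "i < k" for i
      by (simp add: y'_def blk_map_fun[OF that])
    have u: "(\<lambda>i\<in>{..<k}. At (rho (PA F f) (ws i)) (blk n i y)) \<in> hom (pw (X b) k)
        (\<lambda>i\<in>{..<k}. FO (H f) (za i)) (\<lambda>i\<in>{..<k}. FO (Phi (A b) (ws i)) (blk n i y'))"
      using parts(1) by (simp add: hom_pw py py' za_def)
    have v: "(\<lambda>i\<in>{..<k}. FA (Phi (A b) (ws i)) (blk n i (phs ?N f x))) \<in> hom (pw (X b) k)
        (\<lambda>i\<in>{..<k}. FO (Phi (A b) (ws i)) (blk n i y'))
            (\<lambda>i\<in>{..<k}. FO (Phi (A b) (ws i)) (blk n i (pos ?N b x)))"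
      using parts(2) by (simp add: hom_pw py py' blk_map_fun)
    \<comment> \<open>Functoriality of \<open>Phi (A b) w\<close> separates the structure
      isomorphisms of the inner values into a part from the arguments and a part from
      \<open>rho\<close> of the inner words. The latter occurs in the composition law, the former in
      the naturality square.\<close>
    have lz: "lam w k f z = Comp (X b) (Comp (X b)
        (FA (Phi (A b) w) (\<lambda>i\<in>{..<k}. FA (Phi (A b) (ws i)) (blk n i (phs ?N f x))))
        (FA (Phi (A b) w) (\<lambda>i\<in>{..<k}. At (rho (PA F f) (ws i)) (blk n i y))))
        (At (rho (PA F f) w) za)"
    proof -
      have "(\<lambda>i\<in>{..<k}. lam (ws i) (n i) f (blk n i x)) = (\<lambda>i\<in>{..<k}. Comp (X b)
        ((\<lambda>i\<in>{..<k}. FA (Phi (A b) (ws i)) (blk n i (phs ?N f x))) i)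
        ((\<lambda>i\<in>{..<k}. At (rho (PA F f) (ws i)) (blk n i y)) i))"
        by (rule restrict_ext) (simp add: lam_eq[OF f] py blk_map_fun)
      then show ?thesis
        by (simp only: lam_eq[OF f] phz pz f.B.Phi_Comp[OF w u v])
    qed
    have "PA F f \<in> psmors T (A a) (A b)" by (rule M_psmors[OF f])
    then have law: "Comp (X b) (At (cc (A b) w ws) y') (At (rho (PA F f) ?\<gamma>) y)
      = Comp (X b) (FA (Phi (A b) w) (\<lambda>i\<in>{..<k}. At (rho (PA F f) (ws i)) (blk n i y)))
        (Comp (X b) (At (rho (PA F f) w) za) (FA (H f) (At (cc (A a) w ws) y)))"
      unfolding f.psmors_iff f.gamma_law_def using w ws y by (auto simp: y'_def za_def)
    have phx: "phs ?N f x \<in> hom (pw (X b) ?N) y' (pos ?N b x)"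
      using phs_hom[OF x f] by (simp add: y'_def y_def)
    note Pw = functorsD(4)[OF f.B.Phi_functor[OF w]]
    note r = f.rho_hom[OF g y, folded y'_def] and c0
        = functorsD(4)[OF f.fun_functor f.A.c_hom[OF w ws y], folded za_def]
    note rz = f.rho_hom[OF w za]
    have law': "Comp (X b) (At (cc (A b) w ws) y') (At (rho (PA F f) ?\<gamma>) y)
      = Comp (X b) (Comp (X b) (FA (Phi (A b) w) (\<lambda>i\<in>{..<k}. At (rho (PA F f) (ws i)) (blk n i y)))
          (At (rho (PA F f) w) za))
          (FA (H f) (At (cc (A a) w ws) y))"
      unfolding law by (rule f.B.X.Comp_assoc[OF c0 rz Pw[OF u]])
    have "Comp (X b) (At (cc (A b) w ws) (pos ?N b x)) (lam ?\<gamma> ?N f x)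
      = Comp (X b) (Comp (X b) (FA (Phi (A b) w)
          (\<lambda>i\<in>{..<k}. FA (Phi (A b) (ws i)) (blk n i (phs ?N f x))))
          (Comp (X b) (FA (Phi (A b) w) (\<lambda>i\<in>{..<k}. At (rho (PA F f) (ws i)) (blk n i y)))
              (At (rho (PA F f) w) za)))
        (FA (H f) (At (cc (A a) w ws) y))"
      unfolding lam_eq[OF f] y_def[symmetric]
      by (rule f.B.X.paste[OF r functorsD(4)[OF f.B.Phi_functor[OF g] phx]
          f.B.X.Comp_hom[OF rz Pw[OF u]] Pw[OF v]
            c0 f.B.c_hom[OF w ws y'] f.B.c_hom[OF w ws pos_Ob[OF x ob(2)]] law'
                f.B.c_natural[OF w ws phx]])
    also have "\<dots> = Comp (X b) (lam w k f z) (FA (H f) (At (cc (A a) w ws) y))"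
      unfolding lz f.B.X.Comp_assoc[OF rz Pw[OF u] Pw[OF v]] ..
    finally show ?thesis
      using PhiW(3)[OF g x fA] PhiW(3)[OF w z fA]
          by (simp add: FO_gammaF[OF x] z_def[symmetric] y_def[symmetric])
  qed
  show pa: "pa j (At (cW w ws) x) = At (cc (A j) w ws) (pos ?N j x)"
      if "x \<in> Ob (pw W ?N)" "j \<in> Ob J" for x j
    unfolding eq by (rule liftN(2)[OF pw_category[OF W.category_axioms] PhiW(1)[OF g]
        W_gamma(1)[OF w ws]])
      (fact isos_hom[OF iso] nat comp that)+
  have "cW w ws \<in> nats (pw W ?N) W (PhiW ?\<gamma>) ?G"
    unfolding eq by (rule liftN(1)[OF pw_category[OF W.category_axioms] PhiW(1)[OF g]
        W_gamma(1)[OF w ws]])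
      (fact isos_hom[OF iso] nat comp)+
  then show "cW w ws \<in> nat_isos (pw W ?N) W (PhiW ?\<gamma>) ?G"
    by (rule liftN_iso) (simp add: pa iso)
qed

lemma sW:
  assumes w: "w \<in> words T k" and h: "h \<in> {..<k} \<rightarrow>\<^sub>E {..<l}"
  shows "sW l w h \<in> nat_isos (pw W l) W (PhiW (wsubst T k l h w)) (substF W k l h (PhiW w))"
    and "\<lbrakk>x \<in> Ob (pw W l); j \<in> Ob J\<rbrakk> \<Longrightarrow> pa j (At (sW l w h) x) = At (ss (A j) l w h) (pos l j x)"
proof -
  have h': "h i < l" if "i < k" for i using h that by auto
  let ?\<gamma> = "wsubst T k l h w" and ?G = "substF W k l h (PhiW w)"
  have g: "?\<gamma> \<in> words T l" by (rule T.wsubst_words[OF w h'])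
  have eq: "sW l w h = liftN (pw W l) (PhiW ?\<gamma>) ?G (\<lambda>j x. At (ss (A j) l w h) (pos l j x))"
    by (simp add: sW_def Dom_words[OF w])
  have xh: "compose {..<k} x h \<in> Ob (pw W k)" if "x \<in> Ob (pw W l)" for x
    by (rule compose_pw(1)[OF h' that])
  have pc: "compose {..<k} (pos l j x) h = pos k j (compose {..<k} x h)"
    "compose {..<k} (pas l j x) h = pas k j (compose {..<k} x h)" for j x
    by (rule compose_map_fun[OF h'], assumption)+
  have G: "po j (FO ?G x) = FO (Phi (A j) w) (compose {..<k} (pos l j x) h)"
    if "x \<in> Ob (pw W l)" "j \<in> Ob J" for x j
    using PhiW(2)[OF w xh[OF that(1)] that(2)] by (simp add: FO_substF[OF that(1)] pc)
  have iso: "At (ss (A j) l w h) (pos l j x) \<in> isos (X j) (po j (FO (PhiW ?\<gamma>) x)) (po j (FO ?G x))"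
    if j: "j \<in> Ob J" and x: "x \<in> Ob (pw W l)" for j x
    using algebra_data.s_isos[OF A_data[OF j] w h pos_Ob[OF x j]]
        by (simp add: PhiW(2)[OF g x j] G[OF x j])
  have nat: "Comp (X j) (At (ss (A j) l w h) (pos l j y)) (pa j (FA (PhiW ?\<gamma>) m))
    = Comp (X j) (pa j (FA ?G m)) (At (ss (A j) l w h) (pos l j x))"
    if j: "j \<in> Ob J" and m: "m \<in> hom (pw W l) x y" for j m x y
  proof -
    have "compose {..<k} m h \<in> hom (pw W k) (compose {..<k} x h) (compose {..<k} y h)"
      by (rule compose_pw(3)[OF h' m])
    note mh = homD(1)[OF this]
    show ?thesis
      using algebra_data.s_natural[OF A_data[OF j] w h pas_hom[OF m j]]
          PhiW(4)[OF g homD(1)[OF m] j]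
        PhiW(4)[OF w mh j] by (simp add: FA_substF[OF homD(1)[OF m]] pc)
  qed
  \<comment> \<open>The same pasting as for \<open>cW\<close>, with the substitution law of
    \<open>F f\<close> and naturality of \<open>ss (A b) l w h\<close>.\<close>
  have comp: "Comp (X b) (At (ss (A b) l w h) (pos l b x)) (ph f (FO (PhiW ?\<gamma>) x))
    = Comp (X b) (ph f (FO ?G x)) (FA (H f) (At (ss (A a) l w h) (pos l a x)))"
    if f: "f \<in> hom J a b" and x: "x \<in> Ob (pw W l)" for a b f x
  proof -
    note ob = J.hom_Ob[OF f] and fA = homD(1)[OF f]
    interpret f: morphism_data T "A a" "A b" "PA F f" by (rule M_data[OF f])
    define y where "y = pos l a x"
    define y' where "y' = (\<lambda>i\<in>{..<l}. FO (H f) (y i))"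
    have y: "y \<in> Ob (pw (X a) l)" unfolding y_def by (rule pos_Ob[OF x ob(1)])
    have y': "y' \<in> Ob (pw (X b) l)" unfolding y'_def by (rule f.pow_Ob[OF y])
    define z where "z = compose {..<k} x h"
    have z: "z \<in> Ob (pw W k)" unfolding z_def by (rule xh[OF x])
    have pz: "pos k a z = compose {..<k} y h" unfolding y_def z_def
        by (rule compose_map_fun[OF h', symmetric])
    have phz: "phs k f z = compose {..<k} (phs l f x) h" unfolding z_def
        by (rule compose_map_fun[OF h', symmetric])
    have y'h: "compose {..<k} y' h = (\<lambda>i\<in>{..<k}. FO (H f) (compose {..<k} y h i))"
      unfolding y'_def by (rule compose_map_fun[OF h'])
    have yh: "compose {..<k} y h \<in> Ob (pw (X a) k)" using pos_Ob[OF z ob(1)] pz by simp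
    have phx: "phs l f x \<in> hom (pw (X b) l) y' (pos l b x)"
      using phs_hom[OF x f] by (simp add: y'_def y_def)
    have ph': "compose {..<k} (phs l f x) h \<in> hom (pw (X b) k) (compose {..<k} y' h)
        (compose {..<k} (pos l b x) h)"
      by (rule compose_pw(3)[OF h' phx])
    have "PA F f \<in> psmors T (A a) (A b)" by (rule M_psmors[OF f])
    then have law: "Comp (X b) (At (ss (A b) l w h) y') (At (rho (PA F f) ?\<gamma>) y)
      = Comp (X b) (At (rho (PA F f) w) (compose {..<k} y h)) (FA (H f) (At (ss (A a) l w h) y))"
      unfolding f.psmors_iff f.subst_law_def using w h y by (auto simp: y'_def)
    note r = f.rho_hom[OF g y, folded y'_def] and c0
        = functorsD(4)[OF f.fun_functor f.A.s_hom[OF w h y]]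
    have "Comp (X b) (At (ss (A b) l w h) (pos l b x)) (lam ?\<gamma> l f x)
      = Comp (X b) (lam w k f z) (FA (H f) (At (ss (A a) l w h) y))"
      unfolding lam_eq[OF f] y_def[symmetric] pz phz
      by (rule f.B.X.paste[OF r functorsD(4)[OF f.B.Phi_functor[OF g] phx]
          f.rho_hom[OF w yh, folded y'h]
            functorsD(4)[OF f.B.Phi_functor[OF w] ph']
            c0 f.B.s_hom[OF w h y'] f.B.s_hom[OF w h pos_Ob[OF x ob(2)]] law
                f.B.s_natural[OF w h phx]])
    then show ?thesis
      using PhiW(3)[OF g x fA] PhiW(3)[OF w z fA]
          by (simp add: FO_substF[OF x] z_def[symmetric] y_def[symmetric])
  qed
  have G': "?G \<in> functors (pw W l) W"
    by (rule substF_functor[OF W.category_axioms PhiW(1)[OF w] h'])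
  show pa: "pa j (At (sW l w h) x) = At (ss (A j) l w h) (pos l j x)"
      if "x \<in> Ob (pw W l)" "j \<in> Ob J" for x j
    unfolding eq by (rule liftN(2)[OF pw_category[OF W.category_axioms] PhiW(1)[OF g] G'])
      (fact isos_hom[OF iso] nat comp that)+
  have "sW l w h \<in> nats (pw W l) W (PhiW ?\<gamma>) ?G"
    unfolding eq by (rule liftN(1)[OF pw_category[OF W.category_axioms] PhiW(1)[OF g] G'])
      (fact isos_hom[OF iso] nat comp)+
  then show "sW l w h \<in> nat_isos (pw W l) W (PhiW ?\<gamma>) ?G"
    by (rule liftN_iso) (simp add: pa iso)
qed

lemma IW:
  shows "IW \<in> nat_isos (pw W 1) W (PhiW (wunit T)) (unitF W)"
    and "\<lbrakk>x \<in> Ob (pw W 1); j \<in> Ob J\<rbrakk> \<Longrightarrow> pa j (At IW x) = At (II (A j)) (pos 1 j x)"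
proof -
  note [simp del] = One_nat_def
  note g = T.wunit_words
  have G: "po j (FO (unitF W) x) = pos 1 j x 0" if "x \<in> Ob (pw W 1)" "j \<in> Ob J" for x j
    using that by (simp add: FO_unitF)
  have iso: "At (II (A j)) (pos 1 j x) \<in> isos (X j) (po j (FO (PhiW (wunit T)) x))
      (po j (FO (unitF W) x))"
    if j: "j \<in> Ob J" and x: "x \<in> Ob (pw W 1)" for j x
    using algebra_data.I_isos[OF A_data[OF j] pos_Ob[OF x j]]
        by (simp add: PhiW(2)[OF g x j] G[OF x j])
  have nat: "Comp (X j) (At (II (A j)) (pos 1 j y)) (pa j (FA (PhiW (wunit T)) m))
    = Comp (X j) (pa j (FA (unitF W) m)) (At (II (A j)) (pos 1 j x))"
    if j: "j \<in> Ob J" and m: "m \<in> hom (pw W 1) x y" for j m x y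
    using algebra_data.I_natural[OF A_data[OF j] pas_hom[OF m j]] PhiW(4)[OF g homD(1)[OF m] j]
    by (simp add: FA_unitF[OF homD(1)[OF m]])
  \<comment> \<open>The unit law of \<open>F f\<close> is combined with naturality of
    \<open>II (A b)\<close> at the structure isomorphism of the single argument.\<close>
  have comp: "Comp (X b) (At (II (A b)) (pos 1 b x)) (ph f (FO (PhiW (wunit T)) x))
    = Comp (X b) (ph f (FO (unitF W) x)) (FA (H f) (At (II (A a)) (pos 1 a x)))"
    if f: "f \<in> hom J a b" and x: "x \<in> Ob (pw W 1)" for a b f x
  proof -
    note ob = J.hom_Ob[OF f] and fA = homD(1)[OF f]
    interpret f: morphism_data T "A a" "A b" "PA F f" by (rule M_data[OF f])
    define y where "y = pos 1 a x"
    define y' where "y' = (\<lambda>i\<in>{..<1}. FO (H f) (y i))"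
    have y: "y \<in> Ob (pw (X a) 1)" unfolding y_def by (rule pos_Ob[OF x ob(1)])
    have y': "y' \<in> Ob (pw (X b) 1)" unfolding y'_def by (rule f.pow_Ob[OF y])
    have phx: "phs 1 f x \<in> hom (pw (X b) 1) y' (pos 1 b x)"
      using phs_hom[OF x f] by (simp add: y'_def y_def)
    have "PA F f \<in> psmors T (A a) (A b)" by (rule M_psmors[OF f])
    then have law: "Comp (X b) (At (II (A b)) y') (At (rho (PA F f) (wunit T)) y)
        = FA (H f) (At (II (A a)) y)"
      unfolding f.psmors_iff f.unit_law_def using y by (auto simp: y'_def)
    note r = f.rho_hom[OF g y, folded y'_def]
    note p = functorsD(4)[OF f.B.Phi_functor[OF g] phx]
    have p0: "ph f (x 0) \<in> hom (X b) (y' 0) (pos 1 b x 0)" using phx by (simp add: hom_pw)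
    have "Comp (X b) (At (II (A b)) (pos 1 b x)) (lam (wunit T) 1 f x)
      = Comp (X b) (Comp (X b) (At (II (A b)) (pos 1 b x)) (FA (Phi (A b) (wunit T)) (phs 1 f x)))
          (At (rho (PA F f) (wunit T)) y)"
      unfolding lam_eq[OF f] y_def[symmetric]
          by (rule f.B.X.Comp_assoc[OF r p f.B.I_hom[OF pos_Ob[OF x ob(2)]]])
    also have "\<dots> = Comp (X b) (ph f (x 0)) (FA (H f) (At (II (A a)) y))"
      using f.B.I_natural[OF phx] f.B.X.Comp_assoc[OF r f.B.I_hom[OF y'] p0] law by simp
    finally show ?thesis
      using PhiW(3)[OF g x fA] by (simp add: FO_unitF[OF x] y_def[symmetric])
  qed
  show pa: "pa j (At IW x) = At (II (A j)) (pos 1 j x)" if "x \<in> Ob (pw W 1)" "j \<in> Ob J" for x j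
    unfolding IW_def by (rule liftN(2)[OF pw_category[OF W.category_axioms] PhiW(1)[OF g]
        unitF_functor[OF W.category_axioms]])
      (fact isos_hom[OF iso] nat comp that)+
  have "IW \<in> nats (pw W 1) W (PhiW (wunit T)) (unitF W)"
    unfolding IW_def by (rule liftN(1)[OF pw_category[OF W.category_axioms] PhiW(1)[OF g]
        unitF_functor[OF W.category_axioms]])
      (fact isos_hom[OF iso] nat comp)+
  then show "IW \<in> nat_isos (pw W 1) W (PhiW (wunit T)) (unitF W)"
    by (rule liftN_iso) (simp add: pa iso)
qed

text \<open>With the typing settled before the laws, the component criteria of
  \<open>algebra_data\<close> become available for \<open>W\<close> itself.\<close>

sublocale WA: algebra_data T W PhiW cW IW sW
  by unfold_locales (fact PhiW(1) cW(1) IW(1) sW(1))+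

end

declare One_nat_def[simp del]

section \<open>The laws of the limit algebra\<close>

context diagram
begin

lemma A_pseudo: "j \<in> Ob J \<Longrightarrow> pseudo_algebra T (X j) (Phi (A j)) (cc (A j)) (II (A j)) (ss (A j))"
  using A_psalg unfolding is_psalg_def .

lemma pa_PhiW:
  assumes "w \<in> words T k" "u \<in> hom (pw W k) x y" "j \<in> Ob J"
  shows "pa j (FA (PhiW w) u) = FA (Phi (A j) w) (pas k j u)"
  using PhiW(4)[OF assms(1) homD(1)[OF assms(2)] assms(3)] .

lemma pos_blk: "i < k \<Longrightarrow> pos (n i) j (blk n i x) = blk n i (pos (offset n k) j x)"
  by (rule blk_map_fun[symmetric])

lemma pos_compose: "(\<And>i. i < k \<Longrightarrow> f i < l) \<Longrightarrow> pos k j (compose {..<k} x f)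
    = compose {..<k} (pos l j x) f"
  by (rule compose_map_fun[symmetric])

text \<open>Each law becomes an equation of arrows of \<open>W\<close> at an object
  \<open>x\<close>, whose component \<open>j\<close> is the same law of \<open>A j\<close> at the
  tuple of components of \<open>x\<close>. The work lies in showing that the two arrows of
  \<open>W\<close> are parallel, which again uses the identities of \<open>T\<close> and of
  blocks.\<close>

lemma W_psalg: "pseudo_algebra T W PhiW cW IW sW"
proof
  show "PhiW w \<in> functors (pw W k) W" if "w \<in> words T k" for w k
    by (rule PhiW(1)[OF that])
  show "cW w ws \<in> nat_isos (pw W (offset n k)) W (PhiW (wgamma T k n w ws))
      (gammaF W k n (PhiW w) (\<lambda>i. PhiW (ws i)))"
    if "w \<in> words T k" "ws \<in> (\<Pi>\<^sub>E i\<in>{..<k}. words T (n i))" for w k n ws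
    by (rule cW(1)[OF that])
  show "IW \<in> nat_isos (pw W 1) W (PhiW (wunit T)) (unitF W)"
    by (rule IW(1))
  show "sW l w f \<in> nat_isos (pw W l) W (PhiW (wsubst T k l f w)) (substF W k l f (PhiW w))"
    if "w \<in> words T k" "f \<in> {..<k} \<rightarrow>\<^sub>E {..<l}" for w k l f
    by (rule sW(1)[OF that])
next
  fix w k ws n vs p
  assume w: "w \<in> words T k" and ws: "ws \<in> (\<Pi>\<^sub>E i\<in>{..<k}. words T (n i))"
    and vs: "vs \<in> (\<Pi>\<^sub>E j\<in>{..<offset n k}. words T (p j))"
  let ?N = "offset n k" and ?n = "\<lambda>i. offset (blk n i p) (n i)"
  let ?P = "offset p ?N" and ?us = "\<lambda>i\<in>{..<k}. wgamma T (n i) (blk n i p) (ws i) (blk n i vs)"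
  have ws': "ws i \<in> words T (n i)" if "i < k" for i using ws that by auto
  have vs': "vs i \<in> words T (p i)" if "i < ?N" for i using vs that by auto
  have g: "wgamma T k n w ws \<in> words T ?N" by (rule T.wgamma_words[OF w ws'])
  note us = WA.wgamma_PiE[OF ws vs] and bv = WA.blk_words[OF vs]
  have o: "offset ?n k = ?P" by (rule offset_offset_total)
  show "vcomp (pw W ?P) W
        (gammaN W ?N p (cW w ws) (\<lambda>j. idn (pw W (p j)) W (PhiW (vs j))))
        (cW (wgamma T k n w ws) vs)
      = vcomp (pw W ?P) W
        (gammaN W k ?n (idn (pw W k) W (PhiW w)) (\<lambda>i. cW (ws i) (blk n i vs)))
        (cW w ?us)"
    unfolding WA.c_assoc_iff[OF w ws vs]
  proof (rule ballI)
    fix x assume x: "x \<in> Ob (pw W ?P)"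
    then have x': "x \<in> Ob (pw W (offset ?n k))" unfolding o .
    let ?z = "\<lambda>j\<in>{..<?N}. FO (PhiW (vs j)) (blk p j x)"
    let ?u = "\<lambda>i\<in>{..<k}. At (cW (ws i) (blk n i vs)) (blk ?n i x)"
    note z = WA.words_Phi_Ob[OF vs x]
    note c1 = WA.c_hom[OF g vs x] and c2 = WA.c_hom[OF w ws z] and c3 = WA.c_hom[OF w us x']
    have bx: "blk ?n i x \<in> Ob (pw W (?n i))" if "i < k" for i by (rule blk_pw(1)[OF that x'])
    \<comment> \<open>This gives \<open>?u\<close> the target that \<open>c2\<close> requires, so
      that both composites end at the same object of \<open>W\<close>.\<close>
    have bz: "blk n i ?z = (\<lambda>j\<in>{..<n i}. FO (PhiW (blk n i vs j)) (blk (blk n i p) j (blk ?n i x)))"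
        if "i < k" for i
      by (simp add: blk_restrict_offset[OF that] blk_apply blk_blk cong: restrict_cong)
    have u: "?u \<in> hom (pw W k) (\<lambda>i\<in>{..<k}. FO (PhiW (?us i)) (blk ?n i x))
        (\<lambda>i\<in>{..<k}. FO (PhiW (ws i)) (blk n i ?z))"
      using WA.c_hom[OF ws' bv bx] by (simp add: hom_pw bz)
    note pu = functorsD(4)[OF PhiW(1)[OF w] u]
    \<comment> \<open>That both composites also start at the same object of \<open>W\<close> is
      associativity of composition of words.\<close>
    have eq: "wgamma T k ?n w ?us = wgamma T ?N p (wgamma T k n w ws) vs"
      using T.wgamma_assoc[of w k ws n vs p, OF w ws' vs']
        T.wgamma_cong[of k ?us "\<lambda>i. wgamma T (n i) (blk n i p) (ws i) (blk n i vs)" ?n w] by simp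
    note c3' = c3[unfolded eq]
    show "Comp W (At (cW w ws) ?z) (At (cW (wgamma T k n w ws) vs) x)
      = Comp W (FA (PhiW w) ?u) (At (cW w ?us) x)"
    proof (rule W_ar_eqI[OF W_Comp_hom(1)[OF c1 c2] W_Comp_hom(1)[OF c3' pu]])
      fix j assume j: "j \<in> Ob J"
      interpret D: algebra_data T "X j" "Phi (A j)" "cc (A j)" "II (A j)" "ss (A j)"
          by (rule A_data[OF j])
      interpret Q: pseudo_algebra T "X j" "Phi (A j)" "cc (A j)" "II (A j)" "ss (A j)"
          by (rule A_pseudo[OF j])
      have zj: "pos ?N j ?z = (\<lambda>q\<in>{..<?N}. FO (Phi (A j) (vs q)) (blk p q (pos ?P j x)))"
        by (rule W_gamma(3)[OF g vs x j])
      have uj: "pas k j ?u = (\<lambda>i\<in>{..<k}. At (cc (A j) (ws i) (blk n i vs)) (blk ?n i (pos ?P j x)))"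
        by (rule restrict_ext) (simp add: cW(2)[OF ws' bv bx j] pos_blk[where k = k and n = ?n] o)
      show "pa j (Comp W (At (cW w ws) ?z) (At (cW (wgamma T k n w ws) vs) x))
        = pa j (Comp W (FA (PhiW w) ?u) (At (cW w ?us) x))"
        using D.c_assoc_iff[OF w ws vs, THEN iffD1, OF Q.c_assoc[OF w ws vs], rule_format, OF
            pos_Ob[OF x j]]
        unfolding W_Comp_hom(2)[OF c1 c2 j] W_Comp_hom(2)[OF c3' pu j] cW(2)[OF w ws z j]
            cW(2)[OF g vs x j]
          cW(2)[OF w us x' j] pa_PhiW[OF w u j] zj uj o .
    qed
  qed
next
  fix w k assume w: "w \<in> words T k"
  let ?us = "\<lambda>i\<in>{..<k}. wunit T"
  have us: "?us \<in> (\<Pi>\<^sub>E i\<in>{..<k}. words T 1)" using T.wunit_words by auto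
  have o: "offset (\<lambda>_. 1) k = k" by simp
  have eq: "wgamma T k (\<lambda>_. 1) w ?us = w" by (rule T.wgamma_unit_right[OF w]) simp
  show "vcomp (pw W k) W (gammaN W k (\<lambda>_. 1) (idn (pw W k) W (PhiW w)) (\<lambda>_. IW)) (cW w ?us)
      = idn (pw W k) W (PhiW w)"
    unfolding WA.c_unit_right_iff[OF w]
  proof (rule ballI)
    fix x assume x: "x \<in> Ob (pw W k)"
    then have x': "x \<in> Ob (pw W (offset (\<lambda>_. 1) k))" unfolding o .
    let ?u = "\<lambda>i\<in>{..<k}. At IW (blk (\<lambda>_. 1) i x)"
    have bx: "blk (\<lambda>_. 1) i x \<in> Ob (pw W 1)" if "i < k" for i
      by (rule blk_pw(1)[OF that x'])
    have u: "?u \<in> hom (pw W k) (\<lambda>i\<in>{..<k}. FO (PhiW (?us i)) (blk (\<lambda>_. 1) i x)) x"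
      using WA.I_hom[OF bx] x by (simp add: hom_pw blk_1 pw_simps(1) PiE_iff)
    note c = WA.c_hom[OF w us x', unfolded eq] and pu = functorsD(4)[OF PhiW(1)[OF w] u]
    note Px = functorsD(3)[OF PhiW(1)[OF w] x]
    show "Comp W (FA (PhiW w) ?u) (At (cW w ?us) x) = Id W (FO (PhiW w) x)"
    proof (rule W_ar_eqI[OF W_Comp_hom(1)[OF c pu] W_Id_hom(1)[OF Px]])
      fix j assume j: "j \<in> Ob J"
      interpret D: algebra_data T "X j" "Phi (A j)" "cc (A j)" "II (A j)" "ss (A j)"
          by (rule A_data[OF j])
      interpret Q: pseudo_algebra T "X j" "Phi (A j)" "cc (A j)" "II (A j)" "ss (A j)"
          by (rule A_pseudo[OF j])
      have uj: "pas k j ?u = (\<lambda>i\<in>{..<k}. At (II (A j)) (blk (\<lambda>_. 1) i (pos k j x)))"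
        by (rule restrict_ext) (simp add: IW(2)[OF bx j] pos_blk[where k = k and n = "\<lambda>_. 1"])
      show "pa j (Comp W (FA (PhiW w) ?u) (At (cW w ?us) x)) = pa j (Id W (FO (PhiW w) x))"
        using D.c_unit_right_iff[OF w, THEN iffD1, OF Q.c_unit_right[OF w], rule_format, OF
            pos_Ob[OF x j]]
        unfolding W_Comp_hom(2)[OF c pu j] W_Id_hom(2)[OF Px j] cW(2)[OF w us x' j]
            pa_PhiW[OF w u j] uj o
          PhiW(2)[OF w x j] .
    qed
  qed
next
  fix w k assume w: "w \<in> words T k"
  let ?us = "\<lambda>i\<in>{..<1::nat}. w"
  have us: "?us \<in> (\<Pi>\<^sub>E i\<in>{..<1::nat}. words T k)" using w by auto
  have o: "offset (\<lambda>_. k) 1 = k" by simp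
  show "vcomp (pw W k) W (gammaN W 1 (\<lambda>_. k) IW (\<lambda>_. idn (pw W k) W (PhiW w))) (cW (wunit T) ?us)
      = idn (pw W k) W (PhiW w)"
    unfolding WA.c_unit_left_iff[OF w]
  proof (rule ballI)
    fix x assume x: "x \<in> Ob (pw W k)"
    then have x': "x \<in> Ob (pw W (offset (\<lambda>_. k) 1))" unfolding o .
    let ?z = "\<lambda>i\<in>{..<1::nat}. FO (PhiW w) (blk (\<lambda>_. k) i x)"
    have z': "?z = (\<lambda>i\<in>{..<1}. FO (PhiW (?us i)) (blk (\<lambda>_. k) i x))" by auto
    have z: "?z \<in> Ob (pw W 1)" unfolding z' by (rule WA.words_Phi_Ob[OF us x'])
    have bx: "blk (\<lambda>_. k) i x \<in> Ob (pw W k)" if "i < 1" for i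
      by (rule blk_pw(1)[OF that x'])
    \<comment> \<open>With a single block, cutting out block \<open>0\<close> returns the
      extensional tuple \<open>x\<close> itself.\<close>
    have z0: "?z 0 = FO (PhiW w) x" using x by (simp add: blk_0 pw_simps(1) PiE_iff)
    note c = WA.c_hom[OF T.wunit_words us x', unfolded T.wgamma_unit_left[OF w], folded z']
    note i = WA.I_hom[OF z, unfolded z0]
    note Px = functorsD(3)[OF PhiW(1)[OF w] x]
    show "Comp W (At IW ?z) (At (cW (wunit T) ?us) x) = Id W (FO (PhiW w) x)"
    proof (rule W_ar_eqI[OF W_Comp_hom(1)[OF c i] W_Id_hom(1)[OF Px]])
      fix j assume j: "j \<in> Ob J"
      interpret D: algebra_data T "X j" "Phi (A j)" "cc (A j)" "II (A j)" "ss (A j)"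
          by (rule A_data[OF j])
      interpret Q: pseudo_algebra T "X j" "Phi (A j)" "cc (A j)" "II (A j)" "ss (A j)"
          by (rule A_pseudo[OF j])
      have zj: "pos 1 j ?z = (\<lambda>i\<in>{..<1::nat}. FO (Phi (A j) w) (blk (\<lambda>_. k) i (pos k j x)))"
        by (rule restrict_ext) (simp add: PhiW(2)[OF w bx j]
            pos_blk[where k = 1 and n = "\<lambda>_. k", unfolded o])
      show "pa j (Comp W (At IW ?z) (At (cW (wunit T) ?us) x)) = pa j (Id W (FO (PhiW w) x))"
        using D.c_unit_left_iff[OF w, THEN iffD1, OF Q.c_unit_left[OF w], rule_format, OF
            pos_Ob[OF x j]]
        unfolding W_Comp_hom(2)[OF c i j] W_Id_hom(2)[OF Px j] cW(2)[OF T.wunit_words us x' j]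
            IW(2)[OF z j] zj o
          PhiW(2)[OF w x j] .
    qed
  qed
next
  fix w and k l :: nat and f ws and n :: "nat \<Rightarrow> nat"
  assume w: "w \<in> words T k" and f: "f \<in> {..<k} \<rightarrow>\<^sub>E {..<l}"
      and ws: "ws \<in> (\<Pi>\<^sub>E j\<in>{..<l}. words T (n j))"
  let ?us = "compose {..<k} ws f" and ?f = "blk_map n k f" and ?L = "offset n l" and ?N
      = "offset (n \<circ> f) k"
  have ws': "ws i \<in> words T (n i)" if "i < l" for i using ws that by auto
  have f': "f i < l" if "i < k" for i using f that by auto
  note us = WA.compose_words[OF f ws] and bm = blk_map_PiE[OF f, of n]
  have us': "?us i \<in> words T ((n \<circ> f) i)" if "i < k" for i using us that by auto
  have bm': "?f i < ?L" if "i < ?N" for i using bm that by auto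
  have g: "wgamma T k (n \<circ> f) w ?us \<in> words T ?N" by (rule T.wgamma_words[OF w us'])
  have wf: "wsubst T k l f w \<in> words T l" by (rule T.wsubst_words[OF w f'])
  have eq: "wgamma T l n (wsubst T k l f w) ws = wsubst T ?N ?L ?f (wgamma T k (n \<circ> f) w ?us)"
    by (rule T.wgamma_outer[OF w ws' f, symmetric])
  show "vcomp (pw W ?L) W
        (substN W ?N ?L ?f (cW w ?us)) (sW ?L (wgamma T k (n \<circ> f) w ?us) ?f)
      = vcomp (pw W ?L) W
        (gammaN W l n (sW l w f) (\<lambda>j. idn (pw W (n j)) W (PhiW (ws j)))) (cW (wsubst T k l f w) ws)"
    unfolding WA.c_s_outer_iff[OF w f ws]
  proof (rule ballI)
    fix x assume x: "x \<in> Ob (pw W ?L)"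
    let ?y = "compose {..<?N} x ?f" and ?z = "\<lambda>j\<in>{..<l}. FO (PhiW (ws j)) (blk n j x)"
    have y: "?y \<in> Ob (pw W ?N)" by (rule compose_pw(1)[OF bm' x])
    note z = WA.words_Phi_Ob[OF ws x]
    \<comment> \<open>The target of \<open>c1\<close> is matched with that of \<open>s2\<close>:
      both evaluate the word \<open>ws (f i)\<close> on block \<open>f i\<close> of
      \<open>x\<close>. The sources are matched by \<open>eq\<close>.\<close>
    have zf: "(\<lambda>i\<in>{..<k}. FO (PhiW (?us i)) (blk (n \<circ> f) i ?y)) = compose {..<k} ?z f"
      by (simp add: blk_blk_map compose_def[of _ _ f] f' cong: restrict_cong)
    note s1 = WA.s_hom[OF g bm x] and c1 = WA.c_hom[OF w us y, unfolded zf]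
    note c2 = WA.c_hom[OF wf ws x, unfolded eq] and s2 = WA.s_hom[OF w f z]
    show "Comp W (At (cW w ?us) ?y) (At (sW ?L (wgamma T k (n \<circ> f) w ?us) ?f) x)
      = Comp W (At (sW l w f) ?z) (At (cW (wsubst T k l f w) ws) x)"
    proof (rule W_ar_eqI[OF W_Comp_hom(1)[OF s1 c1] W_Comp_hom(1)[OF c2 s2]])
      fix j assume j: "j \<in> Ob J"
      interpret D: algebra_data T "X j" "Phi (A j)" "cc (A j)" "II (A j)" "ss (A j)"
          by (rule A_data[OF j])
      interpret Q: pseudo_algebra T "X j" "Phi (A j)" "cc (A j)" "II (A j)" "ss (A j)"
          by (rule A_pseudo[OF j])
      have zj: "pos l j ?z = (\<lambda>q\<in>{..<l}. FO (Phi (A j) (ws q)) (blk n q (pos ?L j x)))"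
        by (rule W_gamma(3)[OF wf ws x j])
      have yj: "pos ?N j ?y = compose {..<?N} (pos ?L j x) ?f" by (rule pos_compose[OF bm'])
      show "pa j (Comp W (At (cW w ?us) ?y) (At (sW ?L (wgamma T k (n \<circ> f) w ?us) ?f) x))
        = pa j (Comp W (At (sW l w f) ?z) (At (cW (wsubst T k l f w) ws) x))"
        using D.c_s_outer_iff[OF w f ws, THEN iffD1, OF Q.c_s_outer[OF w f ws], rule_format, OF
            pos_Ob[OF x j]]
        unfolding W_Comp_hom(2)[OF s1 c1 j] W_Comp_hom(2)[OF c2 s2 j] cW(2)[OF w us y j]
            cW(2)[OF wf ws x j]
          sW(2)[OF g bm x j] sW(2)[OF w f z j] zj yj .
    qed
  qed
next
  fix w k ws and n n' :: "nat \<Rightarrow> nat" and gs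
  assume w: "w \<in> words T k" and ws: "ws \<in> (\<Pi>\<^sub>E i\<in>{..<k}. words T (n i))"
    and gs: "\<And>i. i < k \<Longrightarrow> gs i \<in> {..<n i} \<rightarrow>\<^sub>E {..<n' i}"
  let ?us = "\<lambda>i\<in>{..<k}. wsubst T (n i) (n' i) (gs i) (ws i)" and ?f = "blk_sum n n' k gs"
  let ?L = "offset n' k" and ?N = "offset n k"
  have ws': "ws i \<in> words T (n i)" if "i < k" for i using ws that by auto
  have gs': "gs i q < n' i" if "i < k" "q < n i" for i q using gs[OF that(1)] that(2) by auto
  have us: "?us \<in> (\<Pi>\<^sub>E i\<in>{..<k}. words T (n' i))"
    using T.wsubst_words[OF ws' gs'] by auto
  have bm: "?f \<in> {..<?N} \<rightarrow>\<^sub>E {..<?L}" by (rule blk_sum_PiE[OF gs])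
  have bm': "?f i < ?L" if "i < ?N" for i using bm that by auto
  have g: "wgamma T k n w ws \<in> words T ?N" by (rule T.wgamma_words[OF w ws'])
  have eq: "wgamma T k n' w ?us = wsubst T ?N ?L ?f (wgamma T k n w ws)"
    using T.wgamma_inner[of w k ws n gs n', OF w ws' gs]
      T.wgamma_cong[of k ?us "\<lambda>i. wsubst T (n i) (n' i) (gs i) (ws i)" n' w] by simp
  have "Comp W (At (cW w ws) (compose {..<?N} x ?f)) (At (sW ?L (wgamma T k n w ws) ?f) x)
      = Comp W (FA (PhiW w) (\<lambda>i\<in>{..<k}. At (sW (n' i) (ws i) (gs i)) (blk n' i x)))
          (At (cW w ?us) x)"
    if x: "x \<in> Ob (pw W ?L)" for x
  proof -
    let ?y = "compose {..<?N} x ?f" and ?u = "\<lambda>i\<in>{..<k}. At (sW (n' i) (ws i) (gs i)) (blk n' i x)"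
    have y: "?y \<in> Ob (pw W ?N)" by (rule compose_pw(1)[OF bm' x])
    have bx: "blk n' i x \<in> Ob (pw W (n' i))" if "i < k" for i by (rule blk_pw(1)[OF that x])
    have gP: "gs i \<in> {..<n i} \<rightarrow> {..<n' i}" if "i < k" for i using gs[OF that] by auto
    \<comment> \<open>By \<open>blk_blk_sum\<close>, substituting in each block separately is the
      same as cutting the jointly substituted tuple \<open>?y\<close> into blocks, which is the
      target of \<open>c1\<close>.\<close>
    have u: "?u \<in> hom (pw W k) (\<lambda>i\<in>{..<k}. FO (PhiW (?us i)) (blk n' i x))
        (\<lambda>i\<in>{..<k}. FO (PhiW (ws i)) (blk n i ?y))"
      using WA.s_hom[OF ws' gs bx] by (simp add: hom_pw blk_blk_sum gP)
    note pu = functorsD(4)[OF PhiW(1)[OF w] u]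
    note s1 = WA.s_hom[OF g bm x] and c1 = WA.c_hom[OF w ws y] and c2
        = WA.c_hom[OF w us x, unfolded eq]
    show ?thesis
    proof (rule W_ar_eqI[OF W_Comp_hom(1)[OF s1 c1] W_Comp_hom(1)[OF c2 pu]])
      fix j assume j: "j \<in> Ob J"
      interpret D: algebra_data T "X j" "Phi (A j)" "cc (A j)" "II (A j)" "ss (A j)"
          by (rule A_data[OF j])
      interpret Q: pseudo_algebra T "X j" "Phi (A j)" "cc (A j)" "II (A j)" "ss (A j)"
          by (rule A_pseudo[OF j])
      have yj: "pos ?N j ?y = compose {..<?N} (pos ?L j x) ?f" by (rule pos_compose[OF bm'])
      have uj: "pas k j ?u = (\<lambda>i\<in>{..<k}. At (ss (A j) (n' i) (ws i) (gs i))
          (blk n' i (pos ?L j x)))"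
        by (rule restrict_ext) (simp add: sW(2)[OF ws' gs bx j] pos_blk[where k = k and n = n'])
      have law: "\<forall>x\<in>Ob (pw (X j) ?L).
        Comp (X j) (At (cc (A j) w ws) (compose {..<?N} x ?f))
            (At (ss (A j) ?L (wgamma T k n w ws) ?f) x)
        = Comp (X j) (FA (Phi (A j) w) (\<lambda>i\<in>{..<k}. At (ss (A j) (n' i) (ws i) (gs i)) (blk n' i x)))
          (At (cc (A j) w ?us) x)"
        by (rule D.c_s_inner_iff[of w k ws n gs n', THEN iffD1], rule w, rule ws, erule gs,
            rule Q.c_s_inner[OF w ws], erule gs)
      show "pa j (Comp W (At (cW w ws) ?y) (At (sW ?L (wgamma T k n w ws) ?f) x))
        = pa j (Comp W (FA (PhiW w) ?u) (At (cW w ?us) x))"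
        using law[rule_format, OF pos_Ob[OF x j]]
        unfolding W_Comp_hom(2)[OF s1 c1 j] W_Comp_hom(2)[OF c2 pu j] cW(2)[OF w us x j]
            cW(2)[OF w ws y j]
          sW(2)[OF g bm x j] pa_PhiW[OF w u j] uj yj .
    qed
  qed
  then show "vcomp (pw W ?L) W (substN W ?N ?L ?f (cW w ws)) (sW ?L (wgamma T k n w ws) ?f)
      = vcomp (pw W ?L) W (gammaN W k n' (idn (pw W k) W (PhiW w)) (\<lambda>i. sW (n' i) (ws i) (gs i)))
          (cW w ?us)"
    using WA.c_s_inner_iff[of w k ws n gs n', OF w ws gs] by simp
next
  fix w and k l m :: nat and f g
  assume w: "w \<in> words T k" and f: "f \<in> {..<k} \<rightarrow>\<^sub>E {..<l}" and g: "g \<in> {..<l} \<rightarrow>\<^sub>E {..<m}"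
  have f': "f i < l" if "i < k" for i using f that by auto
  have g': "g i < m" if "i < l" for i using g that by auto
  have gf: "compose {..<k} g f \<in> {..<k} \<rightarrow>\<^sub>E {..<m}" using f g by (auto simp: compose_def PiE_iff)
  have wf: "wsubst T k l f w \<in> words T l" by (rule T.wsubst_words[OF w f'])
  have eq: "wsubst T l m g (wsubst T k l f w) = wsubst T k m (compose {..<k} g f) w"
    using T.wsubst_wsubst[of w k f l g m, OF w f' g']
        T.wsubst_cong[of k "compose {..<k} g f" "\<lambda>i. g (f i)" m w]
    by (simp add: compose_def)
  show "vcomp (pw W m) W (substN W l m g (sW l w f)) (sW m (wsubst T k l f w) g)
      = sW m w (compose {..<k} g f)"
    unfolding WA.s_comp_iff[OF w f g]
  proof (rule ballI)
    fix x assume x: "x \<in> Ob (pw W m)"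
    let ?y = "compose {..<l} x g"
    have y: "?y \<in> Ob (pw W l)" by (rule compose_pw(1)[OF g' x])
    have yf: "compose {..<k} ?y f = compose {..<k} x (compose {..<k} g f)"
        by (rule compose_compose[OF f'])
    note s1 = WA.s_hom[OF wf g x, unfolded eq] and s2 = WA.s_hom[OF w f y, unfolded yf] and s3
        = WA.s_hom[OF w gf x]
    show "Comp W (At (sW l w f) ?y) (At (sW m (wsubst T k l f w) g) x)
        = At (sW m w (compose {..<k} g f)) x"
    proof (rule W_ar_eqI[OF W_Comp_hom(1)[OF s1 s2] s3])
      fix j assume j: "j \<in> Ob J"
      interpret D: algebra_data T "X j" "Phi (A j)" "cc (A j)" "II (A j)" "ss (A j)"
          by (rule A_data[OF j])
      interpret Q: pseudo_algebra T "X j" "Phi (A j)" "cc (A j)" "II (A j)" "ss (A j)"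
          by (rule A_pseudo[OF j])
      have yj: "pos l j ?y = compose {..<l} (pos m j x) g" by (rule pos_compose[OF g'])
      show "pa j (Comp W (At (sW l w f) ?y) (At (sW m (wsubst T k l f w) g) x))
        = pa j (At (sW m w (compose {..<k} g f)) x)"
        using D.s_comp_iff[OF w f g, THEN iffD1, OF Q.s_comp[OF w f g], rule_format, OF
            pos_Ob[OF x j]]
        unfolding W_Comp_hom(2)[OF s1 s2 j] sW(2)[OF w f y j] sW(2)[OF wf g x j] sW(2)[OF w gf x j]
            yj .
    qed
  qed
next
  fix w k assume w: "w \<in> words T k"
  have i: "(\<lambda>i\<in>{..<k}. i) \<in> {..<k} \<rightarrow>\<^sub>E {..<k}" by auto
  have eq: "wsubst T k k (\<lambda>i\<in>{..<k}. i) w = w"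
    using T.wsubst_id[OF w] T.wsubst_cong[of k "\<lambda>i\<in>{..<k}. i" "\<lambda>i. i" k w] by simp
  show "sW k w (\<lambda>i\<in>{..<k}. i) = idn (pw W k) W (PhiW w)"
    unfolding WA.s_id_iff[OF w]
  proof (rule ballI)
    fix x assume x: "x \<in> Ob (pw W k)"
    note s = WA.s_hom[OF w i x, unfolded eq compose_Id_pw[OF x]]
    note Px = functorsD(3)[OF PhiW(1)[OF w] x]
    show "At (sW k w (\<lambda>i\<in>{..<k}. i)) x = Id W (FO (PhiW w) x)"
    proof (rule W_ar_eqI[OF s W_Id_hom(1)[OF Px]])
      fix j assume j: "j \<in> Ob J"
      interpret D: algebra_data T "X j" "Phi (A j)" "cc (A j)" "II (A j)" "ss (A j)"
          by (rule A_data[OF j])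
      interpret Q: pseudo_algebra T "X j" "Phi (A j)" "cc (A j)" "II (A j)" "ss (A j)"
          by (rule A_pseudo[OF j])
      show "pa j (At (sW k w (\<lambda>i\<in>{..<k}. i)) x) = pa j (Id W (FO (PhiW w) x))"
        using D.s_id_iff[OF w, THEN iffD1, OF Q.s_id[OF w], rule_format, OF pos_Ob[OF x j]]
        unfolding W_Id_hom(2)[OF Px j] sW(2)[OF w i x j] PhiW(2)[OF w x j] .
    qed
  qed
qed

end

section \<open>The universal cone\<close>

text \<open>The inverse functor is made of the two inverse bijections. The facts about identities
  and composites of \<open>A\<close> are taken as hypotheses because for the categories of morphisms
  in \<open>PsAlg\<close> they are what the lemmas on 2-cells supply directly.\<close>

lemma cat_isoI:
  assumes F: "F \<in> functors A B" and ob: "bij_betw (FO F) (Ob A) (Ob B)"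
      and ar: "bij_betw (FA F) (Arr A) (Arr B)"
    and dom: "\<And>f. f \<in> Arr A \<Longrightarrow> Dom A f \<in> Ob A \<and> Cod A f \<in> Ob A"
    and id: "\<And>a. a \<in> Ob A \<Longrightarrow> Id A a \<in> hom A a a"
    and comp: "\<And>f g a b c. \<lbrakk>f \<in> hom A a b; g \<in> hom A b c\<rbrakk> \<Longrightarrow> Comp A g f \<in> hom A a c"
  shows "cat_iso A B F"
proof -
  define G where "G = \<lparr>FO = restrict (inv_into (Ob A) (FO F)) (Ob B), FA
      = restrict (inv_into (Arr A) (FA F)) (Arr B)\<rparr>"
  have GO: "FO G (FO F x) = x" if "x \<in> Ob A" for x
    using that ob bij_betwE[OF ob] by (auto simp: G_def bij_betw_def)
  have GA: "FA G (FA F f) = f" if "f \<in> Arr A" for f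
    using that ar bij_betwE[OF ar] by (auto simp: G_def bij_betw_def)
  have exO: "\<exists>x\<in>Ob A. y = FO F x" if "y \<in> Ob B" for y
    using that ob by (auto simp: bij_betw_def)
  have exA: "\<exists>f\<in>Arr A. g = FA F f" if "g \<in> Arr B" for g
    using that ar by (auto simp: bij_betw_def)
  \<comment> \<open>An arrow of \<open>B\<close> is lifted together with its endpoints, because the
    inverse on arrows and the inverse on objects must fit together.\<close>
  have Ghom: "\<exists>f a' b'. f \<in> hom A a' b' \<and> g = FA F f \<and> a = FO F a' \<and> b = FO F b' \<and> a' \<in> Ob A \<and> b'
      \<in> Ob A"
    if g: "g \<in> hom B a b" for g a b
  proof -
    obtain f where f: "f \<in> Arr A" "g = FA F f" using exA[OF homD(1)[OF g]] by blast
    note h = functorsD(4)[OF F Arr_hom[OF f(1)]]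
    have "a = FO F (Dom A f)" "b = FO F (Cod A f)"
      using homD(2,3)[OF g] homD(2,3)[OF h] f(2) by simp_all
    then show ?thesis using f Arr_hom[OF f(1)] dom[OF f(1)] by blast
  qed
  have "G \<in> functors B A"
  proof (rule functorsI)
    show "FO G \<in> extensional (Ob B)" "FA G \<in> extensional (Arr B)" by (simp_all add: G_def)
    show "FO G y \<in> Ob A" if "y \<in> Ob B" for y using exO[OF that] GO by auto
    show "FA G g \<in> hom A (FO G a) (FO G b)" if "g \<in> hom B a b" for g a b
    proof -
      obtain f a' b' where "f \<in> hom A a' b'" "g = FA F f" "a = FO F a'" "b = FO F b'" "a' \<in> Ob A"
          "b' \<in> Ob A"
        using Ghom[OF \<open>g \<in> hom B a b\<close>] by blast
      then show ?thesis using GO GA homD(1) by metis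
    qed
    show "FA G (Id B y) = Id A (FO G y)" if y: "y \<in> Ob B" for y
    proof -
      obtain x where x: "x \<in> Ob A" "y = FO F x" using exO[OF y] by blast
      show ?thesis
        using functorsD(5)[OF F x(1), symmetric] GA[OF homD(1)[OF id[OF x(1)]]] GO[OF x(1)] x(2)
            by simp
    qed
    show "FA G (Comp B h g) = Comp A (FA G h) (FA G g)" if g: "g \<in> hom B a b" and h: "h \<in> hom B b c"
        for g h a b c
    proof -
      obtain f a' b' where f: "f \<in> hom A a' b'" "g = FA F f" "b = FO F b'" "b' \<in> Ob A"
        using Ghom[OF g] by blast
      obtain k b'' c' where k: "k \<in> hom A b'' c'" "h = FA F k" "b = FO F b''" "b'' \<in> Ob A"
        using Ghom[OF h] by blast
      \<comment> \<open>Composable arrows have composable lifts, as the functor is injective on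
        objects.\<close>
      have "b' = b''" using GO[OF f(4)] GO[OF k(4)] f(3) k(3) by simp
      then have k': "k \<in> hom A b' c'" using k(1) by simp
      show ?thesis
        using functorsD(6)[OF F f(1) k', symmetric] GA[OF homD(1)[OF comp[OF f(1) k']]] f(2) k(2)
          GA[OF homD(1)[OF f(1)]] GA[OF homD(1)[OF k']] by simp
    qed
  qed
  moreover have "fcomp A G F = fid A"
    using GO GA by (simp add: fcomp_def fid_def compose_def cong: restrict_cong)
  moreover have "fcomp B F G = fid B"
  proof -
    have "FO F (FO G y) = y" if "y \<in> Ob B" for y using exO[OF that] GO by auto
    moreover have "FA F (FA G g) = g" if "g \<in> Arr B" for g using exA[OF that] GA by auto
    ultimately show ?thesis by (simp add: fcomp_def fid_def compose_def cong: restrict_cong)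
  qed
  ultimately show ?thesis using F unfolding cat_iso_def by blast
qed

lemma trans_eq_iff:
  assumes "Source \<alpha> = Source \<beta>" "Target \<alpha> = Target \<beta>" "At \<alpha> \<in> extensional S" "At \<beta> \<in> extensional S"
  shows "\<alpha> = \<beta> \<longleftrightarrow> (\<forall>x\<in>S. At \<alpha> x = At (\<beta> :: ('f, 'i, 'x) trans) x)"
  using trans_eqI[OF assms] by auto

lemma const_psfun_simps[simp]:
  "PO (const_psfun K C) j = C" "PA (const_psfun K C) f = One K C"
  "PC (const_psfun K C) g f = Id (Hom K C C) (One K C)"
      "PU (const_psfun K C) j = Id (Hom K C C) (One K C)"
  by (simp_all add: const_psfun_def)

section \<open>Pseudo cones and modifications in components\<close>

context diagram
begin

context
  fixes C :: "('t, 'u, 'u) psalg"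
  assumes C: "is_psalg T C"
begin

lemma FO_fun_comp:
  assumes "x \<in> Ob (car C)"
  shows "FO (fun_of (psmor_comp T C B D M L)) x = FO (fun_of M) (FO (fun_of L) x)"
  using assms by (simp add: T.fun_of_comp FO_fcomp)

text \<open>Strict units and strict associativity of morphisms give both sides of each cone axiom
  the same source and target, so the axioms are equations at the objects of \<open>C\<close>. At a
  fixed object they are the conditions that define objects of the limit.\<close>

lemma psnats_iff:
  "\<alpha> \<in> psnats J K (const_psfun K C) F \<longleftrightarrow>
    NO \<alpha> \<in> (\<Pi>\<^sub>E j\<in>Ob J. psmors T C (A j)) \<and> NA \<alpha> \<in> extensional (Arr J) \<and>
    (\<forall>a b. \<forall>f\<in>hom J a b. NA \<alpha> f \<in> pscells T C (A b) \<and>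
      Source (NA \<alpha> f) = psmor_comp T C (A a) (A b) (PA F f) (NO \<alpha> a) \<and> Target (NA \<alpha> f) = NO \<alpha> b) \<and>
    (\<forall>x\<in>Ob (car C). compatible (\<lambda>j. FO (fun_of (NO \<alpha> j)) x) (\<lambda>f. At (NA \<alpha> f) x))"
  (is "?L \<longleftrightarrow> ?O \<and> ?E \<and> ?N \<and> ?R")
proof -
  note iC = T.psmor_id_psmors[OF C]
  let ?iso = "\<forall>a b. \<forall>f\<in>hom J a b. NA \<alpha> f \<in> isos (Hom K C (A b))
      (psmor_comp T C (A a) (A b) (PA F f) (NO \<alpha> a))
          (psmor_comp T C C (A b) (NO \<alpha> b) (psmor_id T C))"
  let ?iso' = "\<forall>x\<in>Ob (car C). \<forall>a b. \<forall>f\<in>hom J a b.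
      At (NA \<alpha> f) x \<in> isos (X b) (FO (H f) (FO (fun_of (NO \<alpha> a)) x)) (FO (fun_of (NO \<alpha> b)) x)"
  let ?idl = "\<lambda>a. Comp (Hom K C (A a)) (NA \<alpha> (Id J a))
      (Comp2 K C (A a) (A a) (PU F a) (Id (Hom K C (A a)) (NO \<alpha> a)))"
  let ?idr = "\<lambda>a. Comp2 K C C (A a) (Id (Hom K C (A a)) (NO \<alpha> a)) (Id (Hom K C C) (psmor_id T C))"
  let ?col = "\<lambda>a b c f g. Comp (Hom K C (A c)) (NA \<alpha> (Comp J g f))
        (Comp2 K C (A a) (A c) (PC F g f) (Id (Hom K C (A a)) (NO \<alpha> a)))"
  let ?cor = "\<lambda>a b c f g. Comp (Hom K C (A c))
        (Comp2 K C C (A c) (Id (Hom K C (A c)) (NO \<alpha> c)) (Id (Hom K C C) (psmor_id T C)))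
        (Comp (Hom K C (A c))
          (Comp2 K C C (A c) (NA \<alpha> g) (Id (Hom K C C) (psmor_id T C)))
          (Comp2 K C (A b) (A c) (Id (Hom K (A b) (A c)) (PA F g)) (NA \<alpha> f)))"
  have L: "?L \<longleftrightarrow> ?O \<and> ?E \<and> ?iso \<and> (\<forall>a\<in>Ob J. ?idl a = ?idr a) \<and>
      (\<forall>a b c. \<forall>f\<in>hom J a b. \<forall>g\<in>hom J b c. ?col a b c f g = ?cor a b c f g)"
    by (simp add: psnats_def Let_def)
  \<comment> \<open>The typing of the coherence cells is separated from their pointwise
    invertibility, which is part of \<open>compatible\<close>. The factor \<open>psmor_id\<close> in
    the target disappears because units are strict.\<close>
  have iso: "?iso \<longleftrightarrow> ?N \<and> ?iso'" if O: ?O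
  proof -
    have "NA \<alpha> f \<in> isos (Hom K C (A b))
        (psmor_comp T C (A a) (A b) (PA F f) (NO \<alpha> a))
            (psmor_comp T C C (A b) (NO \<alpha> b) (psmor_id T C))
      \<longleftrightarrow> (NA \<alpha> f \<in> pscells T C (A b) \<and>
        Source (NA \<alpha> f) = psmor_comp T C (A a) (A b) (PA F f) (NO \<alpha> a) \<and> Target (NA \<alpha> f) = NO \<alpha> b) \<and>
        (\<forall>x\<in>Ob (car C). At (NA \<alpha> f) x \<in> isos (X b) (FO (H f) (FO (fun_of (NO \<alpha> a)) x))
            (FO (fun_of (NO \<alpha> b)) x))"
      if f: "f \<in> hom J a b" for f a b
    proof -
      note ob = J.hom_Ob[OF f]
      have NO: "NO \<alpha> b \<in> psmors T C (A b)" using O ob by auto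
      show ?thesis
        unfolding T.psmor_comp_id(1)[OF C A_psalg[OF ob(2)] NO] T.cell_isos[OF C A_psalg[OF ob(2)]]
        by (auto simp: FO_fun_comp)
    qed
    then show ?thesis by blast
  qed
  have id: "?idl a = ?idr a \<longleftrightarrow> (\<forall>x\<in>Ob (car C). Comp (X a) (At (NA \<alpha> (Id J a)) x)
      (At (PU F a) (FO (fun_of (NO \<alpha> a)) x))
      = Id (X a) (FO (fun_of (NO \<alpha> a)) x))" if O: ?O and N: ?N and a: "a \<in> Ob J" for a
  proof -
    have NO: "NO \<alpha> a \<in> psmors T C (A a)" using O a by auto
    note Aa = A_psalg[OF a]
    have "At (?idl a) x = Comp (X a) (At (NA \<alpha> (Id J a)) x) (At (PU F a) (FO (fun_of (NO \<alpha> a)) x))"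
      if x: "x \<in> Ob (car C)" for x
      unfolding At_Comp[OF x] T.At_whisker_right[OF C Aa Aa PU_cell(1)[OF a] NO x] ..
    moreover have "At (?idr a) x = Id (X a) (FO (fun_of (NO \<alpha> a)) x)" if x: "x \<in> Ob (car C)" for x
      unfolding T.At_whisker_right[OF C C Aa T.Id_cell[OF C Aa NO] iC x] T.fun_of_id FO_fid[OF x]
          At_Id[OF x] ..
    moreover have "Source (?idl a) = Source (?idr a)"
      by (simp add: PU_cell(2)[OF a] T.psmor_comp_id[OF C Aa NO])
    moreover have "Target (?idl a) = Target (?idr a)"
      using N J.Id_hom[OF a] by (simp add: T.psmor_comp_id[OF C Aa NO])
    ultimately show ?thesis by (subst trans_eq_iff[where S = "Ob (car C)"]) simp_all
  qed
  have co: "?col a b c f g = ?cor a b c f g \<longleftrightarrow> (\<forall>x\<in>Ob (car C).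
      Comp (X c) (At (NA \<alpha> (Comp J g f)) x) (At (PC F g f) (FO (fun_of (NO \<alpha> a)) x))
      = Comp (X c) (At (NA \<alpha> g) x) (FA (H g) (At (NA \<alpha> f) x)))"
    if O: ?O and N: ?N and f: "f \<in> hom J a b" and g: "g \<in> hom J b c" for a b c f g
  proof -
    note ob = J.hom_Ob[OF f] J.hom_Ob(2)[OF g]
    have NOa: "NO \<alpha> a \<in> psmors T C (A a)" and NOc: "NO \<alpha> c \<in> psmors T C (A c)" using O ob by auto
    note Aa = A_psalg[OF ob(1)] and Ab = A_psalg[OF ob(2)] and Ac = A_psalg[OF ob(3)]
    have Nf: "NA \<alpha> f \<in> pscells T C (A b)" "Source (NA \<alpha> f)
        = psmor_comp T C (A a) (A b) (PA F f) (NO \<alpha> a)" "Target (NA \<alpha> f) = NO \<alpha> b"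
      using N f by blast+
    have Ng: "NA \<alpha> g \<in> pscells T C (A c)" "Source (NA \<alpha> g)
        = psmor_comp T C (A b) (A c) (PA F g) (NO \<alpha> b)" "Target (NA \<alpha> g) = NO \<alpha> c"
      using N g by blast+
    have Ngf: "Target (NA \<alpha> (Comp J g f)) = NO \<alpha> c"
      using N J.Comp_hom[OF f g] by blast
    have "At (?col a b c f g) x = Comp (X c) (At (NA \<alpha> (Comp J g f)) x)
        (At (PC F g f) (FO (fun_of (NO \<alpha> a)) x))"
      if x: "x \<in> Ob (car C)" for x
      unfolding At_Comp[OF x] T.At_whisker_right[OF C Aa Ac PC_cell(1)[OF f g] NOa x] ..
    \<comment> \<open>The outermost of the three factors is the whiskering of identity cells and
      hence an identity, which leaves a composite of two.\<close>
    moreover have "At (?cor a b c f g) x = Comp (X c) (At (NA \<alpha> g) x) (FA (H g) (At (NA \<alpha> f) x))"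
      if x: "x \<in> Ob (car C)" for x
    proof -
      have 1: "FA (H g) (At (NA \<alpha> f) x) \<in> hom (X c)
          (FO (H g) (FO (fun_of (psmor_comp T C (A a) (A b) (PA F f) (NO \<alpha> a))) x))
          (FO (H g) (FO (fun_of (NO \<alpha> b)) x))"
        using functorsD(4)[OF H_functor[OF g] T.pscellsD(5)[OF C Ab Nf(1) x]] by (simp add: Nf)
      have 2: "At (NA \<alpha> g) x \<in> hom (X c) (FO (H g) (FO (fun_of (NO \<alpha> b)) x))
          (FO (fun_of (NO \<alpha> c)) x)"
        using T.pscellsD(5)[OF C Ac Ng(1) x] by (simp add: Ng FO_fun_comp[OF x])
      note h = category.Comp_hom[OF X_category[OF ob(3)] 1 2]
      show ?thesis
        unfolding At_Comp[OF x] T.At_whisker_right[OF C C Ac T.Id_cell[OF C Ac NOc] iC x]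
            T.At_whisker_right[OF C C Ac Ng(1) iC x]
          T.At_whisker_left[OF C Ab Ac Nf(1) M_psmors[OF g] x] T.fun_of_id FO_fid[OF x] At_Id[OF x]
        by (rule category.Id_Comp[OF X_category[OF ob(3)] h])
    qed
    moreover have "Source (?col a b c f g) = Source (?cor a b c f g)"
      by (simp add: PC_cell(2)[OF f g] Nf T.psmor_comp_assoc[OF C Aa Ab Ac NOa M_psmors[OF f]
          M_psmors[OF g]])
    moreover have "Target (?col a b c f g) = Target (?cor a b c f g)"
      by (simp add: Ngf T.psmor_comp_id(1)[OF C Ac NOc])
    ultimately show ?thesis by (subst trans_eq_iff[where S = "Ob (car C)"]) simp_all
  qed
  have FO: "FO (fun_of (NO \<alpha> j)) x \<in> Ob (X j)" if O: ?O and "j \<in> Ob J" "x \<in> Ob (car C)" for j x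
  proof -
    have "NO \<alpha> j \<in> psmors T C (A j)" using O that(2) by auto
    then show ?thesis using functorsD(3)[OF T.psmors_functor that(3)] by blast
  qed
  have R: "?R \<longleftrightarrow> ?iso' \<and> (\<forall>a\<in>Ob J. ?idl a = ?idr a) \<and>
      (\<forall>a b c. \<forall>f\<in>hom J a b. \<forall>g\<in>hom J b c. ?col a b c f g = ?cor a b c f g)" if O: ?O and N: ?N
  proof -
    have 1: "(\<forall>a\<in>Ob J. ?idl a = ?idr a) \<longleftrightarrow> (\<forall>a\<in>Ob J. \<forall>x\<in>Ob (car C).
      Comp (X a) (At (NA \<alpha> (Id J a)) x) (At (PU F a) (FO (fun_of (NO \<alpha> a)) x))
          = Id (X a) (FO (fun_of (NO \<alpha> a)) x))"
      by (rule ball_cong[OF refl]) (rule id[OF O N])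
    have 2: "(\<forall>a b c. \<forall>f\<in>hom J a b. \<forall>g\<in>hom J b c. ?col a b c f g = ?cor a b c f g)
      \<longleftrightarrow> (\<forall>a b c. \<forall>f\<in>hom J a b. \<forall>g\<in>hom J b c. \<forall>x\<in>Ob (car C).
        Comp (X c) (At (NA \<alpha> (Comp J g f)) x) (At (PC F g f) (FO (fun_of (NO \<alpha> a)) x))
        = Comp (X c) (At (NA \<alpha> g) x) (FA (H g) (At (NA \<alpha> f) x)))"
      by (intro all_cong1 ball_cong[OF refl]) (rule co[OF O N])
    show ?thesis
      unfolding 1 2 compatible_iff using FO[OF O] by blast
  qed
  have "?iso \<and> (\<forall>a\<in>Ob J. ?idl a = ?idr a) \<and>
      (\<forall>a b c. \<forall>f\<in>hom J a b. \<forall>g\<in>hom J b c. ?col a b c f g = ?cor a b c f g) \<longleftrightarrow> ?N \<and> ?R" if O: ?O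
  \<comment> \<open>The component forms of the axioms are available for well-typed cells only. If
    \<open>?N\<close> fails, both sides are false, since \<open>?iso\<close> contains
    \<open>?N\<close>.\<close>
  proof (cases ?N)
    case True
    show ?thesis unfolding iso[OF O] R[OF O True] using True by satx
  next
    case False
    then show ?thesis unfolding iso[OF O] by satx
  qed
  then show ?thesis unfolding L by satx
qed

text \<open>By the same matching of endpoints, the modification axiom becomes, at each object of
  \<open>C\<close>, the condition that defines an arrow of the limit.\<close>

lemma modifs_iff:
  "\<Xi> \<in> modifs J K (const_psfun K C) F \<longleftrightarrow>
    Source \<Xi> \<in> psnats J K (const_psfun K C) F \<and> Target \<Xi> \<in> psnats J K (const_psfun K C) F \<and>
    At \<Xi> \<in> extensional (Ob J) \<and>
    (\<forall>j\<in>Ob J. At \<Xi> j \<in> pscells T C (A j) \<and> Source (At \<Xi> j) = NO (Source \<Xi>) j \<and> Target (At \<Xi> j)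
        = NO (Target \<Xi>) j) \<and>
    (\<forall>x\<in>Ob (car C). \<forall>a b. \<forall>f\<in>hom J a b.
      Comp (X b) (At (At \<Xi> b) x) (At (NA (Source \<Xi>) f) x)
      = Comp (X b) (At (NA (Target \<Xi>) f) x) (FA (H f) (At (At \<Xi> a) x)))"
  (is "?L \<longleftrightarrow> ?S \<and> ?T \<and> ?E \<and> ?N \<and> ?R")
proof -
  note iC = T.psmor_id_psmors[OF C]
  let ?l = "\<lambda>a b f. Comp (Hom K C (A b)) (Comp2 K C C (A b) (At \<Xi> b)
      (Id (Hom K C C) (psmor_id T C))) (NA (Source \<Xi>) f)"
  let ?r = "\<lambda>a b f. Comp (Hom K C (A b)) (NA (Target \<Xi>) f)
      (Comp2 K C (A a) (A b) (Id (Hom K (A a) (A b)) (PA F f)) (At \<Xi> a))"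
  have L: "?L \<longleftrightarrow> ?S \<and> ?T \<and> ?E \<and> ?N \<and> (\<forall>a b. \<forall>f\<in>hom J a b. ?l a b f = ?r a b f)"
    by (auto simp: modifs_def Let_def PiE_iff hom_PsAlg)
  have eq: "?l a b f = ?r a b f \<longleftrightarrow> (\<forall>x\<in>Ob (car C). Comp (X b) (At (At \<Xi> b) x)
      (At (NA (Source \<Xi>) f) x)
      = Comp (X b) (At (NA (Target \<Xi>) f) x) (FA (H f) (At (At \<Xi> a) x)))"
    if S: ?S and R: ?T and N: ?N and f: "f \<in> hom J a b" for a b f
  proof -
    note ob = J.hom_Ob[OF f]
    note Aa = A_psalg[OF ob(1)] and Ab = A_psalg[OF ob(2)]
    have Na: "At \<Xi> a \<in> pscells T C (A a)" "Source (At \<Xi> a) = NO (Source \<Xi>) a" and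
      Nb: "At \<Xi> b \<in> pscells T C (A b)" "Target (At \<Xi> b) = NO (Target \<Xi>) b"
      using N ob by auto
    have NO: "NO (Target \<Xi>) b \<in> psmors T C (A b)" using R[unfolded psnats_iff] ob by auto
    have Sf: "Source (NA (Source \<Xi>) f) = psmor_comp T C (A a) (A b) (PA F f) (NO (Source \<Xi>) a)"
      using S[unfolded psnats_iff] f by blast
    have Tf: "Target (NA (Target \<Xi>) f) = NO (Target \<Xi>) b"
      using R[unfolded psnats_iff] f by blast
    have "At (?l a b f) x = Comp (X b) (At (At \<Xi> b) x) (At (NA (Source \<Xi>) f) x)"
        if x: "x \<in> Ob (car C)" for x
      unfolding At_Comp[OF x] T.At_whisker_right[OF C C Ab Nb(1) iC x] T.fun_of_id FO_fid[OF x] ..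
    moreover have "At (?r a b f) x = Comp (X b) (At (NA (Target \<Xi>) f) x) (FA (H f) (At (At \<Xi> a) x))"
        if x: "x \<in> Ob (car C)" for x
      unfolding At_Comp[OF x] T.At_whisker_left[OF C Aa Ab Na(1) M_psmors[OF f] x] ..
    moreover have "Source (?l a b f) = Source (?r a b f)" by (simp add: Sf Na)
    moreover have "Target (?l a b f) = Target (?r a b f)"
        by (simp add: Tf Nb T.psmor_comp_id(1)[OF C Ab NO])
    ultimately show ?thesis by (subst trans_eq_iff[where S = "Ob (car C)"]) simp_all
  qed
  show ?thesis unfolding L using eq by blast
qed

end

end

section \<open>The limit cone\<close>

context diagram
begin

definition limit_alg :: "('t, 'u, 'u) psalg" where
  "limit_alg = \<lparr>car = W, Phi = PhiW, cc = cW, II = IW, ss = sW\<rparr>"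

lemma limit_alg_simps[simp]:
  "car limit_alg = W" "Phi limit_alg = PhiW" "cc limit_alg = cW" "II limit_alg = IW"
      "ss limit_alg = sW"
  by (simp_all add: limit_alg_def)

lemma limit_psalg: "is_psalg T limit_alg"
  using W_psalg by (simp add: is_psalg_def)

lemma limit_data: "algebra_data T (car limit_alg) (Phi limit_alg) (cc limit_alg) (II limit_alg)
    (ss limit_alg)"
  using WA.algebra_data_axioms by simp

definition proj_mor :: "'u \<Rightarrow> ('t, 'u, 'u) psmor" where
  "proj_mor j = \<lparr>fun_of = proj j,
    rho = (\<lambda>w\<in>(\<Union>n. words T n). idn (pw W (Dom T w)) (X j) (PhiF w (Dom T w) j))\<rparr>"

lemma fun_of_proj: "fun_of (proj_mor j) = proj j"
  by (simp add: proj_mor_def)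

lemma rho_proj:
  assumes "w \<in> words T n"
  shows "rho (proj_mor j) w = idn (pw W n) (X j) (PhiF w n j)"
proof -
  have "w \<in> (\<Union>n. words T n)" using assms by blast
  then show ?thesis using assms by (simp add: proj_mor_def Dom_words)
qed

lemma At_rho_proj:
  assumes "w \<in> words T n" "x \<in> Ob (pw W n)"
  shows "At (rho (proj_mor j) w) x = Id (X j) (FO (Phi (A j) w) (pos n j x))"
  using assms by (simp add: rho_proj At_idn FO_PhiF)

lemma proj_data:
  assumes j: "j \<in> Ob J"
  shows "morphism_data T limit_alg (A j) (proj_mor j)"
proof (intro morphism_data.intro morphism_data_axioms.intro limit_data A_data[OF j])
  show "fun_of (proj_mor j) \<in> functors (car limit_alg) (X j)"
    using proj_functor[OF j] by (simp add: fun_of_proj)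
  show "rho (proj_mor j) \<in> extensional (\<Union>n. words T n)"
    by (simp add: proj_mor_def)
  fix w n assume w: "w \<in> words T n"
  \<comment> \<open>Strictness of the projection: the two functors that \<open>rho\<close> has to
    compare are equal, so an identity transformation is well typed.\<close>
  have "fcomp (pw W n) (proj j) (PhiW w) = PhiF w n j"
  proof (rule functor_eqI[OF fcomp_functor[OF PhiW(1)[OF w] proj_functor[OF j]
      pw_category[OF W.category_axioms]]
        PhiF_functor[OF w j]])
    show "FO (fcomp (pw W n) (proj j) (PhiW w)) x = FO (PhiF w n j) x" if x: "x \<in> Ob (pw W n)" for x
      using PhiW(2)[OF w x j] functorsD(3)[OF PhiW(1)[OF w] x]
          by (simp add: FO_fcomp[OF x] FO_proj FO_PhiF[OF x])
    show "FA (fcomp (pw W n) (proj j) (PhiW w)) m = FA (PhiF w n j) m" if m: "m \<in> Arr (pw W n)"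
        for m
      using PhiW(4)[OF w m j] homD(1)[OF functorsD(4)[OF PhiW(1)[OF w] Arr_hom[OF m]]]
      by (simp add: FA_fcomp[OF m] FA_proj FA_PhiF[OF m])
  qed
  then show "rho (proj_mor j) w \<in> nat_isos (pw (car limit_alg) n) (X j)
      (fcomp (pw (car limit_alg) n) (fun_of (proj_mor j)) (Phi limit_alg w))
      (fcomp (pw (car limit_alg) n) (Phi (A j) w) (powF (car limit_alg) n (fun_of (proj_mor j))))"
    using idn_nat_isos[OF PhiF_functor[OF w j] pw_category[OF W.category_axioms] X_category[OF j]]
    by (simp add: fun_of_proj rho_proj[OF w]) (simp add: PhiF_def)
qed

lemma pow_proj: "x \<in> Ob (pw W n) \<Longrightarrow> (\<lambda>i\<in>{..<n}. FO (proj j) (x i)) = pos n j x"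
  by (rule restrict_ext) (simp add: FO_proj pw_Ob_nth)

text \<open>All factors \<open>rho\<close> in the laws are identities. What remains says that
  component \<open>j\<close> of a coherence isomorphism of \<open>W\<close> is the corresponding one
  of \<open>A j\<close>, which is how it was constructed.\<close>

lemma proj_psmors:
  assumes j: "j \<in> Ob J"
  shows "proj_mor j \<in> psmors T limit_alg (A j)"
proof -
  interpret P: morphism_data T limit_alg "A j" "proj_mor j" by (rule proj_data[OF j])
  have fa: "FA (proj j) m = pa j m" if "m \<in> hom W w w'" for m w w'
    using homD(1)[OF that] by (simp add: FA_proj)
  show ?thesis
    unfolding P.psmors_iff
  proof (intro conjI allI ballI)
    fix k n w ws x assume w: "w \<in> words T k" and ws: "ws \<in> (\<Pi>\<^sub>E i\<in>{..<k}. words T (n i))"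
      and x': "x \<in> Ob (pw (car limit_alg) (offset n k))"
    have x: "x \<in> Ob (pw W (offset n k))" using x' by simp
    have ws': "ws i \<in> words T (n i)" if "i < k" for i using ws that by auto
    have g: "wgamma T k n w ws \<in> words T (offset n k)" by (rule T.wgamma_words[OF w ws'])
    note z = WA.words_Phi_Ob[OF ws x] and y = pos_Ob[OF x j]
    note c = P.B.c_hom[OF w ws y] and zj = P.B.words_Phi_Ob[OF ws y]
    have pz: "pos k j (\<lambda>i\<in>{..<k}. FO (PhiW (ws i)) (blk n i x))
      = (\<lambda>i\<in>{..<k}. FO (Phi (A j) (ws i)) (blk n i (pos (offset n k) j x)))"
      by (rule W_gamma(3)[OF w ws x j])
    have eq: "(\<lambda>i\<in>{..<k}. At (rho (proj_mor j) (ws i)) (blk n i x))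
      = (\<lambda>i\<in>{..<k}. Id (X j) ((\<lambda>i\<in>{..<k}. FO (Phi (A j) (ws i)) (blk n i (pos (offset n k) j x)))
          i))"
      by (rule restrict_ext) (simp add: At_rho_proj[OF ws' blk_pw(1)[OF _ x]]
          pos_blk[where k = k and n = n])
    show "P.gamma_law k n w ws x"
      unfolding P.gamma_law_def fun_of_proj limit_alg_simps pow_proj[OF x] At_rho_proj[OF g x]
          At_rho_proj[OF w z] pz eq
        fa[OF WA.c_hom[OF w ws x]] cW(2)[OF w ws x j] P.B.Phi_Id[OF w zj]
      using P.B.X.Comp_Id[OF c] P.B.X.Id_Comp[OF c] by simp
  next
    fix x assume x': "x \<in> Ob (pw (car limit_alg) 1)"
    have x: "x \<in> Ob (pw W 1)" using x' by simp
    show "P.unit_law x"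
      unfolding P.unit_law_def fun_of_proj limit_alg_simps pow_proj[OF x]
          At_rho_proj[OF T.wunit_words x]
        fa[OF WA.I_hom[OF x]] IW(2)[OF x j]
      by (rule P.B.X.Comp_Id[OF P.B.I_hom[OF pos_Ob[OF x j]]])
  next
    fix k l w f x assume w: "w \<in> words T k" and f: "f \<in> {..<k} \<rightarrow>\<^sub>E {..<l}"
        and x': "x \<in> Ob (pw (car limit_alg) l)"
    have x: "x \<in> Ob (pw W l)" using x' by simp
    have f': "f i < l" if "i < k" for i using f that by auto
    have g: "wsubst T k l f w \<in> words T l" by (rule T.wsubst_words[OF w f'])
    have y: "compose {..<k} x f \<in> Ob (pw W k)" by (rule compose_pw(1)[OF f' x])
    have py: "pos k j (compose {..<k} x f) = compose {..<k} (pos l j x) f"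
        by (rule pos_compose[OF f'])
    note c = P.B.s_hom[OF w f pos_Ob[OF x j]]
    show "P.subst_law k l w f x"
      unfolding P.subst_law_def fun_of_proj limit_alg_simps pow_proj[OF x] At_rho_proj[OF g x]
          At_rho_proj[OF w y] py
        fa[OF WA.s_hom[OF w f x]] sW(2)[OF w f x j]
      using P.B.X.Comp_Id[OF c] P.B.X.Id_Comp[OF c] by simp
  qed
qed

definition proj_cell :: "'u \<Rightarrow> ('t, 'u, 'u) pscell" where
  "proj_cell f = \<lparr>Source = psmor_comp T limit_alg (A (Dom J f)) (A (Cod J f)) (PA F f)
      (proj_mor (Dom J f)),
    Target = proj_mor (Cod J f), At = (\<lambda>w\<in>Ob W. ph f w)\<rparr>"

text \<open>Naturality is the compatibility condition on arrows of \<open>W\<close>. The 2-cell law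
  is the definition of the structure isomorphisms of \<open>PhiW w\<close>: as the projections have
  identity \<open>rho\<close>, it reduces to \<open>lam_eq\<close>.\<close>

lemma proj_cell:
  assumes f: "f \<in> hom J a b"
  shows "proj_cell f \<in> pscells T limit_alg (A b)"
    and "Source (proj_cell f) = psmor_comp T limit_alg (A a) (A b) (PA F f) (proj_mor a)"
    and "Target (proj_cell f) = proj_mor b"
    and "w \<in> Ob W \<Longrightarrow> At (proj_cell f) w = ph f w"
proof -
  show S: "Source (proj_cell f) = psmor_comp T limit_alg (A a) (A b) (PA F f) (proj_mor a)"
    and R: "Target (proj_cell f) = proj_mor b"
    using homD[OF f] by (simp_all add: proj_cell_def)
  show At: "At (proj_cell f) w = ph f w" if "w \<in> Ob W" for w
    using that by (simp add: proj_cell_def)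
  note ob = J.hom_Ob[OF f]
  note Aa = A_psalg[OF ob(1)] and Ab = A_psalg[OF ob(2)] and L = limit_psalg
  note pa' = proj_psmors[OF ob(1)] and pb = proj_psmors[OF ob(2)] and M = M_psmors[OF f]
  interpret B: category "X b" by (rule X_category[OF ob(2)])
  have HP: "FO (fun_of (psmor_comp T limit_alg (A a) (A b) (PA F f) (proj_mor a))) w
      = FO (H f) (po a w)"
    if "w \<in> Ob W" for w
    using that by (simp add: T.fun_of_comp FO_fcomp fun_of_proj FO_proj)
  show "proj_cell f \<in> pscells T limit_alg (A b)"
  proof (rule T.pscellsI[OF L Ab T.psmor_comp_psmors[OF L Aa Ab pa' M] pb S R], unfold
      limit_alg_simps)
    show "At (proj_cell f) \<in> extensional (Ob W)" by (simp add: proj_cell_def)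
    show "At (proj_cell f) w \<in> hom (X b) (FO (fun_of
        (psmor_comp T limit_alg (A a) (A b) (PA F f) (proj_mor a))) w)
        (FO (fun_of (proj_mor b)) w)" if "w \<in> Ob W" for w
      using ph_hom[OF that f] that by (simp add: At HP fun_of_proj FO_proj)
    show "Comp (X b) (At (proj_cell f) w') (FA
        (fun_of (psmor_comp T limit_alg (A a) (A b) (PA F f) (proj_mor a))) m)
      = Comp (X b) (FA (fun_of (proj_mor b)) m) (At (proj_cell f) w)" if m: "m
          \<in> hom W w w'" for w w' m
      using pa_hom(2)[OF m f] W.hom_Ob[OF m] homD(1)[OF m]
      by (simp add: At T.fun_of_comp FA_fcomp fun_of_proj FA_proj)
    fix n w x assume w: "w \<in> words T n" and x: "x \<in> Ob (pw W n)"
    then have x': "x \<in> Ob (pw (car limit_alg) n)" by simp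
    note Px = functorsD(3)[OF PhiW(1)[OF w] x]
    note p = lam_parts[OF w x f, THEN isos_hom]
    have 1: "(\<lambda>i\<in>{..<n}. At (proj_cell f) (x i)) = phs n f x"
      by (rule restrict_ext) (simp add: At pw_Ob_nth[OF x])
    have 2: "At (rho (psmor_comp T limit_alg (A a) (A b) (PA F f) (proj_mor a)) w) x
        = At (rho (PA F f) w) (pos n a x)"
      unfolding T.At_rho_psmor_comp[OF L Aa Ab pa' M w x'] fun_of_proj pow_proj[OF x]
          At_rho_proj[OF w x]
      using functorsD(5)[OF H_functor[OF f]] functorsD(3)[OF
          algebra_data.Phi_functor[OF A_data[OF ob(1)] w] pos_Ob[OF x ob(1)]]
        B.Comp_Id[OF p(1)] by simp
    show "Comp (X b) (At (rho (proj_mor b) w) x) (At (proj_cell f) (FO (PhiW w) x))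
      = Comp (X b) (FA (Phi (A b) w) (\<lambda>i\<in>{..<n}. At (proj_cell f) (x i)))
          (At (rho (psmor_comp T limit_alg (A a) (A b) (PA F f) (proj_mor a)) w) x)"
      unfolding 1 2 At[OF Px] PhiW(3)[OF w x homD(1)[OF f]] At_rho_proj[OF w x]
      using B.Id_Comp[OF isos_hom[OF lam_isos[OF w x f]]] lam_eq[OF f] by simp
  qed
qed

definition limit_cone :: "('u, 'u, ('t, 'u, 'u) psmor, ('t, 'u, 'u) pscell) psnat" where
  "limit_cone = \<lparr>NO = (\<lambda>j\<in>Ob J. proj_mor j), NA = (\<lambda>f\<in>Arr J. proj_cell f)\<rparr>"

lemma NO_limit: "j \<in> Ob J \<Longrightarrow> NO limit_cone j = proj_mor j"
  and NA_limit: "f \<in> Arr J \<Longrightarrow> NA limit_cone f = proj_cell f"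
  by (simp_all add: limit_cone_def)

lemma compatible_cong:
  assumes "\<And>j. j \<in> Ob J \<Longrightarrow> x j = x' j" "\<And>f. f \<in> Arr J \<Longrightarrow> \<phi> f = \<phi>' f"
  shows "compatible x \<phi> \<longleftrightarrow> compatible x' \<phi>'"
  using assms by (simp add: compatible_def cong: restrict_cong)

text \<open>Read at an object \<open>w\<close> of \<open>W\<close>, the limit cone returns the
  components and structure isomorphisms of \<open>w\<close>, so the cone axioms are the conditions
  that \<open>w\<close> satisfies.\<close>

lemma limit_cone_psnats: "limit_cone \<in> psnats J K (const_psfun K limit_alg) F"
  unfolding psnats_iff[OF limit_psalg]
proof (intro conjI allI ballI)
  show "NO limit_cone \<in> (\<Pi>\<^sub>E j\<in>Ob J. psmors T limit_alg (A j))"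
      "NA limit_cone \<in> extensional (Arr J)"
    using proj_psmors by (auto simp: limit_cone_def)
  fix a b f assume f: "f \<in> hom J a b"
  show "NA limit_cone f \<in> pscells T limit_alg (A b)"
    "Source (NA limit_cone f) = psmor_comp T limit_alg (A a) (A b) (PA F f) (NO limit_cone a)"
    "Target (NA limit_cone f) = NO limit_cone b"
    using proj_cell[OF f] J.hom_Ob[OF f] homD(1)[OF f] by (simp_all add: NO_limit NA_limit)
next
  fix w assume "w \<in> Ob (car limit_alg)"
  then have w: "w \<in> Ob W" by simp
  have "compatible (\<lambda>j. FO (fun_of (NO limit_cone j)) w) (\<lambda>f. At (NA limit_cone f) w)
    \<longleftrightarrow> compatible (\<lambda>j. po j w) (\<lambda>f. ph f w)"
    using w proj_cell(4)[OF Arr_hom w]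
    by (intro compatible_cong) (simp_all add: NO_limit NA_limit fun_of_proj FO_proj)
  then show "compatible (\<lambda>j. FO (fun_of (NO limit_cone j)) w) (\<lambda>f. At (NA limit_cone f) w)"
    using W_compatible[OF w] by simp
qed

section \<open>The universal property\<close>

context
  fixes C :: "('t, 'u, 'u) psalg"
  assumes C: "is_psalg T C"
begin

text \<open>The object part of \<open>postcomp\<close>. It is named because it also provides the
  sources and targets of the modifications in the arrow part.\<close>

definition cone_of :: "('t, 'u, 'u) psmor \<Rightarrow> ('u, 'u, ('t, 'u, 'u) psmor, ('t, 'u, 'u) pscell) psnat"
    where
  "cone_of h = \<lparr>NO = (\<lambda>j\<in>Ob J. psmor_comp T C limit_alg (A j) (NO limit_cone j) h),
    NA = (\<lambda>f\<in>Arr J. Comp2 K C limit_alg (A (Cod J f)) (NA limit_cone f)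
        (Id (Hom K C limit_alg) h))\<rparr>"

lemma postcomp_eq:
  "FO (postcomp J K F limit_alg limit_cone C) = (\<lambda>h\<in>psmors T C limit_alg. cone_of h)"
  "FA (postcomp J K F limit_alg limit_cone C) = (\<lambda>\<theta>\<in>pscells T C limit_alg.
    \<lparr>Source = cone_of (Source \<theta>), Target = cone_of (Target \<theta>),
     At = (\<lambda>j\<in>Ob J. Comp2 K C limit_alg (A j) (Id (Hom K limit_alg (A j)) (NO limit_cone j)) \<theta>)\<rparr>)"
  by (simp_all add: postcomp_def Let_def cone_of_def)

lemma NO_cone: "j \<in> Ob J \<Longrightarrow> NO (cone_of h) j = psmor_comp T C limit_alg (A j) (proj_mor j) h"
  by (simp add: cone_of_def NO_limit)

lemma NA_cone: "f \<in> hom J a b \<Longrightarrow>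
    NA (cone_of h) f = Comp2 K C limit_alg (A b) (proj_cell f) (Id (Hom K C limit_alg) h)"
  using homD[of f J a b] by (simp add: cone_of_def NA_limit)

lemma mor_functor: "h \<in> psmors T C limit_alg \<Longrightarrow> fun_of h \<in> functors (car C) W"
  using T.psmors_functor[of h C limit_alg] by simp

text \<open>Composing with a projection merely extracts a component, for \<open>rho\<close> as well:
  the projection contributes an identity to \<open>rho\<close> of the composite.\<close>

lemma cone_components:
  assumes h: "h \<in> psmors T C limit_alg" and j: "j \<in> Ob J"
  shows "NO (cone_of h) j \<in> psmors T C (A j)"
    and "x \<in> Ob (car C) \<Longrightarrow> FO (fun_of (NO (cone_of h) j)) x = po j (FO (fun_of h) x)"
    and "m \<in> Arr (car C) \<Longrightarrow> FA (fun_of (NO (cone_of h) j)) m = pa j (FA (fun_of h) m)"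
    and "\<lbrakk>w \<in> words T n; x' \<in> Ob (pw (car C) n)\<rbrakk> \<Longrightarrow> At (rho (NO (cone_of h) j) w) x'
        = pa j (At (rho h w) x')"
proof -
  note hf = mor_functor[OF h]
  show "NO (cone_of h) j \<in> psmors T C (A j)"
    unfolding NO_cone[OF j] by (rule T.psmor_comp_psmors[OF C limit_psalg A_psalg[OF j] h
        proj_psmors[OF j]])
  show "x \<in> Ob (car C) \<Longrightarrow> FO (fun_of (NO (cone_of h) j)) x = po j (FO (fun_of h) x)"
    using functorsD(3)[OF hf] by (simp add: NO_cone[OF j] T.fun_of_comp FO_fcomp fun_of_proj
        FO_proj)
  show "m \<in> Arr (car C) \<Longrightarrow> FA (fun_of (NO (cone_of h) j)) m = pa j (FA (fun_of h) m)"
    using homD(1)[OF functorsD(4)[OF hf Arr_hom]]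
        by (simp add: NO_cone[OF j] T.fun_of_comp FA_fcomp fun_of_proj FA_proj)
  interpret h: morphism_data T C limit_alg h by
      (rule psmors_data[OF T.is_theory_axioms C limit_psalg h])
  show "At (rho (NO (cone_of h) j) w) x' = pa j (At (rho h w) x')" if w: "w \<in> words T n"
      and x: "x' \<in> Ob (pw (car C) n)" for w n x'
  proof -
    have hx: "(\<lambda>i\<in>{..<n}. FO (fun_of h) (x' i)) \<in> Ob (pw W n)" using h.pow_Ob[OF x] by simp
    have r: "At (rho h w) x' \<in> hom W (FO (fun_of h) (FO (Phi C w) x'))
        (FO (PhiW w) (\<lambda>i\<in>{..<n}. FO (fun_of h) (x' i)))"
      using h.rho_hom[OF w x] by simp
    have "pa j (At (rho h w) x') \<in> hom (X j) (po j (FO (fun_of h) (FO (Phi C w) x')))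
        (FO (Phi (A j) w) (pos n j (\<lambda>i\<in>{..<n}. FO (fun_of h) (x' i))))"
      using pa_hom(1)[OF r j] PhiW(2)[OF w hx j] by simp
    then show ?thesis
      unfolding NO_cone[OF j] T.At_rho_psmor_comp[OF C limit_psalg A_psalg[OF j] h proj_psmors[OF j]
          w x]
        At_rho_proj[OF w hx] fun_of_proj FA_proj[OF homD(1)[OF r]]
      by (rule category.Id_Comp[OF X_category[OF j]])
  qed
qed

lemma At_NA_cone:
  assumes h: "h \<in> psmors T C limit_alg" and f: "f \<in> hom J a b" and x: "x \<in> Ob (car C)"
  shows "At (NA (cone_of h) f) x = ph f (FO (fun_of h) x)"
  unfolding NA_cone[OF f] T.At_whisker_right[OF C limit_psalg A_psalg[OF J.hom_Ob(2)[OF f]]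
      proj_cell(1)[OF f] h x]
  by (rule proj_cell(4)[OF f functorsD(3)[OF mor_functor[OF h] x]])

lemma cone_psnats:
  assumes h: "h \<in> psmors T C limit_alg"
  shows "cone_of h \<in> psnats J K (const_psfun K C) F"
  unfolding psnats_iff[OF C]
proof (intro conjI allI ballI)
  show "NO (cone_of h) \<in> (\<Pi>\<^sub>E j\<in>Ob J. psmors T C (A j))"
    using cone_components(1)[OF h] by (auto simp: PiE_iff) (simp add: cone_of_def)
  show "NA (cone_of h) \<in> extensional (Arr J)" by (simp add: cone_of_def)
  fix a b f assume f: "f \<in> hom J a b"
  note ob = J.hom_Ob[OF f]
  note Aa = A_psalg[OF ob(1)] and Ab = A_psalg[OF ob(2)]
  show "NA (cone_of h) f \<in> pscells T C (A b)"
    unfolding NA_cone[OF f] by (rule T.whisker_right_cell[OF C limit_psalg Ab proj_cell(1)[OF f] h])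
  show "Source (NA (cone_of h) f) = psmor_comp T C (A a) (A b) (PA F f) (NO (cone_of h) a)"
    unfolding NA_cone[OF f] NO_cone[OF ob(1)]
    by (simp add: proj_cell(2)[OF f] T.psmor_comp_assoc[OF C limit_psalg Aa Ab h
        proj_psmors[OF ob(1)] M_psmors[OF f]])
  show "Target (NA (cone_of h) f) = NO (cone_of h) b"
    unfolding NA_cone[OF f] NO_cone[OF ob(2)] by (simp add: proj_cell(3)[OF f])
next
  fix x assume x: "x \<in> Ob (car C)"
  have "compatible (\<lambda>j. FO (fun_of (NO (cone_of h) j)) x) (\<lambda>f. At (NA (cone_of h) f) x)
    \<longleftrightarrow> compatible (\<lambda>j. po j (FO (fun_of h) x)) (\<lambda>f. ph f (FO (fun_of h) x))"
    using cone_components(2)[OF h _ x] At_NA_cone[OF h Arr_hom x]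
        by (intro compatible_cong) simp_all
  then show "compatible (\<lambda>j. FO (fun_of (NO (cone_of h) j)) x) (\<lambda>f. At (NA (cone_of h) f) x)"
    using W_compatible[OF functorsD(3)[OF mor_functor[OF h] x]] by simp
qed

text \<open>The cone contains all components of \<open>h\<close>: the legs give \<open>po j\<close>
  and \<open>pa j\<close> of its values and \<open>pa j\<close> of its \<open>rho\<close>, and the
  coherence cells give \<open>ph f\<close>. Objects and arrows of \<open>W\<close> are determined by
  these.\<close>

lemma cone_inj:
  assumes h: "h \<in> psmors T C limit_alg" and k: "k \<in> psmors T C limit_alg"
      and eq: "cone_of h = cone_of k"
  shows "h = k"
proof (rule psmor_eqI[OF T.is_theory_axioms C limit_psalg h k])
  interpret h: morphism_data T C limit_alg h by
      (rule psmors_data[OF T.is_theory_axioms C limit_psalg h])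
  interpret k: morphism_data T C limit_alg k by
      (rule psmors_data[OF T.is_theory_axioms C limit_psalg k])
  have FO: "FO (fun_of h) x = FO (fun_of k) x" if x: "x \<in> Ob (car C)" for x
  proof (rule W_ob_eqI[OF functorsD(3)[OF mor_functor[OF h] x]
      functorsD(3)[OF mor_functor[OF k] x]])
    show "po j (FO (fun_of h) x) = po j (FO (fun_of k) x)" if "j \<in> Ob J" for j
      using cone_components(2)[OF h that x] cone_components(2)[OF k that x] eq by simp
    show "ph f (FO (fun_of h) x) = ph f (FO (fun_of k) x)" if "f \<in> Arr J" for f
      using At_NA_cone[OF h Arr_hom[OF that] x] At_NA_cone[OF k Arr_hom[OF that] x] eq by simp
  qed
  show funs: "fun_of h = fun_of k"
  proof (rule functor_eqI[OF mor_functor[OF h] mor_functor[OF k] FO])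
    fix m assume m: "m \<in> Arr (car C)"
    note m' = Arr_hom[OF m]
    have hm: "FA (fun_of h) m \<in> hom W (FO (fun_of k) (Dom (car C) m))
        (FO (fun_of k) (Cod (car C) m))"
      using functorsD(4)[OF mor_functor[OF h] m'] FO[OF h.A.X.hom_Ob(1)[OF m']]
          FO[OF h.A.X.hom_Ob(2)[OF m']] by simp
    show "FA (fun_of h) m = FA (fun_of k) m"
    proof (rule W_ar_eqI[OF hm functorsD(4)[OF mor_functor[OF k] m']])
      show "pa j (FA (fun_of h) m) = pa j (FA (fun_of k) m)" if "j \<in> Ob J" for j
        using cone_components(3)[OF h that m] cone_components(3)[OF k that m] eq by simp
    qed
  qed
  fix n w x assume w: "w \<in> words T n" and x: "x \<in> Ob (pw (car C) n)"
  show "At (rho h w) x = At (rho k w) x"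
  proof (rule W_ar_eqI)
    show "At (rho h w) x \<in> hom W (FO (fun_of k) (FO (Phi C w) x))
        (FO (PhiW w) (\<lambda>i\<in>{..<n}. FO (fun_of k) (x i)))"
      "At (rho k w) x \<in> hom W (FO (fun_of k) (FO (Phi C w) x))
          (FO (PhiW w) (\<lambda>i\<in>{..<n}. FO (fun_of k) (x i)))"
      using h.rho_hom[OF w x] k.rho_hom[OF w x] funs by simp_all
    show "pa j (At (rho h w) x) = pa j (At (rho k w) x)" if "j \<in> Ob J" for j
      using cone_components(4)[OF h that w x] cone_components(4)[OF k that w x] eq by simp
  qed
qed

text \<open>Both parts are forced by \<open>cone_components\<close> and \<open>At_NA_cone\<close>:
  the legs and coherence cells of the cone prescribe the values of the functor, and
  \<open>rho\<close> of the legs prescribes \<open>rho\<close>.\<close>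

definition lift_mor :: "('u, 'u, ('t, 'u, 'u) psmor, ('t, 'u, 'u) pscell) psnat \<Rightarrow> ('t, 'u, 'u)
    psmor" where
  "lift_mor \<alpha> = (let G = liftF (car C) (\<lambda>j. fun_of (NO \<alpha> j)) (\<lambda>f x. At (NA \<alpha> f) x) in
    \<lparr>fun_of = G, rho = (\<lambda>w\<in>(\<Union>n. words T n). let P = pw (car C) (Dom T w) in
      liftN P (fcomp P G (Phi C w)) (fcomp P (PhiW w) (powF (car C) (Dom T w) G))
        (\<lambda>j x. At (rho (NO \<alpha> j) w) x))\<rparr>)"

text \<open>This is surjectivity of \<open>cone_of\<close>, with an explicit preimage. Its algebra
  laws can be tested in the components, where they are the laws of the legs
  \<open>NO \<alpha> j\<close>.\<close>

lemma lift_mor: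
  assumes \<alpha>: "\<alpha> \<in> psnats J K (const_psfun K C) F"
  shows "lift_mor \<alpha> \<in> psmors T C limit_alg" "cone_of (lift_mor \<alpha>) = \<alpha>"
proof -
  let ?h = "lift_mor \<alpha>" and ?G = "liftF (car C) (\<lambda>j. fun_of (NO \<alpha> j)) (\<lambda>f x. At (NA \<alpha> f) x)"
  note a = \<alpha>[unfolded psnats_iff[OF C]]
  have NO: "NO \<alpha> j \<in> psmors T C (A j)" if "j \<in> Ob J" for j
    using a that by auto
  have NA: "NA \<alpha> f \<in> pscells T C (A b)"
      "Source (NA \<alpha> f) = psmor_comp T C (A a) (A b) (PA F f) (NO \<alpha> a)" "Target (NA \<alpha> f) = NO \<alpha> b"
    if "f \<in> hom J a b" for f a b
    using a that by blast+
  have comp: "compatible (\<lambda>j. FO (fun_of (NO \<alpha> j)) x) (\<lambda>f. At (NA \<alpha> f) x)" if "x \<in> Ob (car C)" for x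
    using a that by blast
  note Cc = psalg_category[OF C]
  interpret C: algebra_data T "car C" "Phi C" "cc C" "II C" "ss C"
      by (rule is_psalg_data[OF T.is_theory_axioms C])
  \<comment> \<open>Naturality of the coherence cell over \<open>f\<close> is what makes the images
    of an arrow under the legs an arrow of \<open>W\<close>.\<close>
  have nat: "Comp (X b) (FA (fun_of (NO \<alpha> b)) m) (At (NA \<alpha> f) x)
    = Comp (X b) (At (NA \<alpha> f) y) (FA (H f) (FA (fun_of (NO \<alpha> a)) m))"
    if f: "f \<in> hom J a b" and m: "m \<in> hom (car C) x y" for a b f m x y
    using T.pscellsD(6)[OF C A_psalg[OF J.hom_Ob(2)[OF f]] NA(1)[OF f] m] homD(1)[OF m]
    by (simp add: NA[OF f] T.fun_of_comp FA_fcomp)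
  note G = liftF[OF Cc T.psmors_functor[OF NO] comp nat]
  have GF: "?G \<in> functors (car C) W"
    and Gpo: "\<And>x j. \<lbrakk>x \<in> Ob (car C); j \<in> Ob J\<rbrakk> \<Longrightarrow> po j (FO ?G x) = FO (fun_of (NO \<alpha> j)) x"
    and Gph: "\<And>x f. \<lbrakk>x \<in> Ob (car C); f \<in> Arr J\<rbrakk> \<Longrightarrow> ph f (FO ?G x) = At (NA \<alpha> f) x"
    and Gpa: "\<And>m j. \<lbrakk>m \<in> Arr (car C); j \<in> Ob J\<rbrakk> \<Longrightarrow> pa j (FA ?G m) = FA (fun_of (NO \<alpha> j)) m"
    by (rule G; assumption)+
  have funs: "fun_of ?h = ?G" by (simp add: lift_mor_def Let_def)
  have rho: "rho ?h w = liftN (pw (car C) n) (fcomp (pw (car C) n) ?G (Phi C w))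
      (fcomp (pw (car C) n) (PhiW w) (powF (car C) n ?G)) (\<lambda>j x. At (rho (NO \<alpha> j) w) x)"
    if "w \<in> words T n" for w n
  proof -
    have "w \<in> (\<Union>n. words T n)" using that by blast
    then show ?thesis using that by (simp add: lift_mor_def Let_def Dom_words)
  qed
  have Gx: "(\<lambda>i\<in>{..<n}. FO ?G (x i)) \<in> Ob (pw W n)" if "x \<in> Ob (pw (car C) n)" for x n
    using functorsD(3)[OF powF_functor[OF Cc GF] that] by (simp add: FO_powF[OF that])
  have Gpos: "pos n j (\<lambda>i\<in>{..<n}. FO ?G (x i)) = (\<lambda>i\<in>{..<n}. FO (fun_of (NO \<alpha> j)) (x i))"
    if "x \<in> Ob (pw (car C) n)" "j \<in> Ob J" for x n j
    by (rule restrict_ext) (simp add: Gpo[OF pw_Ob_nth[OF that(1)] that(2)])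
  have Gphs: "phs n f (\<lambda>i\<in>{..<n}. FO ?G (x i)) = (\<lambda>i\<in>{..<n}. At (NA \<alpha> f) (x i))"
    if "x \<in> Ob (pw (car C) n)" "f \<in> Arr J" for x n f
    by (rule restrict_ext) (simp add: Gph[OF pw_Ob_nth[OF that(1)] that(2)])
  have rho_props: "rho ?h w \<in> nat_isos (pw (car C) n) W (fcomp (pw (car C) n) ?G (Phi C w))
      (fcomp (pw (car C) n) (PhiW w) (powF (car C) n ?G))"
    "\<And>x j. \<lbrakk>x \<in> Ob (pw (car C) n); j \<in> Ob J\<rbrakk> \<Longrightarrow> pa j (At (rho ?h w) x) = At (rho (NO \<alpha> j) w) x"
    if w: "w \<in> words T n" for w n
  proof -
    let ?S = "fcomp (pw (car C) n) ?G (Phi C w)" and ?R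
        = "fcomp (pw (car C) n) (PhiW w) (powF (car C) n ?G)"
    note pC = pw_category[OF Cc, of n]
    have S: "?S \<in> functors (pw (car C) n) W" by (rule fcomp_functor[OF C.Phi_functor[OF w] GF pC])
    have R: "?R \<in> functors (pw (car C) n) W" by
        (rule fcomp_functor[OF powF_functor[OF Cc GF] PhiW(1)[OF w] pC])
    have So: "po j (FO ?S x) = FO (fun_of (NO \<alpha> j)) (FO (Phi C w) x)" if x: "x \<in> Ob (pw (car C) n)"
        and j: "j \<in> Ob J" for x j
      using Gpo[OF functorsD(3)[OF C.Phi_functor[OF w] x] j] by (simp add: FO_fcomp[OF x])
    have Ro: "po j (FO ?R x) = FO (Phi (A j) w) (\<lambda>i\<in>{..<n}. FO (fun_of (NO \<alpha> j)) (x i))"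
      if x: "x \<in> Ob (pw (car C) n)" and j: "j \<in> Ob J" for x j
      using PhiW(2)[OF w Gx[OF x] j] Gpos[OF x j] by (simp add: FO_fcomp[OF x] FO_powF[OF x])
    have iso: "At (rho (NO \<alpha> j) w) x \<in> isos (X j) (po j (FO ?S x)) (po j (FO ?R x))"
      if j: "j \<in> Ob J" and x: "x \<in> Ob (pw (car C) n)" for j x
      using morphism_data.rho_isos[OF psmors_data[OF T.is_theory_axioms C A_psalg[OF j] NO[OF j]] w
          x]
      by (simp add: So[OF x j] Ro[OF x j])
    have n: "Comp (X j) (At (rho (NO \<alpha> j) w) y) (pa j (FA ?S m))
        = Comp (X j) (pa j (FA ?R m)) (At (rho (NO \<alpha> j) w) x)"
      if j: "j \<in> Ob J" and m: "m \<in> hom (pw (car C) n) x y" for j m x y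
    proof -
      have mi: "m i \<in> hom (car C) (x i) (y i)" if "i < n" for i using m that by (simp add: hom_pw)
      have Gm: "(\<lambda>i\<in>{..<n}. FA ?G (m i)) \<in> Arr (pw W n)"
        using homD(1)[OF functorsD(4)[OF GF mi]] by (auto simp: pw_simps(2))
      have "pas n j (\<lambda>i\<in>{..<n}. FA ?G (m i)) = (\<lambda>i\<in>{..<n}. FA (fun_of (NO \<alpha> j)) (m i))"
        by (rule restrict_ext) (simp add: Gpa[OF homD(1)[OF mi] j])
      then show ?thesis
        using morphism_data.rho_natural[OF psmors_data[OF T.is_theory_axioms C A_psalg[OF j]
            NO[OF j]] w m]
          Gpa[OF homD(1)[OF functorsD(4)[OF C.Phi_functor[OF w] m]] j] PhiW(4)[OF w Gm j]
        by (simp add: FA_fcomp[OF homD(1)[OF m]] FA_powF[OF homD(1)[OF m]])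
    qed
    \<comment> \<open>That \<open>rho\<close> of the legs forms an arrow of \<open>W\<close> is the
      2-cell law of \<open>NA \<alpha> f\<close>: its right side, with \<open>rho\<close> of the
      composite of \<open>F f\<close> and a leg expanded, contains the structure isomorphism
      \<open>lam\<close>.\<close>
    have c: "Comp (X b) (At (rho (NO \<alpha> b) w) x) (ph f (FO ?S x))
      = Comp (X b) (ph f (FO ?R x)) (FA (H f) (At (rho (NO \<alpha> a) w) x))"
      if f: "f \<in> hom J a b" and x: "x \<in> Ob (pw (car C) n)" for a b f x
    proof -
      note ob = J.hom_Ob[OF f] and fA = homD(1)[OF f]
      note Aa = A_psalg[OF ob(1)] and Ab = A_psalg[OF ob(2)]
      interpret N: morphism_data T C "A a" "NO \<alpha> a"
          by (rule psmors_data[OF T.is_theory_axioms C Aa NO[OF ob(1)]])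
      note p = lam_parts[OF w Gx[OF x] f, THEN isos_hom, unfolded Gpos[OF x ob(1)] Gphs[OF x fA]]
      note r = functorsD(4)[OF H_functor[OF f] N.rho_hom[OF w x]]
      have "Comp (X b) (At (rho (NO \<alpha> b) w) x) (At (NA \<alpha> f) (FO (Phi C w) x))
        = Comp (X b) (FA (Phi (A b) w) (\<lambda>i\<in>{..<n}. At (NA \<alpha> f) (x i)))
            (Comp (X b) (At (rho (PA F f) w) (\<lambda>i\<in>{..<n}. FO (fun_of (NO \<alpha> a)) (x i)))
              (FA (H f) (At (rho (NO \<alpha> a) w) x)))"
        using T.pscellsD(7)[OF C Ab NA(1)[OF f] w x]
            T.At_rho_psmor_comp[OF C Aa Ab NO[OF ob(1)] M_psmors[OF f] w x]
        by (simp add: NA[OF f])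
      also have "\<dots> = Comp (X b) (lam w n f (\<lambda>i\<in>{..<n}. FO ?G (x i)))
          (FA (H f) (At (rho (NO \<alpha> a) w) x))"
        unfolding lam_eq[OF f] Gpos[OF x ob(1)] Gphs[OF x fA]
        by (rule category.Comp_assoc[OF X_category[OF ob(2)] r p])
      finally show ?thesis
        using Gph[OF functorsD(3)[OF C.Phi_functor[OF w] x] fA] PhiW(3)[OF w Gx[OF x] fA]
        by (simp add: FO_fcomp[OF x] FO_powF[OF x])
    qed
    show pa: "pa j (At (rho ?h w) x) = At (rho (NO \<alpha> j) w) x" if "x \<in> Ob (pw (car C) n)" "j \<in> Ob J"
        for x j
      unfolding rho[OF w] by (rule liftN(2)[OF pC S R]) (fact isos_hom[OF iso] n c that)+
    have "rho ?h w \<in> nats (pw (car C) n) W ?S ?R"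
      unfolding rho[OF w] by (rule liftN(1)[OF pC S R]) (fact isos_hom[OF iso] n c)+
    then show "rho ?h w \<in> nat_isos (pw (car C) n) W ?S ?R"
      by (rule liftN_iso) (simp add: pa iso)
  qed
  interpret h: morphism_data T C limit_alg ?h
  proof (intro morphism_data.intro morphism_data_axioms.intro limit_data C.algebra_data_axioms)
    show "fun_of ?h \<in> functors (car C) (car limit_alg)" using GF by (simp add: funs)
    show "rho ?h \<in> extensional (\<Union>n. words T n)" by (simp add: lift_mor_def Let_def)
    show "rho ?h w \<in> nat_isos (pw (car C) n) (car limit_alg)
        (fcomp (pw (car C) n) (fun_of ?h) (Phi C w))
      (fcomp (pw (car C) n) (Phi limit_alg w) (powF (car C) n (fun_of ?h)))" if "w
          \<in> words T n" for w n
      using rho_props(1)[OF that] by (simp add: funs)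
  qed
  have rh: "At (rho ?h w) x \<in> hom W (FO ?G (FO (Phi C w) x)) (FO (PhiW w) (\<lambda>i\<in>{..<n}. FO ?G (x i)))"
    if "w \<in> words T n" "x \<in> Ob (pw (car C) n)" for w n x
    using h.rho_hom[OF that] by (simp add: funs)
  show h: "?h \<in> psmors T C limit_alg"
    unfolding h.psmors_iff
  proof (intro conjI allI ballI)
    fix k n w ws x assume w: "w \<in> words T k" and ws: "ws \<in> (\<Pi>\<^sub>E i\<in>{..<k}. words T (n i))"
      and x: "x \<in> Ob (pw (car C) (offset n k))"
    let ?N = "offset n k"
    have ws': "ws i \<in> words T (n i)" if "i < k" for i using ws that by auto
    have g: "wgamma T k n w ws \<in> words T ?N" by (rule T.wgamma_words[OF w ws'])
    define y where "y = (\<lambda>i\<in>{..<?N}. FO ?G (x i))"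
    define z where "z = (\<lambda>i\<in>{..<k}. FO (Phi C (ws i)) (blk n i x))"
    define u where "u = (\<lambda>i\<in>{..<k}. At (rho ?h (ws i)) (blk n i x))"
    have y: "y \<in> Ob (pw W ?N)" unfolding y_def by (rule Gx[OF x])
    have z: "z \<in> Ob (pw (car C) k)" unfolding z_def by (rule C.words_Phi_Ob[OF ws x])
    have bx: "blk n i x \<in> Ob (pw (car C) (n i))" if "i < k" for i by (rule blk_pw(1)[OF that x])
    have bly: "blk n i y = (\<lambda>q\<in>{..<n i}. FO ?G (blk n i x q))" if "i < k" for i
      unfolding y_def by (rule blk_map_fun[OF that])
    have u: "u \<in> hom (pw W k) (\<lambda>i\<in>{..<k}. FO ?G (z i)) (\<lambda>i\<in>{..<k}. FO (PhiW (ws i)) (blk n i y))"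
      using rh[OF ws' bx] by (simp add: hom_pw u_def z_def bly)
    note h1 = rh[OF g x, folded y_def] and h2 = WA.c_hom[OF w ws y]
    note h3 = functorsD(4)[OF GF C.c_hom[OF w ws x], folded z_def] and h4 = rh[OF w z]
    note h5 = functorsD(4)[OF PhiW(1)[OF w] u]
    \<comment> \<open>The right side of the law is a threefold composite in \<open>W\<close>; the
      typing of its inner part is needed to distribute \<open>pa j\<close> over all of it.\<close>
    note h34 = W_Comp_hom(1)[OF h3 h4]
    show "h.gamma_law k n w ws x"
      unfolding h.gamma_law_def limit_alg_simps funs y_def[symmetric] z_def[symmetric]
          u_def[symmetric]
    proof (rule W_ar_eqI[OF W_Comp_hom(1)[OF h1 h2] W_Comp_hom(1)[OF h34 h5]])
      fix j assume j: "j \<in> Ob J"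
      interpret N: morphism_data T C "A j" "NO \<alpha> j"
          by (rule psmors_data[OF T.is_theory_axioms C A_psalg[OF j] NO[OF j]])
      have "N.gamma_law k n w ws x"
        using NO[OF j, unfolded N.psmors_iff] w ws x by blast
      moreover have "pas k j u = (\<lambda>i\<in>{..<k}. At (rho (NO \<alpha> j) (ws i)) (blk n i x))"
        by (rule restrict_ext) (simp add: u_def rho_props(2)[OF ws' bx j])
      ultimately show "pa j (Comp W (At (cW w ws) y) (At (rho ?h (wgamma T k n w ws)) x))
        = pa j (Comp W (FA (PhiW w) u) (Comp W (At (rho ?h w) z) (FA ?G (At (cc C w ws) x))))"
        unfolding W_Comp_hom(2)[OF h1 h2 j] W_Comp_hom(2)[OF h34 h5 j] W_Comp_hom(2)[OF h3 h4 j]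
          cW(2)[OF w ws y j] rho_props(2)[OF g x j] rho_props(2)[OF w z j] pa_PhiW[OF w u j]
          Gpa[OF homD(1)[OF C.c_hom[OF w ws x]] j] N.gamma_law_def
        using Gpos[OF x j] by (simp add: y_def z_def)
    qed
  next
    fix x assume x: "x \<in> Ob (pw (car C) 1)"
    define y where "y = (\<lambda>i\<in>{..<1}. FO ?G (x i))"
    have y: "y \<in> Ob (pw W 1)" unfolding y_def by (rule Gx[OF x])
    have y0: "y 0 = FO ?G (x 0)" by (simp add: y_def)
    note h1 = rh[OF T.wunit_words x, folded y_def] and h2 = WA.I_hom[OF y, unfolded y0]
    note h3 = functorsD(4)[OF GF C.I_hom[OF x]]
    show "h.unit_law x"
      unfolding h.unit_law_def limit_alg_simps funs y_def[symmetric]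
    proof (rule W_ar_eqI[OF W_Comp_hom(1)[OF h1 h2] h3])
      fix j assume j: "j \<in> Ob J"
      interpret N: morphism_data T C "A j" "NO \<alpha> j"
          by (rule psmors_data[OF T.is_theory_axioms C A_psalg[OF j] NO[OF j]])
      have "N.unit_law x"
        using NO[OF j, unfolded N.psmors_iff] x by blast
      then show "pa j (Comp W (At IW y) (At (rho ?h (wunit T)) x)) = pa j (FA ?G (At (II C) x))"
        unfolding W_Comp_hom(2)[OF h1 h2 j] IW(2)[OF y j] rho_props(2)[OF T.wunit_words x j]
          Gpa[OF homD(1)[OF C.I_hom[OF x]] j] N.unit_law_def
        using Gpos[OF x j] by (simp add: y_def)
    qed
  next
    fix k l w f x assume w: "w \<in> words T k" and f: "f \<in> {..<k} \<rightarrow>\<^sub>E {..<l}"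
        and x: "x \<in> Ob (pw (car C) l)"
    have f': "f i < l" if "i < k" for i using f that by auto
    have g: "wsubst T k l f w \<in> words T l" by (rule T.wsubst_words[OF w f'])
    define y where "y = (\<lambda>i\<in>{..<l}. FO ?G (x i))"
    have y: "y \<in> Ob (pw W l)" unfolding y_def by (rule Gx[OF x])
    have z: "compose {..<k} x f \<in> Ob (pw (car C) k)" by (rule compose_pw(1)[OF f' x])
    have yf: "(\<lambda>i\<in>{..<k}. FO ?G (compose {..<k} x f i)) = compose {..<k} y f"
      unfolding y_def by (rule compose_map_fun[OF f', symmetric])
    note h1 = rh[OF g x, folded y_def] and h2 = WA.s_hom[OF w f y]
    note h3 = functorsD(4)[OF GF C.s_hom[OF w f x]] and h4 = rh[OF w z, unfolded yf]
    show "h.subst_law k l w f x"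
      unfolding h.subst_law_def limit_alg_simps funs y_def[symmetric]
    proof (rule W_ar_eqI[OF W_Comp_hom(1)[OF h1 h2] W_Comp_hom(1)[OF h3 h4]])
      fix j assume j: "j \<in> Ob J"
      interpret N: morphism_data T C "A j" "NO \<alpha> j"
          by (rule psmors_data[OF T.is_theory_axioms C A_psalg[OF j] NO[OF j]])
      have "N.subst_law k l w f x"
        using NO[OF j, unfolded N.psmors_iff] w f x by blast
      then show "pa j (Comp W (At (sW l w f) y) (At (rho ?h (wsubst T k l f w)) x))
        = pa j (Comp W (At (rho ?h w) (compose {..<k} x f)) (FA ?G (At (ss C l w f) x)))"
        unfolding W_Comp_hom(2)[OF h1 h2 j] W_Comp_hom(2)[OF h3 h4 j] sW(2)[OF w f y j]
            rho_props(2)[OF g x j]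
          rho_props(2)[OF w z j] Gpa[OF homD(1)[OF C.s_hom[OF w f x]] j] N.subst_law_def
        using Gpos[OF x j] by (simp add: y_def)
    qed
  qed
  note cone = cone_psnats[OF h, unfolded psnats_iff[OF C]]
  \<comment> \<open>The legs come first, because the coherence cells can be compared only once their
    sources and targets, which are built from the legs, are known to agree.\<close>
  have NOeq: "NO (cone_of ?h) j = NO \<alpha> j" if j: "j \<in> Ob J" for j
  proof (rule psmor_eqI[OF T.is_theory_axioms C A_psalg[OF j] cone_components(1)[OF h j] NO[OF j]])
    show "fun_of (NO (cone_of ?h) j) = fun_of (NO \<alpha> j)"
      by (rule functor_eqI[OF T.psmors_functor[OF cone_components(1)[OF h j]]
          T.psmors_functor[OF NO[OF j]]])
        (simp_all add: cone_components[OF h j] funs Gpo Gpa j)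
    show "At (rho (NO (cone_of ?h) j) w) x = At (rho (NO \<alpha> j) w) x"
      if "w \<in> words T n" "x \<in> Ob (pw (car C) n)" for n w x
      using cone_components(4)[OF h j that] rho_props(2)[OF that j] by simp
  qed
  show "cone_of ?h = \<alpha>"
  proof (rule psnat.equality)
    show "NO (cone_of ?h) = NO \<alpha>"
      by (rule extensionalityI[of _ "Ob J"]) (use cone a NOeq in \<open>auto simp: PiE_iff\<close>)
    show "NA (cone_of ?h) = NA \<alpha>"
    proof (rule extensionalityI[of _ "Arr J"])
      show "NA (cone_of ?h) \<in> extensional (Arr J)" "NA \<alpha> \<in> extensional (Arr J)"
        using cone a by blast+
      fix f assume "f \<in> Arr J"
      then have f: "f \<in> hom J (Dom J f) (Cod J f)" by (rule Arr_hom)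
      note ob = J.hom_Ob[OF f]
      have c: "NA (cone_of ?h) f \<in> pscells T C (A (Cod J f))"
        "Source (NA (cone_of ?h) f) = psmor_comp T C (A (Dom J f)) (A (Cod J f)) (PA F f)
            (NO (cone_of ?h) (Dom J f))"
        "Target (NA (cone_of ?h) f) = NO (cone_of ?h) (Cod J f)"
        using cone f by blast+
      show "NA (cone_of ?h) f = NA \<alpha> f"
      proof (rule trans_eqI)
        show "Source (NA (cone_of ?h) f) = Source (NA \<alpha> f)"
            "Target (NA (cone_of ?h) f) = Target (NA \<alpha> f)"
          using c NA[OF f] NOeq ob by simp_all
        show "At (NA (cone_of ?h) f) \<in> extensional (Ob (car C))"
            "At (NA \<alpha> f) \<in> extensional (Ob (car C))"
          using T.pscellsD(3)[OF C A_psalg[OF ob(2)]] c(1) NA(1)[OF f] by blast+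
        show "At (NA (cone_of ?h) f) x = At (NA \<alpha> f) x" if "x \<in> Ob (car C)" for x
          using At_NA_cone[OF h f that] Gph[OF that homD(1)[OF f]] by (simp add: funs)
      qed
    qed
  qed simp
qed

section \<open>2-cells into the limit and modifications of cones\<close>

abbreviation cell_modif :: "('t, 'u, 'u) pscell \<Rightarrow> ('u, 'u, ('t, 'u, 'u) psmor, ('t, 'u, 'u) pscell)
    modif" where
  "cell_modif \<theta> \<equiv> \<lparr>Source = cone_of (Source \<theta>), Target = cone_of (Target \<theta>),
     At = (\<lambda>j\<in>Ob J. Comp2 K C limit_alg (A j) (Id (Hom K limit_alg (A j)) (proj_mor j)) \<theta>)\<rparr>"

lemma FA_postcomp:
  "FA (postcomp J K F limit_alg limit_cone C) = (\<lambda>\<theta>\<in>pscells T C limit_alg. cell_modif \<theta>)"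
  by (simp add: postcomp_eq NO_limit cong: restrict_cong)

lemma cell_component:
  assumes \<theta>: "\<theta> \<in> pscells T C limit_alg" and j: "j \<in> Ob J"
  shows "At (cell_modif \<theta>) j \<in> pscells T C (A j)"
    and "Source (At (cell_modif \<theta>) j) = NO (cone_of (Source \<theta>)) j"
    and "Target (At (cell_modif \<theta>) j) = NO (cone_of (Target \<theta>)) j"
    and "x \<in> Ob (car C) \<Longrightarrow> At (At (cell_modif \<theta>) j) x = pa j (At \<theta> x)"
proof -
  show "At (cell_modif \<theta>) j \<in> pscells T C (A j)"
    using T.whisker_left_cell[OF C limit_psalg A_psalg[OF j] \<theta> proj_psmors[OF j]] j by simp
  show "Source (At (cell_modif \<theta>) j) = NO (cone_of (Source \<theta>)) j"
    "Target (At (cell_modif \<theta>) j) = NO (cone_of (Target \<theta>)) j"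
    using j by (simp_all add: NO_cone)
  show "At (At (cell_modif \<theta>) j) x = pa j (At \<theta> x)" if x: "x \<in> Ob (car C)"
  proof -
    have "At \<theta> x \<in> hom W (FO (fun_of (Source \<theta>)) x) (FO (fun_of (Target \<theta>)) x)"
      using T.pscellsD(5)[OF C limit_psalg \<theta> x] by simp
    then show ?thesis
      using T.At_whisker_left[OF C limit_psalg A_psalg[OF j] \<theta> proj_psmors[OF j] x] j
      by (simp add: fun_of_proj FA_proj homD)
  qed
qed

lemma cell_hom:
  assumes \<theta>: "\<theta> \<in> pscells T C limit_alg" and x: "x \<in> Ob (car C)"
  shows "At \<theta> x \<in> hom W (FO (fun_of (Source \<theta>)) x) (FO (fun_of (Target \<theta>)) x)"
  using T.pscellsD(5)[OF C limit_psalg \<theta> x] by simp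

text \<open>The modification axiom at \<open>x\<close> is the compatibility of the arrow
  \<open>At \<theta> x\<close> of \<open>W\<close> with the structure isomorphisms, given by
  \<open>pa_hom(2)\<close>.\<close>

lemma cell_modif:
  assumes \<theta>: "\<theta> \<in> pscells T C limit_alg"
  shows "cell_modif \<theta> \<in> modifs J K (const_psfun K C) F"
  unfolding modifs_iff[OF C]
proof (intro conjI ballI allI)
  note S = T.pscellsD(1)[OF C limit_psalg \<theta>] and R = T.pscellsD(2)[OF C limit_psalg \<theta>]
  show "Source (cell_modif \<theta>) \<in> psnats J K (const_psfun K C) F"
      "Target (cell_modif \<theta>) \<in> psnats J K (const_psfun K C) F"
    using cone_psnats[OF S] cone_psnats[OF R] by simp_all
  show "At (cell_modif \<theta>) \<in> extensional (Ob J)" by simp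
  show "At (cell_modif \<theta>) j \<in> pscells T C (A j)"
    "Source (At (cell_modif \<theta>) j) = NO (Source (cell_modif \<theta>)) j"
    "Target (At (cell_modif \<theta>) j) = NO (Target (cell_modif \<theta>)) j" if "j \<in> Ob J" for j
    using cell_component(1-3)[OF \<theta> that] by simp_all
  fix x a b f assume x: "x \<in> Ob (car C)" and f: "f \<in> hom J a b"
  note ob = J.hom_Ob[OF f]
  show "Comp (X b) (At (At (cell_modif \<theta>) b) x) (At (NA (Source (cell_modif \<theta>)) f) x)
    = Comp (X b) (At (NA (Target (cell_modif \<theta>)) f) x) (FA (H f) (At (At (cell_modif \<theta>) a) x))"
    unfolding cell_component(4)[OF \<theta> ob(1) x] cell_component(4)[OF \<theta> ob(2) x]
    using pa_hom(2)[OF cell_hom[OF \<theta> x] f] At_NA_cone[OF S f x] At_NA_cone[OF R f x] by simp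
qed

lemma cell_modif_inj:
  assumes \<theta>: "\<theta> \<in> pscells T C limit_alg" and \<theta>': "\<theta>' \<in> pscells T C limit_alg"
    and eq: "cell_modif \<theta> = cell_modif \<theta>'"
  shows "\<theta> = \<theta>'"
proof (rule trans_eqI)
  note D = T.pscellsD[OF C limit_psalg \<theta>] and D' = T.pscellsD[OF C limit_psalg \<theta>']
  show S: "Source \<theta> = Source \<theta>'" using cone_inj[OF D(1) D'(1)] eq by simp
  show R: "Target \<theta> = Target \<theta>'" using cone_inj[OF D(2) D'(2)] eq by simp
  show "At \<theta> \<in> extensional (Ob (car C))" "At \<theta>' \<in> extensional (Ob (car C))" using D(3) D'(3)
      by simp_all
  show "At \<theta> x = At \<theta>' x" if x: "x \<in> Ob (car C)" for x
  proof (rule W_ar_eqI[OF cell_hom[OF \<theta> x, unfolded S R] cell_hom[OF \<theta>' x]])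
    show "pa j (At \<theta> x) = pa j (At \<theta>' x)" if "j \<in> Ob J" for j
      using cell_component(4)[OF \<theta> that x] cell_component(4)[OF \<theta>' that x] eq by simp
  qed
qed

text \<open>The two cones lift by \<open>lift_mor\<close>. At each object of \<open>C\<close> the
  components of the modification form one arrow of \<open>W\<close> between the lifted values, and
  its laws as a 2-cell are checked in the components.\<close>

lemma cell_modif_surj:
  assumes \<Xi>: "\<Xi> \<in> modifs J K (const_psfun K C) F"
  shows "\<exists>\<theta>\<in>pscells T C limit_alg. cell_modif \<theta> = \<Xi>"
proof -
  note m = \<Xi>[unfolded modifs_iff[OF C]]
  define g where "g = lift_mor (Source \<Xi>)"
  define h where "h = lift_mor (Target \<Xi>)"
  have g: "g \<in> psmors T C limit_alg" "cone_of g = Source \<Xi>" using lift_mor[of "Source \<Xi>"] m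
      by (simp_all add: g_def)
  have h: "h \<in> psmors T C limit_alg" "cone_of h = Target \<Xi>" using lift_mor[of "Target \<Xi>"] m
      by (simp_all add: h_def)
  have cell: "At \<Xi> j \<in> pscells T C (A j)" "Source (At \<Xi> j) = NO (cone_of g) j"
      "Target (At \<Xi> j) = NO (cone_of h) j"
    if "j \<in> Ob J" for j
    using m that by (simp_all add: g h)
  interpret g: morphism_data T C limit_alg g by
      (rule psmors_data[OF T.is_theory_axioms C limit_psalg g(1)])
  interpret h: morphism_data T C limit_alg h by
      (rule psmors_data[OF T.is_theory_axioms C limit_psalg h(1)])
  define \<theta> where "\<theta> = \<lparr>Source = g, Target = h,
    At = (\<lambda>x\<in>Ob (car C). mk_ar (FO (fun_of g) x) (FO (fun_of h) x) (\<lambda>j. At (At \<Xi> j) x))\<rparr>"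
  have ar: "At \<theta> x \<in> hom W (FO (fun_of g) x) (FO (fun_of h) x)"
      "\<And>j. j \<in> Ob J \<Longrightarrow> pa j (At \<theta> x) = At (At \<Xi> j) x"
    if x: "x \<in> Ob (car C)" for x
  proof -
    have 1: "At (At \<Xi> j) x \<in> hom (X j) (po j (FO (fun_of g) x)) (po j (FO (fun_of h) x))"
        if j: "j \<in> Ob J" for j
      using T.pscellsD(5)[OF C A_psalg[OF j] cell(1)[OF j] x]
      by (simp add: cell[OF j] cone_components(2)[OF g(1) j x] cone_components(2)[OF h(1) j x])
    \<comment> \<open>The modification axiom at \<open>x\<close> supplies the compatibility
      condition that \<open>mk_ar\<close> demands.\<close>
    have 2: "Comp (X b) (At (At \<Xi> b) x) (ph f (FO (fun_of g) x))
        = Comp (X b) (ph f (FO (fun_of h) x)) (FA (H f) (At (At \<Xi> a) x))"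
      if f: "f \<in> hom J a b" for a b f
    proof -
      have "Comp (X b) (At (At \<Xi> b) x) (At (NA (Source \<Xi>) f) x)
        = Comp (X b) (At (NA (Target \<Xi>) f) x) (FA (H f) (At (At \<Xi> a) x))"
        using m f x by blast
      then show ?thesis
        using At_NA_cone[OF g(1) f x] At_NA_cone[OF h(1) f x] by (simp add: g h)
    qed
    show "At \<theta> x \<in> hom W (FO (fun_of g) x) (FO (fun_of h) x)"
        "\<And>j. j \<in> Ob J \<Longrightarrow> pa j (At \<theta> x) = At (At \<Xi> j) x"
      using mk_ar[OF functorsD(3)[OF mor_functor[OF g(1)] x]
          functorsD(3)[OF mor_functor[OF h(1)] x],
          of "\<lambda>j. At (At \<Xi> j) x", OF 1 2] x by (simp_all add: \<theta>_def)
  qed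
  have \<theta>: "\<theta> \<in> pscells T C limit_alg"
  proof (rule T.pscellsI[OF C limit_psalg g(1) h(1)])
    show "Source \<theta> = g" "Target \<theta> = h" "At \<theta> \<in> extensional (Ob (car C))" by (simp_all add: \<theta>_def)
    show "At \<theta> x \<in> hom (car limit_alg) (FO (fun_of g) x) (FO (fun_of h) x)" if "x \<in> Ob (car C)"
        for x
      using ar(1)[OF that] by simp
    show "Comp (car limit_alg) (At \<theta> y) (FA (fun_of g) m)
        = Comp (car limit_alg) (FA (fun_of h) m) (At \<theta> x)"
      if m: "m \<in> hom (car C) x y" for x y m
    proof -
      note xy = category.hom_Ob[OF psalg_category[OF C] m]
      note gm = functorsD(4)[OF mor_functor[OF g(1)] m] and hm
          = functorsD(4)[OF mor_functor[OF h(1)] m]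
      have "Comp W (At \<theta> y) (FA (fun_of g) m) = Comp W (FA (fun_of h) m) (At \<theta> x)"
      proof (rule W_ar_eqI[OF W_Comp_hom(1)[OF gm ar(1)[OF xy(2)]]
          W_Comp_hom(1)[OF ar(1)[OF xy(1)] hm]])
        fix j assume j: "j \<in> Ob J"
        show "pa j (Comp W (At \<theta> y) (FA (fun_of g) m)) = pa j (Comp W (FA (fun_of h) m) (At \<theta> x))"
          using T.pscellsD(6)[OF C A_psalg[OF j] cell(1)[OF j] m] homD(1)[OF m]
          unfolding W_Comp_hom(2)[OF gm ar(1)[OF xy(2)] j] W_Comp_hom(2)[OF ar(1)[OF xy(1)] hm j]
              ar(2)[OF xy(1) j] ar(2)[OF xy(2) j]
          by (simp add: cell[OF j] cone_components(3)[OF g(1) j] cone_components(3)[OF h(1) j])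
      qed
      then show ?thesis by simp
    qed
    fix n w x assume w: "w \<in> words T n" and x: "x \<in> Ob (pw (car C) n)"
    note Px = functorsD(3)[OF g.A.Phi_functor[OF w] x]
    define u where "u = (\<lambda>i\<in>{..<n}. At \<theta> (x i))"
    have u: "u \<in> hom (pw W n) (\<lambda>i\<in>{..<n}. FO (fun_of g) (x i)) (\<lambda>i\<in>{..<n}. FO (fun_of h) (x i))"
      using ar(1)[OF pw_Ob_nth[OF x]] by (simp add: hom_pw u_def)
    note pu = functorsD(4)[OF PhiW(1)[OF w] u]
    note rg = g.rho_hom[OF w x, unfolded limit_alg_simps] and rh
        = h.rho_hom[OF w x, unfolded limit_alg_simps]
    have "Comp W (At (rho h w) x) (At \<theta> (FO (Phi C w) x)) = Comp W (FA (PhiW w) u) (At (rho g w) x)"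
    proof (rule W_ar_eqI[OF W_Comp_hom(1)[OF ar(1)[OF Px] rh] W_Comp_hom(1)[OF rg pu]])
      fix j assume j: "j \<in> Ob J"
      \<comment> \<open>With \<open>u\<close> replaced by its components over \<open>j\<close>, the
        equation is the 2-cell law of \<open>At \<Xi> j\<close>.\<close>
      have pj: "pas n j u = (\<lambda>i\<in>{..<n}. At (At \<Xi> j) (x i))"
        by (rule restrict_ext) (simp add: u_def ar(2)[OF pw_Ob_nth[OF x] j])
      show "pa j (Comp W (At (rho h w) x) (At \<theta> (FO (Phi C w) x)))
          = pa j (Comp W (FA (PhiW w) u) (At (rho g w) x))"
        using T.pscellsD(7)[OF C A_psalg[OF j] cell(1)[OF j] w x]
        unfolding W_Comp_hom(2)[OF ar(1)[OF Px] rh j] W_Comp_hom(2)[OF rg pu j] pa_PhiW[OF w u j] pj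
            ar(2)[OF Px j]
        by (simp add: cell[OF j] cone_components(4)[OF g(1) j w x]
            cone_components(4)[OF h(1) j w x])
    qed
    then show "Comp (car limit_alg) (At (rho h w) x) (At \<theta> (FO (Phi C w) x))
      = Comp (car limit_alg) (FA (Phi limit_alg w) (\<lambda>i\<in>{..<n}. At \<theta> (x i))) (At (rho g w) x)"
      by (simp add: u_def)
  qed
  have "cell_modif \<theta> = \<Xi>"
  proof (rule trans_eqI)
    show "Source (cell_modif \<theta>) = Source \<Xi>" "Target (cell_modif \<theta>) = Target \<Xi>"
      using g h by (simp_all add: \<theta>_def)
    show "At (cell_modif \<theta>) \<in> extensional (Ob J)" by simp
    show "At \<Xi> \<in> extensional (Ob J)" using m by blast
    fix j assume j: "j \<in> Ob J"
    show "At (cell_modif \<theta>) j = At \<Xi> j"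
    proof (rule trans_eqI)
      show "Source (At (cell_modif \<theta>) j) = Source (At \<Xi> j)"
          "Target (At (cell_modif \<theta>) j) = Target (At \<Xi> j)"
        using cell_component(2,3)[OF \<theta> j] cell[OF j] by (simp_all add: \<theta>_def)
      show "At (At (cell_modif \<theta>) j) \<in> extensional (Ob (car C))"
          "At (At \<Xi> j) \<in> extensional (Ob (car C))"
        using T.pscellsD(3)[OF C A_psalg[OF j]] cell_component(1)[OF \<theta> j] cell(1)[OF j] by blast+
      show "At (At (cell_modif \<theta>) j) x = At (At \<Xi> j) x" if "x \<in> Ob (car C)" for x
        using cell_component(4)[OF \<theta> j that] ar(2)[OF that j] by simp
    qed
  qed
  then show ?thesis using \<theta> by blast
qed

lemma psnat_cat_simps:
  "Ob (pseudo_cone J K C F) = psnats J K (const_psfun K C) F"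
      "Arr (pseudo_cone J K C F) = modifs J K (const_psfun K C) F"
  "Dom (pseudo_cone J K C F) = Source" "Cod (pseudo_cone J K C F) = Target"
  "Id (pseudo_cone J K C F) \<alpha> = \<lparr>Source = \<alpha>, Target = \<alpha>, At
      = (\<lambda>j\<in>Ob J. Id (Hom K C (A j)) (NO \<alpha> j))\<rparr>"
  "Comp (pseudo_cone J K C F) \<Theta> \<Xi> = \<lparr>Source = Source \<Xi>, Target = Target \<Theta>,
    At = (\<lambda>j\<in>Ob J. Comp (Hom K C (A j)) (At \<Theta> j) (At \<Xi> j))\<rparr>"
  by (simp_all add: pseudo_cone_def psnat_cat_def)

text \<open>A functor that is bijective on objects, by \<open>cone_inj\<close> and
  \<open>lift_mor\<close>, and on arrows, by \<open>cell_modif_inj\<close> and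
  \<open>cell_modif_surj\<close>. Functoriality holds because identities and composites in
  \<open>W\<close> are formed componentwise.\<close>

lemma postcomp_iso: "cat_iso (Hom K C limit_alg) (pseudo_cone J K C F)
    (postcomp J K F limit_alg limit_cone C)"
proof (rule cat_isoI)
  let ?P = "postcomp J K F limit_alg limit_cone C"
  note L = limit_psalg
  have Id: "Id (Hom K C limit_alg) h \<in> pscells T C limit_alg" if "h \<in> psmors T C limit_alg" for h
    by (rule T.Id_cell[OF C L that])
  have Co: "Comp (Hom K C limit_alg) \<beta> \<alpha> \<in> pscells T C limit_alg"
    if "\<alpha> \<in> pscells T C limit_alg" "\<beta> \<in> pscells T C limit_alg" "Source \<beta> = Target \<alpha>" for \<alpha> \<beta>
    by (rule T.Comp_cell[OF C L that])
  show "?P \<in> functors (Hom K C limit_alg) (pseudo_cone J K C F)"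
  proof (rule functorsI)
    show "FO ?P \<in> extensional (Ob (Hom K C limit_alg))"
        "FA ?P \<in> extensional (Arr (Hom K C limit_alg))"
      by (simp_all add: postcomp_eq)
    show "FO ?P h \<in> Ob (pseudo_cone J K C F)" if "h \<in> Ob (Hom K C limit_alg)" for h
      using that cone_psnats by (simp add: postcomp_eq psnat_cat_simps)
    show "FA ?P \<theta> \<in> hom (pseudo_cone J K C F) (FO ?P g) (FO ?P h)"
        if "\<theta> \<in> hom (Hom K C limit_alg) g h" for \<theta> g h
    proof -
      have \<theta>: "\<theta> \<in> pscells T C limit_alg" "Source \<theta> = g" "Target \<theta> = h" using that
          by (simp_all add: hom_PsAlg)
      then show ?thesis
        using cell_modif[OF \<theta>(1)] T.pscellsD(1,2)[OF C L \<theta>(1)]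
        by (intro homI) (simp_all add: FA_postcomp postcomp_eq(1) psnat_cat_simps)
    qed
    show "FA ?P (Id (Hom K C limit_alg) h) = Id (pseudo_cone J K C F) (FO ?P h)"
        if "h \<in> Ob (Hom K C limit_alg)" for h
    proof -
      have h: "h \<in> psmors T C limit_alg" using that by simp
      have "cell_modif (Id (Hom K C limit_alg) h) = Id (pseudo_cone J K C F) (cone_of h)"
        unfolding psnat_cat_simps
      proof (rule trans_eqI[where S = "Ob J"])
        fix j assume j: "j \<in> Ob J"
        show "At (cell_modif (Id (Hom K C limit_alg) h)) j
            = At \<lparr>Source = cone_of h, Target = cone_of h,
            At = (\<lambda>j\<in>Ob J. Id (Hom K C (A j)) (NO (cone_of h) j))\<rparr> j"
        proof (rule trans_eqI[where S = "Ob (car C)"])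
          show "At (At (cell_modif (Id (Hom K C limit_alg) h)) j) x
            = At (At \<lparr>Source = cone_of h, Target = cone_of h, At
                = (\<lambda>j\<in>Ob J. Id (Hom K C (A j)) (NO (cone_of h) j))\<rparr> j) x"
            if x: "x \<in> Ob (car C)" for x
            unfolding cell_component(4)[OF Id[OF h] j x]
            using j W_Id_hom(2)[OF functorsD(3)[OF mor_functor[OF h] x] j]
                cone_components(2)[OF h j x] by (simp add: At_Id[OF x])
        qed (use j in \<open>simp_all add: NO_cone\<close>)
      qed simp_all
      then show ?thesis using h Id[OF h] by (simp add: FA_postcomp postcomp_eq(1))
    qed
    show "FA ?P (Comp (Hom K C limit_alg) \<beta> \<alpha>) = Comp (pseudo_cone J K C F) (FA ?P \<beta>) (FA ?P \<alpha>)"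
      if "\<alpha> \<in> hom (Hom K C limit_alg) g h" "\<beta> \<in> hom (Hom K C limit_alg) h k" for \<alpha> \<beta> g h k
    proof -
      have \<alpha>: "\<alpha> \<in> pscells T C limit_alg" "Source \<alpha> = g" "Target \<alpha> = h"
        and \<beta>: "\<beta> \<in> pscells T C limit_alg" "Source \<beta> = h" "Target \<beta> = k"
        using that by (simp_all add: hom_PsAlg)
      have \<beta>\<alpha>: "Comp (Hom K C limit_alg) \<beta> \<alpha> \<in> pscells T C limit_alg" using Co \<alpha> \<beta> by simp
      \<comment> \<open>Equality is descended twice: modifications are compared at each
        \<open>j\<close>, and the resulting 2-cells at each object of \<open>C\<close>, where
        \<open>W_Comp_hom\<close> finishes.\<close>
      have "cell_modif (Comp (Hom K C limit_alg) \<beta> \<alpha>)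
          = Comp (pseudo_cone J K C F) (cell_modif \<beta>) (cell_modif \<alpha>)"
        unfolding psnat_cat_simps
      proof (rule trans_eqI[where S = "Ob J"])
        fix j assume j: "j \<in> Ob J"
        show "At (cell_modif (Comp (Hom K C limit_alg) \<beta> \<alpha>)) j
            = At \<lparr>Source = Source (cell_modif \<alpha>), Target = Target (cell_modif \<beta>),
            At = (\<lambda>j\<in>Ob J. Comp (Hom K C (A j)) (At (cell_modif \<beta>) j) (At (cell_modif \<alpha>) j))\<rparr> j"
        proof (rule trans_eqI[where S = "Ob (car C)"])
          show "At (At (cell_modif (Comp (Hom K C limit_alg) \<beta> \<alpha>)) j) x
            = At (At \<lparr>Source = Source (cell_modif \<alpha>), Target = Target (cell_modif \<beta>),
                At = (\<lambda>j\<in>Ob J. Comp (Hom K C (A j)) (At (cell_modif \<beta>) j) (At (cell_modif \<alpha>) j))\<rparr> j)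
                    x"
            if x: "x \<in> Ob (car C)" for x
          proof -
            have "At (At \<lparr>Source = Source (cell_modif \<alpha>), Target = Target (cell_modif \<beta>),
                At = (\<lambda>j\<in>Ob J. Comp (Hom K C (A j)) (At (cell_modif \<beta>) j) (At (cell_modif \<alpha>) j))\<rparr> j)
                    x
              = Comp (X j) (pa j (At \<beta> x)) (pa j (At \<alpha> x))"
              unfolding cell_component(4)[OF \<alpha>(1) j x, symmetric]
                  cell_component(4)[OF \<beta>(1) j x, symmetric]
              using j by (simp add: At_Comp[OF x])
            moreover have "At \<alpha> x \<in> hom W (FO (fun_of g) x) (FO (fun_of h) x)"
                "At \<beta> x \<in> hom W (FO (fun_of h) x) (FO (fun_of k) x)"
              using cell_hom[OF \<alpha>(1) x] cell_hom[OF \<beta>(1) x] \<alpha> \<beta> by simp_all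
            ultimately show ?thesis
              unfolding cell_component(4)[OF \<beta>\<alpha> j x] At_Comp[OF x] limit_alg_simps
                  using W_Comp_hom(2) j by simp
          qed
        qed (use j in \<open>simp_all add: NO_cone\<close>)
      qed simp_all
      then show ?thesis using \<alpha> \<beta> \<beta>\<alpha> by (simp add: FA_postcomp)
    qed
  qed
  show "bij_betw (FO ?P) (Ob (Hom K C limit_alg)) (Ob (pseudo_cone J K C F))"
    unfolding psnat_cat_simps postcomp_eq PsAlg_simps
  proof (rule bij_betwI')
    show "(restrict cone_of (psmors T C limit_alg) g = restrict cone_of (psmors T C limit_alg) h)
        = (g = h)"
      if "g \<in> psmors T C limit_alg" "h \<in> psmors T C limit_alg" for g h
      using that cone_inj by auto
    show "restrict cone_of (psmors T C limit_alg) h \<in> psnats J K (const_psfun K C) F"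
        if "h \<in> psmors T C limit_alg" for h
      using that cone_psnats by simp
    show "\<exists>h\<in>psmors T C limit_alg. \<alpha> = restrict cone_of (psmors T C limit_alg) h"
      if "\<alpha> \<in> psnats J K (const_psfun K C) F" for \<alpha>
      using lift_mor[OF that] by (intro bexI[of _ "lift_mor \<alpha>"]) simp_all
  qed
  show "bij_betw (FA ?P) (Arr (Hom K C limit_alg)) (Arr (pseudo_cone J K C F))"
    unfolding psnat_cat_simps FA_postcomp PsAlg_simps
  proof (rule bij_betwI')
    show "((\<lambda>\<theta>\<in>pscells T C limit_alg. cell_modif \<theta>) \<alpha> = (\<lambda>\<theta>\<in>pscells T C limit_alg. cell_modif \<theta>) \<beta>)
        = (\<alpha> = \<beta>)"
      if "\<alpha> \<in> pscells T C limit_alg" "\<beta> \<in> pscells T C limit_alg" for \<alpha> \<beta>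
      unfolding restrict_apply'[OF that(1)] restrict_apply'[OF that(2)]
          using cell_modif_inj[OF that] by blast
    show "(\<lambda>\<theta>\<in>pscells T C limit_alg. cell_modif \<theta>) \<alpha> \<in> modifs J K (const_psfun K C) F"
        if "\<alpha> \<in> pscells T C limit_alg" for \<alpha>
      unfolding restrict_apply'[OF that] by (rule cell_modif[OF that])
    show "\<exists>\<theta>\<in>pscells T C limit_alg. \<Xi> = (\<lambda>\<theta>\<in>pscells T C limit_alg. cell_modif \<theta>) \<theta>"
      if "\<Xi> \<in> modifs J K (const_psfun K C) F" for \<Xi>
    proof -
      obtain \<theta> where \<theta>: "\<theta> \<in> pscells T C limit_alg" "cell_modif \<theta> = \<Xi>"
        using cell_modif_surj[OF \<open>\<Xi> \<in> modifs J K (const_psfun K C) F\<close>] by blast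
      show ?thesis by (rule bexI[OF _ \<theta>(1)]) (simp only: restrict_apply'[OF \<theta>(1)] \<theta>(2))
    qed
  qed
  show "Dom (Hom K C limit_alg) \<theta> \<in> Ob (Hom K C limit_alg) \<and> Cod (Hom K C limit_alg) \<theta>
      \<in> Ob (Hom K C limit_alg)"
    if "\<theta> \<in> Arr (Hom K C limit_alg)" for \<theta>
    using T.pscellsD(1,2)[OF C L] that by simp
  show "Id (Hom K C limit_alg) h \<in> hom (Hom K C limit_alg) h h" if "h \<in> Ob (Hom K C limit_alg)"
      for h
    using Id that by (simp add: hom_PsAlg)
  show "Comp (Hom K C limit_alg) \<beta> \<alpha> \<in> hom (Hom K C limit_alg) g k"
    if "\<alpha> \<in> hom (Hom K C limit_alg) g h" "\<beta> \<in> hom (Hom K C limit_alg) h k" for \<alpha> \<beta> g h k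
    using Co that by (simp add: hom_PsAlg)
qed

end

lemma limit: "pseudo_limit J K F limit_alg limit_cone"
  using limit_psalg W_small limit_cone_psnats postcomp_iso by (simp add: pseudo_limit_def)

end

theorem theorem8p1:
  fixes U :: "'u set set"
    and T :: "'t theory_data"
    and J :: "('u, 'u) cat"
    and F :: "('u, 'u, ('t, 'u, 'u) psalg, ('t, 'u, 'u) psmor, ('t, 'u, 'u) pscell) psfun"
  assumes "universe U"
    and "is_theory T"
    and "small_cat U J"
    and "pseudo_functor J (PsAlg U T) F"
  shows "\<exists>W \<pi>. pseudo_limit J (PsAlg U T) F W \<pi>"
  using diagram.limit[OF diagram.intro[OF assms(2,1,4) diagram_axioms.intro[OF assms(3)]]] by blast

end
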